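(* Let $\alpha\in(0,2)$, let $H_1,H_2,\ldots$ be i.i.d. random vectors in $\mathbb{R}^d$ whose common law has regularly varying tails with tail exponent $\alpha$, let $\rho$ be an $\alpha$-stable law on $\mathbb{R}^d$ to whose domain of attraction this law belongs, let $\Gamma$ be the spectral measure of $\rho$ and $\tilde\Gamma(\cdot)=\Gamma(\cdot)/\Gamma(S)$ its normalization, where $S$ is the unit sphere. Let $X_{nj}$, $1\le j\le n$, be the associated truncated observations with truncation levels $M_n\to\infty$ and auxiliary variables $R_j$ (see context), and let $S_n=\sum_{j=1}^nX_{nj}$. Assume that $ER_1^2<\infty$ and that $\lim_{n\to\infty}nP(\|H_1\|>M_n)=\infty$ (hard truncation regime). Let $$B_n=\bigl[nM_n^2P(\|H_1\|>M_n)\bigr]^{1/2},\quad n=1,2,\ldots.$$ Then $$B_n^{-1}(S_n-ES_n)\Longrightarrow\eta\quad(n\to\infty),$$ where $\eta$ is the centered Gaussian law on $\mathbb{R}^d$ whose covariance matrix has the entries $$\frac{2}{2-\alpha}\int_S s_is_j\,\tilde\Gamma(ds),\quad i,j=1,\ldots,d.$$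
   Context: $\Longrightarrow$ denotes weak convergence; $\|\cdot\|$ is the Euclidean norm on $\mathbb{R}^d$, $d\ge1$, and $S=\{x\in\mathbb{R}^d:\|x\|=1\}$. Regularly varying tails: let $\overline{\mathbb{R}^d}$ be the compactification of $\mathbb{R}^d$ obtained by adding a sphere of infinite radius centered at the origin. The law of a random vector $H_1$ has regularly varying tails with tail exponent $\alpha>0$ if there exist a sequence $a_n\uparrow\infty$ and a non-null Radon measure $\mu$ on $\overline{\mathbb{R}^d}\setminus\{0\}$ with $\mu(\overline{\mathbb{R}^d}\setminus\mathbb{R}^d)=0$ such that $nP(a_n^{-1}H_1\in\cdot)\to\mu(\cdot)$ vaguely on $\overline{\mathbb{R}^d}\setminus\{0\}$, where $\mu(cB)=c^{-\alpha}\mu(B)$ for all $c>0$ and Borel $B$. For $\alpha\in(0,2)$ such a law is in the domain of attraction of an $\alpha$-stable law $\rho$: there are $b_n>0$, $c_n\in\mathbb{R}^d$ with $b_n^{-1}\sum_{j=1}^nH_j-c_n\Longrightarrow\rho$. Spectral measure: the characteristic function of $\rho$ has the form $$\hat\rho(\theta)=\exp\Bigl[i\langle\theta,\gamma\rangle+\int_S\Bigl(\int_0^\infty\{e^{ix\langle\theta,s\rangle}-1-ix\langle\theta,s\rangle\mathbf 1(x\le1)\}x^{-(1+\alpha)}dx\Bigr)\Gamma(ds)\Bigr],\quad\theta\in\mathbb{R}^d,$$ with $\gamma\in\mathbb{R}^d$ and $\Gamma$ a finite (non-null) measure on $S$, called the spectral measure of $\rho$. Truncated model: $R_1,R_2,\ldots$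 are i.i.d. nonnegative random variables independent of $(H_j)$, $M_n>0$ are deterministic truncation levels, and $$X_{nj}=H_j\mathbf 1(\|H_j\|\le M_n)+\frac{H_j}{\|H_j\|}(M_n+R_j)\mathbf 1(\|H_j\|>M_n),\qquad j=1,\ldots,n,\ n\ge1.$$ *)

theory Defs
  imports "HOL-Probability.Probability"
begin

subsection \<open>Laws on Euclidean space\<close>

definition weakly_converges ::
    "(nat \<Rightarrow> 'a::topological_space measure) \<Rightarrow> 'a measure \<Rightarrow> bool" where
  "weakly_converges \<mu> \<nu> \<longleftrightarrow>
     (\<forall>f::'a \<Rightarrow> real. continuous_on UNIV f \<and> bounded (range f) \<longrightarrow>
        (\<lambda>n. \<integral>x. f x \<partial>\<mu> n) \<longlonglongrightarrow> (\<integral>x. f x \<partial>\<nu>))"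

definition char_fun :: "(real ^ 'd) measure \<Rightarrow> real ^ 'd \<Rightarrow> complex" where
  "char_fun \<nu> \<theta> = (\<integral>x. exp (\<i> * complex_of_real (\<theta> \<bullet> x)) \<partial>\<nu>)"

text \<open>Gaussian laws may be degenerate (the covariance matrix may be singular): a one-dimensional
  normal law with standard deviation 0 is a point mass.\<close>

definition normal_law :: "real \<Rightarrow> real \<Rightarrow> real measure" where
  "normal_law m \<sigma> =
     (if \<sigma> = 0 then return borel m else density lborel (normal_density m \<sigma>))"

definition gaussian_law :: "(real ^ 'd) measure \<Rightarrow> bool" where
  "gaussian_law \<eta> \<longleftrightarrow> prob_space \<eta> \<and> sets \<eta> = sets borel \<and>
     (\<forall>\<theta>. \<exists>m \<sigma>. 0 \<le> \<sigma> \<and> distr \<eta> borel (\<lambda>x. \<theta> \<bullet> x) = normal_law m \<sigma>)"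

definition mean_vector :: "(real ^ 'd) measure \<Rightarrow> real ^ 'd" where
  "mean_vector \<nu> = (\<integral>x. x \<partial>\<nu>)"

definition covariance_matrix :: "(real ^ 'd) measure \<Rightarrow> real ^ 'd ^ 'd" where
  "covariance_matrix \<nu> =
     (\<chi> i j. \<integral>x. (x $ i - mean_vector \<nu> $ i) * (x $ j - mean_vector \<nu> $ j) \<partial>\<nu>)"

text \<open>The sequences of the model are indexed by 1, 2, ...\<close>

definition iid_seq :: "'w measure \<Rightarrow> (nat \<Rightarrow> 'w \<Rightarrow> 'a::topological_space) \<Rightarrow> bool" where
  "iid_seq P X \<longleftrightarrow>
     prob_space.indep_vars P (\<lambda>_. borel) X {1..} \<and>
     (\<forall>j\<ge>1. distr P borel (X j) = distr P borel (X 1))"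

definition generated_events ::
    "'w measure \<Rightarrow> (nat \<Rightarrow> 'w \<Rightarrow> 'a::topological_space) \<Rightarrow> 'w set set" where
  "generated_events P X =
     sets (vimage_algebra (space P) (\<lambda>\<omega>. \<lambda>j\<in>{1..}. X j \<omega>) (PiM {1..} (\<lambda>_. borel)))"

text \<open>The library's \<open>indep_var\<close> needs both variables to have the same type, hence the
  formulation by generated sigma-algebras.\<close>

definition indep_seqs ::
    "'w measure \<Rightarrow> (nat \<Rightarrow> 'w \<Rightarrow> 'a::topological_space) \<Rightarrow>
     (nat \<Rightarrow> 'w \<Rightarrow> 'b::topological_space) \<Rightarrow> bool" where
  "indep_seqs P X Y \<longleftrightarrow>
     prob_space.indep_set P (generated_events P X) (generated_events P Y)"

subsection \<open>Regularly varying tails\<close>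

text \<open>The compactification of the space by a sphere of infinite radius centered at the origin is
  modelled by the closed unit ball: \<open>compactify\<close> embeds the space as the open unit ball, and the
  unit sphere plays the role of the sphere at infinity. The compactification without the origin
  is then \<open>punctured_ball\<close>. Multiplication by \<open>c > 0\<close> extends to the compactification, fixing
  the points at infinity; \<open>ball_scale\<close> is this extension.\<close>

definition compactify :: "real ^ 'd \<Rightarrow> real ^ 'd" where
  "compactify x = (1 / (1 + norm x)) *\<^sub>R x"

definition punctured_ball :: "(real ^ 'd) set" where
  "punctured_ball = cball 0 1 - {0}"

definition ball_scale :: "real \<Rightarrow> real ^ 'd \<Rightarrow> real ^ 'd" where
  "ball_scale c y = (c / (1 + (c - 1) * norm y)) *\<^sub>R y"

lemma ball_scale_compactify:
  assumes "0 < c"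
  shows "ball_scale c (compactify x) = compactify (c *\<^sub>R x)"
proof -
  have "0 < 1 + norm x"
    by (simp add: add_pos_nonneg)
  moreover have "0 < 1 + c * norm x"
    using assms by (simp add: add_pos_nonneg)
  ultimately have "c / (1 + (c - 1) * (norm x / (1 + norm x))) / (1 + norm x) = c / (1 + c * norm x)"
    by (simp add: divide_simps) (auto simp: algebra_simps)
  then show ?thesis
    using assms by (simp add: ball_scale_def compactify_def)
qed

lemma ball_scale_infinity:
  assumes "0 < c" "norm y = 1"
  shows "ball_scale c y = y"
  using assms by (simp add: ball_scale_def)

definition radon_on_punctured_ball :: "(real ^ 'd) measure \<Rightarrow> bool" where
  "radon_on_punctured_ball \<mu> \<longleftrightarrow>
     sets \<mu> = sets (restrict_space borel punctured_ball) \<and>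
     (\<forall>K. compact K \<and> K \<subseteq> punctured_ball \<longrightarrow> emeasure \<mu> K < \<infinity>)"

definition test_function :: "(real ^ 'd \<Rightarrow> real) \<Rightarrow> bool" where
  "test_function f \<longleftrightarrow> continuous_on punctured_ball f \<and>
     (\<exists>K. compact K \<and> K \<subseteq> punctured_ball \<and> (\<forall>y. y \<notin> K \<longrightarrow> f y = 0))"

text \<open>In the last clause, vague convergence is tested against continuous functions with compact
  support in the compactification without the origin. They vanish at 0, so the atom that the law
  of the rescaled vector may have at the origin does not contribute.\<close>

definition regularly_varying_tails :: "real \<Rightarrow> (real ^ 'd) measure \<Rightarrow> bool" where
  "regularly_varying_tails \<alpha> \<nu> \<longleftrightarrow>
     (\<exists>(a :: nat \<Rightarrow> real) (\<mu> :: (real ^ 'd) measure).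
        (\<forall>n. 0 < a n) \<and> incseq a \<and> filterlim a at_top sequentially \<and>
        radon_on_punctured_ball \<mu> \<and>
        emeasure \<mu> punctured_ball \<noteq> 0 \<and>
        emeasure \<mu> (sphere 0 1) = 0 \<and>
        (\<forall>c>0. \<forall>B\<in>sets \<mu>.
           emeasure \<mu> (ball_scale c ` B) = ennreal (c powr (- \<alpha>)) * emeasure \<mu> B) \<and>
        (\<forall>f. test_function f \<longrightarrow>
           (\<lambda>n. real n * (\<integral>x. f (compactify ((1 / a n) *\<^sub>R x)) \<partial>\<nu>))
             \<longlonglongrightarrow> (\<integral>y. f y \<partial>\<mu>)))"

subsection \<open>Stable laws\<close>

text \<open>Point masses satisfy the following scaling property for every \<open>\<alpha>\<close>; they are excluded by
  the requirement that the spectral measure be non-null.\<close>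

definition stable_law :: "real \<Rightarrow> (real ^ 'd) measure \<Rightarrow> bool" where
  "stable_law \<alpha> \<rho> \<longleftrightarrow> prob_space \<rho> \<and> sets \<rho> = sets borel \<and>
     (\<forall>a>0. \<forall>b>0. \<exists>c.
        distr (\<rho> \<Otimes>\<^sub>M \<rho>) borel (\<lambda>(x, y). a *\<^sub>R x + b *\<^sub>R y) =
        distr \<rho> borel (\<lambda>x. ((a powr \<alpha> + b powr \<alpha>) powr (1 / \<alpha>)) *\<^sub>R x + c))"

definition spectral_measure ::
    "real \<Rightarrow> (real ^ 'd) measure \<Rightarrow> (real ^ 'd) measure \<Rightarrow> bool" where
  "spectral_measure \<alpha> \<rho> \<Gamma> \<longleftrightarrow>
     finite_measure \<Gamma> \<and>
     sets \<Gamma> = sets (restrict_space borel (sphere 0 1)) \<and>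
     emeasure \<Gamma> (sphere 0 1) \<noteq> 0 \<and>
     (\<exists>\<gamma>. \<forall>\<theta>. char_fun \<rho> \<theta> =
        exp (\<i> * complex_of_real (\<theta> \<bullet> \<gamma>) +
          (\<integral>s. (\<integral>x\<in>{0<..}.
                  (exp (\<i> * complex_of_real (x * (\<theta> \<bullet> s))) - 1
                     - \<i> * complex_of_real (x * (\<theta> \<bullet> s) * indicator {..1} x))
                  * complex_of_real (x powr (- (1 + \<alpha>))) \<partial>lborel) \<partial>\<Gamma>)))"

definition normalized_measure :: "'a measure \<Rightarrow> 'a measure" where
  "normalized_measure \<Gamma> = scale_measure (1 / emeasure \<Gamma> (space \<Gamma>)) \<Gamma>"

definition in_domain_of_attraction ::
    "'w measure \<Rightarrow> (nat \<Rightarrow> 'w \<Rightarrow> real ^ 'd) \<Rightarrow> (real ^ 'd) measure \<Rightarrow> bool" where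
  "in_domain_of_attraction P H \<rho> \<longleftrightarrow>
     (\<exists>(b :: nat \<Rightarrow> real) (c :: nat \<Rightarrow> real ^ 'd).
        (\<forall>n. 0 < b n) \<and>
        weakly_converges
          (\<lambda>n. distr P borel (\<lambda>\<omega>. (1 / b n) *\<^sub>R (\<Sum>j=1..n. H j \<omega>) - c n)) \<rho>)"

subsection \<open>The truncated model\<close>

definition truncated :: "real \<Rightarrow> real ^ 'd \<Rightarrow> real \<Rightarrow> real ^ 'd" where
  "truncated m h r = (if norm h \<le> m then h else ((m + r) / norm h) *\<^sub>R h)"

definition truncated_sum ::
    "(nat \<Rightarrow> real) \<Rightarrow> (nat \<Rightarrow> 'w \<Rightarrow> real ^ 'd) \<Rightarrow> (nat \<Rightarrow> 'w \<Rightarrow> real) \<Rightarrow>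
     nat \<Rightarrow> 'w \<Rightarrow> real ^ 'd" where
  "truncated_sum M H R n \<omega> = (\<Sum>j=1..n. truncated (M n) (H j \<omega>) (R j \<omega>))"

definition tail_prob :: "'w measure \<Rightarrow> ('w \<Rightarrow> real ^ 'd) \<Rightarrow> real \<Rightarrow> real" where
  "tail_prob P X m = measure P {\<omega> \<in> space P. m < norm (X \<omega>)}"

definition norming ::
    "'w measure \<Rightarrow> (nat \<Rightarrow> real) \<Rightarrow> (nat \<Rightarrow> 'w \<Rightarrow> real ^ 'd) \<Rightarrow> nat \<Rightarrow> real" where
  "norming P M H n = sqrt (real n * (M n)\<^sup>2 * tail_prob P (H 1) (M n))"

end

theory Submission
  imports Defs "HOL-Real_Asymp.Real_Asymp"
begin

text \<open>Vague convergence gives, for every continuous \<open>g \<ge> 0\<close>,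
  \<open>E (g (H / |H|); |H| > l x) / P (|H| > x) \<longlongrightarrow> l\<^sup>-\<^sup>\<alpha> L g\<close> with an angular functional \<open>L\<close>.
  Karamata's theorem turns this into \<open>E \<langle>\<theta>, X\<^sub>n\<^sub>1\<rangle>\<^sup>2 \<sim> 2 / (2 - \<alpha>) L (\<langle>s, \<theta>\<rangle>\<^sup>2) M\<^sub>n\<^sup>2 P (|H| > M\<^sub>n)\<close>. Since the
  truncated vectors are of order \<open>M\<^sub>n\<close> and \<open>B\<^sub>n / M\<^sub>n \<longlongrightarrow> \<infinity>\<close>, Lindeberg's condition holds, and the squared means are
  negligible because the second moment is carried by rare large values. This gives the Gaussian limit through
  characteristic functions, with covariance expressed by \<open>L\<close>.

  It remains to see that \<open>L\<close> and the normalized spectral measure have the same second moments. If \<open>\<phi>\<close> is the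
  characteristic function of \<open>H\<close>, then \<open>n (1 - |\<phi> (\<theta> / b\<^sub>n)|\<^sup>2)\<close> converges to minus twice the real part of the
  Levy exponent of \<open>\<rho>\<close>; taking moduli removes the centering. Averaging over a Gaussian \<open>\<theta>\<close>, with the weights
  \<open>1\<close> and \<open>\<langle>\<theta>, v\<rangle>\<^sup>2\<close>, expresses both sides through \<open>L (\<langle>s, v\<rangle>\<^sup>2)\<close> and \<open>\<integral> \<langle>s, v\<rangle>\<^sup>2 d\<Gamma>\<close>, and the unknown
  norming cancels.\<close>

subsection \<open>Weak convergence from characteristic functions\<close>

text \<open>The obstacle is that \<open>\<rho>\<close> is known only through some norming
  \<open>b\<close>, which nothing relates to the \<open>a\<close> of regular variation, so the two
  limits cannot be compared term by term. Gaussian averages of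
  \<open>1 - cos (\<theta> \<bullet> y)\<close> help because they are explicit: with weight
  \<open>1\<close> the average is \<open>1 - exp (- |y|^2 / 2)\<close>, which is radial and sees
  only the total mass of the angular part; with weight \<open>(\<theta> \<bullet> v)^2\<close> the
  angle enters exactly through \<open>(y \<bullet> v)^2\<close>. Two averages thus determine one
  second moment, and second moments are all that a centered Gaussian limit depends on; the angular
  measure itself is never identified. Weak convergence in several dimensions is reduced to
  characteristic functions by bounded second moments: these give tightness through Chebyshev's
  inequality, and on a ball trigonometric polynomials approximate every continuous function. The
  factor \<open>2 / (2 - \<alpha>)\<close> is the integral of
  \<open>2 * r * r powr - \<alpha>\<close> over the unit interval: apart from the overshoot
  \<open>R\<close>, which is of lower order, truncation replaces \<open>|H|\<close> by its minimum
  with \<open>M n\<close>.\<close>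

inductive trig_poly :: "(real ^ 'd \<Rightarrow> real) \<Rightarrow> bool" where
  wave: "trig_poly (\<lambda>x. c * cos (\<theta> \<bullet> x + \<phi>))"
| add: "trig_poly f \<Longrightarrow> trig_poly g \<Longrightarrow> trig_poly (\<lambda>x. f x + g x)"

lemma trig_poly_const: "trig_poly (\<lambda>x. c)"
  using trig_poly.wave[of c 0 0] by simp

text \<open>The product-to-sum formula keeps products of waves in the class. The free phase
  \<open>\<phi>\<close> makes sines waves as well, so cosines alone generate all trigonometric
  polynomials.\<close>

lemma trig_poly_mult:
  assumes "trig_poly f" "trig_poly g"
  shows "trig_poly (\<lambda>x. f x * g x)"
  using assms(1)
proof (induction)
  case (wave c \<theta> \<phi>)
  from assms(2) show ?case
  proof (induction)
    case (wave c' \<theta>' \<phi>')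
    have "(\<lambda>x. c * cos (\<theta> \<bullet> x + \<phi>) * (c' * cos (\<theta>' \<bullet> x + \<phi>'))) =
      (\<lambda>x. c * c' / 2 * cos ((\<theta> - \<theta>') \<bullet> x + (\<phi> - \<phi>')) + c * c' / 2 * cos ((\<theta> + \<theta>') \<bullet> x + (\<phi> + \<phi>')))"
    proof
      fix x
      have "cos (\<theta> \<bullet> x + \<phi>) * cos (\<theta>' \<bullet> x + \<phi>') =
        (cos ((\<theta> \<bullet> x + \<phi>) - (\<theta>' \<bullet> x + \<phi>')) + cos ((\<theta> \<bullet> x + \<phi>) + (\<theta>' \<bullet> x + \<phi>'))) / 2"
        by (rule cos_times_cos)
      moreover have "(\<theta> \<bullet> x + \<phi>) - (\<theta>' \<bullet> x + \<phi>') = (\<theta> - \<theta>') \<bullet> x + (\<phi> - \<phi>')"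
        "(\<theta> \<bullet> x + \<phi>) + (\<theta>' \<bullet> x + \<phi>') = (\<theta> + \<theta>') \<bullet> x + (\<phi> + \<phi>')"
        by (simp_all add: inner_diff_left inner_add_left)
      ultimately have *: "cos (\<theta> \<bullet> x + \<phi>) * cos (\<theta>' \<bullet> x + \<phi>') =
        (cos ((\<theta> - \<theta>') \<bullet> x + (\<phi> - \<phi>')) + cos ((\<theta> + \<theta>') \<bullet> x + (\<phi> + \<phi>'))) / 2" by simp
      have "c * cos (\<theta> \<bullet> x + \<phi>) * (c' * cos (\<theta>' \<bullet> x + \<phi>')) =
        c * c' * (cos (\<theta> \<bullet> x + \<phi>) * cos (\<theta>' \<bullet> x + \<phi>'))" by (simp only: mult_ac)
      also have "\<dots> = c * c' / 2 * cos ((\<theta> - \<theta>') \<bullet> x + (\<phi> - \<phi>')) + c * c' / 2 * cos ((\<theta> + \<theta>') \<bullet> x + (\<phi> + \<phi>'))"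
        unfolding * by (simp add: field_simps)
      finally show "c * cos (\<theta> \<bullet> x + \<phi>) * (c' * cos (\<theta>' \<bullet> x + \<phi>')) =
        c * c' / 2 * cos ((\<theta> - \<theta>') \<bullet> x + (\<phi> - \<phi>')) + c * c' / 2 * cos ((\<theta> + \<theta>') \<bullet> x + (\<phi> + \<phi>'))" .
    qed
    then show ?case by (simp only:) (intro trig_poly.intros)
  next
    case (add f g)
    then show ?case by (simp add: distrib_left trig_poly.add)
  qed
next
  case (add f1 f2)
  then show ?case by (simp add: distrib_right trig_poly.add)
qed

lemma trig_poly_sum: "finite A \<Longrightarrow> (\<And>i. i \<in> A \<Longrightarrow> trig_poly (f i)) \<Longrightarrow> trig_poly (\<lambda>x. \<Sum>i\<in>A. f i x)"
  by (induction A rule: finite_induct) (auto intro: trig_poly_const trig_poly.add)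

text \<open>A polynomial is built from constants and linear maps by sums and products, and the class
  is closed under these; only a linear map of the sine vector takes a computation, with
  \<open>sin u = cos (u - pi / 2)\<close>.\<close>

lemma trig_poly_polynomial_sin:
  fixes p :: "real ^ 'd \<Rightarrow> real"
  assumes "real_polynomial_function p"
  shows "trig_poly (\<lambda>x. p (\<chi> i. sin (x $ i / L)))"
  using assms
proof (induction)
  case (linear f)
  then interpret bounded_linear f .
  have "f (\<chi> i. sin (x $ i / L)) = (\<Sum>i\<in>UNIV. f (axis i 1) * cos (axis i (1 / L) \<bullet> x + (- pi / 2)))" for x
  proof -
    have "(\<chi> i. sin (x $ i / L)) = (\<Sum>i\<in>UNIV. sin (x $ i / L) *\<^sub>R axis i 1)"
      by (simp add: vec_eq_iff axis_def if_distrib cong: if_cong)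
    then have "f (\<chi> i. sin (x $ i / L)) = (\<Sum>i\<in>UNIV. sin (x $ i / L) * f (axis i 1))"
      by (simp add: sum scaleR)
    also have "\<dots> = (\<Sum>i\<in>UNIV. f (axis i 1) * cos (axis i (1 / L) \<bullet> x + (- pi / 2)))"
    proof (rule sum.cong)
      fix i
      have "axis i (1 / L) \<bullet> x = x $ i / L" by (simp add: inner_axis' )
      moreover have "cos (u - pi / 2) = sin u" for u :: real
        by (simp add: cos_diff)
      ultimately show "sin (x $ i / L) * f (axis i 1) = f (axis i 1) * cos (axis i (1 / L) \<bullet> x + (- pi / 2))"
        by simp
    qed simp
    finally show ?thesis .
  qed
  then show ?case by (simp only:) (intro trig_poly_sum trig_poly.wave; simp)
qed (auto intro: trig_poly_const trig_poly.add trig_poly_mult)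

lemma trig_poly_bounded_continuous:
  "trig_poly f \<Longrightarrow> continuous_on UNIV f \<and> bounded (range f)"
proof (induction rule: trig_poly.induct)
  case (wave c \<theta> \<phi>)
  have "bounded (range (\<lambda>x. c * cos (\<theta> \<bullet> x + \<phi>)))"
    by (intro boundedI[of _ "\<bar>c\<bar>"]) (auto simp: abs_mult intro!: mult_left_le)
  then show ?case by (auto intro!: continuous_intros)
next
  case (add f g)
  then show ?case by (auto intro!: continuous_intros bounded_plus_comp)
qed

lemma integrable_bounded_continuous:
  fixes f :: "real ^ 'd \<Rightarrow> real"
  assumes "finite_measure \<mu>" "sets \<mu> = sets borel" "continuous_on UNIV f" "bounded (range f)"
  shows "integrable \<mu> f"
proof -
  interpret finite_measure \<mu> by fact
  obtain B where "\<And>x. \<bar>f x\<bar> \<le> B" using assms(4) by (auto simp: bounded_iff)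
  moreover have "f \<in> borel_measurable \<mu>"
    using borel_measurable_continuous_onI[OF assms(3)] assms(2) by (simp cong: measurable_cong_sets)
  ultimately show ?thesis by (intro integrable_const_bound[of _ B]) auto
qed

lemma char_fun_Re_Im:
  fixes \<mu> :: "(real ^ 'd) measure"
  assumes "prob_space \<mu>" "sets \<mu> = sets borel"
  shows "Re (char_fun \<mu> \<theta>) = (\<integral>x. cos (\<theta> \<bullet> x) \<partial>\<mu>)" "Im (char_fun \<mu> \<theta>) = (\<integral>x. sin (\<theta> \<bullet> x) \<partial>\<mu>)"
proof -
  interpret prob_space \<mu> by fact
  note [measurable_cong] = assms(2)
  have i: "integrable \<mu> (\<lambda>x. exp (\<i> * complex_of_real (\<theta> \<bullet> x)))"
    by (intro integrable_const_bound[of _ 1]) auto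
  show "Re (char_fun \<mu> \<theta>) = (\<integral>x. cos (\<theta> \<bullet> x) \<partial>\<mu>)" "Im (char_fun \<mu> \<theta>) = (\<integral>x. sin (\<theta> \<bullet> x) \<partial>\<mu>)"
    unfolding char_fun_def using i
    by (simp_all flip: integral_Re integral_Im add: Re_exp Im_exp)
qed

text \<open>Expanding \<open>cos (\<theta> \<bullet> x + \<phi>)\<close> turns the integral of a
  wave into a combination of the real and the imaginary part of one value of the characteristic
  function.\<close>

lemma trig_poly_tendsto:
  fixes \<mu> :: "nat \<Rightarrow> (real ^ 'd) measure"
  assumes mu: "\<And>n. prob_space (\<mu> n)" "\<And>n. sets (\<mu> n) = sets borel"
    and nu: "prob_space \<nu>" "sets \<nu> = sets borel"
    and char: "\<And>\<theta>. (\<lambda>n. char_fun (\<mu> n) \<theta>) \<longlonglongrightarrow> char_fun \<nu> \<theta>"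
    and "trig_poly f"
  shows "(\<lambda>n. \<integral>x. f x \<partial>\<mu> n) \<longlonglongrightarrow> (\<integral>x. f x \<partial>\<nu>)"
  using assms(6)
proof (induction)
  case (wave c \<theta> \<phi>)
  have eq: "(\<integral>x. c * cos (\<theta> \<bullet> x + \<phi>) \<partial>m) = c * cos \<phi> * Re (char_fun m \<theta>) - c * sin \<phi> * Im (char_fun m \<theta>)"
    if m: "prob_space m" "sets m = sets borel" for m
  proof -
    interpret prob_space m by fact
    note [measurable_cong] = m(2)
    have [simp]: "integrable m (\<lambda>x. cos (\<theta> \<bullet> x))" "integrable m (\<lambda>x. sin (\<theta> \<bullet> x))"
      by (intro integrable_const_bound[of _ 1]; auto)+
    have "(\<lambda>x. c * cos (\<theta> \<bullet> x + \<phi>)) = (\<lambda>x. c * cos \<phi> * cos (\<theta> \<bullet> x) - c * sin \<phi> * sin (\<theta> \<bullet> x))"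
      by (auto simp: cos_add algebra_simps)
    then show ?thesis using char_fun_Re_Im[OF m] by simp
  qed
  show ?case unfolding eq[OF mu] eq[OF nu]
    by (intro tendsto_intros char)
next
  case (add f g)
  have "integrable m h" if "prob_space m" "sets m = sets borel" "trig_poly h" for m h
    using trig_poly_bounded_continuous[OF that(3)] that
    by (intro integrable_bounded_continuous) (auto simp: prob_space_def)
  from this[OF mu] this[OF nu] add show ?case by (simp add: tendsto_add)
qed

lemma chebyshev_second_moment:
  fixes \<mu> :: "(real ^ 'd) measure"
  assumes "prob_space \<mu>" "sets \<mu> = sets borel" "integrable \<mu> (\<lambda>x. (norm x)\<^sup>2)" "(\<integral>x. (norm x)\<^sup>2 \<partial>\<mu>) \<le> C" "0 < K"
  shows "measure \<mu> {x. K < norm x} \<le> C / K\<^sup>2"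
proof -
  interpret prob_space \<mu> by fact
  note [measurable_cong] = assms(2)
  have sp: "space \<mu> = UNIV" using sets_eq_imp_space_eq[OF assms(2)] by simp
  have "{x. K < norm x} \<subseteq> {x \<in> space \<mu>. (norm x)\<^sup>2 \<ge> K\<^sup>2}"
    using assms(5) by (auto simp: sp intro: power_mono)
  then have "measure \<mu> {x. K < norm x} \<le> measure \<mu> {x \<in> space \<mu>. (norm x)\<^sup>2 \<ge> K\<^sup>2}"
    by (intro finite_measure_mono) auto
  also have "\<dots> \<le> (\<integral>x. (norm x)\<^sup>2 \<partial>\<mu>) / K\<^sup>2"
    using assms by (intro integral_Markov_inequality_measure[where A = "{}"]) auto
  also have "\<dots> \<le> C / K\<^sup>2" using assms(4) by (simp add: divide_right_mono)
  finally show ?thesis .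
qed

text \<open>On a large box every continuous function is a continuous function of the \<open>sin (x\<^sub>i / L)\<close>,
  and a polynomial in these is controlled on the whole space by its values on the box.\<close>

lemma trig_poly_approx:
  fixes f :: "real ^ 'd \<Rightarrow> real"
  assumes f: "continuous_on UNIV f" "\<And>x. \<bar>f x\<bar> \<le> B" and "0 < e" "0 < K"
  shows "\<exists>p. trig_poly p \<and> (\<forall>x. norm x \<le> K \<longrightarrow> \<bar>f x - p x\<bar> \<le> e) \<and> (\<forall>x. \<bar>p x\<bar> \<le> B + e)"
proof -
  \<comment> \<open>With this scale \<open>norm x \<le> K\<close> gives
    \<open>|x $ i / L| \<le> pi / 2\<close>, the range on which \<open>arcsin\<close> inverts
    \<open>sin\<close>.\<close>
  define L where "L = K * 2 / pi"
  have L: "0 < L" using \<open>0 < K\<close> by (simp add: L_def)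
  define C :: "(real ^ 'd) set" where "C = cbox (- 1) 1"
  have C: "y \<in> C \<longleftrightarrow> (\<forall>i. \<bar>y $ i\<bar> \<le> 1)" for y
    by (auto simp: C_def mem_box_cart abs_le_iff minus_le_iff)
  define g where "g y = f (\<chi> i. L * arcsin (y $ i))" for y
  have "continuous_on C g"
    unfolding g_def
    by (rule continuous_on_compose2[OF f(1)])
       (auto simp: C abs_le_iff minus_le_iff intro!: continuous_intros continuous_on_vec_lambda)
  moreover have "compact C" by (simp add: C_def)
  ultimately obtain p where p: "real_polynomial_function p" "\<And>y. y \<in> C \<Longrightarrow> \<bar>g y - p y\<bar> < e"
    using Stone_Weierstrass_polynomial_function[of C g e] \<open>0 < e\<close>
    by (auto simp flip: real_polynomial_function_eq)
  let ?q = "\<lambda>x. p (\<chi> i. sin (x $ i / L))"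
  have inC: "(\<chi> i. sin (x $ i / L)) \<in> C" for x by (simp add: C)
  have "\<bar>f x - ?q x\<bar> \<le> e" if "norm x \<le> K" for x
  proof -
    have abs: "\<bar>x $ i / L\<bar> \<le> pi / 2" for i
    proof -
      have "\<bar>x $ i\<bar> \<le> K" using that component_le_norm_cart order_trans by blast
      then show ?thesis using \<open>0 < K\<close> by (simp add: L_def field_simps abs_mult)
    qed
    then have "arcsin (sin (x $ i / L)) = x $ i / L" for i
      using abs[of i] by (intro arcsin_sin) linarith+
    then have "g (\<chi> i. sin (x $ i / L)) = f x"
      using L by (simp add: g_def vec_lambda_eta)
    with p(2)[OF inC[of x]] show ?thesis by simp
  qed
  moreover have "\<bar>?q x\<bar> \<le> B + e" for x
  proof -
    have "\<bar>g (\<chi> i. sin (x $ i / L))\<bar> \<le> B" by (simp add: g_def f(2))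
    with p(2)[OF inC[of x]] show ?thesis by linarith
  qed
  ultimately show ?thesis using trig_poly_polynomial_sin[OF p(1)] by blast
qed

text \<open>Levy's continuity theorem under bounded second moments, which supply tightness. The
  bound is asked of \<open>\<mu> n\<close> only eventually, because it will come from a convergent
  sequence of variances.\<close>

lemma weakly_converges_of_char_fun:
  fixes \<mu> :: "nat \<Rightarrow> (real ^ 'd) measure"
  assumes mu: "\<And>n. prob_space (\<mu> n)" "\<And>n. sets (\<mu> n) = sets borel"
    and nu: "prob_space \<nu>" "sets \<nu> = sets borel"
    and char: "\<And>\<theta>. (\<lambda>n. char_fun (\<mu> n) \<theta>) \<longlonglongrightarrow> char_fun \<nu> \<theta>"
    and mom: "\<forall>\<^sub>F n in sequentially. integrable (\<mu> n) (\<lambda>x. (norm x)\<^sup>2) \<and> (\<integral>x. (norm x)\<^sup>2 \<partial>\<mu> n) \<le> C"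
    and momnu: "integrable \<nu> (\<lambda>x. (norm x)\<^sup>2)" "(\<integral>x. (norm x)\<^sup>2 \<partial>\<nu>) \<le> C"
  shows "weakly_converges \<mu> \<nu>"
  unfolding weakly_converges_def
proof (intro allI impI LIMSEQ_I, elim conjE)
  fix f :: "real ^ 'd \<Rightarrow> real" and r :: real
  assume f: "continuous_on UNIV f" "bounded (range f)" and r: "0 < r"
  obtain B where B: "\<And>x. \<bar>f x\<bar> \<le> B" using f(2) by (auto simp: bounded_iff)
  have B0: "0 \<le> B" using B[of 0] by linarith
  have C0: "0 \<le> C" by (rule order_trans[OF integral_nonneg_AE momnu(2)]) auto
  \<comment> \<open>The error is \<open>2 * e\<close> for each of the two measures and
    \<open>e\<close> between the integrals of \<open>p\<close>, in total below \<open>r\<close>. The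
    bound \<open>e \<le> 1\<close> gives \<open>|f - p| \<le> 2 * B + 1\<close> everywhere.\<close>
  define e where "e = min 1 (r / 8)"
  have e: "0 < e" "e \<le> 1" "8 * e \<le> r" using r by (auto simp: e_def)
  \<comment> \<open>Chebyshev bounds the mass outside the ball by \<open>C / K^2\<close>; this
    radius makes its contribution \<open>(2 * B + 1) * C / K^2\<close> at most \<open>e\<close>. The
    summand \<open>1\<close> in \<open>C + 1\<close> keeps \<open>K\<close> positive when
    \<open>C = 0\<close>.\<close>
  define K where "K = sqrt ((2 * B + 1) * (C + 1) / e)"
  have K: "0 < K" "K\<^sup>2 = (2 * B + 1) * (C + 1) / e" using B0 C0 e by (auto simp: K_def)
  obtain p where p: "trig_poly p" "\<And>x. norm x \<le> K \<Longrightarrow> \<bar>f x - p x\<bar> \<le> e" "\<And>x. \<bar>p x\<bar> \<le> B + e"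
    using trig_poly_approx[OF f(1) B e(1) K(1)] by blast
  have close: "\<bar>(\<integral>x. f x \<partial>m) - (\<integral>x. p x \<partial>m)\<bar> \<le> 2 * e"
    if m: "prob_space m" "sets m = sets borel" "integrable m (\<lambda>x. (norm x)\<^sup>2)" "(\<integral>x. (norm x)\<^sup>2 \<partial>m) \<le> C" for m
  proof -
    interpret prob_space m by fact
    note [measurable_cong] = m(2)
    have sp: "space m = UNIV" using sets_eq_imp_space_eq[OF m(2)] by simp
    have fi: "integrable m f" using m f by (intro integrable_bounded_continuous) unfold_locales
    have pi: "integrable m p" using m trig_poly_bounded_continuous[OF p(1)] by (intro integrable_bounded_continuous) (auto intro: finite_measure_axioms)
    have "measure m {x. K < norm x} \<le> C / K\<^sup>2" by (rule chebyshev_second_moment[OF m K(1)])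
    have "\<bar>(\<integral>x. f x \<partial>m) - (\<integral>x. p x \<partial>m)\<bar> = \<bar>\<integral>x. f x - p x \<partial>m\<bar>" using fi pi by simp
    also have "\<dots> \<le> (\<integral>x. \<bar>f x - p x\<bar> \<partial>m)" using integral_norm_bound[of m "\<lambda>x. f x - p x"] by simp
    also have "\<dots> \<le> (\<integral>x. e + (2 * B + 1) * indicator {x. K < norm x} x \<partial>m)"
    proof (rule integral_mono)
      show "integrable m (\<lambda>x. \<bar>f x - p x\<bar>)" using fi pi by auto
      show "integrable m (\<lambda>x. e + (2 * B + 1) * indicator {x. K < norm x} x)"
        by (intro integrable_const_bound[of _ "e + (2 * B + 1)"]) (use B0 e in \<open>auto simp: indicator_def\<close>)
      show "\<bar>f x - p x\<bar> \<le> e + (2 * B + 1) * indicator {x. K < norm x} x" for x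
        using p(2)[of x] p(3)[of x] B[of x] e by (auto simp: indicator_def)
    qed
    also have "\<dots> = e + (2 * B + 1) * measure m {x. K < norm x}"
      by (subst Bochner_Integration.integral_add) (auto simp: prob_space[unfolded sp] sp integrable_indicator_iff less_top[symmetric])
    also have "\<dots> \<le> e + (2 * B + 1) * (C / K\<^sup>2)"
      using chebyshev_second_moment[OF m K(1)] B0 by (intro add_left_mono mult_left_mono) auto
    also have "(2 * B + 1) * (C / K\<^sup>2) = e * (C / (C + 1))" using B0 C0 e by (simp add: K(2))
    also have "\<dots> \<le> e * 1" using C0 e by (intro mult_left_mono) auto
    finally show ?thesis by simp
  qed
  have "(\<lambda>n. \<integral>x. p x \<partial>\<mu> n) \<longlonglongrightarrow> (\<integral>x. p x \<partial>\<nu>)" by (rule trig_poly_tendsto[OF mu nu char p(1)])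
  then have "\<forall>\<^sub>F n in sequentially. dist (\<integral>x. p x \<partial>\<mu> n) (\<integral>x. p x \<partial>\<nu>) < e" using e(1) by (rule tendstoD)
  with mom have "\<forall>\<^sub>F n in sequentially. norm ((\<integral>x. f x \<partial>\<mu> n) - (\<integral>x. f x \<partial>\<nu>)) < r"
  proof eventually_elim
    case (elim n)
    have "\<bar>(\<integral>x. f x \<partial>\<mu> n) - (\<integral>x. p x \<partial>\<mu> n)\<bar> \<le> 2 * e" using elim by (intro close mu) auto
    moreover have "\<bar>(\<integral>x. f x \<partial>\<nu>) - (\<integral>x. p x \<partial>\<nu>)\<bar> \<le> 2 * e" using momnu by (intro close nu) auto
    ultimately show ?case using elim e unfolding dist_real_def real_norm_def by linarith
  qed
  then show "\<exists>no. \<forall>n\<ge>no. norm ((\<integral>x. f x \<partial>\<mu> n) - (\<integral>x. f x \<partial>\<nu>)) < r"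
    by (simp add: eventually_sequentially)
qed

subsection \<open>Gaussian laws\<close>

text \<open>The value of the form at \<open>x + t y\<close> is a nonnegative quadratic in
  \<open>t\<close>. Degenerate forms are included: when \<open>B y y = 0\<close> this quadratic is
  affine in \<open>t\<close>, so its slope has to vanish.\<close>

lemma psd_Cauchy_Schwarz:
  fixes B :: "'a::real_vector \<Rightarrow> 'a \<Rightarrow> real"
  assumes sym: "\<And>x y. B x y = B y x" and lin: "\<And>y. linear (\<lambda>x. B x y)" and pos: "\<And>x. 0 \<le> B x x"
  shows "(B x y)\<^sup>2 \<le> B x x * B y y"
proof -
  have lin2: "linear (B x)" for x using lin[of x] unfolding sym[of _ x] .
  have exp: "0 \<le> B x x + 2 * t * B x y + t\<^sup>2 * B y y" for t
    using pos[of "x + t *\<^sub>R y"] sym[of y x]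
    by (simp add: linear_add[OF lin] linear_add[OF lin2] linear_cmul[OF lin] linear_cmul[OF lin2]
        power2_eq_square algebra_simps)
  show ?thesis
  proof (cases "B y y = 0")
    case True
    have "B x y = 0"
    proof (rule ccontr)
      assume "B x y \<noteq> 0"
      \<comment> \<open>At this \<open>t\<close> the affine expression equals
        \<open>- 1\<close>.\<close>
      then show False using exp[of "- (B x x + 1) / (2 * B x y)"] True pos[of x] by (simp add: field_simps)
    qed
    with True show ?thesis by simp
  next
    case False
    then have "0 < B y y" using pos[of y] by linarith
    \<comment> \<open>This \<open>t\<close> is the minimizer of the quadratic.\<close>
    then show ?thesis using exp[of "- B x y / B y y"]
      by (simp add: field_simps power2_eq_square)
  qed
qed

text \<open>Symmetric Gaussian elimination: for each coordinate the square of a linear form is split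
  off, after which that axis lies in the kernel of the remainder. When all axes are treated the
  remainder is zero.\<close>

lemma psd_sum_of_squares:
  fixes B :: "real ^ 'd \<Rightarrow> real ^ 'd \<Rightarrow> real"
  assumes sym: "\<And>x y. B x y = B y x" and lin: "\<And>y. linear (\<lambda>x. B x y)" and pos: "\<And>x. 0 \<le> B x x"
  shows "\<exists>a :: 'd \<Rightarrow> real ^ 'd. \<forall>\<theta>. B \<theta> \<theta> = (\<Sum>k\<in>UNIV. (\<theta> \<bullet> a k)\<^sup>2)"
proof -
  \<comment> \<open>Invariant after treating the coordinates in \<open>I\<close>: the remainder
    \<open>B'\<close> is again symmetric, linear and nonnegative, and the axes in \<open>I\<close>
    are in its kernel.\<close>
  let ?Q = "\<lambda>I (a :: 'd \<Rightarrow> real ^ 'd) B'. (\<forall>x y. B' x y = B' y x) \<and> (\<forall>y. linear (\<lambda>x. B' x y)) \<and>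
    (\<forall>x. 0 \<le> B' x x) \<and> (\<forall>\<theta>. B \<theta> \<theta> = B' \<theta> \<theta> + (\<Sum>k\<in>I. (\<theta> \<bullet> a k)\<^sup>2)) \<and>
    (\<forall>k\<in>I. \<forall>y. B' (axis k 1) y = (0 :: real))"
  have "\<exists>a B'. ?Q I a B'" if "finite I" for I :: "'d set"
    using that
  proof (induction I)
    case empty
    show ?case
      by (rule exI[of _ "\<lambda>_. 0"], rule exI[of _ B], intro conjI allI ballI sym lin pos) auto
  next
    case (insert j I)
    then obtain a B' where Q: "?Q I a B'" by blast
    have sym': "\<And>x y. B' x y = B' y x" using Q by blast
    have lin': "\<And>y. linear (\<lambda>x. B' x y)" using Q by blast
    have pos': "\<And>x. 0 \<le> B' x x" using Q by blast
    have eq: "\<And>\<theta>. B \<theta> \<theta> = B' \<theta> \<theta> + (\<Sum>k\<in>I. (\<theta> \<bullet> a k)\<^sup>2)" using Q by blast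
    have ker: "\<And>k y. k \<in> I \<Longrightarrow> B' (axis k 1) y = 0" using Q by blast
    define e :: "real ^ 'd" where "e = axis j 1"
    define c where "c = B' e e"
    have CS: "(B' e y)\<^sup>2 \<le> c * B' y y" for y
      unfolding c_def by (rule psd_Cauchy_Schwarz[OF sym' lin' pos'])
    have lin2: "linear (B' x)" for x using lin'[of x] unfolding sym'[of _ x] .
    have "c \<ge> 0" using pos' by (simp add: c_def)
    show ?case
    proof (cases "c = 0")
      case True
      \<comment> \<open>A zero pivot forces its whole row to vanish by Cauchy-Schwarz, so the zero
        vector can be recorded for it.\<close>
      then have "B' e y = 0" for y using CS[of y] by simp
      moreover have "B \<theta> \<theta> = B' \<theta> \<theta> + (\<Sum>k\<in>insert j I. (\<theta> \<bullet> (a(j := 0)) k)\<^sup>2)" for \<theta>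
        using insert.hyps by (auto simp: eq intro!: sum.cong)
      ultimately show ?thesis using ker
        by (intro exI[of _ "a(j := 0)"] exI[of _ B'] conjI allI ballI sym' lin' pos')
          (auto simp: e_def)
    next
      case False
      with \<open>c \<ge> 0\<close> have c: "0 < c" by simp
      \<comment> \<open>The scaled pivot row:
        \<open>(\<theta> \<bullet> b)^2 = (B' e \<theta>)^2 / c\<close> is the square to be split
        off.\<close>
      define b :: "real ^ 'd" where "b = (1 / sqrt c) *\<^sub>R (\<chi> i. B' e (axis i 1))"
      have b: "\<theta> \<bullet> b = B' e \<theta> / sqrt c" for \<theta>
      proof -
        have "B' e \<theta> = B' e (\<Sum>i\<in>UNIV. \<theta> $ i *\<^sub>R axis i 1)"
          using basis_expansion[of \<theta>] by (simp add: scalar_mult_eq_scaleR)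
        also have "\<dots> = (\<Sum>i\<in>UNIV. \<theta> $ i * B' e (axis i 1))"
          by (simp add: linear_sum[OF lin2] linear_cmul[OF lin2])
        finally show ?thesis by (simp add: b_def inner_vec_def sum_divide_distrib)
      qed
      \<comment> \<open>The Schur complement of the pivot; its nonnegativity is exactly
        Cauchy-Schwarz.\<close>
      define B2 where "B2 x y = B' x y - B' e x * B' e y / c" for x y
      have "B2 x y = B2 y x" for x y by (simp add: B2_def sym'[of x y])
      moreover have "linear (\<lambda>x. B2 x y)" for y
        unfolding B2_def
        by (intro linear_compose_sub lin' linearI)
          (simp_all add: linear_add[OF lin2] linear_cmul[OF lin2] algebra_simps add_divide_distrib)
      moreover have "0 \<le> B2 x x" for x
        using CS[of x] c by (simp add: B2_def field_simps power2_eq_square)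
      moreover have "B \<theta> \<theta> = B2 \<theta> \<theta> + (\<Sum>k\<in>insert j I. (\<theta> \<bullet> (a(j := b)) k)\<^sup>2)" for \<theta>
      proof -
        have "(\<Sum>k\<in>I. (\<theta> \<bullet> (a(j := b)) k)\<^sup>2) = (\<Sum>k\<in>I. (\<theta> \<bullet> a k)\<^sup>2)"
          using insert.hyps by (intro sum.cong) auto
        then show ?thesis using insert.hyps c
          by (simp add: eq B2_def b power_divide) (simp add: power2_eq_square)
      qed
      moreover have "B2 (axis k 1) y = 0" if "k \<in> insert j I" for k y
      proof (cases "k = j")
        case True
        then show ?thesis using c by (simp add: B2_def c_def e_def)
      next
        case False
        then show ?thesis using that ker sym'[of e] by (simp add: B2_def)
      qed
      ultimately show ?thesis
        by (intro exI[of _ "a(j := b)"] exI[of _ B2] conjI allI ballI)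
    qed
  qed
  from this[of UNIV, OF finite] obtain a B' where Q: "?Q UNIV a B'" by (elim exE)
  have lin': "\<And>y. linear (\<lambda>x. B' x y)" using Q by (elim conjE) (erule spec)
  have eq: "\<And>\<theta>. B \<theta> \<theta> = B' \<theta> \<theta> + (\<Sum>k\<in>UNIV. (\<theta> \<bullet> a k)\<^sup>2)" using Q by (elim conjE) (erule spec)
  from Q have "\<forall>k\<in>UNIV. \<forall>y. B' (axis k 1) y = 0" by (elim conjE)
  then have ker: "\<And>k y. B' (axis k 1) y = 0" by blast
  have "B' \<theta> y = 0" for \<theta> y
  proof -
    have "B' \<theta> y = B' (\<Sum>i\<in>UNIV. \<theta> $ i *\<^sub>R axis i 1) y"
      using basis_expansion[of \<theta>] by (simp add: scalar_mult_eq_scaleR)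
    also have "\<dots> = 0"
      by (simp add: linear_sum[OF lin', unfolded o_def] linear_cmul[OF lin'] ker)
    finally show ?thesis .
  qed
  with eq show ?thesis by auto
qed

text \<open>Scaling a standard normal variable also produces the point mass for
  \<open>\<sigma> = 0\<close>, so the characteristic function and the moments can be computed
  without a case distinction.\<close>

lemma normal_law_eq_distr:
  assumes "0 \<le> \<sigma>"
  shows "normal_law 0 \<sigma> = distr std_normal_distribution borel (\<lambda>x. \<sigma> * x)"
proof (cases "\<sigma> = 0")
  case True
  interpret real_distribution std_normal_distribution by (rule real_dist_normal_dist)
  from True show ?thesis by (simp add: normal_law_def distr_const)
next
  case False
  interpret real_distribution std_normal_distribution by (rule real_dist_normal_dist)
  have "distributed std_normal_distribution lborel (\<lambda>x. x) std_normal_density"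
    unfolding distributed_def by (auto simp: distr_id2)
  from normal_density_affine[OF this, of \<sigma> 0] False assms
  have "distributed std_normal_distribution lborel (\<lambda>x. \<sigma> * x) (normal_density 0 \<sigma>)" by simp
  then have "distr std_normal_distribution lborel (\<lambda>x. \<sigma> * x) = density lborel (normal_density 0 \<sigma>)"
    by (simp add: distributed_def)
  then show ?thesis using False by (simp add: normal_law_def cong: distr_cong)
qed

lemma char_normal_law:
  assumes "0 \<le> \<sigma>"
  shows "char (normal_law 0 \<sigma>) t = exp (- (\<sigma> * t)\<^sup>2 / 2)"
proof -
  have "char (normal_law 0 \<sigma>) t = char std_normal_distribution (\<sigma> * t)"
    by (simp add: normal_law_eq_distr[OF assms] char_def integral_distr mult_ac)
  then show ?thesis by (simp add: char_std_normal_distribution exp_of_real[symmetric])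
qed

lemma char_fun_eq_char:
  fixes \<mu> :: "(real ^ 'd) measure"
  assumes "sets \<mu> = sets borel"
  shows "char_fun \<mu> (t *\<^sub>R \<theta>) = char (distr \<mu> borel (\<lambda>x. \<theta> \<bullet> x)) t"
proof -
  note [measurable_cong] = assms
  show ?thesis by (simp add: char_fun_def char_def integral_distr)
qed

text \<open>The law is the image of independent standard normals under the linear map with columns
  \<open>a k\<close>, the vectors of the decomposition of \<open>B\<close> into squares.\<close>

lemma gaussian_exists:
  fixes B :: "real ^ 'd \<Rightarrow> real ^ 'd \<Rightarrow> real"
  assumes sym: "\<And>x y. B x y = B y x" and lin: "\<And>y. linear (\<lambda>x. B x y)" and pos: "\<And>x. 0 \<le> B x x"
  shows "\<exists>\<eta> :: (real ^ 'd) measure. prob_space \<eta> \<and> sets \<eta> = sets borel \<and>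
    (\<forall>\<theta>. char_fun \<eta> \<theta> = exp (- B \<theta> \<theta> / 2))"
proof -
  obtain a :: "'d \<Rightarrow> real ^ 'd" where a: "\<And>\<theta>. B \<theta> \<theta> = (\<Sum>k\<in>UNIV. (\<theta> \<bullet> a k)\<^sup>2)"
    using psd_sum_of_squares[OF assms] by blast
  interpret Z: real_distribution std_normal_distribution by (rule real_dist_normal_dist)
  interpret product_prob_space "\<lambda>_::'d. std_normal_distribution" UNIV by unfold_locales
  let ?N = "PiM (UNIV :: 'd set) (\<lambda>_. std_normal_distribution)"
  define \<eta> where "\<eta> = distr ?N borel (\<lambda>z. \<Sum>k\<in>UNIV. z k *\<^sub>R a k)"
  have meas[measurable]: "(\<lambda>z. \<Sum>k\<in>UNIV. z k *\<^sub>R a k) \<in> borel_measurable ?N" by measurable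
  have "char_fun \<eta> \<theta> = exp (- B \<theta> \<theta> / 2)" for \<theta>
  proof -
    have "char_fun \<eta> \<theta> = (\<integral>z. exp (\<i> * complex_of_real (\<theta> \<bullet> (\<Sum>k\<in>UNIV. z k *\<^sub>R a k))) \<partial>?N)"
      unfolding char_fun_def \<eta>_def by (subst integral_distr) auto
    also have "\<dots> = (\<integral>z. (\<Prod>k\<in>UNIV. exp (\<i> * complex_of_real ((\<theta> \<bullet> a k) * z k))) \<partial>?N)"
      by (simp add: inner_sum_right exp_sum[symmetric] sum_distrib_left mult_ac)
    also have "\<dots> = (\<Prod>k\<in>UNIV. \<integral>x. exp (\<i> * complex_of_real ((\<theta> \<bullet> a k) * x)) \<partial>std_normal_distribution)"
      by (rule product_integral_prod) (auto intro!: Z.integrable_const_bound[of _ 1])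
    also have "\<dots> = (\<Prod>k\<in>UNIV. complex_of_real (exp (- (\<theta> \<bullet> a k)\<^sup>2 / 2)))"
      using char_std_normal_distribution by (simp add: char_def fun_eq_iff)
    also have "\<dots> = exp (- B \<theta> \<theta> / 2)"
      by (simp only: of_real_prod[symmetric] exp_sum[symmetric] finite a)
         (simp add: sum_divide_distrib sum_negf)
    finally show ?thesis .
  qed
  moreover have "prob_space \<eta>" unfolding \<eta>_def by (rule prob_space_distr) simp
  ultimately show ?thesis by (intro exI[of _ \<eta>]) (auto simp: \<eta>_def)
qed

text \<open>Uniqueness is applied in one dimension: the characteristic function of a projection is
  that of \<open>\<eta>\<close> along a line, where \<open>Q\<close> is a multiple of
  \<open>t^2\<close>.\<close>

lemma gaussian_marginal:
  fixes \<eta> :: "(real ^ 'd) measure"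
  assumes "prob_space \<eta>" "sets \<eta> = sets borel" "\<And>\<theta>. char_fun \<eta> \<theta> = exp (- Q \<theta> / 2)"
    and "\<And>t \<theta>. Q (t *\<^sub>R \<theta>) = t\<^sup>2 * Q \<theta>" "\<And>\<theta>. 0 \<le> Q \<theta>"
  shows "distr \<eta> borel (\<lambda>x. \<theta> \<bullet> x) = normal_law 0 (sqrt (Q \<theta>))"
proof (rule Levy_uniqueness)
  interpret prob_space \<eta> by fact
  interpret Z: real_distribution std_normal_distribution by (rule real_dist_normal_dist)
  note [measurable_cong] = assms(2)
  show "real_distribution (distr \<eta> borel (\<lambda>x. \<theta> \<bullet> x))"
    by (rule real_distribution_distr) simp
  have s: "0 \<le> sqrt (Q \<theta>)" using assms(5) by simp
  show "real_distribution (normal_law 0 (sqrt (Q \<theta>)))"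
    unfolding normal_law_eq_distr[OF s] by (rule Z.real_distribution_distr) simp
  show "char (distr \<eta> borel (\<lambda>x. \<theta> \<bullet> x)) = char (normal_law 0 (sqrt (Q \<theta>)))"
  proof
    fix t
    show "char (distr \<eta> borel (\<lambda>x. \<theta> \<bullet> x)) t = char (normal_law 0 (sqrt (Q \<theta>))) t"
      using assms(5) by (simp add: char_normal_law char_fun_eq_char[OF assms(2), symmetric] assms(3,4)
        power_mult_distrib mult_ac exp_of_real[symmetric])
  qed
qed

lemma gaussian_moments:
  fixes \<eta> :: "(real ^ 'd) measure"
  assumes "prob_space \<eta>" "sets \<eta> = sets borel" "0 \<le> \<sigma>" "distr \<eta> borel (\<lambda>x. \<theta> \<bullet> x) = normal_law 0 \<sigma>"
  shows "integrable \<eta> (\<lambda>x. (\<theta> \<bullet> x) ^ k)" "(\<integral>x. \<theta> \<bullet> x \<partial>\<eta>) = 0" "(\<integral>x. (\<theta> \<bullet> x)\<^sup>2 \<partial>\<eta>) = \<sigma>\<^sup>2"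
proof -
  note [measurable_cong] = assms(2)
  have eq: "distr \<eta> borel (\<lambda>x. \<theta> \<bullet> x) = distr std_normal_distribution borel (\<lambda>x. \<sigma> * x)"
    using assms(3,4) by (simp add: normal_law_eq_distr)
  have i: "integrable (distr std_normal_distribution borel (\<lambda>x. \<sigma> * x)) (\<lambda>x. x ^ k)" for k
    by (simp add: integrable_distr_eq power_mult_distrib integrable_std_normal_distribution_moment)
  show "integrable \<eta> (\<lambda>x. (\<theta> \<bullet> x) ^ k)"
    using i[of k] unfolding eq[symmetric] by (simp add: integrable_distr_eq)
  have "(\<integral>x. (\<theta> \<bullet> x) ^ k \<partial>\<eta>) = (\<integral>x. x ^ k \<partial>distr \<eta> borel (\<lambda>x. \<theta> \<bullet> x))" for k
    by (simp add: integral_distr)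
  also have "\<dots> k = \<sigma> ^ k * (\<integral>x. x ^ k \<partial>std_normal_distribution)" for k
    unfolding eq by (simp add: integral_distr power_mult_distrib)
  finally have m: "(\<integral>x. (\<theta> \<bullet> x) ^ k \<partial>\<eta>) = \<sigma> ^ k * (\<integral>x. x ^ k \<partial>std_normal_distribution)" for k .
  show "(\<integral>x. \<theta> \<bullet> x \<partial>\<eta>) = 0"
    using m[of 1] integral_std_normal_distribution_moment_odd[of 1] by simp
  show "(\<integral>x. (\<theta> \<bullet> x)\<^sup>2 \<partial>\<eta>) = \<sigma>\<^sup>2"
    using m[of 2] std_normal_distribution_even_moments[of 1] by simp
qed

text \<open>The weighted identity is minus the second derivative of the plain one in the direction
  \<open>v\<close>. It is obtained from second difference quotients, whose limit under the integral
  is dominated by \<open>(\<theta> \<bullet> v)^2\<close>.\<close>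

lemma std_gaussian_exists:
  "\<exists>\<gamma> :: (real ^ 'd) measure. prob_space \<gamma> \<and> sets \<gamma> = sets borel \<and>
    (\<forall>y. (\<integral>\<theta>. cos (\<theta> \<bullet> y) \<partial>\<gamma>) = exp (- (norm y)\<^sup>2 / 2)) \<and>
    (\<forall>y v. (\<integral>\<theta>. cos (\<theta> \<bullet> y) * (\<theta> \<bullet> v)\<^sup>2 \<partial>\<gamma>) = ((norm v)\<^sup>2 - (y \<bullet> v)\<^sup>2) * exp (- (norm y)\<^sup>2 / 2)) \<and>
    (\<forall>v k. integrable \<gamma> (\<lambda>\<theta>. (\<theta> \<bullet> v) ^ k))"
proof -
  obtain \<gamma> :: "(real ^ 'd) measure" where \<gamma>: "prob_space \<gamma>" "sets \<gamma> = sets borel"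
    and char: "\<And>\<theta>. char_fun \<gamma> \<theta> = exp (- (\<theta> \<bullet> \<theta>) / 2)"
    using gaussian_exists[of "(\<bullet>)"]
    using inner_commute bounded_linear.linear[OF bounded_linear_inner_left] inner_ge_zero by blast
  interpret prob_space \<gamma> by fact
  note [measurable_cong] = \<gamma>(2)
  have marg: "distr \<gamma> borel (\<lambda>x. \<theta> \<bullet> x) = normal_law 0 (sqrt (\<theta> \<bullet> \<theta>))" for \<theta>
    by (rule gaussian_marginal[OF \<gamma>]) (auto simp: char power2_eq_square exp_of_real[symmetric])
  have int: "integrable \<gamma> (\<lambda>\<theta>. (\<theta> \<bullet> v) ^ k)" for v k
    using gaussian_moments(1)[OF \<gamma> _ marg[of v], of k] by (simp add: inner_commute)
  have cosint: "(\<integral>\<theta>. cos (\<theta> \<bullet> y) \<partial>\<gamma>) = exp (- (norm y)\<^sup>2 / 2)" for y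
    using char_fun_Re_Im(1)[OF \<gamma>, of y] char[of y]
    by (simp add: inner_commute power2_norm_eq_inner exp_of_real)
  have "(\<integral>\<theta>. cos (\<theta> \<bullet> y) * (\<theta> \<bullet> v)\<^sup>2 \<partial>\<gamma>) = ((norm v)\<^sup>2 - (y \<bullet> v)\<^sup>2) * exp (- (norm y)\<^sup>2 / 2)" for y v
  proof -
    \<comment> \<open>Minus the second difference quotient of \<open>cos\<close> along
      \<open>v\<close> is \<open>cos (\<theta> \<bullet> y)\<close> times this weight, which tends
      to \<open>(\<theta> \<bullet> v)^2\<close> as \<open>t\<close> tends to
      \<open>0\<close>.\<close>
    define w where "w t \<theta> = 2 * (1 - cos (t * (\<theta> \<bullet> v))) / t\<^sup>2" for t :: real and \<theta>
    define a where "a = y \<bullet> v"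
    define b where "b = (norm v)\<^sup>2"
    have eq: "(\<integral>\<theta>. cos (\<theta> \<bullet> y) * w t \<theta> \<partial>\<gamma>) =
      exp (- (norm y)\<^sup>2 / 2) * ((2 - exp (- (t * a) - t\<^sup>2 * b / 2) - exp (t * a - t\<^sup>2 * b / 2)) / t\<^sup>2)" for t
    proof -
      have "cos (\<theta> \<bullet> y) * w t \<theta> = (2 * cos (\<theta> \<bullet> y) - cos (\<theta> \<bullet> (y + t *\<^sub>R v)) - cos (\<theta> \<bullet> (y - t *\<^sub>R v))) / t\<^sup>2" for \<theta>
      proof -
        have "cos (\<theta> \<bullet> (y + t *\<^sub>R v)) + cos (\<theta> \<bullet> (y - t *\<^sub>R v)) = 2 * cos (\<theta> \<bullet> y) * cos (t * (\<theta> \<bullet> v))"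
          by (simp add: inner_add_right inner_diff_right cos_add cos_diff)
        then show ?thesis by (simp add: w_def right_diff_distrib)
      qed
      moreover have "integrable \<gamma> (\<lambda>\<theta>. cos (\<theta> \<bullet> z))" for z
        by (intro integrable_const_bound[of _ 1]) auto
      ultimately have "(\<integral>\<theta>. cos (\<theta> \<bullet> y) * w t \<theta> \<partial>\<gamma>) =
        (2 * exp (- (norm y)\<^sup>2 / 2) - exp (- (norm (y + t *\<^sub>R v))\<^sup>2 / 2) - exp (- (norm (y - t *\<^sub>R v))\<^sup>2 / 2)) / t\<^sup>2"
        by (simp add: cosint)
      also have "(norm (y + t *\<^sub>R v))\<^sup>2 = (norm y)\<^sup>2 + 2 * (t * a) + t\<^sup>2 * b"
        unfolding b_def a_def using dot_norm[of y "t *\<^sub>R v"] by (simp add: power_mult_distrib)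
      also have "(norm (y - t *\<^sub>R v))\<^sup>2 = (norm y)\<^sup>2 - 2 * (t * a) + t\<^sup>2 * b"
        unfolding b_def a_def using dot_norm_neg[of y "t *\<^sub>R v"] by (simp add: power_mult_distrib)
      also have "- ((norm y)\<^sup>2 + 2 * (t * a) + t\<^sup>2 * b) / 2 = - (norm y)\<^sup>2 / 2 + (- (t * a) - t\<^sup>2 * b / 2)"
        by (simp add: field_simps)
      also have "- ((norm y)\<^sup>2 - 2 * (t * a) + t\<^sup>2 * b) / 2 = - (norm y)\<^sup>2 / 2 + (t * a - t\<^sup>2 * b / 2)"
        by (simp add: field_simps)
      finally show ?thesis by (simp only: exp_add) (simp add: algebra_simps)
    qed
    have "((\<lambda>n. \<integral>\<theta>. cos (\<theta> \<bullet> y) * w (1 / real n) \<theta> \<partial>\<gamma>) \<longlonglongrightarrow> (\<integral>\<theta>. cos (\<theta> \<bullet> y) * (\<theta> \<bullet> v)\<^sup>2 \<partial>\<gamma>))"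
    proof (rule integral_dominated_convergence[where w = "\<lambda>\<theta>. (\<theta> \<bullet> v)\<^sup>2"])
      show "integrable \<gamma> (\<lambda>\<theta>. (\<theta> \<bullet> v)\<^sup>2)" by (rule int)
      have "(\<lambda>n. 2 * (1 - cos (1 / real n * c)) / (1 / real n)\<^sup>2) \<longlonglongrightarrow> c\<^sup>2" for c
        by (real_asymp simp: power2_eq_square)
      then show "AE \<theta> in \<gamma>. (\<lambda>n. cos (\<theta> \<bullet> y) * w (1 / real n) \<theta>) \<longlonglongrightarrow> cos (\<theta> \<bullet> y) * (\<theta> \<bullet> v)\<^sup>2"
        unfolding w_def by (intro AE_I2 tendsto_mult tendsto_const)
      have "\<bar>w t \<theta>\<bar> \<le> (\<theta> \<bullet> v)\<^sup>2" for t \<theta>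
      proof -
        have "1 - cos (t * (\<theta> \<bullet> v)) = 2 * (sin (t * (\<theta> \<bullet> v) / 2))\<^sup>2"
          using cos_double_sin[of "t * (\<theta> \<bullet> v) / 2"] by simp
        moreover have "(sin (t * (\<theta> \<bullet> v) / 2))\<^sup>2 \<le> (t * (\<theta> \<bullet> v) / 2)\<^sup>2"
          using abs_sin_x_le_abs_x[of "t * (\<theta> \<bullet> v) / 2"] abs_le_square_iff by blast
        ultimately have "2 * (1 - cos (t * (\<theta> \<bullet> v))) \<le> t\<^sup>2 * (\<theta> \<bullet> v)\<^sup>2" by (simp add: power_mult_distrib power_divide)
        \<comment> \<open>For \<open>t = 0\<close>, which is the index \<open>n = 0\<close> below,
          division by zero makes the weight \<open>0\<close>.\<close>
        then show ?thesis by (cases "t = 0") (auto simp: w_def abs_mult field_simps)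
      qed
      then show "AE \<theta> in \<gamma>. norm (cos (\<theta> \<bullet> y) * w (1 / real n) \<theta>) \<le> (\<theta> \<bullet> v)\<^sup>2" for n
        by (intro AE_I2) (simp add: abs_mult mult_le_one mult_mono[of "\<bar>cos (_ \<bullet> y)\<bar>" 1, simplified])
    qed (auto simp: w_def)
    moreover have "(\<lambda>n. (2 - exp (- (1 / real n * a) - (1 / real n)\<^sup>2 * b / 2) - exp (1 / real n * a - (1 / real n)\<^sup>2 * b / 2)) / (1 / real n)\<^sup>2) \<longlonglongrightarrow> b - a\<^sup>2"
      by (real_asymp simp: power2_eq_square)
    then have "((\<lambda>n. \<integral>\<theta>. cos (\<theta> \<bullet> y) * w (1 / real n) \<theta> \<partial>\<gamma>) \<longlonglongrightarrow> exp (- (norm y)\<^sup>2 / 2) * (b - a\<^sup>2))"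
      unfolding eq by (intro tendsto_intros)
    ultimately have "(\<integral>\<theta>. cos (\<theta> \<bullet> y) * (\<theta> \<bullet> v)\<^sup>2 \<partial>\<gamma>) = exp (- (norm y)\<^sup>2 / 2) * (b - a\<^sup>2)"
      by (rule LIMSEQ_unique)
    then show ?thesis by (simp add: a_def b_def mult.commute)
  qed
  with \<gamma> cosint int show ?thesis by blast
qed

subsection \<open>A central limit theorem for triangular arrays\<close>

lemma exp_minus_first_order:
  fixes u :: real
  assumes "0 \<le> u"
  shows "\<bar>1 - u - exp (- u)\<bar> \<le> u\<^sup>2"
proof -
  have "1 - u \<le> exp (- u)" using exp_ge_add_one_self[of "- u"] by simp
  moreover have "exp (- u) \<le> 1 / (1 + u)"
    using exp_ge_add_one_self[of u] assms by (simp add: exp_minus field_simps)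
  moreover have "1 / (1 + u) \<le> 1 - u + u\<^sup>2"
    using assms by (simp add: field_simps power2_eq_square)
  ultimately show ?thesis by linarith
qed

text \<open>Rows are identically distributed, so the characteristic function of a row sum is a
  power, and \<open>|a^n - b^n| \<le> n * |a - b|\<close> in the unit disc compares it with
  \<open>exp (- u n) ^ n\<close>. The single factors differ by a third-order Taylor remainder, which
  Lindeberg's condition makes \<open>o (1 / n)\<close>, and by at most
  \<open>(u n)^2\<close>.\<close>

theorem (in prob_space) triangular_char_limit:
  fixes W :: "nat \<Rightarrow> nat \<Rightarrow> 'a \<Rightarrow> real" and \<mu> :: "nat \<Rightarrow> real measure"
  assumes indep: "\<And>n. 1 \<le> n \<Longrightarrow> indep_vars (\<lambda>_. borel) (W n) {1..n}"
    and ident: "\<And>n j. 1 \<le> j \<Longrightarrow> j \<le> n \<Longrightarrow> distr M borel (W n j) = \<mu> n"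
    and mean: "\<And>n. 1 \<le> n \<Longrightarrow> (\<integral>x. x \<partial>\<mu> n) = 0"
    and sq: "\<And>n. 1 \<le> n \<Longrightarrow> integrable (\<mu> n) (\<lambda>x. x\<^sup>2)"
    and var: "(\<lambda>n. real n * (\<integral>x. x\<^sup>2 \<partial>\<mu> n)) \<longlonglongrightarrow> q"
    and lindeberg: "\<And>e. 0 < e \<Longrightarrow>
      (\<lambda>n. real n * (\<integral>x. x\<^sup>2 * indicator {e<..} \<bar>x\<bar> \<partial>\<mu> n)) \<longlonglongrightarrow> 0"
  shows "(\<lambda>n. char (distr M borel (\<lambda>\<omega>. \<Sum>j=1..n. W n j \<omega>)) 1) \<longlonglongrightarrow> exp (- complex_of_real q / 2)"
proof -
  define v where "v n = real n * (\<integral>x. x\<^sup>2 \<partial>\<mu> n)" for n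
  define \<phi> where "\<phi> n = char (\<mu> n) 1" for n
  \<comment> \<open>For \<open>n \<ge> 1\<close> this is half the variance of one entry of row
    \<open>n\<close>.\<close>
  define u where "u n = v n / (2 * real n)" for n
  have v0: "0 \<le> v n" for n by (simp add: v_def)
  have D: "real_distribution (\<mu> n)" if "1 \<le> n" for n
  proof -
    have "random_variable borel (W n n)" using indep[OF that] that by (auto simp: indep_vars_def2)
    then show ?thesis using real_distribution_distr[of "W n n"] ident[OF that order_refl] by simp
  qed
  have approx: "cmod (\<phi> n - complex_of_real (1 - u n)) \<le> (\<integral>x. min (6 * x\<^sup>2) (\<bar>x\<bar> ^ 3) \<partial>\<mu> n) / 6"
    if n: "1 \<le> n" for n
  proof -
    interpret \<mu>: real_distribution "\<mu> n" by (rule D[OF n])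
    have "\<mu>.variance (\<lambda>x. x) = 2 * u n"
      unfolding mean[OF n] using n by (simp add: u_def v_def)
    moreover have "integrable (\<mu> n) (\<lambda>x. x)" by (rule \<mu>.square_integrable_imp_integrable[OF _ sq[OF n]]) simp
    ultimately have "cmod (\<phi> n - (1 - 1\<^sup>2 * (2 * u n) / 2)) \<le>
      1\<^sup>2 / 6 * (\<integral>x. min (6 * x\<^sup>2) (\<bar>1\<bar> * \<bar>x\<bar> ^ 3) \<partial>\<mu> n)"
      unfolding \<phi>_def using sq[OF n] mean[OF n] by (intro \<mu>.char_approx3) auto
    then show ?thesis by simp
  qed
  have small: "(\<lambda>n. real n * ((\<integral>x. min (6 * x\<^sup>2) (\<bar>x\<bar> ^ 3) \<partial>\<mu> n) / 6)) \<longlonglongrightarrow> 0"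
    (is "?m \<longlonglongrightarrow> 0")
  proof (rule order_tendstoI)
    fix a :: real assume "a < 0"
    have "0 \<le> ?m n" for n by simp
    with \<open>a < 0\<close> show "\<forall>\<^sub>F n in sequentially. a < ?m n"
      by (intro always_eventually allI) (rule less_le_trans)
  next
    fix a :: real assume a: "0 < a"
    \<comment> \<open>Chosen so that the limit \<open>e * q / 6\<close> of the variance term stays
      below \<open>a\<close>; the summand \<open>1\<close> covers \<open>q = 0\<close>.\<close>
    define e where "e = a / (\<bar>q\<bar> + 1)"
    have e: "0 < e" using a by (simp add: e_def)
    let ?L = "\<lambda>n. real n * (\<integral>x. x\<^sup>2 * indicator {e<..} \<bar>x\<bar> \<partial>\<mu> n)"
    have le: "?m n \<le> e * v n / 6 + ?L n" if n: "1 \<le> n" for n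
    proof -
      interpret \<mu>: real_distribution "\<mu> n" by (rule D[OF n])
      have i: "integrable (\<mu> n) (\<lambda>x. x\<^sup>2 * indicator {e<..} \<bar>x\<bar>)"
        by (rule Bochner_Integration.integrable_bound[OF sq[OF n]]) (auto simp: indicator_def)
      have "(\<integral>x. min (6 * x\<^sup>2) (\<bar>x\<bar> ^ 3) \<partial>\<mu> n) \<le>
         (\<integral>x. e * x\<^sup>2 + 6 * (x\<^sup>2 * indicator {e<..} \<bar>x\<bar>) \<partial>\<mu> n)"
      proof (rule integral_mono)
        show "integrable (\<mu> n) (\<lambda>x. min (6 * x\<^sup>2) (\<bar>x\<bar> ^ 3))"
          by (rule Bochner_Integration.integrable_bound[where f = "\<lambda>x. 6 * x\<^sup>2"]) (use sq[OF n] in auto)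
        show "integrable (\<mu> n) (\<lambda>x. e * x\<^sup>2 + 6 * (x\<^sup>2 * indicator {e<..} \<bar>x\<bar>))"
          using i sq[OF n] by auto
        \<comment> \<open>Below the threshold the cubic branch gives \<open>e * x^2\<close>; above
          it the quadratic branch is left to Lindeberg's condition.\<close>
        show "min (6 * x\<^sup>2) (\<bar>x\<bar> ^ 3) \<le> e * x\<^sup>2 + 6 * (x\<^sup>2 * indicator {e<..} \<bar>x\<bar>)" for x
        proof (cases "\<bar>x\<bar> \<le> e")
          case True
          then have "\<bar>x\<bar> * x\<^sup>2 \<le> e * x\<^sup>2" by (intro mult_right_mono) auto
          moreover have "\<bar>x\<bar> ^ 3 = \<bar>x\<bar> * x\<^sup>2"
            by (simp add: power3_eq_cube power2_eq_square)
          ultimately show ?thesis using True by (intro min.coboundedI2) simp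
        next
          case False
          then show ?thesis using e by (intro min.coboundedI1) simp
        qed
      qed
      also have "\<dots> = e * (\<integral>x. x\<^sup>2 \<partial>\<mu> n) + 6 * (\<integral>x. x\<^sup>2 * indicator {e<..} \<bar>x\<bar> \<partial>\<mu> n)"
        using i sq[OF n] by simp
      finally have "real n * ((\<integral>x. min (6 * x\<^sup>2) (\<bar>x\<bar> ^ 3) \<partial>\<mu> n) / 6) \<le>
         real n * ((e * (\<integral>x. x\<^sup>2 \<partial>\<mu> n) + 6 * (\<integral>x. x\<^sup>2 * indicator {e<..} \<bar>x\<bar> \<partial>\<mu> n)) / 6)"
        by (intro mult_left_mono divide_right_mono) auto
      then show ?thesis by (simp add: v_def algebra_simps add_divide_distrib)
    qed
    have "(\<lambda>n. e * v n / 6 + ?L n) \<longlonglongrightarrow> e * q / 6 + 0"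
      unfolding v_def by (intro tendsto_intros var lindeberg e) auto
    moreover have "e * q / 6 + 0 < a"
    proof -
      have "e * q \<le> e * \<bar>q\<bar>" using e by (intro mult_left_mono) auto
      also have "\<dots> \<le> a" using a by (simp add: e_def field_simps)
      finally show ?thesis using a by simp
    qed
    ultimately have lt: "\<forall>\<^sub>F n in sequentially. e * v n / 6 + ?L n < a"
      by (intro order_tendstoD(2)[where y = "e * q / 6 + 0"])
    from lt eventually_ge_at_top[of 1] show "\<forall>\<^sub>F n in sequentially. ?m n < a"
      by eventually_elim (rule le_less_trans[OF le])
  qed
  have vq: "v \<longlonglongrightarrow> q" using var by (simp add: v_def[abs_def])
  have char_sum: "char (distr M borel (\<lambda>\<omega>. \<Sum>j=1..n. W n j \<omega>)) 1 = \<phi> n ^ n" if n: "1 \<le> n" for n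
  proof -
    have "char (distr M borel (\<lambda>\<omega>. \<Sum>j=1..n. W n j \<omega>)) 1 = (\<Prod>j=1..n. char (distr M borel (W n j)) 1)"
      by (rule char_distr_sum[OF indep[OF n]])
    also have "\<dots> = (\<Prod>j=1..n. \<phi> n)" unfolding \<phi>_def
      by (intro prod.cong arg_cong2[where f = char] ident) auto
    finally show ?thesis by simp
  qed
  have bound: "cmod (\<phi> n ^ n - complex_of_real (exp (- v n / 2))) \<le>
    ?m n + (v n)\<^sup>2 * (1 / (4 * real n))" if n: "1 \<le> n" for n
  proof -
    have u0: "0 \<le> u n" using v0 by (simp add: u_def)
    interpret \<mu>: real_distribution "\<mu> n" by (rule D[OF n])
    have "exp (- v n / 2) = exp (- u n) ^ n"
      using n by (simp add: exp_of_nat_mult[symmetric] u_def)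
    then have "cmod (\<phi> n ^ n - complex_of_real (exp (- v n / 2))) = cmod (\<phi> n ^ n - complex_of_real (exp (- u n)) ^ n)"
      by simp
    also have "\<dots> \<le> n * cmod (\<phi> n - complex_of_real (exp (- u n)))"
      unfolding \<phi>_def using \<mu>.cmod_char_le_1[of 1] u0 by (intro norm_power_diff) auto
    also have "\<dots> \<le> n * ((\<integral>x. min (6 * x\<^sup>2) (\<bar>x\<bar> ^ 3) \<partial>\<mu> n) / 6 + (u n)\<^sup>2)"
    proof (rule mult_left_mono)
      have "cmod (\<phi> n - complex_of_real (exp (- u n))) \<le>
        cmod (\<phi> n - complex_of_real (1 - u n)) + cmod (complex_of_real (1 - u n) - complex_of_real (exp (- u n)))"
        using norm_triangle_ineq[of "\<phi> n - complex_of_real (1 - u n)" "complex_of_real (1 - u n) - complex_of_real (exp (- u n))"]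
        by simp
      also have "cmod (complex_of_real (1 - u n) - complex_of_real (exp (- u n))) = \<bar>1 - u n - exp (- u n)\<bar>"
        by (simp only: of_real_diff[symmetric] norm_of_real)
      finally show "cmod (\<phi> n - complex_of_real (exp (- u n))) \<le> (\<integral>x. min (6 * x\<^sup>2) (\<bar>x\<bar> ^ 3) \<partial>\<mu> n) / 6 + (u n)\<^sup>2"
        using approx[OF n] exp_minus_first_order[OF u0] by linarith
    qed simp
    also have "\<dots> = ?m n + n * (u n)\<^sup>2" by (simp add: distrib_left)
    also have "n * (u n)\<^sup>2 = (v n)\<^sup>2 * (1 / (4 * real n))"
      using n by (simp add: u_def power2_eq_square)
    finally show ?thesis .
  qed
  have "(\<lambda>n. ?m n + (v n)\<^sup>2 * (1 / (4 * real n))) \<longlonglongrightarrow> 0 + q\<^sup>2 * 0"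
    by (intro tendsto_intros small vq) real_asymp
  then have lim0: "(\<lambda>n. ?m n + (v n)\<^sup>2 * (1 / (4 * real n))) \<longlonglongrightarrow> 0" by simp
  have "\<forall>\<^sub>F n in sequentially. cmod (\<phi> n ^ n - complex_of_real (exp (- v n / 2))) \<le>
    ?m n + (v n)\<^sup>2 * (1 / (4 * real n))"
    using eventually_ge_at_top[of 1] by eventually_elim (rule bound)
  from Lim_null_comparison[OF this lim0]
  have "(\<lambda>n. \<phi> n ^ n - complex_of_real (exp (- v n / 2))) \<longlonglongrightarrow> 0" .
  moreover have "(\<lambda>n. complex_of_real (exp (- v n / 2))) \<longlonglongrightarrow> complex_of_real (exp (- q / 2))"
    by (intro tendsto_intros vq) auto
  ultimately have "(\<lambda>n. \<phi> n ^ n) \<longlonglongrightarrow> complex_of_real (exp (- q / 2))"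
    by (rule Lim_transform[rotated])
  then have "(\<lambda>n. \<phi> n ^ n) \<longlonglongrightarrow> exp (- complex_of_real q / 2)"
    by (simp add: exp_of_real[symmetric])
  moreover have "\<forall>\<^sub>F n in sequentially. \<phi> n ^ n = char (distr M borel (\<lambda>\<omega>. \<Sum>j=1..n. W n j \<omega>)) 1"
    using eventually_ge_at_top[of 1] by eventually_elim (simp only: char_sum)
  ultimately show ?thesis by (rule Lim_transform_eventually)
qed

subsection \<open>Tails of a regularly varying law\<close>

text \<open>The numerator of a conditional mean of \<open>g\<close> at the direction of
  \<open>h\<close>; \<open>g = 1\<close> gives the tail probability. The default
  \<open>sgn 0 = 0\<close> is cut off by the indicator as soon as \<open>0 \<le> x\<close>.\<close>

definition tail_integral :: "(real ^ 'd) measure \<Rightarrow> (real ^ 'd \<Rightarrow> real) \<Rightarrow> real \<Rightarrow> real" where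
  "tail_integral \<nu> g x = (\<integral>h. g (sgn h) * indicator {x<..} (norm h) \<partial>\<nu>)"

lemma borel_measurable_sgn_vec[measurable]: "(sgn :: real ^ 'd \<Rightarrow> real ^ 'd) \<in> borel_measurable borel"
  unfolding sgn_div_norm[abs_def] by measurable

lemma sphere_bound:
  fixes g :: "real ^ 'd \<Rightarrow> real"
  assumes "continuous_on UNIV g"
  shows "\<exists>C\<ge>0. \<forall>s. norm s = 1 \<longrightarrow> \<bar>g s\<bar> \<le> C"
proof -
  have "compact (g ` sphere 0 1)"
    by (intro compact_continuous_image continuous_on_subset[OF assms]) auto
  then have "bounded (g ` sphere 0 1)" by (rule compact_imp_bounded)
  then obtain C where "\<forall>s\<in>sphere 0 1. \<bar>g s\<bar> \<le> C" by (auto simp: bounded_iff)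
  then have "\<bar>g s\<bar> \<le> C" if "norm s = 1" for s using that by simp
  then have "\<bar>g s\<bar> \<le> \<bar>C\<bar>" if "norm s = 1" for s
    by (rule order_trans[OF _ abs_ge_self]) (use that in blast)
  then show ?thesis by (intro exI[of _ "\<bar>C\<bar>"]) auto
qed

section \<open>The ball model of the compactification\<close>

lemma ball_scale_norm:
  assumes "0 < c" "norm y \<le> 1"
  shows "0 < 1 + (c - 1) * norm y" "norm (ball_scale c y) = c * norm y / (1 + (c - 1) * norm y)"
proof -
  have "1 + (c - 1) * norm y = (1 - norm y) + c * norm y" by (simp add: algebra_simps)
  moreover have "0 < (1 - norm y) + c * norm y"
  proof (cases "norm y = 0")
    case False
    then show ?thesis using assms by (intro add_nonneg_pos mult_pos_pos) auto
  qed simp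
  ultimately show *: "0 < 1 + (c - 1) * norm y" by simp
  then show "norm (ball_scale c y) = c * norm y / (1 + (c - 1) * norm y)"
    using assms by (simp add: ball_scale_def)
qed

lemma sgn_ball_scale:
  assumes "0 < c" "norm y \<le> 1"
  shows "sgn (ball_scale c y) = sgn y"
  using ball_scale_norm(1)[OF assms] assms by (simp add: ball_scale_def sgn_scaleR)

lemma ball_scale_punctured:
  assumes "0 < c" "y \<in> punctured_ball"
  shows "ball_scale c y \<in> punctured_ball"
proof -
  have y: "norm y \<le> 1" "y \<noteq> 0" using assms by (auto simp: punctured_ball_def)
  note b = ball_scale_norm[OF assms(1) y(1)]
  have "c * norm y \<le> 1 + (c - 1) * norm y" using y by (simp add: algebra_simps)
  then have "norm (ball_scale c y) \<le> 1" using b by simp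
  moreover have "ball_scale c y \<noteq> 0" using b(1) y assms by (simp add: ball_scale_def)
  ultimately show ?thesis by (simp add: punctured_ball_def)
qed

lemma ball_scale_inverse:
  assumes "0 < c" "norm y \<le> 1"
  shows "ball_scale (1 / c) (ball_scale c y) = y"
proof -
  note b = ball_scale_norm[OF assms]
  let ?D = "1 + (c - 1) * norm y"
  have "1 + (1 / c - 1) * norm (ball_scale c y) = 1 / ?D"
  proof -
    have "(1 / c - 1) * (c * norm y / ?D) = ((1 / c - 1) * c) * norm y / ?D" by simp
    moreover have "(1 / c - 1) * c = 1 - c" using assms by (simp add: field_simps)
    moreover have "1 + (1 - c) * norm y / ?D = (?D + (1 - c) * norm y) / ?D" using b(1) by (simp add: add_divide_distrib)
    moreover have "?D + (1 - c) * norm y = 1" by (simp add: algebra_simps)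
    ultimately show ?thesis unfolding b(2) by (simp only:)
  qed
  then have "ball_scale (1 / c) (ball_scale c y) = ((1 / c) / (1 / ?D)) *\<^sub>R ((c / ?D) *\<^sub>R y)"
    by (simp add: ball_scale_def)
  also have "\<dots> = y" using assms b(1) by simp
  finally show ?thesis .
qed

lemma norm_compactify: "norm (compactify z) = norm z / (1 + norm z)"
  by (simp add: compactify_def)

lemma norm_compactify_greater:
  assumes "0 < l"
  shows "l / (1 + l) < norm (compactify z) \<longleftrightarrow> l < norm z"
proof -
  have "0 < 1 + norm z" by (simp add: add_pos_nonneg)
  then show ?thesis using assms by (simp add: norm_compactify field_simps)
qed

lemma sgn_compactify: "sgn (compactify z) = sgn z"
proof -
  have "0 < 1 + norm z" by (simp add: add_pos_nonneg)
  then show ?thesis by (simp add: compactify_def sgn_scaleR)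
qed

lemma punctured_ball_borel[measurable]: "punctured_ball \<in> sets borel"
  by (simp add: punctured_ball_def)

text \<open>A ramp in the norm times an angular function is the continuous stand-in for the
  indicator of a tail set. Its support lies in \<open>u1 \<le> norm y \<le> 1\<close>, which is
  compact and contains the points at infinity, so a whole tail can be tested at once.\<close>

lemma test_function_radial:
  fixes g :: "real ^ 'd \<Rightarrow> real"
  assumes g: "continuous_on UNIV g" and u: "0 < u1" "u1 < u2"
  shows "test_function (\<lambda>y. if y \<in> punctured_ball then max 0 (min 1 ((norm y - u1) / (u2 - u1))) * g (sgn y) else 0)"
  unfolding test_function_def
proof (intro conjI exI[of _ "cball 0 1 - ball 0 u1"] allI impI)
  have "continuous_on punctured_ball (\<lambda>y :: real ^ 'd. max 0 (min 1 ((norm y - u1) / (u2 - u1))) * g (sgn y))"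
    unfolding sgn_div_norm
    by (intro continuous_intros continuous_on_compose2[OF g]) (use u in \<open>auto simp: punctured_ball_def\<close>)
  then show "continuous_on punctured_ball (\<lambda>y. if y \<in> punctured_ball then max 0 (min 1 ((norm y - u1) / (u2 - u1))) * g (sgn y) else 0)"
    by (rule continuous_on_eq) simp
  show "compact (cball (0 :: real ^ 'd) 1 - ball 0 u1)" by (intro compact_diff) auto
  show "cball (0 :: real ^ 'd) 1 - ball 0 u1 \<subseteq> punctured_ball" using u by (auto simp: punctured_ball_def)
  show "(if y \<in> punctured_ball then max 0 (min 1 ((norm y - u1) / (u2 - u1))) * g (sgn y) else 0) = 0"
    if "y \<notin> cball 0 1 - ball 0 u1" for y
    using that u by (auto simp: punctured_ball_def divide_nonpos_pos)
qed

lemma tail_integral_integrable: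
  fixes \<nu> :: "(real ^ 'd) measure" and g :: "real ^ 'd \<Rightarrow> real"
  assumes "prob_space \<nu>" "sets \<nu> = sets borel" "continuous_on UNIV g" and [measurable]: "A \<in> sets borel"
  shows "integrable \<nu> (\<lambda>h. g (sgn h) * indicator A (norm h))"
proof -
  interpret prob_space \<nu> by fact
  note [measurable_cong] = assms(2)
  have [measurable]: "g \<in> borel_measurable borel" using assms(3) by (rule borel_measurable_continuous_onI)
  obtain C where C: "0 \<le> C" "\<And>s. norm s = 1 \<Longrightarrow> \<bar>g s\<bar> \<le> C" using sphere_bound[OF assms(3)] by blast
  have "\<bar>g (sgn h)\<bar> \<le> C + \<bar>g 0\<bar>" for h :: "real ^ 'd"
    using C(2)[of "sgn h"] C(1) by (cases "h = 0") (auto simp: norm_sgn intro: order_trans)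
  then show ?thesis
    by (intro integrable_const_bound[of _ "C + \<bar>g 0\<bar>"]) (auto simp: indicator_def intro: order_trans[OF abs_ge_zero])
qed

lemma tail_integral_antimono:
  fixes \<nu> :: "(real ^ 'd) measure"
  assumes "prob_space \<nu>" "sets \<nu> = sets borel" "continuous_on UNIV g" "\<And>s. 0 \<le> g s" "x \<le> y"
  shows "tail_integral \<nu> g y \<le> tail_integral \<nu> g x"
  unfolding tail_integral_def
  by (intro integral_mono tail_integral_integrable[OF assms(1-3)]) (use assms(4,5) in \<open>auto simp: indicator_def\<close>)

lemma tail_integral_one:
  fixes \<nu> :: "(real ^ 'd) measure"
  assumes "sets \<nu> = sets borel"
  shows "tail_integral \<nu> (\<lambda>_. 1) x = measure \<nu> {h. x < norm h}"
proof -
  have "space \<nu> = UNIV" using sets_eq_imp_space_eq[OF assms] by simp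
  then have "(\<integral>h. indicator {h. x < norm h} h \<partial>\<nu>) = measure \<nu> {h. x < norm h}" by simp
  moreover have "(indicator {x<..} (norm h) :: real) = indicator {h. x < norm h} h" for h :: "real ^ 'd"
    by (simp add: indicator_def)
  ultimately show ?thesis by (simp add: tail_integral_def)
qed

text \<open>Indicators of tails are squeezed between ramps. The gap closes because the scaling
  property makes the tail of \<open>\<mu>\<close> beyond radius \<open>x\<close> equal to
  \<open>x powr - \<alpha> * \<sigma> g\<close>, which is continuous in \<open>x\<close>. Here
  \<open>\<sigma> g\<close> is the tail integral of \<open>\<mu>\<close> beyond radius
  \<open>1\<close>.\<close>

lemma rv_tail_sequence:
  fixes \<nu> :: "(real ^ 'd) measure"
  assumes \<nu>: "prob_space \<nu>" "sets \<nu> = sets borel" and rv: "regularly_varying_tails \<alpha> \<nu>"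
  shows "\<exists>a (\<sigma> :: (real ^ 'd \<Rightarrow> real) \<Rightarrow> real). (\<forall>n. 0 < a n) \<and> incseq a \<and> filterlim a at_top sequentially \<and> 0 < \<sigma> (\<lambda>_. 1) \<and>
    (\<forall>g l. continuous_on UNIV g \<and> (\<forall>s. 0 \<le> g s) \<and> 0 < l \<longrightarrow>
      (\<lambda>n. real n * tail_integral \<nu> g (l * a n)) \<longlonglongrightarrow> l powr - \<alpha> * \<sigma> g)"
proof -
  from rv[unfolded regularly_varying_tails_def]
  obtain a :: "nat \<Rightarrow> real" and \<mu> :: "(real ^ 'd) measure"
    where a: "\<forall>n. 0 < a n" "incseq a" "filterlim a at_top sequentially"
      and rad: "radon_on_punctured_ball \<mu>" and nonnull: "emeasure \<mu> punctured_ball \<noteq> 0"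
      and scal: "\<forall>c>0. \<forall>B\<in>sets \<mu>. emeasure \<mu> (ball_scale c ` B) = ennreal (c powr (- \<alpha>)) * emeasure \<mu> B"
      and vague: "\<forall>f. test_function f \<longrightarrow>
           (\<lambda>n. real n * (\<integral>x. f (compactify ((1 / a n) *\<^sub>R x)) \<partial>\<nu>)) \<longlonglongrightarrow> (\<integral>y. f y \<partial>\<mu>)"
    by blast
  interpret \<nu>: prob_space \<nu> by fact
  note [measurable_cong] = \<nu>(2)
  have sets: "sets \<mu> = sets (restrict_space borel punctured_ball)"
    using rad by (simp add: radon_on_punctured_ball_def)
  have sp: "space \<mu> = punctured_ball"
    using sets_eq_imp_space_eq[OF sets] by (simp add: space_restrict_space)
  have mB: "f \<in> borel_measurable \<mu>" if "f \<in> borel_measurable borel" for f :: "real ^ 'd \<Rightarrow> real"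
    using measurable_restrict_space1[OF that] by (simp add: measurable_cong_sets[OF sets refl])
  define I where "I g r = (\<integral>y. g (sgn y) * indicator {r<..} (norm y) \<partial>\<mu>)" for g :: "real ^ 'd \<Rightarrow> real" and r :: real
  define B where "B r = {y :: real ^ 'd. y \<in> punctured_ball \<and> r < norm y}" for r :: real
  have B_sets: "B r \<in> sets \<mu>" for r
  proof -
    have "{y :: real ^ 'd. r < norm y} \<in> sets borel" by measurable
    then have "punctured_ball \<inter> {y :: real ^ 'd. r < norm y} \<in> sets (restrict_space borel punctured_ball)"
      by (auto simp: sets_restrict_space)
    moreover have "B r = punctured_ball \<inter> {y. r < norm y}" by (auto simp: B_def)
    ultimately show ?thesis by (simp add: sets)
  qed
  have B_fin: "emeasure \<mu> (B r) < \<infinity>" if "0 < r" for r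
  proof -
    let ?K = "cball (0 :: real ^ 'd) 1 - ball 0 r"
    have K: "compact ?K" "?K \<subseteq> punctured_ball" using that
      by (auto intro: compact_diff simp: punctured_ball_def)
    have "?K \<in> sets \<mu>" using K(2) unfolding sets sets_restrict_space
      by (intro image_eqI[of _ _ ?K]) (auto simp: compact_imp_closed)
    moreover have "B r \<subseteq> ?K" by (auto simp: B_def punctured_ball_def)
    ultimately have "emeasure \<mu> (B r) \<le> emeasure \<mu> ?K" by (intro emeasure_mono)
    also have "\<dots> < \<infinity>" using rad K by (auto simp: radon_on_punctured_ball_def)
    finally show ?thesis .
  qed
  have int: "integrable \<mu> f" if "f \<in> borel_measurable borel" "0 < r" "\<And>y. y \<in> punctured_ball \<Longrightarrow> \<bar>f y\<bar> \<le> C * indicator (B r) y" for f :: "real ^ 'd \<Rightarrow> real" and C r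
  proof (rule Bochner_Integration.integrable_bound)
    show "integrable \<mu> (\<lambda>y. C * indicator (B r) y)"
      using B_sets B_fin[OF that(2)] by (intro integrable_mult_right integrable_real_indicator) auto
    show "f \<in> borel_measurable \<mu>" by (rule mB[OF that(1)])
    show "AE y in \<mu>. norm (f y) \<le> norm (C * indicator (B r) y)"
    proof (rule AE_I2)
      fix y assume "y \<in> space \<mu>"
      then have "\<bar>f y\<bar> \<le> C * indicator (B r) y" by (intro that(3)) (simp add: sp)
      also have "\<dots> \<le> norm (C * indicator (B r) y)" by simp
      finally show "norm (f y) \<le> norm (C * indicator (B r) y)" by simp
    qed
  qed
  have I_int: "integrable \<mu> (\<lambda>y. g (sgn y) * indicator {r<..} (norm y))"
    if g: "continuous_on UNIV g" and r: "0 < r" for g :: "real ^ 'd \<Rightarrow> real" and r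
  proof -
    have [measurable]: "g \<in> borel_measurable borel" using g by (rule borel_measurable_continuous_onI)
    obtain C where C: "0 \<le> C" "\<And>s. norm s = 1 \<Longrightarrow> \<bar>g s\<bar> \<le> C" using sphere_bound[OF g] by blast
    show ?thesis using r C
      by (intro int[of _ r C]) (auto simp: B_def punctured_ball_def indicator_def norm_sgn)
  qed
  \<comment> \<open>\<open>compactify\<close> takes norm \<open>c\<close> to \<open>c / (1 + c)\<close>, so the thresholds \<open>1 / 2\<close> and \<open>c / (1 + c)\<close> are the
    images of the norms \<open>1\<close> and \<open>c\<close>.\<close>
  have I_scale: "I g (c / (1 + c)) = c powr - \<alpha> * I g (1 / 2)"
    if g: "continuous_on UNIV g" "\<And>s. 0 \<le> g s" and c: "0 < c" for g :: "real ^ 'd \<Rightarrow> real" and c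
  proof -
    have [measurable]: "g \<in> borel_measurable borel" using g(1) by (rule borel_measurable_continuous_onI)
    let ?T = "ball_scale (1 / c) :: real ^ 'd \<Rightarrow> real ^ 'd"
    have T: "?T \<in> measurable \<mu> \<mu>"
    proof -
      have "?T \<in> borel_measurable borel" unfolding ball_scale_def[abs_def] by measurable
      then have "?T \<in> measurable (restrict_space borel punctured_ball) (restrict_space borel punctured_ball)"
        using c by (intro measurable_restrict_space2 measurable_restrict_space1)
          (auto simp: space_restrict_space intro: ball_scale_punctured)
      then show ?thesis by (simp add: measurable_cong_sets[OF sets sets])
    qed
    \<comment> \<open>Scaling is given for images under \<open>ball_scale c\<close>, and these are
      the preimages under the inverse map \<open>?T\<close>.\<close>
    have distr: "distr \<mu> \<mu> ?T = scale_measure (ennreal (c powr - \<alpha>)) \<mu>"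
    proof (rule measure_eqI)
      fix A assume "A \<in> sets (distr \<mu> \<mu> ?T)"
      then have A: "A \<in> sets \<mu>" by simp
      then have A': "A \<subseteq> punctured_ball" using sets.sets_into_space sp by blast
      have "?T -` A \<inter> space \<mu> = ball_scale c ` A"
      proof (intro equalityI subsetI)
        fix y assume "y \<in> ?T -` A \<inter> space \<mu>"
        then have y: "?T y \<in> A" "y \<in> space \<mu>" by auto
        then have "ball_scale c (?T y) = y"
          using ball_scale_inverse[of "1 / c" y] c by (auto simp: sp punctured_ball_def)
        with y(1) show "y \<in> ball_scale c ` A" by (metis imageI)
      next
        fix x assume "x \<in> ball_scale c ` A"
        then obtain y where y: "y \<in> A" "x = ball_scale c y" by blast
        then have "y \<in> punctured_ball" "norm y \<le> 1" using A' by (auto simp: punctured_ball_def)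
        with y show "x \<in> ?T -` A \<inter> space \<mu>"
          using c ball_scale_inverse[of c y] ball_scale_punctured[of c y] by (simp add: sp)
      qed
      then show "emeasure (distr \<mu> \<mu> ?T) A = emeasure (scale_measure (ennreal (c powr - \<alpha>)) \<mu>) A"
        using scal c A T by (simp add: emeasure_distr)
    qed simp
    let ?f = "\<lambda>y. g (sgn y) * indicator {1 / 2<..} (norm y)"
    have f: "?f \<in> borel_measurable \<mu>" by (rule mB) measurable
    have fT: "?f (?T y) = g (sgn y) * indicator {c / (1 + c)<..} (norm y)" if "y \<in> space \<mu>" for y
    proof -
      have y: "norm y \<le> 1" "0 < norm y" using that by (auto simp: sp punctured_ball_def)
      have c': "0 < 1 / c" using c by simp
      note b = ball_scale_norm[OF c' y(1)]
      have "1 / 2 < norm (?T y) \<longleftrightarrow> 1 / 2 * (1 + (1 / c - 1) * norm y) < 1 / c * norm y"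
        unfolding b(2) by (rule pos_less_divide_eq[OF b(1)])
      also have "\<dots> \<longleftrightarrow> 0 < 1 / c * norm y - 1 / 2 * (1 + (1 / c - 1) * norm y)" by simp
      also have "1 / c * norm y - 1 / 2 * (1 + (1 / c - 1) * norm y) = ((1 + c) * norm y - c) / (2 * c)"
        using c by (simp add: field_simps)
      also have "0 < \<dots> \<longleftrightarrow> c < norm y * (1 + c)" using c by (simp add: zero_less_divide_iff mult.commute)
      also have "\<dots> \<longleftrightarrow> c / (1 + c) < norm y" using c by (intro pos_divide_less_eq[symmetric]) simp
      finally show ?thesis by (simp add: sgn_ball_scale[OF c' y(1)] indicator_def)
    qed
    have "I g (c / (1 + c)) = (\<integral>y. ?f (?T y) \<partial>\<mu>)"
      unfolding I_def by (intro Bochner_Integration.integral_cong) (auto simp: fT)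
    also have "\<dots> = (\<integral>y. ?f y \<partial>distr \<mu> \<mu> ?T)" using f T by (simp add: integral_distr)
    also have "\<dots> = enn2real (\<integral>\<^sup>+y. ennreal (?f y) \<partial>distr \<mu> \<mu> ?T)"
      using f g(2) by (intro integral_eq_nn_integral) auto
    also have "(\<integral>\<^sup>+y. ennreal (?f y) \<partial>distr \<mu> \<mu> ?T) = ennreal (c powr - \<alpha>) * (\<integral>\<^sup>+y. ennreal (?f y) \<partial>\<mu>)"
      unfolding distr using f by (intro nn_integral_scale_measure) simp
    also have "enn2real \<dots> = c powr - \<alpha> * I g (1 / 2)"
      unfolding I_def using f g(2) by (subst integral_eq_nn_integral) (auto simp: enn2real_mult)
    finally show ?thesis .
  qed
  have bracket: "(\<lambda>n. real n * tail_integral \<nu> g (l * a n)) \<longlonglongrightarrow> l powr - \<alpha> * I g (1 / 2)"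
    if g: "continuous_on UNIV g" "\<And>s. 0 \<le> g s" and l: "0 < l" for g :: "real ^ 'd \<Rightarrow> real" and l
  proof -
    have [measurable]: "g \<in> borel_measurable borel" using g(1) by (rule borel_measurable_continuous_onI)
    define t :: "real \<Rightarrow> real" where "t x = x / (1 + x)" for x
    have t: "0 < t x" "t x < t y" "t x < 1" if "0 < x" "x < y" for x y using that by (auto simp: t_def field_simps)
    \<comment> \<open>In the ball, the ramp rises between the images of the radii \<open>x\<close>
      and \<open>y\<close>.\<close>
    define F where "F x y z = (if z \<in> punctured_ball then max 0 (min 1 ((norm z - t x) / (t y - t x))) * g (sgn z) else 0)"
      for x y and z :: "real ^ 'd"
    have F_meas[measurable]: "F x y \<in> borel_measurable borel" for x y unfolding F_def[abs_def] by measurable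
    have F_lim: "(\<lambda>n. real n * (\<integral>h. F x y (compactify ((1 / a n) *\<^sub>R h)) \<partial>\<nu>)) \<longlonglongrightarrow> (\<integral>z. F x y z \<partial>\<mu>)"
      if "0 < x" "x < y" for x y
      using vague test_function_radial[OF g(1) t(1)[OF that] t(2)[OF that]] unfolding F_def[abs_def] by blast
    obtain C where C: "0 \<le> C" "\<And>s. norm s = 1 \<Longrightarrow> \<bar>g s\<bar> \<le> C" using sphere_bound[OF g(1)] by blast
    have F_bounds: "g (sgn z) * indicator {t y<..} (norm z) \<le> F x y z" "F x y z \<le> g (sgn z) * indicator {t x<..} (norm z)"
      if "0 < x" "x < y" "norm z \<le> 1" for x y z
      unfolding atomize_conj
    proof (cases "z = 0")
      case True
      then show "g (sgn z) * indicator {t y<..} (norm z) \<le> F x y z \<and> F x y z \<le> g (sgn z) * indicator {t x<..} (norm z)"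
        using t(1)[of y "y+1"] t(1)[OF that(1,2)] that by (simp add: F_def punctured_ball_def)
    next
      case False
      define k where "k = max 0 (min 1 ((norm z - t x) / (t y - t x)))"
      have d: "0 < t y - t x" using t(2)[OF that(1,2)] by simp
      have k: "indicator {t y<..} (norm z) \<le> k" "k \<le> indicator {t x<..} (norm z)"
        using d by (auto simp: k_def indicator_def field_simps divide_nonpos_pos)
      have "F x y z = k * g (sgn z)" using False that by (simp add: F_def punctured_ball_def k_def)
      then show "g (sgn z) * indicator {t y<..} (norm z) \<le> F x y z \<and> F x y z \<le> g (sgn z) * indicator {t x<..} (norm z)"
        using mult_left_mono[OF k(1) g(2)[of "sgn z"]] mult_left_mono[OF k(2) g(2)[of "sgn z"]]
        by (simp add: mult.commute)
    qed
    have F_abs: "\<bar>F x y z\<bar> \<le> C" if xy: "0 < x" "x < y" for x y z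
    proof (cases "z \<in> punctured_ball")
      case True
      then have z: "norm z \<le> 1" "z \<noteq> 0" by (auto simp: punctured_ball_def)
      have "0 \<le> g (sgn z) * indicator {t y<..} (norm z)" using g(2) by simp
      moreover have "g (sgn z) * indicator {t x<..} (norm z) \<le> C"
        using C(2)[of "sgn z"] C(1) z by (auto simp: indicator_def norm_sgn)
      ultimately show ?thesis using F_bounds[OF xy z(1)] by simp
    qed (use C in \<open>simp add: F_def\<close>)
    have I_low: "I g (t y) \<le> (\<integral>z. F x y z \<partial>\<mu>)" and I_up: "(\<integral>z. F x y z \<partial>\<mu>) \<le> I g (t x)"
      if xy: "0 < x" "x < y" for x y
    proof -
      have "integrable \<mu> (F x y)"
      proof (rule int[OF F_meas t(1)[OF xy]])
        fix z :: "real ^ 'd" assume z: "z \<in> punctured_ball"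
        then have "norm z \<le> 1" by (simp add: punctured_ball_def)
        note b = F_bounds[OF xy this]
        show "\<bar>F x y z\<bar> \<le> C * indicator (B (t x)) z"
        proof (cases "t x < norm z")
          case True
          with z have "z \<in> B (t x)" by (simp add: B_def)
          then show ?thesis using F_abs[OF xy, of z] by simp
        next
          case False
          moreover have "0 \<le> g (sgn z) * indicator {t y<..} (norm z)" using g(2) by simp
          ultimately have "F x y z = 0" using b by (simp add: indicator_def)
          then show ?thesis using C(1) by (simp add: indicator_def)
        qed
      qed
      then show "I g (t y) \<le> (\<integral>z. F x y z \<partial>\<mu>)" "(\<integral>z. F x y z \<partial>\<mu>) \<le> I g (t x)"
        unfolding I_def using I_int[OF g(1)] t(1)[of x y] t(1)[of y "y + 1"] xy F_bounds[OF xy]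
        by (auto intro!: integral_mono simp: sp punctured_ball_def)
    qed
    have F_int: "integrable \<nu> (\<lambda>h. F x y (compactify ((1 / a n) *\<^sub>R h)))" if "0 < x" "x < y" for x y n
      using F_abs[OF that] by (intro \<nu>.integrable_const_bound[of _ C]) (auto simp: compactify_def)
    have T_eq: "tail_integral \<nu> g (x * a n) = (\<integral>h. g (sgn (compactify ((1 / a n) *\<^sub>R h))) * indicator {t x<..} (norm (compactify ((1 / a n) *\<^sub>R h))) \<partial>\<nu>)"
      if "0 < x" for x n
      unfolding tail_integral_def
    proof (rule Bochner_Integration.integral_cong)
      fix h :: "real ^ 'd"
      have "0 < a n" using a(1) by blast
      then have "x * a n < norm h \<longleftrightarrow> t x < norm (compactify ((1 / a n) *\<^sub>R h))"
        unfolding t_def norm_compactify_greater[OF that] by (simp add: field_simps)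
      moreover have "sgn (compactify ((1 / a n) *\<^sub>R h)) = sgn h"
        using \<open>0 < a n\<close> by (simp add: sgn_compactify sgn_scaleR)
      ultimately show "g (sgn h) * indicator {x * a n<..} (norm h) =
        g (sgn (compactify ((1 / a n) *\<^sub>R h))) * indicator {t x<..} (norm (compactify ((1 / a n) *\<^sub>R h)))"
        by (simp add: indicator_def)
    qed simp
    have T_int: "integrable \<nu> (\<lambda>h. g (sgn (compactify ((1 / a n) *\<^sub>R h))) * indicator {t x<..} (norm (compactify ((1 / a n) *\<^sub>R h))))"
      if "0 < x" for x n
    proof (rule \<nu>.integrable_const_bound[of _ C])
      show "AE h in \<nu>. norm (g (sgn (compactify ((1 / a n) *\<^sub>R h))) * indicator {t x<..} (norm (compactify ((1 / a n) *\<^sub>R h)))) \<le> C"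
      proof (rule AE_I2)
        fix h :: "real ^ 'd"
        let ?z = "compactify ((1 / a n) *\<^sub>R h)"
        have "norm (sgn ?z) = 1" if "t x < norm ?z" using that t(1)[of x "x + 1"] \<open>0 < x\<close> by (auto simp: norm_sgn)
        then show "norm (g (sgn ?z) * indicator {t x<..} (norm ?z)) \<le> C"
          using C by (auto simp: indicator_def)
      qed
    qed (simp add: compactify_def)
    have nc: "norm (compactify z) \<le> 1" for z :: "real ^ 'd"
      by (simp add: norm_compactify divide_le_eq_1 add_pos_nonneg)
    show ?thesis
    proof (rule order_tendstoI)
      fix c assume c: "l powr - \<alpha> * I g (1 / 2) < c"
      \<comment> \<open>A ramp that starts slightly below radius \<open>l\<close> and is complete at
        \<open>l\<close> dominates the indicator; how far below is fixed by the continuity of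
        \<open>x powr - \<alpha>\<close>.\<close>
      have "((\<lambda>x. x powr - \<alpha> * I g (1 / 2)) \<longlongrightarrow> l powr - \<alpha> * I g (1 / 2)) (at_left l)"
        using l by (intro tendsto_intros) auto
      from order_tendstoD(2)[OF this c] eventually_at_left_real[OF l]
      have "\<forall>\<^sub>F x in at_left l. x powr - \<alpha> * I g (1 / 2) < c \<and> x \<in> {0<..<l}" by eventually_elim simp
      then obtain x where x: "x powr - \<alpha> * I g (1 / 2) < c" "0 < x" "x < l"
        using eventually_happens[of _ "at_left l"] by (auto simp: trivial_limit_at_left_real)
      have "(\<integral>z. F x l z \<partial>\<mu>) < c"
        using I_up[OF x(2,3)] x I_scale[OF g x(2)] by (simp add: t_def)
      from order_tendstoD(2)[OF F_lim[OF x(2,3)] this]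
      show "\<forall>\<^sub>F n in sequentially. real n * tail_integral \<nu> g (l * a n) < c"
      proof eventually_elim
        case (elim n)
        have "tail_integral \<nu> g (l * a n) \<le> (\<integral>h. F x l (compactify ((1 / a n) *\<^sub>R h)) \<partial>\<nu>)"
          unfolding T_eq[OF l] by (intro integral_mono T_int[OF l] F_int[OF x(2,3)] F_bounds[OF x(2,3)] nc)
        then have "real n * tail_integral \<nu> g (l * a n) \<le> real n * (\<integral>h. F x l (compactify ((1 / a n) *\<^sub>R h)) \<partial>\<nu>)"
          by (rule mult_left_mono) simp
        with elim show ?case by linarith
      qed
    next
      fix c assume c: "c < l powr - \<alpha> * I g (1 / 2)"
      \<comment> \<open>For the lower bound the ramp starts at \<open>l\<close> and is complete at a
        slightly larger radius.\<close>
      have l1: "l < l + 1" by simp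
      have "((\<lambda>x. x powr - \<alpha> * I g (1 / 2)) \<longlongrightarrow> l powr - \<alpha> * I g (1 / 2)) (at_right l)"
        using l by (intro tendsto_intros) auto
      from order_tendstoD(1)[OF this c] eventually_at_right_real[OF l1]
      have "\<forall>\<^sub>F x in at_right l. c < x powr - \<alpha> * I g (1 / 2) \<and> x \<in> {l<..<l+1}" by eventually_elim simp
      then obtain x where x: "c < x powr - \<alpha> * I g (1 / 2)" "l < x"
        using eventually_happens[of _ "at_right l"] by (auto simp: trivial_limit_at_right_real)
      have "c < (\<integral>z. F l x z \<partial>\<mu>)"
        using I_low[OF l x(2)] x I_scale[OF g, of x] l by (simp add: t_def)
      from order_tendstoD(1)[OF F_lim[OF l x(2)] this]
      show "\<forall>\<^sub>F n in sequentially. c < real n * tail_integral \<nu> g (l * a n)"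
      proof eventually_elim
        case (elim n)
        have "(\<integral>h. F l x (compactify ((1 / a n) *\<^sub>R h)) \<partial>\<nu>) \<le> tail_integral \<nu> g (l * a n)"
          unfolding T_eq[OF l] by (intro integral_mono T_int[OF l] F_int[OF l x(2)] F_bounds[OF l x(2)] nc)
        then have "real n * (\<integral>h. F l x (compactify ((1 / a n) *\<^sub>R h)) \<partial>\<nu>) \<le> real n * tail_integral \<nu> g (l * a n)"
          by (rule mult_left_mono) simp
        with elim show ?case by linarith
      qed
    qed
  qed
  have I_meas: "I (\<lambda>_. 1) r = measure \<mu> (B r)" if "0 < r" for r
  proof -
    have "I (\<lambda>_. 1) r = (\<integral>y. indicator (B r) y \<partial>\<mu>)"
      unfolding I_def by (intro Bochner_Integration.integral_cong) (auto simp: B_def sp indicator_def)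
    also have "\<dots> = measure \<mu> (B r \<inter> space \<mu>)" by simp
    finally show ?thesis using B_sets[of r] sets.sets_into_space by (metis Int_absorb2)
  qed
  \<comment> \<open>If the tail beyond radius \<open>1\<close> were null, scaling would make every
    tail null, and these exhaust the punctured ball. The radius \<open>1 / (k + 1)\<close> has the
    image \<open>1 / (k + 2)\<close>.\<close>
  have "0 < I (\<lambda>_. 1) (1 / 2)"
  proof (rule ccontr)
    assume "\<not> 0 < I (\<lambda>_. 1) (1 / 2)"
    then have zero: "I (\<lambda>_. 1) (1 / 2) = 0" using I_meas[of "1/2"] measure_nonneg[of \<mu> "B (1 / 2)"] by simp
    have "emeasure \<mu> (B (1 / (real k + 2))) = 0" for k
    proof -
      have "I (\<lambda>_. 1) (1 / (real k + 2)) = 0"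
        using I_scale[of "\<lambda>_. 1" "1 / (real k + 1)"] zero by (simp add: field_simps)
      then have "measure \<mu> (B (1 / (real k + 2))) = 0" using I_meas by simp
      then show ?thesis using B_fin[of "1 / (real k + 2)"] by (auto simp: measure_def enn2real_eq_0_iff)
    qed
    moreover have "punctured_ball = (\<Union>k. B (1 / (real k + 2)))"
    proof safe
      fix y :: "real ^ 'd" assume y: "y \<in> punctured_ball"
      then have "0 < norm y" by (auto simp: punctured_ball_def)
      then obtain k where "inverse (real (Suc k)) < norm y" using reals_Archimedean by blast
      moreover have "1 / (real k + 2) \<le> inverse (real (Suc k))" by (simp add: field_simps)
      ultimately show "y \<in> (\<Union>k. B (1 / (real k + 2)))" using y by (auto simp: B_def intro!: exI[of _ k])
    qed (auto simp: B_def)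
    moreover have "emeasure \<mu> (\<Union>k. B (1 / (real k + 2))) = 0"
      using calculation(1) B_sets by (intro emeasure_UN_eq_0) auto
    ultimately have "emeasure \<mu> punctured_ball = 0" by (simp only:)
    with nonnull show False by simp
  qed
  then show ?thesis using a bracket
    by (intro exI[of _ a] exI[of _ "\<lambda>g. I g (1 / 2)"]) auto
qed

text \<open>This carries limits along \<open>a\<close> over to a continuous variable: the least
  index with \<open>x < a n\<close> is preceded by the last one with \<open>a n \<le> x\<close>. For
  \<open>a 0 \<le> x\<close> the least index is positive, so the subtraction is not cut off.\<close>

lemma incseq_bracket_index:
  assumes "filterlim a at_top sequentially" "incseq a"
  shows "filterlim (\<lambda>x::real. (LEAST n. x < a n) - 1) at_top at_top"
    and "a 0 \<le> x \<Longrightarrow> a ((LEAST n. x < a n) - 1) \<le> x \<and> x < a (Suc ((LEAST n. x < a n) - 1))"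
proof -
  have ex: "\<exists>n. x < a n" for x
    using filterlim_at_top_dense[THEN iffD1, OF assms(1), rule_format, of x] eventually_happens by force
  have lt: "x < a (LEAST n. x < a n)" for x by (rule LeastI_ex[OF ex])
  show "filterlim (\<lambda>x. (LEAST n. x < a n) - 1) at_top at_top"
    unfolding filterlim_at_top
  proof
    fix K
    have "K \<le> (LEAST n. x < a n) - 1" if "a (Suc K) \<le> x" for x
    proof -
      have "\<not> (LEAST n. x < a n) \<le> Suc K"
        using lt[of x] that incseqD[OF assms(2), of "LEAST n. x < a n" "Suc K"] by linarith
      then show ?thesis by simp
    qed
    then show "\<forall>\<^sub>F x in at_top. K \<le> (LEAST n. x < a n) - 1"
      by (rule eventually_mono[OF eventually_ge_at_top[of "a (Suc K)"]])
  qed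
  assume x: "a 0 \<le> x"
  have "(LEAST n. x < a n) \<noteq> 0" using lt[of x] x by (metis not_less)
  then obtain m where m: "(LEAST n. x < a n) = Suc m" by (meson not0_implies_Suc)
  have "\<not> x < a m" using not_less_Least[of m "\<lambda>n. x < a n"] m by simp
  then show "a ((LEAST n. x < a n) - 1) \<le> x \<and> x < a (Suc ((LEAST n. x < a n) - 1))"
    using lt[of x] m by simp
qed

text \<open>Tails are monotone, so between consecutive terms of \<open>a\<close> the quotient is
  enclosed by quotients at these terms, and shifting the index costs only a factor
  \<open>(n + 1) / n\<close>. Dividing by the total angular mass
  \<open>\<sigma> (\<lambda>_. 1)\<close> normalizes \<open>L\<close>.\<close>

lemma rv_tail:
  fixes \<nu> :: "(real ^ 'd) measure"
  assumes \<nu>: "prob_space \<nu>" "sets \<nu> = sets borel" and rv: "regularly_varying_tails \<alpha> \<nu>"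
  shows "(\<forall>x. 0 < tail_integral \<nu> (\<lambda>_. 1) x) \<and>
    (\<exists>L :: (real ^ 'd \<Rightarrow> real) \<Rightarrow> real. L (\<lambda>_. 1) = 1 \<and>
      (\<forall>g l. continuous_on UNIV g \<and> (\<forall>s. 0 \<le> g s) \<and> 0 < l \<longrightarrow>
        ((\<lambda>x. tail_integral \<nu> g (l * x) / tail_integral \<nu> (\<lambda>_. 1) x) \<longlongrightarrow> l powr - \<alpha> * L g) at_top))"
proof -
  obtain a and \<sigma> :: "(real ^ 'd \<Rightarrow> real) \<Rightarrow> real" where a: "\<And>n. 0 < a n" "incseq a" "filterlim a at_top sequentially"
    and \<sigma>1: "0 < \<sigma> (\<lambda>_. 1)"
    and lim: "\<And>g l. continuous_on UNIV g \<Longrightarrow> (\<And>s. 0 \<le> g s) \<Longrightarrow> 0 < l \<Longrightarrow>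
      (\<lambda>n. real n * tail_integral \<nu> g (l * a n)) \<longlonglongrightarrow> l powr - \<alpha> * \<sigma> g"
    using rv_tail_sequence[OF assms] by blast
  let ?G = "tail_integral \<nu> (\<lambda>_. 1)"
  have G_anti: "?G y \<le> ?G x" if "x \<le> y" for x y by (rule tail_integral_antimono[OF \<nu> _ _ that]) auto
  have G_lim: "(\<lambda>n. real n * ?G (a n)) \<longlonglongrightarrow> \<sigma> (\<lambda>_. 1)" using lim[of "\<lambda>_. 1" 1] by simp
  have G_pos: "0 < ?G x" for x
  proof -
    have "\<forall>\<^sub>F n in sequentially. 0 < real n * ?G (a n) \<and> x \<le> a n"
      using order_tendstoD(1)[OF G_lim \<sigma>1] a(3)[unfolded filterlim_at_top, rule_format, of x] by eventually_elim simp
    then obtain n where "0 < real n * ?G (a n)" "x \<le> a n" using eventually_happens by force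
    then show ?thesis using G_anti[of x "a n"] by (auto simp: zero_less_mult_iff)
  qed
  have "((\<lambda>x. tail_integral \<nu> g (l * x) / ?G x) \<longlongrightarrow> l powr - \<alpha> * (\<sigma> g / \<sigma> (\<lambda>_. 1))) at_top"
    if g: "continuous_on UNIV g" "\<And>s. 0 \<le> g s" and l: "0 < l" for g l
  proof -
    define T where "T x = tail_integral \<nu> g (l * x)" for x
    have T_anti: "T y \<le> T x" if "x \<le> y" for x y
      unfolding T_def using l that by (intro tail_integral_antimono[OF \<nu> g]) simp
    have T0: "0 \<le> T x" for x unfolding T_def tail_integral_def using g(2) by (intro Bochner_Integration.integral_nonneg) auto
    define c where "c = l powr - \<alpha> * \<sigma> g"
    have T_lim: "(\<lambda>n. real n * T (a n)) \<longlonglongrightarrow> c" unfolding T_def c_def by (rule lim[OF g l])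
    define N where "N x = (LEAST n. x < a n) - 1" for x
    have N: "filterlim N at_top at_top" "\<And>x. a 0 \<le> x \<Longrightarrow> a (N x) \<le> x \<and> x < a (Suc (N x))"
      unfolding N_def using incseq_bracket_index[OF a(3,2)] by auto
    have G_lim': "(\<lambda>n. real (Suc n) * ?G (a (Suc n))) \<longlonglongrightarrow> \<sigma> (\<lambda>_. 1)" using G_lim by (rule LIMSEQ_Suc)
    have T_lim': "(\<lambda>n. real (Suc n) * T (a (Suc n))) \<longlonglongrightarrow> c" using T_lim by (rule LIMSEQ_Suc)
    have r1: "(\<lambda>n. real (Suc n) / real n) \<longlonglongrightarrow> 1" and r2: "(\<lambda>n. real n / real (Suc n)) \<longlonglongrightarrow> 1" by real_asymp+
    have "(\<lambda>n. (real n * T (a n)) / (real (Suc n) * ?G (a (Suc n))) * (real (Suc n) / real n)) \<longlonglongrightarrow> c / \<sigma> (\<lambda>_. 1)"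
      using \<sigma>1 tendsto_mult[OF tendsto_divide[OF T_lim G_lim'] r1] by simp
    then have "(\<lambda>n. T (a n) / ?G (a (Suc n))) \<longlonglongrightarrow> c / \<sigma> (\<lambda>_. 1)"
      by (rule Lim_transform_eventually)
         (use eventually_gt_at_top[of 0] in eventually_elim, simp)
    from filterlim_compose[OF this N(1)]
    have up: "((\<lambda>x. T (a (N x)) / ?G (a (Suc (N x)))) \<longlongrightarrow> c / \<sigma> (\<lambda>_. 1)) at_top" .
    have "(\<lambda>n. (real (Suc n) * T (a (Suc n))) / (real n * ?G (a n)) * (real n / real (Suc n))) \<longlonglongrightarrow> c / \<sigma> (\<lambda>_. 1)"
      using \<sigma>1 tendsto_mult[OF tendsto_divide[OF T_lim' G_lim] r2] by simp
    then have "(\<lambda>n. T (a (Suc n)) / ?G (a n)) \<longlonglongrightarrow> c / \<sigma> (\<lambda>_. 1)"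
      by (rule Lim_transform_eventually)
         (use eventually_gt_at_top[of 0] in eventually_elim, simp)
    from filterlim_compose[OF this N(1)]
    have low: "((\<lambda>x. T (a (Suc (N x))) / ?G (a (N x))) \<longlongrightarrow> c / \<sigma> (\<lambda>_. 1)) at_top" .
    have "((\<lambda>x. T x / ?G x) \<longlongrightarrow> c / \<sigma> (\<lambda>_. 1)) at_top"
    proof (rule tendsto_sandwich[OF _ _ low up])
      show "\<forall>\<^sub>F x in at_top. T (a (Suc (N x))) / ?G (a (N x)) \<le> T x / ?G x"
        using eventually_ge_at_top[of "a 0"]
      proof eventually_elim
        case (elim x)
        then show ?case using N(2)[OF elim] by (intro frac_le T0 T_anti G_pos G_anti) auto
      qed
      show "\<forall>\<^sub>F x in at_top. T x / ?G x \<le> T (a (N x)) / ?G (a (Suc (N x)))"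
        using eventually_ge_at_top[of "a 0"]
      proof eventually_elim
        case (elim x)
        then show ?case using N(2)[OF elim] by (intro frac_le T0 T_anti G_pos G_anti) auto
      qed
    qed
    then show ?thesis by (simp add: T_def c_def)
  qed
  then show ?thesis using G_pos \<sigma>1
    by (intro conjI allI exI[of _ "\<lambda>g. \<sigma> g / \<sigma> (\<lambda>_. 1)"]) auto
qed

text \<open>Beyond some radius one doubling costs at most \<open>2 powr \<beta>\<close>, because
  \<open>\<alpha> < \<beta>\<close>, and logarithmically many doublings lead from \<open>y\<close>
  to \<open>x\<close>. Smaller \<open>y\<close> are covered by \<open>G y \<le> 1\<close> at the
  price of a constant.\<close>

lemma potter_bound:
  fixes G :: "real \<Rightarrow> real"
  assumes G: "\<And>x. 0 < G x" "\<And>x. G x \<le> 1" "\<And>x y. x \<le> y \<Longrightarrow> G y \<le> G x"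
    and lim: "((\<lambda>x. G (2 * x) / G x) \<longlongrightarrow> 2 powr - \<alpha>) at_top" and \<beta>: "\<alpha> < \<beta>" "0 < \<beta>"
  shows "\<exists>C x0. 0 < C \<and> 0 < x0 \<and> (\<forall>x y. x0 \<le> x \<longrightarrow> 0 < y \<longrightarrow> y \<le> x \<longrightarrow> G y \<le> C * (x / y) powr \<beta> * G x)"
proof -
  have "2 powr - \<beta> < (2 powr - \<alpha> :: real)" using \<beta> by simp
  from order_tendstoD(1)[OF lim this] obtain x1 where x1: "\<And>x. x1 \<le> x \<Longrightarrow> 2 powr - \<beta> < G (2 * x) / G x"
    by (auto simp: eventually_at_top_linorder)
  define x0 where "x0 = max x1 1"
  have x0: "0 < x0" by (simp add: x0_def)
  have dbl: "G x \<le> 2 powr \<beta> * G (2 * x)" if "x0 \<le> x" for x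
    using x1[of x] that G(1)[of x] by (simp add: x0_def powr_minus field_simps)
  \<comment> \<open>Induction on a number \<open>n\<close> of doublings that carries
    \<open>y\<close> to \<open>x\<close> or beyond; the extra factor \<open>2 powr \<beta>\<close>
    pays for the last, incomplete doubling.\<close>
  have main: "G y \<le> 2 powr \<beta> * (x / y) powr \<beta> * G x" if "x0 \<le> y" "y \<le> x" "x \<le> 2 ^ n * y" for n x y
    using that
  proof (induction n arbitrary: y)
    case 0
    then have "x = y" by simp
    moreover have "1 \<le> (2 :: real) powr \<beta>" using \<beta> by (intro ge_one_powr_ge_zero) auto
    ultimately show ?case using 0 x0 G(1)[of x] by simp
  next
    case (Suc n)
    have y: "0 < y" using Suc.prems x0 by simp
    show ?case
    proof (cases "x \<le> 2 * y")
      case True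
      have "G y \<le> 2 powr \<beta> * G (2 * y)" using dbl Suc.prems by simp
      also have "\<dots> \<le> 2 powr \<beta> * G x" using True G(3) by (intro mult_left_mono) auto
      also have "\<dots> \<le> 2 powr \<beta> * (x / y) powr \<beta> * G x"
      proof -
        have "1 \<le> (x / y) powr \<beta>" using Suc.prems y \<beta> by (intro ge_one_powr_ge_zero) auto
        then show ?thesis using G(1)[of x] by (intro mult_right_mono) auto
      qed
      finally show ?thesis .
    next
      case False
      have "G y \<le> 2 powr \<beta> * G (2 * y)" using dbl Suc.prems by simp
      also have "\<dots> \<le> 2 powr \<beta> * (2 powr \<beta> * (x / (2 * y)) powr \<beta> * G x)"
        using False Suc.prems y by (intro mult_left_mono Suc.IH) (auto simp: mult_ac)
      also have "(x / (2 * y)) powr \<beta> = (x / y) powr \<beta> / 2 powr \<beta>"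
        using False y by (simp add: powr_divide powr_mult)
      finally show ?thesis by simp
    qed
  qed
  have main': "G y \<le> 2 powr \<beta> * (x / y) powr \<beta> * G x" if xy: "x0 \<le> y" "y \<le> x" for x y
  proof -
    obtain n where "x / y < 2 ^ n" using real_arch_pow[of 2 "x / y"] by auto
    then have "x \<le> 2 ^ n * y" using x0 xy by (simp add: field_simps)
    with main xy show ?thesis by blast
  qed
  \<comment> \<open>The quotient \<open>1 / G x0\<close> compensates for starting at
    \<open>x0\<close> instead of \<open>y\<close> when \<open>y < x0\<close>.\<close>
  define C where "C = max 1 (1 / G x0) * 2 powr \<beta>"
  have "G y \<le> C * (x / y) powr \<beta> * G x" if "x0 \<le> x" "0 < y" "y \<le> x" for x y
  proof (cases "x0 \<le> y")
    case True
    have "G y \<le> 1 * (2 powr \<beta> * (x / y) powr \<beta> * G x)" using main'[OF True that(3)] by simp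
    also have "\<dots> \<le> max 1 (1 / G x0) * (2 powr \<beta> * (x / y) powr \<beta> * G x)"
      using G(1)[of x] by (intro mult_right_mono) auto
    finally show ?thesis by (simp add: C_def mult_ac)
  next
    case False
    have "G y \<le> 1 / G x0 * G x0" using G(2)[of y] G(1)[of x0] by simp
    also have "\<dots> \<le> 1 / G x0 * (2 powr \<beta> * (x / x0) powr \<beta> * G x)"
      using main'[OF order_refl that(1)] G(1)[of x0] by (intro mult_left_mono) auto
    also have "\<dots> \<le> max 1 (1 / G x0) * (2 powr \<beta> * (x / y) powr \<beta> * G x)"
      using False that x0 \<beta> G(1)[of x] G(1)[of x0]
      by (intro mult_mono mult_nonneg_nonneg powr_mono2 divide_left_mono) auto
    finally show ?thesis by (simp add: C_def mult_ac)
  qed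
  moreover have "0 < C" by (simp add: C_def)
  ultimately show ?thesis using x0 by blast
qed

section \<open>Integrals of powers on the half-line\<close>

lemma nonneg_has_integral_lborel:
  fixes f :: "real \<Rightarrow> real"
  assumes [measurable]: "A \<in> sets borel" "f \<in> borel_measurable borel"
    and f: "\<And>x. x \<in> A \<Longrightarrow> 0 \<le> f x" and I: "(f has_integral I) A"
  shows "integrable lborel (\<lambda>x. indicator A x * f x)" "(\<integral>x. indicator A x * f x \<partial>lborel) = I"
proof -
  let ?f = "\<lambda>x. indicator A x * f x"
  have "?f = (\<lambda>x. if x \<in> A then f x else 0)" by (auto simp: indicator_def)
  then have "(?f has_integral I) UNIV" using I has_integral_restrict_UNIV[of A f I] by simp
  moreover have f0: "0 \<le> ?f x" for x using f by (simp add: indicator_def)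
  ultimately have nn: "(\<integral>\<^sup>+x. ennreal (?f x) \<partial>lborel) = ennreal I"
    by (intro nn_integral_has_integral_lborel) auto
  have "0 \<le> I" using has_integral_nonneg[OF I f] .
  with nn f0 show "integrable lborel ?f" "(\<integral>x. ?f x \<partial>lborel) = I"
    by (auto intro!: integrableI_nn_integral_finite simp: integral_eq_nn_integral)
qed

lemma integrable_powr_0_1:
  fixes p :: real
  assumes "- 1 < p"
  shows "integrable lborel (\<lambda>r. indicator {0<..1} r * r powr p)"
    and "(\<integral>r. indicator {0<..1} r * r powr p \<partial>lborel) = 1 / (p + 1)"
proof -
  have "((\<lambda>r. r powr p) has_integral 1 / (p + 1)) {0..1}"
    using has_integral_powr_from_0[OF assms, of 1] by simp
  then have "((\<lambda>r. r powr p) has_integral 1 / (p + 1)) {0<..1}"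
    by (rule has_integral_spike_set_eq[THEN iffD1, rotated 2]) (auto intro: negligible_subset[of "{0}"])
  from nonneg_has_integral_lborel[OF _ _ _ this]
  show "integrable lborel (\<lambda>r. indicator {0<..1} r * r powr p)"
    "(\<integral>r. indicator {0<..1} r * r powr p \<partial>lborel) = 1 / (p + 1)" by auto
qed

lemma integrable_powr_inf:
  fixes p a :: real
  assumes "p < - 1" "0 < a"
  shows "integrable lborel (\<lambda>r. indicator {a<..} r * r powr p)"
    and "(\<integral>r. indicator {a<..} r * r powr p \<partial>lborel) = - (a powr (p + 1)) / (p + 1)"
proof -
  have "((\<lambda>r. r powr p) has_integral - (a powr (p + 1)) / (p + 1)) {a..}"
    by (rule has_integral_powr_to_inf[OF assms])
  then have "((\<lambda>r. r powr p) has_integral - (a powr (p + 1)) / (p + 1)) {a<..}"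
    by (rule has_integral_spike_set_eq[THEN iffD1, rotated 2]) (auto intro: negligible_subset[of "{a}"])
  from nonneg_has_integral_lborel[OF _ _ _ this]
  show "integrable lborel (\<lambda>r. indicator {a<..} r * r powr p)"
    "(\<integral>r. indicator {a<..} r * r powr p \<partial>lborel) = - (a powr (p + 1)) / (p + 1)" by auto
qed

subsection \<open>Truncated moments\<close>

lemma borel_measurable_indicator_intervals[measurable (raw)]:
  fixes a b :: "'a \<Rightarrow> real"
  assumes [measurable]: "a \<in> borel_measurable M" "b \<in> borel_measurable M"
  shows "(\<lambda>x. indicator {a x<..} (b x) :: real) \<in> borel_measurable M"
    and "(\<lambda>x. indicator {..<a x} (b x) :: real) \<in> borel_measurable M"
proof -
  have "(\<lambda>x. indicator {a x<..} (b x) :: real) = (\<lambda>x. if a x < b x then 1 else 0)"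
    "(\<lambda>x. indicator {..<a x} (b x) :: real) = (\<lambda>x. if b x < a x then 1 else 0)"
    by (auto simp: indicator_def)
  then show "(\<lambda>x. indicator {a x<..} (b x) :: real) \<in> borel_measurable M"
    "(\<lambda>x. indicator {..<a x} (b x) :: real) \<in> borel_measurable M" by simp_all
qed

text \<open>\<open>L g\<close> is the limit of the mean of \<open>g (sgn h)\<close> given that \<open>h\<close> is large; only the tail functionals are
  kept from the definition of regular variation.\<close>

locale tail_law = prob_space \<nu> for \<nu> :: "(real ^ 'd) measure" +
  fixes \<alpha> :: real and L :: "(real ^ 'd \<Rightarrow> real) \<Rightarrow> real"
  assumes sets_law[measurable_cong]: "sets \<nu> = sets borel"
    and alpha: "0 < \<alpha>" "\<alpha> < 2"
    and tail_pos: "\<And>x. 0 < tail_integral \<nu> (\<lambda>_. 1) x"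
    and L_one: "L (\<lambda>_. 1) = 1"
    and tail_lim: "\<And>g l. continuous_on UNIV g \<Longrightarrow> (\<And>s. 0 \<le> g s) \<Longrightarrow> 0 < l \<Longrightarrow>
      ((\<lambda>x. tail_integral \<nu> g (l * x) / tail_integral \<nu> (\<lambda>_. 1) x) \<longlongrightarrow> l powr - \<alpha> * L g) at_top"
begin

abbreviation "G \<equiv> tail_integral \<nu> (\<lambda>_. 1)"

lemma tail_eq: "G x = measure \<nu> {h. x < norm h}"
  by (rule tail_integral_one[OF sets_law])

lemma tail_le_1: "G x \<le> 1" by (simp add: tail_eq)

lemma tail_antimono: "x \<le> y \<Longrightarrow> G y \<le> G x"
  by (rule tail_integral_antimono[OF prob_space_axioms sets_law]) auto

lemma tail_integral_bound:
  assumes "continuous_on UNIV g" "\<And>s. norm s = 1 \<Longrightarrow> \<bar>g s\<bar> \<le> C" "0 \<le> x"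
  shows "tail_integral \<nu> g x \<le> C * G x"
proof -
  have "tail_integral \<nu> g x \<le> (\<integral>h. C * (1 * indicator {x<..} (norm h)) \<partial>\<nu>)"
    unfolding tail_integral_def
  proof (rule integral_mono)
    show "integrable \<nu> (\<lambda>h. g (sgn h) * indicator {x<..} (norm h))"
      by (rule tail_integral_integrable[OF prob_space_axioms sets_law assms(1)]) simp
    show "integrable \<nu> (\<lambda>h. C * (1 * indicator {x<..} (norm h)))"
      by (intro integrable_mult_right tail_integral_integrable[OF prob_space_axioms sets_law, of "\<lambda>_. 1"]) auto
    show "g (sgn h) * indicator {x<..} (norm h) \<le> C * (1 * indicator {x<..} (norm h))" for h
    proof (cases "x < norm h")
      case True
      with assms(3) have "norm (sgn h) = 1" by (auto simp: norm_sgn)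
      then show ?thesis using assms(2)[of "sgn h"] True by (simp add: abs_le_iff)
    qed (simp add: indicator_def)
  qed
  then show ?thesis by (simp add: tail_integral_def)
qed

text \<open>An exponent strictly between \<open>\<alpha>\<close> and \<open>2\<close> is fixed:
  being below \<open>2\<close> it keeps \<open>r powr (1 - \<beta>)\<close> integrable at
  \<open>0\<close> and makes \<open>x^2 * G x\<close> grow.\<close>

lemma potter:
  "\<exists>C x0 \<beta>. 0 < C \<and> 0 < x0 \<and> 0 < \<beta> \<and> \<beta> < 2 \<and>
    (\<forall>x y. x0 \<le> x \<longrightarrow> 0 < y \<longrightarrow> y \<le> x \<longrightarrow> G y \<le> C * (x / y) powr \<beta> * G x)"
proof -
  define \<beta> where "\<beta> = (\<alpha> + 2) / 2"
  have \<beta>: "\<alpha> < \<beta>" "0 < \<beta>" "\<beta> < 2" using alpha by (auto simp: \<beta>_def)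
  have "((\<lambda>x. G (2 * x) / G x) \<longlongrightarrow> 2 powr - \<alpha>) at_top" using tail_lim[of "\<lambda>_. 1" 2] L_one by simp
  from potter_bound[OF tail_pos tail_le_1 tail_antimono this \<beta>(1,2)] \<beta> show ?thesis by blast
qed

text \<open>Potter's bound at the fixed point \<open>y = x0\<close> can be read as a lower bound of
  order \<open>x powr - \<beta>\<close> for the tail, and \<open>\<beta> < 2\<close>.\<close>

lemma tail_growth: "filterlim (\<lambda>x. x\<^sup>2 * G x) at_top at_top"
proof -
  obtain C x0 \<beta> where C: "0 < C" "0 < x0" "0 < \<beta>" "\<beta> < 2"
    and P: "\<And>x y. x0 \<le> x \<Longrightarrow> 0 < y \<Longrightarrow> y \<le> x \<Longrightarrow> G y \<le> C * (x / y) powr \<beta> * G x"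
    using potter by blast
  define c where "c = G x0 * x0 powr \<beta> / C"
  have c: "0 < c" using C tail_pos by (simp add: c_def)
  have "filterlim (\<lambda>x. c * x powr (2 - \<beta>)) at_top at_top"
    using c C by (intro filterlim_tendsto_pos_mult_at_top[OF tendsto_const c]) real_asymp
  moreover have "\<forall>\<^sub>F x in at_top. c * x powr (2 - \<beta>) \<le> x\<^sup>2 * G x"
    using eventually_ge_at_top[of x0]
  proof eventually_elim
    case (elim x)
    then have x: "0 < x" using C by simp
    have "G x0 \<le> C * (x / x0) powr \<beta> * G x" using P[OF elim C(2) elim] .
    then have "c \<le> x powr \<beta> * G x"
      using C x by (simp add: c_def powr_divide field_simps)
    then have "x powr (2 - \<beta>) * c \<le> x powr (2 - \<beta>) * (x powr \<beta> * G x)" by (intro mult_left_mono) auto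
    also have "\<dots> = x powr 2 * G x" by (simp add: powr_add[symmetric] flip: mult.assoc)
    finally show ?case using x by (simp add: mult.commute powr_numeral)
  qed
  ultimately show ?thesis by (rule filterlim_at_top_mono)
qed

text \<open>Fubini: \<open>r < |h| / x\<close> says the same as \<open>r * x < |h|\<close>, so the
  mean of a primitive of \<open>w\<close> becomes an integral over the tails at all radii
  \<open>r * x\<close>, where regular variation applies.\<close>

lemma radial_integral:
  assumes [measurable]: "w \<in> borel_measurable borel" and w0: "\<And>r. r \<le> 0 \<Longrightarrow> w r = 0" and w: "integrable lborel w"
    and g: "continuous_on UNIV g" "\<And>s. 0 \<le> g s" and x: "0 < x"
  shows "(\<integral>h. (\<integral>r. w r * indicator {..<norm h / x} r \<partial>lborel) * g (sgn h) \<partial>\<nu>) = (\<integral>r. w r * tail_integral \<nu> g (r * x) \<partial>lborel)"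
    and "integrable \<nu> (\<lambda>h. (\<integral>r. w r * indicator {..<norm h / x} r \<partial>lborel) * g (sgn h))"
proof -
  have [measurable]: "g \<in> borel_measurable borel" using g(1) by (rule borel_measurable_continuous_onI)
  obtain C where C: "0 \<le> C" "\<And>s. norm s = 1 \<Longrightarrow> \<bar>g s\<bar> \<le> C" using sphere_bound[OF g(1)] by blast
  interpret pair_sigma_finite lborel \<nu> ..
  define f where "f r h = w r * (g (sgn h) * indicator {r * x<..} (norm h))" for r and h :: "real ^ 'd"
  have T_int: "integrable \<nu> (\<lambda>h. g (sgn h) * indicator {r * x<..} (norm h))" for r
    by (rule tail_integral_integrable[OF prob_space_axioms sets_law g(1)]) simp
  have T: "0 \<le> tail_integral \<nu> g y" for y
    unfolding tail_integral_def using g(2) by (intro Bochner_Integration.integral_nonneg) auto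
  have T_meas[measurable]: "(\<lambda>r. tail_integral \<nu> g (r * x)) \<in> borel_measurable borel"
    unfolding tail_integral_def by measurable
  have int: "integrable (lborel \<Otimes>\<^sub>M \<nu>) (case_prod f)"
  proof (rule Fubini_integrable)
    show "case_prod f \<in> borel_measurable (lborel \<Otimes>\<^sub>M \<nu>)" unfolding f_def by measurable
    have "integrable lborel (\<lambda>r. \<bar>w r\<bar> * tail_integral \<nu> g (r * x))"
    proof (rule Bochner_Integration.integrable_bound[of _ "\<lambda>r. C * \<bar>w r\<bar>"])
      show "AE r in lborel. norm (\<bar>w r\<bar> * tail_integral \<nu> g (r * x)) \<le> norm (C * \<bar>w r\<bar>)"
      proof (rule AE_I2)
        fix r
        show "norm (\<bar>w r\<bar> * tail_integral \<nu> g (r * x)) \<le> norm (C * \<bar>w r\<bar>)"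
        proof (cases "r \<le> 0")
          case False
          have "tail_integral \<nu> g (r * x) \<le> C * G (r * x)"
            using False x by (intro tail_integral_bound[OF g(1) C(2)]) auto
          also have "\<dots> \<le> C * 1" using C tail_le_1 by (intro mult_left_mono) auto
          finally have "\<bar>w r\<bar> * tail_integral \<nu> g (r * x) \<le> \<bar>w r\<bar> * C" by (intro mult_left_mono) auto
          then show ?thesis using C T by (simp add: abs_mult mult.commute)
        qed (simp add: w0)
      qed
    qed (use w in auto)
    then show "integrable lborel (\<lambda>r. \<integral>h. norm (case_prod f (r, h)) \<partial>\<nu>)"
      using g(2) by (simp add: f_def abs_mult tail_integral_def)
    show "AE r in lborel. integrable \<nu> (\<lambda>h. case_prod f (r, h))"
      using T_int by (intro AE_I2) (auto simp: f_def)
  qed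
  have inner: "(\<integral>r. f r h \<partial>lborel) = (\<integral>r. w r * indicator {..<norm h / x} r \<partial>lborel) * g (sgn h)" for h
  proof -
    have "f r h = w r * indicator {..<norm h / x} r * g (sgn h)" for r
      using x by (simp add: f_def indicator_def field_simps)
    then show ?thesis by simp
  qed
  show "(\<integral>h. (\<integral>r. w r * indicator {..<norm h / x} r \<partial>lborel) * g (sgn h) \<partial>\<nu>) = (\<integral>r. w r * tail_integral \<nu> g (r * x) \<partial>lborel)"
    using Fubini_integral[OF int] by (simp add: inner) (simp add: f_def tail_integral_def)
  show "integrable \<nu> (\<lambda>h. (\<integral>r. w r * indicator {..<norm h / x} r \<partial>lborel) * g (sgn h))"
    using integrable_snd[OF int] by (simp add: inner)
qed

text \<open>Dominated convergence in \<open>r\<close>. For \<open>r > 1\<close> the tail quotient is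
  bounded by monotonicity; for \<open>r \<le> 1\<close> Potter's bound gives
  \<open>r powr - \<beta>\<close>, and the linear bound on the weight improves this to the
  integrable \<open>r powr (1 - \<beta>)\<close>.\<close>

lemma karamata:
  assumes [measurable]: "w \<in> borel_measurable borel" and w0: "\<And>r. r \<le> 0 \<Longrightarrow> w r = 0" and w: "integrable lborel w"
    and K: "\<And>r. 0 < r \<Longrightarrow> \<bar>w r\<bar> \<le> K * r"
    and g: "continuous_on UNIV g" "\<And>s. 0 \<le> g s"
  shows "((\<lambda>x. (\<integral>h. (\<integral>r. w r * indicator {..<norm h / x} r \<partial>lborel) * g (sgn h) \<partial>\<nu>) / G x)
    \<longlongrightarrow> L g * (\<integral>r. w r * r powr - \<alpha> \<partial>lborel)) at_top"
proof -
  have [measurable]: "g \<in> borel_measurable borel" using g(1) by (rule borel_measurable_continuous_onI)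
  obtain C where C: "0 \<le> C" "\<And>s. norm s = 1 \<Longrightarrow> \<bar>g s\<bar> \<le> C" using sphere_bound[OF g(1)] by blast
  obtain D x0 \<beta> where D: "0 < D" "0 < x0" "0 < \<beta>" "\<beta> < 2"
    and P: "\<And>x y. x0 \<le> x \<Longrightarrow> 0 < y \<Longrightarrow> y \<le> x \<Longrightarrow> G y \<le> D * (x / y) powr \<beta> * G x"
    using potter by blast
  have K0: "0 \<le> K" using K[of 1] by simp
  have T: "0 \<le> tail_integral \<nu> g y" for y
    unfolding tail_integral_def using g(2) by (intro Bochner_Integration.integral_nonneg) auto
  have [measurable]: "(\<lambda>r. tail_integral \<nu> g (r * x)) \<in> borel_measurable borel" for x
    unfolding tail_integral_def by measurable
  let ?b = "\<lambda>r. K * C * D * (indicator {0<..1} r * r powr (1 - \<beta>)) + C * \<bar>w r\<bar>"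
  have lim: "((\<lambda>x. \<integral>r. w r * (tail_integral \<nu> g (r * x) / G x) \<partial>lborel) \<longlongrightarrow> (\<integral>r. w r * (r powr - \<alpha> * L g) \<partial>lborel)) at_top"
  proof (rule integral_dominated_convergence_at_top[where w = ?b])
    show "integrable lborel ?b" using D w by (intro integrable_mult_right Bochner_Integration.integrable_add integrable_abs integrable_powr_0_1) auto
    show "AE r in lborel. ((\<lambda>x. w r * (tail_integral \<nu> g (r * x) / G x)) \<longlongrightarrow> w r * (r powr - \<alpha> * L g)) at_top"
    proof (rule AE_I2)
      fix r :: real
      show "((\<lambda>x. w r * (tail_integral \<nu> g (r * x) / G x)) \<longlongrightarrow> w r * (r powr - \<alpha> * L g)) at_top"
      proof (cases "r \<le> 0")
        case False
        then show ?thesis by (intro tendsto_mult tendsto_const tail_lim g) simp_all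
      qed (simp add: w0)
    qed
    show "\<forall>\<^sub>F x in at_top. AE r in lborel. norm (w r * (tail_integral \<nu> g (r * x) / G x)) \<le> ?b r"
      using eventually_ge_at_top[of x0]
    proof eventually_elim
      case (elim x)
      then have x: "0 < x" using D by simp
      show ?case
      proof (rule AE_I2)
        fix r :: real
        show "norm (w r * (tail_integral \<nu> g (r * x) / G x)) \<le> ?b r"
        proof (cases "r \<le> 0")
          case True
          then show ?thesis using K0 C D by (simp add: w0)
        next
          case False
          then have r: "0 < r" by simp
          have "tail_integral \<nu> g (r * x) \<le> C * G (r * x)"
            using r x by (intro tail_integral_bound[OF g(1) C(2)]) auto
          then have q: "tail_integral \<nu> g (r * x) / G x \<le> C * (G (r * x) / G x)"
            using tail_pos[of x] by (simp add: divide_right_mono)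
          have q0: "0 \<le> tail_integral \<nu> g (r * x) / G x" using T tail_pos[of x] by simp
          have n: "norm (w r * (tail_integral \<nu> g (r * x) / G x)) = \<bar>w r\<bar> * (tail_integral \<nu> g (r * x) / G x)"
            using q0 by (simp only: real_norm_def abs_mult abs_of_nonneg)
          show ?thesis
          proof (cases "r \<le> 1")
            case True
            have "G (r * x) \<le> D * (x / (r * x)) powr \<beta> * G x" using r x True by (intro P elim) auto
            also have "x / (r * x) = inverse r" using x by (simp add: field_simps)
            also have "inverse r powr \<beta> = r powr - \<beta>" using r by (simp add: powr_minus inverse_powr)
            finally have "G (r * x) / G x \<le> D * r powr - \<beta>" using tail_pos[of x] by (simp add: pos_divide_le_eq)
            then have "C * (G (r * x) / G x) \<le> C * (D * r powr - \<beta>)" using C(1) by (intro mult_left_mono) auto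
            with q have "\<bar>w r\<bar> * (tail_integral \<nu> g (r * x) / G x) \<le> (K * r) * (C * (D * r powr - \<beta>))"
              using K[OF r] q0 K0 r by (intro mult_mono) auto
            also have "\<dots> = K * C * D * (r powr 1 * r powr - \<beta>)" using r by (simp add: mult_ac)
            also have "r powr 1 * r powr - \<beta> = r powr (1 - \<beta>)" by (simp only: powr_add[symmetric] add_uminus_conv_diff)
            finally show ?thesis unfolding n using r True C(1) by (simp add: add_increasing2)
          next
            case False
            have "G (r * x) \<le> G x" using False x by (intro tail_antimono) simp
            then have "G (r * x) / G x \<le> 1" using tail_pos[of x] by simp
            then have "C * (G (r * x) / G x) \<le> C * 1" using C(1) by (intro mult_left_mono) auto
            with q have "\<bar>w r\<bar> * (tail_integral \<nu> g (r * x) / G x) \<le> \<bar>w r\<bar> * C"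
              by (intro mult_left_mono) auto
            then show ?thesis unfolding n using False by (simp add: mult.commute)
          qed
        qed
      qed
    qed
  qed auto
  have "(\<integral>r. w r * (r powr - \<alpha> * L g) \<partial>lborel) = L g * (\<integral>r. w r * r powr - \<alpha> \<partial>lborel)"
    by (simp add: mult.commute[of _ "L g"] mult.left_commute[of _ "L g"])
  moreover have "\<forall>\<^sub>F x in at_top. (\<integral>r. w r * (tail_integral \<nu> g (r * x) / G x) \<partial>lborel) =
      (\<integral>h. (\<integral>r. w r * indicator {..<norm h / x} r \<partial>lborel) * g (sgn h) \<partial>\<nu>) / G x"
    using eventually_gt_at_top[of 0]
    by eventually_elim (simp add: radial_integral(1)[OF assms(1) w0 w g])
  ultimately show ?thesis using lim by (auto elim: Lim_transform_eventually)
qed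

end

text \<open>Fubini, with \<open>s powr - \<alpha> / \<alpha>\<close> as the integral of
  \<open>r powr (- 1 - \<alpha>)\<close> over \<open>r > s\<close>. It turns the constants of
  Karamata's theorem into Levy integrals of the primitive of \<open>w\<close>, the form in which the
  spectral side produces them.\<close>

lemma radial_moment:
  fixes w :: "real \<Rightarrow> real"
  assumes [measurable]: "w \<in> borel_measurable borel" and w0: "\<And>r. r \<le> 0 \<Longrightarrow> w r = 0" and w: "integrable lborel w"
    and K: "\<And>r. 0 < r \<Longrightarrow> \<bar>w r\<bar> \<le> K * r" and \<alpha>: "0 < \<alpha>" "\<alpha> < 2"
  shows "integrable lborel (\<lambda>r. (\<integral>s. w s * indicator {..<r} s \<partial>lborel) * (indicator {0<..} r * r powr (- 1 - \<alpha>)))"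
    and "(\<integral>r. w r * r powr - \<alpha> \<partial>lborel) =
      \<alpha> * (\<integral>r. (\<integral>s. w s * indicator {..<r} s \<partial>lborel) * (indicator {0<..} r * r powr (- 1 - \<alpha>)) \<partial>lborel)"
proof -
  define f where "f s r = w s * (indicator {s<..} r * (indicator {0<..} r * r powr (- 1 - \<alpha>)))" for s r :: real
  have powr: "integrable lborel (\<lambda>r. indicator {s<..} r * (indicator {0<..} r * r powr (- 1 - \<alpha>)))"
    "(\<integral>r. indicator {s<..} r * (indicator {0<..} r * r powr (- 1 - \<alpha>)) \<partial>lborel) = s powr - \<alpha> / \<alpha>" if s: "0 < s" for s
  proof -
    have "(\<lambda>r. indicator {s<..} r * (indicator {0<..} r * r powr (- 1 - \<alpha>))) = (\<lambda>r. indicator {s<..} r * r powr (- 1 - \<alpha>))"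
      using s by (auto simp: indicator_def)
    then show "integrable lborel (\<lambda>r. indicator {s<..} r * (indicator {0<..} r * r powr (- 1 - \<alpha>)))"
      "(\<integral>r. indicator {s<..} r * (indicator {0<..} r * r powr (- 1 - \<alpha>)) \<partial>lborel) = s powr - \<alpha> / \<alpha>"
      using integrable_powr_inf[of "- 1 - \<alpha>" s] s \<alpha> by simp_all
  qed
  have K0: "0 \<le> K" using K[of 1] by simp
  have wa: "integrable lborel (\<lambda>s. \<bar>w s\<bar> * (s powr - \<alpha> / \<alpha>))"
  proof (rule Bochner_Integration.integrable_bound[of _ "\<lambda>s. (K * (indicator {0<..1} s * s powr (1 - \<alpha>)) + \<bar>w s\<bar>) / \<alpha>"])
    show "integrable lborel (\<lambda>s. (K * (indicator {0<..1} s * s powr (1 - \<alpha>)) + \<bar>w s\<bar>) / \<alpha>)"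
      using \<alpha> w by (intro integrable_divide integrable_mult_right Bochner_Integration.integrable_add integrable_abs integrable_powr_0_1) auto
    show "AE s in lborel. norm (\<bar>w s\<bar> * (s powr - \<alpha> / \<alpha>)) \<le> norm ((K * (indicator {0<..1} s * s powr (1 - \<alpha>)) + \<bar>w s\<bar>) / \<alpha>)"
    proof (rule AE_I2)
      fix s :: real
      have "\<bar>w s\<bar> * s powr - \<alpha> \<le> K * (indicator {0<..1} s * s powr (1 - \<alpha>)) + \<bar>w s\<bar>"
      proof (cases "0 < s")
        case s: True
        show ?thesis
        proof (cases "s \<le> 1")
          case True
          have "\<bar>w s\<bar> * s powr - \<alpha> \<le> K * s * s powr - \<alpha>" using K[OF s] by (intro mult_right_mono) auto
          also have "\<dots> = K * (s powr 1 * s powr - \<alpha>)" using s by simp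
          also have "s powr 1 * s powr - \<alpha> = s powr (1 - \<alpha>)" by (simp only: powr_add[symmetric] add_uminus_conv_diff)
          finally show ?thesis using True s by simp
        next
          case False
          then have "s powr - \<alpha> \<le> s powr 0" using \<alpha> by (intro powr_mono) auto
          then have "\<bar>w s\<bar> * s powr - \<alpha> \<le> \<bar>w s\<bar> * 1" using s by (intro mult_left_mono) auto
          then show ?thesis using False by simp
        qed
      qed (use K0 in \<open>simp add: w0\<close>)
      then have "\<bar>w s\<bar> * s powr - \<alpha> / \<alpha> \<le> (K * (indicator {0<..1} s * s powr (1 - \<alpha>)) + \<bar>w s\<bar>) / \<alpha>"
        using \<alpha> by (intro divide_right_mono) auto
      then show "norm (\<bar>w s\<bar> * (s powr - \<alpha> / \<alpha>)) \<le> norm ((K * (indicator {0<..1} s * s powr (1 - \<alpha>)) + \<bar>w s\<bar>) / \<alpha>)"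
        using \<alpha> K0 by simp
    qed
  qed simp
  have f_eq: "(\<integral>r. f s r \<partial>lborel) = w s * (s powr - \<alpha> / \<alpha>)" "(\<integral>r. norm (f s r) \<partial>lborel) = \<bar>w s\<bar> * (s powr - \<alpha> / \<alpha>)"
    "integrable lborel (f s)" for s
    using powr[of s] w0[of s] by (cases "0 < s"; simp add: f_def[abs_def] abs_mult)+
  have int: "integrable (lborel \<Otimes>\<^sub>M lborel) (case_prod f)"
  proof (rule lborel_pair.Fubini_integrable)
    show "case_prod f \<in> borel_measurable (lborel \<Otimes>\<^sub>M lborel)" unfolding f_def by measurable
    show "integrable lborel (\<lambda>s. \<integral>r. norm (case_prod f (s, r)) \<partial>lborel)"
      using wa by (simp only: prod.case f_eq)
    show "AE s in lborel. integrable lborel (\<lambda>r. case_prod f (s, r))" using f_eq(3) by simp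
  qed
  have inner: "(\<integral>s. f s r \<partial>lborel) = (\<integral>s. w s * indicator {..<r} s \<partial>lborel) * (indicator {0<..} r * r powr (- 1 - \<alpha>))" for r
  proof -
    have "f s r = w s * indicator {..<r} s * (indicator {0<..} r * r powr (- 1 - \<alpha>))" for s
      by (simp add: f_def indicator_def)
    then show ?thesis by simp
  qed
  show "integrable lborel (\<lambda>r. (\<integral>s. w s * indicator {..<r} s \<partial>lborel) * (indicator {0<..} r * r powr (- 1 - \<alpha>)))"
    using lborel_pair.integrable_snd[OF int] by (simp add: inner)
  show "(\<integral>r. w r * r powr - \<alpha> \<partial>lborel) =
      \<alpha> * (\<integral>r. (\<integral>s. w s * indicator {..<r} s \<partial>lborel) * (indicator {0<..} r * r powr (- 1 - \<alpha>)) \<partial>lborel)"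
    using lborel_pair.Fubini_integral[OF int] \<alpha> unfolding inner f_eq by simp
qed

lemma primitive_integral:
  fixes F f :: "real \<Rightarrow> real"
  assumes F: "\<And>x. (F has_real_derivative f x) (at x)" and f: "continuous_on UNIV f" and "F 0 = 0" "0 \<le> u"
  shows "(\<integral>r. (if 0 < r then f r else 0) * indicator {..<u} r \<partial>lborel) = F u"
proof -
  have [measurable]: "f \<in> borel_measurable borel" using f by (rule borel_measurable_continuous_onI)
  have "(\<integral>r. (if 0 < r then f r else 0) * indicator {..<u} r \<partial>lborel) = (\<integral>r. indicator {0..u} r *\<^sub>R f r \<partial>lborel)"
  proof (rule integral_cong_AE)
    show "AE r in lborel. (if 0 < r then f r else 0) * indicator {..<u} r = indicator {0..u} r *\<^sub>R f r"
      using AE_lborel_singleton[of 0] AE_lborel_singleton[of u]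
      by eventually_elim (auto simp: indicator_def)
  qed simp_all
  also have "\<dots> = F u - F 0"
    using assms(4) by (intro integral_FTC_atLeastAtMost continuous_on_subset[OF f])
      (auto intro: has_vector_derivative_at_within F[unfolded has_real_derivative_iff_has_vector_derivative])
  finally show ?thesis using assms(3) by simp
qed

text \<open>A function of the norm is integrated against \<open>\<nu>\<close> by writing it as a primitive: the weights below are the
  derivatives of \<open>(min 1 u)\<^sup>2\<close>, \<open>1 - exp (- u\<^sup>2 / 2)\<close> and \<open>u\<^sup>2 * exp (- u\<^sup>2 / 2)\<close>.\<close>

definition trunc_weight :: "real \<Rightarrow> real" where
  "trunc_weight r = (if 0 < r \<and> r < 1 then 2 * r else 0)"
definition gauss_weight1 :: "real \<Rightarrow> real" where
  "gauss_weight1 r = (if 0 < r then r * exp (- r\<^sup>2 / 2) else 0)"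
definition gauss_weight2 :: "real \<Rightarrow> real" where
  "gauss_weight2 r = (if 0 < r then (2 * r - r ^ 3) * exp (- r\<^sup>2 / 2) else 0)"

lemma weight_measurable[measurable]:
  "trunc_weight \<in> borel_measurable borel" "gauss_weight1 \<in> borel_measurable borel" "gauss_weight2 \<in> borel_measurable borel"
  unfolding trunc_weight_def[abs_def] gauss_weight1_def[abs_def] gauss_weight2_def[abs_def] by measurable

lemma gauss_weight1_primitive:
  "0 \<le> u \<Longrightarrow> (\<integral>r. gauss_weight1 r * indicator {..<u} r \<partial>lborel) = 1 - exp (- u\<^sup>2 / 2)"
  unfolding gauss_weight1_def
  by (rule primitive_integral) (auto intro!: derivative_eq_intros continuous_intros simp: algebra_simps)

lemma gauss_weight2_primitive:
  "0 \<le> u \<Longrightarrow> (\<integral>r. gauss_weight2 r * indicator {..<u} r \<partial>lborel) = u\<^sup>2 * exp (- u\<^sup>2 / 2)"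
  unfolding gauss_weight2_def
  by (rule primitive_integral) (auto intro!: derivative_eq_intros continuous_intros simp: algebra_simps power3_eq_cube power2_eq_square)

lemma trunc_weight_primitive:
  assumes "0 \<le> u"
  shows "(\<integral>r. trunc_weight r * indicator {..<u} r \<partial>lborel) = (min 1 u)\<^sup>2"
proof -
  have "trunc_weight r * indicator {..<u} r = (if 0 < r then 2 * r else 0) * indicator {..<min 1 u} r" for r :: real
    by (auto simp: trunc_weight_def indicator_def)
  moreover have "(\<integral>r. (if 0 < r then 2 * r else 0) * indicator {..<min 1 u} r \<partial>lborel) = (min 1 u)\<^sup>2"
    using assms by (intro primitive_integral[where F = "\<lambda>r. r\<^sup>2"]) (auto intro!: derivative_eq_intros continuous_intros)
  ultimately show ?thesis by simp
qed

lemma weight_bounds: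
  "0 < r \<Longrightarrow> \<bar>trunc_weight r\<bar> \<le> 2 * r" "0 < r \<Longrightarrow> \<bar>gauss_weight1 r\<bar> \<le> 1 * r" "0 < r \<Longrightarrow> \<bar>gauss_weight2 r\<bar> \<le> 2 * r"
proof -
  assume r: "0 < r"
  show "\<bar>trunc_weight r\<bar> \<le> 2 * r" using r by (simp add: trunc_weight_def)
  show "\<bar>gauss_weight1 r\<bar> \<le> 1 * r" using r by (simp add: gauss_weight1_def abs_mult)
  \<comment> \<open>The estimate \<open>1 + z \<le> exp z\<close> at \<open>z = r^2 / 2\<close>
    absorbs the polynomial factor.\<close>
  have "\<bar>2 - r\<^sup>2\<bar> \<le> 2 * (1 + r\<^sup>2 / 2)" by (simp add: abs_le_iff)
  also have "\<dots> \<le> 2 * exp (r\<^sup>2 / 2)" by (intro mult_left_mono exp_ge_add_one_self) auto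
  finally have "\<bar>2 - r\<^sup>2\<bar> * exp (- r\<^sup>2 / 2) \<le> 2 * exp (r\<^sup>2 / 2) * exp (- r\<^sup>2 / 2)" by (intro mult_right_mono) auto
  also have "\<dots> = 2" by (simp add: exp_minus field_simps)
  finally have "r * (\<bar>2 - r\<^sup>2\<bar> * exp (- r\<^sup>2 / 2)) \<le> r * 2" using r by (intro mult_left_mono) auto
  moreover have "\<bar>gauss_weight2 r\<bar> = r * (\<bar>2 - r\<^sup>2\<bar> * exp (- r\<^sup>2 / 2))"
  proof -
    have "2 * r - r ^ 3 = r * (2 - r\<^sup>2)" by (simp add: power3_eq_cube power2_eq_square algebra_simps)
    then show ?thesis using r by (simp add: gauss_weight2_def abs_mult)
  qed
  ultimately show "\<bar>gauss_weight2 r\<bar> \<le> 2 * r" by simp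
qed

lemma weight_integrable:
  "integrable lborel trunc_weight" "integrable lborel gauss_weight1" "integrable lborel gauss_weight2"
proof -
  \<comment> \<open>Up to the constant \<open>sqrt (2 * pi)\<close> both Gaussian weights are
    dominated by absolute moments of the standard normal density.\<close>
  have i: "integrable lborel (\<lambda>x. sqrt (2 * pi) * (std_normal_density x * \<bar>x\<bar> ^ k))" for k
    by (intro integrable_mult_right integrable_std_normal_moment_abs)
  have eq: "sqrt (2 * pi) * (std_normal_density x * \<bar>x\<bar> ^ k) = exp (- x\<^sup>2 / 2) * \<bar>x\<bar> ^ k" for x k
    by (simp add: std_normal_density_def)
  show "integrable lborel gauss_weight1"
    by (rule Bochner_Integration.integrable_bound[OF i[of 1]], simp, unfold eq) (auto simp: gauss_weight1_def abs_mult mult_le_0_iff)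
  show "integrable lborel gauss_weight2"
  proof (rule Bochner_Integration.integrable_bound)
    show "integrable lborel (\<lambda>x. 2 * (sqrt (2 * pi) * (std_normal_density x * \<bar>x\<bar> ^ 1)) + sqrt (2 * pi) * (std_normal_density x * \<bar>x\<bar> ^ 3))"
      by (intro Bochner_Integration.integrable_add integrable_mult_right[of 2] i)
    show "AE x in lborel. norm (gauss_weight2 x) \<le> norm (2 * (sqrt (2 * pi) * (std_normal_density x * \<bar>x\<bar> ^ 1)) + sqrt (2 * pi) * (std_normal_density x * \<bar>x\<bar> ^ 3))"
    proof (rule AE_I2)
      fix x :: real
      have "\<bar>2 * x - x ^ 3\<bar> \<le> 2 * \<bar>x\<bar> ^ 1 + \<bar>x\<bar> ^ 3"
        using abs_triangle_ineq4[of "2 * x" "x ^ 3"] by (simp add: power_abs abs_mult)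
      then have le: "\<bar>2 * x - x ^ 3\<bar> * exp (- x\<^sup>2 / 2) \<le> (2 * \<bar>x\<bar> ^ 1 + \<bar>x\<bar> ^ 3) * exp (- x\<^sup>2 / 2)" by (intro mult_right_mono) auto
      have "norm (gauss_weight2 x) \<le> \<bar>2 * x - x ^ 3\<bar> * exp (- x\<^sup>2 / 2)"
        by (simp add: gauss_weight2_def abs_mult)
      also note le
      also have "(2 * \<bar>x\<bar> ^ 1 + \<bar>x\<bar> ^ 3) * exp (- x\<^sup>2 / 2) =
        norm (2 * (exp (- x\<^sup>2 / 2) * \<bar>x\<bar> ^ 1) + exp (- x\<^sup>2 / 2) * \<bar>x\<bar> ^ 3)"
        by (simp only: real_norm_def abs_of_nonneg[OF add_nonneg_nonneg] mult_nonneg_nonneg exp_ge_zero zero_le_power abs_ge_zero zero_le_numeral)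
           (simp add: algebra_simps)
      finally show "norm (gauss_weight2 x) \<le> norm (2 * (sqrt (2 * pi) * (std_normal_density x * \<bar>x\<bar> ^ 1)) + sqrt (2 * pi) * (std_normal_density x * \<bar>x\<bar> ^ 3))"
        unfolding eq .
    qed
  qed simp
  show "integrable lborel trunc_weight"
  proof (rule Bochner_Integration.integrable_bound)
    show "integrable lborel (\<lambda>r::real. 2 * (indicator {0<..1} r * r powr 0))"
      by (intro integrable_mult_right integrable_powr_0_1) simp
  qed (auto simp: trunc_weight_def indicator_def)
qed

text \<open>On the positive half-line \<open>r powr (- 1 - \<alpha>)\<close> is the radial density
  of the Levy measure of an \<open>\<alpha>\<close>-stable law.\<close>

definition levy_moment :: "real \<Rightarrow> (real \<Rightarrow> real) \<Rightarrow> real" where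
  "levy_moment \<alpha> F = (\<integral>r. F r * (indicator {0<..} r * r powr (- 1 - \<alpha>)) \<partial>lborel)"

text \<open>The two moments appear on both sides of the final comparison; that they are finite and
  strictly positive is what allows them to be cancelled there.\<close>

lemma levy_moment_gauss:
  assumes \<alpha>: "0 < \<alpha>" "\<alpha> < 2"
  defines "F1 \<equiv> \<lambda>r. 1 - exp (- r\<^sup>2 / 2)" and "F2 \<equiv> \<lambda>r::real. r\<^sup>2 * exp (- r\<^sup>2 / 2)"
  shows "integrable lborel (\<lambda>r. F1 r * (indicator {0<..} r * r powr (- 1 - \<alpha>)))"
    and "integrable lborel (\<lambda>r. F2 r * (indicator {0<..} r * r powr (- 1 - \<alpha>)))"
    and "(\<integral>r. gauss_weight1 r * r powr - \<alpha> \<partial>lborel) = \<alpha> * levy_moment \<alpha> F1"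
    and "(\<integral>r. gauss_weight2 r * r powr - \<alpha> \<partial>lborel) = \<alpha> * levy_moment \<alpha> F2"
    and "0 < levy_moment \<alpha> F1" and "0 < levy_moment \<alpha> F2"
proof -
  have w0: "gauss_weight1 r = 0" "gauss_weight2 r = 0" if "r \<le> 0" for r
    using that by (auto simp: gauss_weight1_def gauss_weight2_def)
  have e1: "(\<integral>s. gauss_weight1 s * indicator {..<r} s \<partial>lborel) * (indicator {0<..} r * r powr (- 1 - \<alpha>)) = F1 r * (indicator {0<..} r * r powr (- 1 - \<alpha>))" for r
    unfolding F1_def by (cases "0 < r") (simp_all add: gauss_weight1_primitive)
  have e2: "(\<integral>s. gauss_weight2 s * indicator {..<r} s \<partial>lborel) * (indicator {0<..} r * r powr (- 1 - \<alpha>)) = F2 r * (indicator {0<..} r * r powr (- 1 - \<alpha>))" for r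
    unfolding F2_def by (cases "0 < r") (simp_all add: gauss_weight2_primitive)
  note m1 = radial_moment[OF weight_measurable(2) w0(1) weight_integrable(2) weight_bounds(2) \<alpha>, unfolded e1]
  note m2 = radial_moment[OF weight_measurable(3) w0(2) weight_integrable(3) weight_bounds(3) \<alpha>, unfolded e2]
  show i1: "integrable lborel (\<lambda>r. F1 r * (indicator {0<..} r * r powr (- 1 - \<alpha>)))"
    and i2: "integrable lborel (\<lambda>r. F2 r * (indicator {0<..} r * r powr (- 1 - \<alpha>)))"
    and "(\<integral>r. gauss_weight1 r * r powr - \<alpha> \<partial>lborel) = \<alpha> * levy_moment \<alpha> F1"
    and "(\<integral>r. gauss_weight2 r * r powr - \<alpha> \<partial>lborel) = \<alpha> * levy_moment \<alpha> F2"
    using m1 m2 by (simp_all add: levy_moment_def)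
  have pos: "0 < levy_moment \<alpha> F" if i: "integrable lborel (\<lambda>r. F r * (indicator {0<..} r * r powr (- 1 - \<alpha>)))"
    and F: "\<And>r. 0 \<le> F r" "\<And>r. 0 < r \<Longrightarrow> 0 < F r" for F
  proof -
    have "levy_moment \<alpha> F \<noteq> 0"
    proof
      assume "levy_moment \<alpha> F = 0"
      then have "AE r in lborel. F r * (indicator {0<..} r * r powr (- 1 - \<alpha>)) = 0"
        using i F(1) unfolding levy_moment_def by (subst (asm) integral_nonneg_eq_0_iff_AE) auto
      then have "AE r in lborel. r \<notin> {0<..<1::real}"
      proof eventually_elim
        case (elim r)
        then show ?case using F(2)[of r] by (auto simp: indicator_def)
      qed
      then have "emeasure lborel {0<..<1::real} = 0"
        by (subst (asm) AE_iff_measurable[where N = "{0<..<1}"]) auto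
      then show False by simp
    qed
    moreover have "0 \<le> levy_moment \<alpha> F"
      unfolding levy_moment_def using F(1) by (intro Bochner_Integration.integral_nonneg) auto
    ultimately show ?thesis by simp
  qed
  show "0 < levy_moment \<alpha> F1" by (rule pos[OF i1]) (auto simp: F1_def)
  show "0 < levy_moment \<alpha> F2" by (rule pos[OF i2]) (auto simp: F2_def)
qed

section \<open>Karamata limits for the chosen weights\<close>

context tail_law
begin

text \<open>The origin of \<open>2 / (2 - \<alpha>)\<close>, the integral of
  \<open>2 * r * r powr - \<alpha>\<close> over the unit interval. The part \<open>|h| > x\<close>
  is kept, moved to radius \<open>x\<close>, just as in the truncated model without
  overshoot.\<close>

lemma truncated_moment_lim:
  assumes g: "continuous_on UNIV g" "\<And>s. 0 \<le> g s"
  shows "((\<lambda>x. (\<integral>h. (min 1 (norm h / x))\<^sup>2 * g (sgn h) \<partial>\<nu>) / G x) \<longlongrightarrow> L g * (2 / (2 - \<alpha>))) at_top"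
proof -
  have w0: "trunc_weight r = 0" if "r \<le> 0" for r using that by (auto simp: trunc_weight_def)
  have "(\<integral>r. trunc_weight r * r powr - \<alpha> \<partial>lborel) = (\<integral>r. 2 * (indicator {0<..1} r * r powr (1 - \<alpha>)) \<partial>lborel)"
  proof (rule integral_cong_AE)
    show "AE r in lborel. trunc_weight r * r powr - \<alpha> = 2 * (indicator {0<..1} r * r powr (1 - \<alpha>))"
      using AE_lborel_singleton[of 1]
    proof eventually_elim
      case (elim r)
      have "r * r powr - \<alpha> = r powr (1 - \<alpha>)" if "0 < r"
      proof -
        have "r powr 1 * r powr - \<alpha> = r powr (1 - \<alpha>)" by (simp only: powr_add[symmetric] add_uminus_conv_diff)
        then show ?thesis using that by simp
      qed
      then show ?case using elim by (auto simp: trunc_weight_def indicator_def)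
    qed
  qed auto
  also have "\<dots> = 2 / (2 - \<alpha>)" using integrable_powr_0_1(2)[of "1 - \<alpha>"] alpha by simp
  finally have "((\<lambda>x. (\<integral>h. (\<integral>r. trunc_weight r * indicator {..<norm h / x} r \<partial>lborel) * g (sgn h) \<partial>\<nu>) / G x)
    \<longlongrightarrow> L g * (2 / (2 - \<alpha>))) at_top"
    using karamata[OF weight_measurable(1) w0 weight_integrable(1) weight_bounds(1) g] by simp
  then show ?thesis
    by (rule Lim_transform_eventually)
      (use eventually_gt_at_top[of 0] in eventually_elim, simp add: trunc_weight_primitive)
qed

lemma gauss_moment_lim:
  assumes g: "continuous_on UNIV g" "\<And>s. 0 \<le> g s"
  shows "((\<lambda>x. (\<integral>h. (1 - exp (- (norm h / x)\<^sup>2 / 2)) \<partial>\<nu>) / G x) \<longlongrightarrow> \<alpha> * levy_moment \<alpha> (\<lambda>r. 1 - exp (- r\<^sup>2 / 2))) at_top"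
    and "((\<lambda>x. (\<integral>h. (norm h / x)\<^sup>2 * exp (- (norm h / x)\<^sup>2 / 2) * g (sgn h) \<partial>\<nu>) / G x)
      \<longlongrightarrow> L g * (\<alpha> * levy_moment \<alpha> (\<lambda>r. r\<^sup>2 * exp (- r\<^sup>2 / 2)))) at_top"
proof -
  have w0: "gauss_weight1 r = 0" "gauss_weight2 r = 0" if "r \<le> 0" for r
    using that by (auto simp: gauss_weight1_def gauss_weight2_def)
  have "((\<lambda>x. (\<integral>h. (\<integral>r. gauss_weight1 r * indicator {..<norm h / x} r \<partial>lborel) * 1 \<partial>\<nu>) / G x)
    \<longlongrightarrow> L (\<lambda>_. 1) * (\<alpha> * levy_moment \<alpha> (\<lambda>r. 1 - exp (- r\<^sup>2 / 2)))) at_top"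
    using karamata[OF weight_measurable(2) w0(1) weight_integrable(2) weight_bounds(2), of "\<lambda>_. 1"]
    unfolding levy_moment_gauss(3)[OF alpha] by simp
  then show "((\<lambda>x. (\<integral>h. (1 - exp (- (norm h / x)\<^sup>2 / 2)) \<partial>\<nu>) / G x) \<longlongrightarrow> \<alpha> * levy_moment \<alpha> (\<lambda>r. 1 - exp (- r\<^sup>2 / 2))) at_top"
    unfolding L_one mult_1
    by (rule Lim_transform_eventually)
      (use eventually_gt_at_top[of 0] in eventually_elim, simp add: gauss_weight1_primitive)
  have "((\<lambda>x. (\<integral>h. (\<integral>r. gauss_weight2 r * indicator {..<norm h / x} r \<partial>lborel) * g (sgn h) \<partial>\<nu>) / G x)
    \<longlongrightarrow> L g * (\<alpha> * levy_moment \<alpha> (\<lambda>r. r\<^sup>2 * exp (- r\<^sup>2 / 2)))) at_top"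
    using karamata[OF weight_measurable(3) w0(2) weight_integrable(3) weight_bounds(3) g]
    unfolding levy_moment_gauss(4)[OF alpha] by simp
  then show "((\<lambda>x. (\<integral>h. (norm h / x)\<^sup>2 * exp (- (norm h / x)\<^sup>2 / 2) * g (sgn h) \<partial>\<nu>) / G x)
      \<longlongrightarrow> L g * (\<alpha> * levy_moment \<alpha> (\<lambda>r. r\<^sup>2 * exp (- r\<^sup>2 / 2)))) at_top"
    by (rule Lim_transform_eventually)
      (use eventually_gt_at_top[of 0] in eventually_elim, simp add: gauss_weight2_primitive)
qed

end

text \<open>After taking logarithms \<open>n * ln (a n)\<close> tends to \<open>- c\<close>, so
  \<open>a n\<close> tends to \<open>1\<close>, and
  \<open>1 - a \<le> - ln a \<le> (1 - a) / a\<close> encloses the claim.\<close>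

lemma power_limit_exp:
  fixes a :: "nat \<Rightarrow> real"
  assumes a: "\<And>n. 0 \<le> a n" "\<And>n. a n \<le> 1" and lim: "(\<lambda>n. a n ^ n) \<longlonglongrightarrow> exp (- c)"
  shows "(\<lambda>n. real n * (1 - a n)) \<longlonglongrightarrow> c"
proof -
  have ev: "\<forall>\<^sub>F n in sequentially. 0 < a n"
    using order_tendstoD(1)[OF lim exp_gt_zero] eventually_gt_at_top[of 0]
  proof eventually_elim
    case (elim n)
    \<comment> \<open>A vanishing base would have vanishing powers for \<open>n > 0\<close>, but
      \<open>a n ^ n\<close> is positive here.\<close>
    then have "a n \<noteq> 0" by (intro notI) (simp add: zero_power)
    then show ?case using a(1)[of n] by simp
  qed
  have "(\<lambda>n. ln (a n ^ n)) \<longlonglongrightarrow> ln (exp (- c))" by (intro tendsto_ln lim) simp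
  moreover have "\<forall>\<^sub>F n in sequentially. ln (a n ^ n) = real n * ln (a n)"
    using ev by eventually_elim (simp add: ln_realpow)
  ultimately have l: "(\<lambda>n. real n * ln (a n)) \<longlonglongrightarrow> - c"
    unfolding ln_exp by (rule Lim_transform_eventually)
  have "(\<lambda>n. real n * ln (a n) * (1 / real n)) \<longlonglongrightarrow> - c * 0"
    by (intro tendsto_mult l lim_1_over_n)
  then have "(\<lambda>n. exp (real n * ln (a n) * (1 / real n))) \<longlonglongrightarrow> exp (- c * 0)" by (rule tendsto_exp)
  moreover have "\<forall>\<^sub>F n in sequentially. exp (real n * ln (a n) * (1 / real n)) = a n"
    using ev eventually_gt_at_top[of 0] by eventually_elim simp
  ultimately have a1: "a \<longlonglongrightarrow> 1" by (auto dest: Lim_transform_eventually)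
  show ?thesis
  proof (rule tendsto_sandwich[where f = "\<lambda>n. - (real n * ln (a n)) * a n" and h = "\<lambda>n. - (real n * ln (a n))"])
    show "\<forall>\<^sub>F n in sequentially. - (real n * ln (a n)) * a n \<le> real n * (1 - a n)"
      using ev
    proof eventually_elim
      case (elim n)
      have "- ln (a n) \<le> 1 / a n - 1"
        using ln_le_minus_one[of "1 / a n"] elim by (simp add: ln_div)
      then have "- ln (a n) * a n \<le> (1 / a n - 1) * a n" using elim by (intro mult_right_mono) auto
      also have "\<dots> = 1 - a n" using elim by (simp add: field_simps)
      finally have "real n * (- ln (a n) * a n) \<le> real n * (1 - a n)" by (intro mult_left_mono) auto
      then show ?case by simp
    qed
    show "\<forall>\<^sub>F n in sequentially. real n * (1 - a n) \<le> - (real n * ln (a n))"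
      using ev
    proof eventually_elim
      case (elim n)
      have "1 - a n \<le> - ln (a n)" using ln_le_minus_one[OF elim] by simp
      then have "real n * (1 - a n) \<le> real n * (- ln (a n))" by (intro mult_left_mono) auto
      then show ?case by simp
    qed
    show "(\<lambda>n. - (real n * ln (a n)) * a n) \<longlonglongrightarrow> c" using tendsto_mult[OF tendsto_minus[OF l] a1] by simp
    show "(\<lambda>n. - (real n * ln (a n))) \<longlonglongrightarrow> c" using tendsto_minus[OF l] by simp
  qed
qed

text \<open>Cauchy-Schwarz for \<open>Z\<close> and an indicator, in the form
  \<open>2 * x * y \<le> t * x^2 + y^2 / t\<close>. If \<open>Z\<close> restricted to
  \<open>A\<close> is not integrable, its expectation is \<open>0\<close> by convention.\<close>

lemma (in prob_space) expectation_square_le: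
  fixes Z :: "'a \<Rightarrow> real"
  assumes "integrable M (\<lambda>\<omega>. (Z \<omega>)\<^sup>2)" "A \<in> events" "expectation (\<lambda>\<omega>. (Z \<omega>)\<^sup>2) \<le> S" "0 < S" "0 < p" "prob A \<le> p"
  shows "expectation (\<lambda>\<omega>. Z \<omega> * indicator A \<omega>) \<le> sqrt (p * S)"
proof (cases "integrable M (\<lambda>\<omega>. Z \<omega> * indicator A \<omega>)")
  case True
  \<comment> \<open>This \<open>t\<close> balances the two terms: both become
    \<open>sqrt (p * S)\<close>.\<close>
  define t where "t = sqrt p / sqrt S"
  have t: "0 < t" using assms by (simp add: t_def)
  have "expectation (\<lambda>\<omega>. Z \<omega> * indicator A \<omega>) \<le> expectation (\<lambda>\<omega>. (t * (Z \<omega>)\<^sup>2 + indicator A \<omega> / t) / 2)"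
  proof (rule integral_mono[OF True])
    show "integrable M (\<lambda>\<omega>. (t * (Z \<omega>)\<^sup>2 + indicator A \<omega> / t) / 2)"
      using assms(1,2) by (intro integrable_divide Bochner_Integration.integrable_add integrable_mult_right integrable_real_indicator)
        (auto simp: less_top[symmetric])
    show "Z \<omega> * indicator A \<omega> \<le> (t * (Z \<omega>)\<^sup>2 + indicator A \<omega> / t) / 2" for \<omega>
    proof (cases "\<omega> \<in> A")
      case True
      have "0 \<le> (t * Z \<omega> - 1)\<^sup>2 / t" using t by simp
      also have "(t * Z \<omega> - 1)\<^sup>2 / t = t * (Z \<omega>)\<^sup>2 + 1 / t - 2 * Z \<omega>"
        using t by (simp add: power2_eq_square field_simps)
      finally show ?thesis using True by simp
    qed (use t in simp)
  qed
  also have "\<dots> = (t * expectation (\<lambda>\<omega>. (Z \<omega>)\<^sup>2) + prob A / t) / 2"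
    using assms(1,2) by (simp add: less_top[symmetric])
  also have "\<dots> \<le> (t * S + p / t) / 2"
    using t assms by (intro divide_right_mono add_mono mult_left_mono) auto
  also have "t * S = sqrt (p * S)" using assms by (simp add: t_def real_sqrt_mult field_simps)
  also have "p / t = sqrt (p * S)" using assms by (simp add: t_def real_sqrt_mult real_div_sqrt field_simps)
  finally show ?thesis by simp
qed (use assms in \<open>simp add: not_integrable_integral_eq\<close>)

section \<open>Negligible means\<close>

context tail_law
begin

lemma tail_vanish: "(G \<longlongrightarrow> 0) at_top"
proof -
  have "((\<lambda>x. \<integral>h. indicator {x<..} (norm h) \<partial>\<nu>) \<longlongrightarrow> (\<integral>h. (0::real) \<partial>\<nu>)) at_top"
  proof (rule integral_dominated_convergence_at_top[where w = "\<lambda>_. 1"])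
    show "AE h in \<nu>. ((\<lambda>x. indicator {x<..} (norm h) :: real) \<longlongrightarrow> 0) at_top"
    proof (rule AE_I2)
      fix h :: "real ^ 'd"
      have "\<forall>\<^sub>F x in at_top. (indicator {x<..} (norm h) :: real) = 0"
        using eventually_ge_at_top[of "norm h"] by eventually_elim simp
      then show "((\<lambda>x. indicator {x<..} (norm h) :: real) \<longlongrightarrow> 0) at_top" by (rule tendsto_eventually)
    qed
  qed (auto simp: indicator_def)
  then show ?thesis by (simp add: tail_integral_def[abs_def])
qed

text \<open>The part of \<open>Z\<close> where \<open>norm h \<le> K\<close> has bounded mean while the denominator tends to infinity; on the
  rest the mean is controlled by the second moment and the small probability \<open>G K\<close>.\<close>

lemma small_mean:
  fixes P :: "'w measure" and h :: "'w \<Rightarrow> real ^ 'd" and Z :: "nat \<Rightarrow> 'w \<Rightarrow> real"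
  assumes P: "prob_space P" and [measurable]: "h \<in> borel_measurable P" and distr: "distr P borel h = \<nu>"
    and x: "filterlim x at_top sequentially"
    and Z: "\<And>n. Z n \<in> borel_measurable P" "\<And>n. integrable P (\<lambda>\<omega>. (Z n \<omega>)\<^sup>2)"
      "\<And>n \<omega>. norm (h \<omega>) \<le> x n \<Longrightarrow> Z n \<omega> \<le> c * norm (h \<omega>)" and Z0: "\<And>n \<omega>. \<omega> \<in> space P \<Longrightarrow> 0 \<le> Z n \<omega>"
    and c: "0 \<le> c" and C: "0 < C"
    and Zsq: "\<forall>\<^sub>F n in sequentially. (\<integral>\<omega>. (Z n \<omega>)\<^sup>2 \<partial>P) \<le> C * ((x n)\<^sup>2 * G (x n))"
  shows "(\<lambda>n. (\<integral>\<omega>. Z n \<omega> \<partial>P)\<^sup>2 / ((x n)\<^sup>2 * G (x n))) \<longlonglongrightarrow> 0"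
proof (rule order_tendstoI)
  fix e :: real assume "e < 0"
  moreover have "0 \<le> (\<integral>\<omega>. Z n \<omega> \<partial>P)\<^sup>2 / ((x n)\<^sup>2 * G (x n))" for n
    using tail_pos[of "x n"] by simp
  ultimately show "\<forall>\<^sub>F n in sequentially. e < (\<integral>\<omega>. Z n \<omega> \<partial>P)\<^sup>2 / ((x n)\<^sup>2 * G (x n))"
    by (intro always_eventually allI) (rule less_le_trans)
next
  fix e :: real assume e: "0 < e"
  interpret P: prob_space P by fact
  have G_P: "P.prob {\<omega> \<in> space P. K < norm (h \<omega>)} = G K" for K
  proof -
    have "G K = measure (distr P borel h) {h. K < norm h}" by (simp add: tail_eq distr)
    also have "\<dots> = P.prob (h -` {h. K < norm h} \<inter> space P)" by (intro measure_distr) measurable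
    also have "h -` {h. K < norm h} \<inter> space P = {\<omega> \<in> space P. K < norm (h \<omega>)}" by auto
    finally show ?thesis by simp
  qed
  \<comment> \<open>By \<open>(a + b)^2 \<le> 2 * a^2 + 2 * b^2\<close> the tail part contributes
    \<open>2 * C * G K\<close>, which this \<open>K\<close> makes less than \<open>e / 2\<close>;
    the bounded part gets the other half.\<close>
  have "\<forall>\<^sub>F K in at_top. G K < e / (4 * C) \<and> 0 < K"
    using order_tendstoD(2)[OF tail_vanish, of "e / (4 * C)"] e C by (intro eventually_conj eventually_gt_at_top) simp
  then obtain K where K: "G K < e / (4 * C)" "0 < K" unfolding eventually_at_top_linorder by blast
  define D where "D n = (x n)\<^sup>2 * G (x n)" for n
  have D: "filterlim D at_top sequentially"
    unfolding D_def by (rule filterlim_compose[OF tail_growth x])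
  then have "(\<lambda>n. 2 * (c * K)\<^sup>2 / D n) \<longlonglongrightarrow> 0"
    by (intro tendsto_divide_0[OF tendsto_const] filterlim_at_top_imp_at_infinity)
  from order_tendstoD(2)[OF this, of "e / 2"] e
  have "\<forall>\<^sub>F n in sequentially. 2 * (c * K)\<^sup>2 / D n < e / 2" by simp
  moreover have "\<forall>\<^sub>F n in sequentially. K \<le> x n" using x by (simp add: filterlim_at_top)
  moreover have "\<forall>\<^sub>F n in sequentially. 1 \<le> D n" using D by (simp add: filterlim_at_top)
  ultimately show "\<forall>\<^sub>F n in sequentially. (\<integral>\<omega>. Z n \<omega> \<partial>P)\<^sup>2 / ((x n)\<^sup>2 * G (x n)) < e"
    using Zsq
  proof eventually_elim
    case (elim n)
    let ?A = "{\<omega> \<in> space P. K < norm (h \<omega>)}"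
    have Zi: "integrable P (Z n)" by (rule P.square_integrable_imp_integrable[OF Z(1,2)])
    have A: "?A \<in> P.events" by measurable
    have "(\<integral>\<omega>. Z n \<omega> \<partial>P) \<le> (\<integral>\<omega>. c * K + Z n \<omega> * indicator ?A \<omega> \<partial>P)"
    proof (rule integral_mono)
      show "integrable P (\<lambda>\<omega>. c * K + Z n \<omega> * indicator ?A \<omega>)"
        using Zi A by (intro Bochner_Integration.integrable_add integrable_real_mult_indicator) auto
      fix \<omega> assume \<omega>: "\<omega> \<in> space P"
      show "Z n \<omega> \<le> c * K + Z n \<omega> * indicator ?A \<omega>"
      proof (cases "\<omega> \<in> ?A")
        case False
        then have "norm (h \<omega>) \<le> K" using \<omega> by auto
        moreover have "c * norm (h \<omega>) \<le> c * K" using calculation c by (rule mult_left_mono)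
        ultimately show ?thesis using Z(3)[of \<omega> n] elim(2) False by simp
      qed (use c K in simp)
    qed (rule Zi)
    also have "\<dots> = c * K + (\<integral>\<omega>. Z n \<omega> * indicator ?A \<omega> \<partial>P)"
      using Zi A by (subst Bochner_Integration.integral_add) (auto intro: integrable_real_mult_indicator simp: P.prob_space)
    also have "(\<integral>\<omega>. Z n \<omega> * indicator ?A \<omega> \<partial>P) \<le> sqrt (G K * (C * D n))"
      using elim C tail_pos[of K] A Z(2)[of n]
      by (intro P.expectation_square_le) (auto simp: D_def G_P intro!: mult_pos_pos)
    finally have "(\<integral>\<omega>. Z n \<omega> \<partial>P) \<le> c * K + sqrt (G K * (C * D n))" by simp
    moreover have "0 \<le> (\<integral>\<omega>. Z n \<omega> \<partial>P)" using Z0 by (intro Bochner_Integration.integral_nonneg)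
    ultimately have "(\<integral>\<omega>. Z n \<omega> \<partial>P)\<^sup>2 \<le> (c * K + sqrt (G K * (C * D n)))\<^sup>2" by (intro power_mono)
    also have "\<dots> \<le> 2 * (c * K)\<^sup>2 + 2 * (sqrt (G K * (C * D n)))\<^sup>2"
      using sum_squares_bound[of "c * K" "sqrt (G K * (C * D n))"] unfolding power2_sum by linarith
    also have "(sqrt (G K * (C * D n)))\<^sup>2 = G K * (C * D n)"
      using tail_pos[of K] C elim by (intro real_sqrt_pow2 mult_nonneg_nonneg) (auto simp: less_imp_le)
    finally have "(\<integral>\<omega>. Z n \<omega> \<partial>P)\<^sup>2 / D n \<le> (2 * (c * K)\<^sup>2 + 2 * (G K * (C * D n))) / D n"
      using elim by (intro divide_right_mono) auto
    also have "\<dots> = 2 * (c * K)\<^sup>2 / D n + 2 * (C * G K)" using elim by (simp add: add_divide_distrib)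
    also have "2 * (C * G K) < e / 2" using K C by (simp add: field_simps)
    finally show ?case using elim by (simp add: D_def)
  qed
qed

lemma truncated_moment_bound:
  "\<exists>C>0. \<forall>\<^sub>F x in at_top. (\<integral>h. (min 1 (norm h / x))\<^sup>2 \<partial>\<nu>) \<le> C * G x"
proof -
  have "((\<lambda>x. (\<integral>h. (min 1 (norm h / x))\<^sup>2 \<partial>\<nu>) / G x) \<longlongrightarrow> 2 / (2 - \<alpha>)) at_top"
    using truncated_moment_lim[of "\<lambda>_. 1"] L_one by simp
  from order_tendstoD(2)[OF this, of "2 / (2 - \<alpha>) + 1"]
  have "\<forall>\<^sub>F x in at_top. (\<integral>h. (min 1 (norm h / x))\<^sup>2 \<partial>\<nu>) / G x < 2 / (2 - \<alpha>) + 1" by simp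
  then have "\<forall>\<^sub>F x in at_top. (\<integral>h. (min 1 (norm h / x))\<^sup>2 \<partial>\<nu>) \<le> (2 / (2 - \<alpha>) + 1) * G x"
    by eventually_elim (use tail_pos in \<open>simp add: pos_divide_less_eq less_imp_le\<close>)
  moreover have "0 < 2 / (2 - \<alpha>) + 1" using alpha by (intro add_pos_pos divide_pos_pos) auto
  ultimately show ?thesis by blast
qed

end

subsection \<open>Characteristic functions near the origin\<close>

lemma one_minus_cos_bounds:
  fixes z :: real
  shows "0 \<le> 1 - cos z" "1 - cos z \<le> 2" "1 - cos z \<le> z\<^sup>2 / 2"
proof -
  show "0 \<le> 1 - cos z" by simp
  show "1 - cos z \<le> 2" using cos_ge_minus_one[of z] by linarith
  have "1 - cos z = 2 * (sin (z / 2))\<^sup>2" using cos_double_sin[of "z / 2"] by simp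
  also have "\<dots> \<le> 2 * (z / 2)\<^sup>2"
    using iffD1[OF abs_le_square_iff abs_sin_x_le_abs_x[of "z / 2"]] by simp
  finally show "1 - cos z \<le> z\<^sup>2 / 2" by (simp add: power_divide)
qed

text \<open>One envelope for both regimes \<open>1 - cos z \<le> z^2 / 2\<close> and
  \<open>1 - cos z \<le> 2\<close>. The dependence on \<open>\<theta>\<close> sits in a separate
  polynomial factor, which is integrable against a Gaussian law.\<close>

lemma one_minus_cos_inner:
  fixes \<theta> h :: "'a::real_inner"
  assumes "0 < b"
  shows "1 - cos (\<theta> \<bullet> ((1 / b) *\<^sub>R h)) \<le> (2 + (norm \<theta>)\<^sup>2) * (min 1 (norm h / b))\<^sup>2"
proof (cases "norm h / b \<le> 1")
  case True
  have "(\<theta> \<bullet> ((1 / b) *\<^sub>R h))\<^sup>2 \<le> (norm \<theta> * norm ((1 / b) *\<^sub>R h))\<^sup>2"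
    using Cauchy_Schwarz_ineq2[of \<theta> "(1 / b) *\<^sub>R h"] by (metis abs_ge_zero power2_abs power_mono)
  also have "\<dots> = (norm \<theta>)\<^sup>2 * (norm h / b)\<^sup>2" using assms by (simp add: power_mult_distrib power_divide)
  also have "\<dots> \<le> 2 * ((2 + (norm \<theta>)\<^sup>2) * (norm h / b)\<^sup>2)" by (simp add: algebra_simps)
  finally show ?thesis using one_minus_cos_bounds(3)[of "\<theta> \<bullet> ((1 / b) *\<^sub>R h)"] True by simp
next
  case False
  then have "(min 1 (norm h / b))\<^sup>2 = 1" by simp
  then show ?thesis using one_minus_cos_bounds(2)[of "\<theta> \<bullet> ((1 / b) *\<^sub>R h)"] by (simp add: add_increasing2)
qed

lemma cmod_char_fun_le_1:
  fixes \<nu> :: "(real ^ 'd) measure"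
  assumes "prob_space \<nu>" "sets \<nu> = sets borel"
  shows "cmod (char_fun \<nu> \<theta>) \<le> 1"
proof -
  interpret prob_space \<nu> by fact
  note [measurable_cong] = assms(2)
  have "cmod (char_fun \<nu> \<theta>) \<le> (\<integral>x. norm (exp (\<i> * complex_of_real (\<theta> \<bullet> x))) \<partial>\<nu>)"
    unfolding char_fun_def by (rule integral_norm_bound)
  then show ?thesis by (simp add: prob_space)
qed

lemma char_fun_measurable[measurable]:
  fixes \<nu> :: "(real ^ 'd) measure"
  assumes "prob_space \<nu>" and [measurable_cong]: "sets \<nu> = sets borel"
  shows "char_fun \<nu> \<in> borel_measurable borel"
proof -
  interpret prob_space \<nu> by fact
  show ?thesis unfolding char_fun_def[abs_def] by measurable
qed

context tail_law
begin

text \<open>The first term is a mean of \<open>1 - cos\<close>, the form that Gaussian averaging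
  evaluates; the square that the passage to the modulus leaves behind will turn out to be of smaller
  order.\<close>

lemma one_minus_cmod_square:
  "1 - (cmod (char_fun \<nu> \<theta>))\<^sup>2 = 2 * (1 - Re (char_fun \<nu> \<theta>)) - (cmod (1 - char_fun \<nu> \<theta>))\<^sup>2"
  unfolding cmod_power2 by (simp add: power2_eq_square algebra_simps)

lemma one_minus_Re:
  "1 - Re (char_fun \<nu> \<theta>) = (\<integral>h. 1 - cos (\<theta> \<bullet> h) \<partial>\<nu>)"
proof -
  have "integrable \<nu> (\<lambda>h. cos (\<theta> \<bullet> h))" by (intro integrable_const_bound[of _ 1]) auto
  then show ?thesis by (simp add: char_fun_Re_Im[OF prob_space_axioms sets_law] prob_space)
qed

lemma one_minus_Re_bound:
  assumes "0 < b"
  shows "1 - Re (char_fun \<nu> ((1 / b) *\<^sub>R \<theta>)) \<le> (2 + (norm \<theta>)\<^sup>2) * (\<integral>h. (min 1 (norm h / b))\<^sup>2 \<partial>\<nu>)"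
proof -
  have "1 - Re (char_fun \<nu> ((1 / b) *\<^sub>R \<theta>)) \<le> (\<integral>h. (2 + (norm \<theta>)\<^sup>2) * (min 1 (norm h / b))\<^sup>2 \<partial>\<nu>)"
    unfolding one_minus_Re
  proof (rule integral_mono)
    show "integrable \<nu> (\<lambda>h. 1 - cos ((1 / b) *\<^sub>R \<theta> \<bullet> h))"
      using one_minus_cos_bounds(1,2) by (intro integrable_const_bound[of _ 2]) (auto simp: abs_of_nonneg)
    show "integrable \<nu> (\<lambda>h. (2 + (norm \<theta>)\<^sup>2) * (min 1 (norm h / b))\<^sup>2)"
      using assms by (intro integrable_mult_right integrable_const_bound[of _ 1]) (auto simp: power_le_one)
    show "1 - cos ((1 / b) *\<^sub>R \<theta> \<bullet> h) \<le> (2 + (norm \<theta>)\<^sup>2) * (min 1 (norm h / b))\<^sup>2" for h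
      using one_minus_cos_inner[OF assms, of \<theta> h] by simp
  qed
  then show ?thesis by simp
qed

text \<open>The bound \<open>|1 - exp (i z)| \<le> min 2 |z|\<close> reduces the deviation to a
  truncated first moment, whose square is \<open>o (G (b n))\<close> by \<open>small_mean\<close>.
  Second moments alone would give only \<open>O (G (b n))\<close>.\<close>

lemma char_fun_deviation_small:
  assumes b: "\<And>n. 0 < b n" "filterlim b at_top sequentially"
  shows "(\<lambda>n. (cmod (1 - char_fun \<nu> ((1 / b n) *\<^sub>R \<theta>)))\<^sup>2 / G (b n)) \<longlonglongrightarrow> 0"
proof -
  obtain C where C: "0 < C" "\<forall>\<^sub>F x in at_top. (\<integral>h. (min 1 (norm h / x))\<^sup>2 \<partial>\<nu>) \<le> C * G x"
    using truncated_moment_bound by blast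
  \<comment> \<open>The factor \<open>b n\<close> puts the truncated variable on the scale of
    \<open>h\<close>, so that it is at most \<open>|\<theta>| * |h|\<close>, as
    \<open>small_mean\<close> requires.\<close>
  define Z where "Z n h = b n * min 2 (\<bar>\<theta> \<bullet> h\<bar> / b n)" for n and h :: "real ^ 'd"
  have Zm[measurable]: "Z n \<in> borel_measurable \<nu>" for n unfolding Z_def by measurable
  have Z0: "0 \<le> Z n h" for n h using b(1)[of n] by (simp add: Z_def less_imp_le)
  have Z2: "Z n h \<le> 2 * b n" for n h using b(1)[of n] by (simp add: Z_def mult.commute mult_left_mono)
  have Z_sq: "(Z n h)\<^sup>2 \<le> (b n)\<^sup>2 * ((4 + (norm \<theta>)\<^sup>2) * (min 1 (norm h / b n))\<^sup>2)" for n h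
  proof (cases "norm h / b n \<le> 1")
    case True
    have "Z n h \<le> \<bar>\<theta> \<bullet> h\<bar>" using b(1)[of n] mult_left_mono[of "min 2 (\<bar>\<theta> \<bullet> h\<bar> / b n)" "\<bar>\<theta> \<bullet> h\<bar> / b n" "b n"]
      by (simp add: Z_def)
    also have "\<dots> \<le> norm \<theta> * norm h" by (rule Cauchy_Schwarz_ineq2)
    finally have "(Z n h)\<^sup>2 \<le> (norm \<theta> * norm h)\<^sup>2" using Z0 by (intro power_mono)
    also have "\<dots> = (b n)\<^sup>2 * ((norm \<theta>)\<^sup>2 * (norm h / b n)\<^sup>2)" using b(1)[of n] by (simp add: power_mult_distrib power_divide)
    also have "\<dots> \<le> (b n)\<^sup>2 * ((4 + (norm \<theta>)\<^sup>2) * (norm h / b n)\<^sup>2)" by (intro mult_left_mono mult_right_mono) auto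
    finally show ?thesis using True by simp
  next
    case False
    have "(Z n h)\<^sup>2 \<le> (2 * b n)\<^sup>2" using Z0 Z2 by (intro power_mono)
    also have "\<dots> \<le> (b n)\<^sup>2 * (4 + (norm \<theta>)\<^sup>2)" by (simp add: power_mult_distrib algebra_simps)
    finally show ?thesis using False by simp
  qed
  have Zi: "integrable \<nu> (\<lambda>h. (Z n h)\<^sup>2)" for n
  proof (rule integrable_const_bound[of _ "(2 * b n)\<^sup>2"])
    show "AE h in \<nu>. norm ((Z n h)\<^sup>2) \<le> (2 * b n)\<^sup>2"
      using power_mono[OF Z2 Z0, of n _ 2] by (intro AE_I2) simp
  qed simp
  have main: "(\<lambda>n. (\<integral>h. Z n h \<partial>\<nu>)\<^sup>2 / ((b n)\<^sup>2 * G (b n))) \<longlonglongrightarrow> 0"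
  proof (rule small_mean[where P = \<nu> and h = "\<lambda>h. h" and c = "norm \<theta>" and C = "(4 + (norm \<theta>)\<^sup>2) * C"])
    show "distr \<nu> borel (\<lambda>h. h) = \<nu>" by (rule distr_id2) (simp add: sets_law)
    show "Z n h \<le> norm \<theta> * norm h" for n and h :: "real ^ 'd"
    proof -
      have "Z n h \<le> \<bar>\<theta> \<bullet> h\<bar>" using b(1)[of n] mult_left_mono[of "min 2 (\<bar>\<theta> \<bullet> h\<bar> / b n)" "\<bar>\<theta> \<bullet> h\<bar> / b n" "b n"]
        by (simp add: Z_def)
      also have "\<dots> \<le> norm \<theta> * norm h" by (rule Cauchy_Schwarz_ineq2)
      finally show ?thesis .
    qed
    show "\<forall>\<^sub>F n in sequentially. (\<integral>h. (Z n h)\<^sup>2 \<partial>\<nu>) \<le> (4 + (norm \<theta>)\<^sup>2) * C * ((b n)\<^sup>2 * G (b n))"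
      using eventually_compose_filterlim[OF C(2) b(2)]
    proof eventually_elim
      case (elim n)
      have i: "integrable \<nu> (\<lambda>h. (min 1 (norm h / b n))\<^sup>2)"
        using b(1)[of n] by (intro integrable_const_bound[of _ 1]) (auto simp: power_le_one)
      have "(\<integral>h. (Z n h)\<^sup>2 \<partial>\<nu>) \<le> (\<integral>h. (b n)\<^sup>2 * ((4 + (norm \<theta>)\<^sup>2) * (min 1 (norm h / b n))\<^sup>2) \<partial>\<nu>)"
        by (intro integral_mono Zi integrable_mult_right i Z_sq)
      also have "\<dots> = (b n)\<^sup>2 * ((4 + (norm \<theta>)\<^sup>2) * (\<integral>h. (min 1 (norm h / b n))\<^sup>2 \<partial>\<nu>))" by simp
      also have "\<dots> \<le> (b n)\<^sup>2 * ((4 + (norm \<theta>)\<^sup>2) * (C * G (b n)))" using elim by (intro mult_left_mono) auto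
      finally show ?case by (simp add: mult_ac)
    qed
    show "0 < (4 + (norm \<theta>)\<^sup>2) * C" using C by (simp add: add_pos_nonneg)
  qed (use b Zm Zi Z0 prob_space_axioms in auto)
  have bound: "(cmod (1 - char_fun \<nu> ((1 / b n) *\<^sub>R \<theta>)))\<^sup>2 / G (b n) \<le> (\<integral>h. Z n h \<partial>\<nu>)\<^sup>2 / ((b n)\<^sup>2 * G (b n))" for n
  proof -
    have ii: "integrable \<nu> (\<lambda>h. exp (\<i> * complex_of_real ((1 / b n) *\<^sub>R \<theta> \<bullet> h)))"
      by (intro integrable_const_bound[of _ 1]) auto
    have "cmod (1 - char_fun \<nu> ((1 / b n) *\<^sub>R \<theta>)) = cmod (\<integral>h. 1 - exp (\<i> * complex_of_real ((1 / b n) *\<^sub>R \<theta> \<bullet> h)) \<partial>\<nu>)"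
      unfolding char_fun_def using ii by (simp add: prob_space)
    also have "\<dots> \<le> (\<integral>h. cmod (1 - exp (\<i> * complex_of_real ((1 / b n) *\<^sub>R \<theta> \<bullet> h))) \<partial>\<nu>)"
      by (rule integral_norm_bound)
    also have "\<dots> \<le> (\<integral>h. Z n h / b n \<partial>\<nu>)"
    proof (rule integral_mono)
      show "integrable \<nu> (\<lambda>h. cmod (1 - exp (\<i> * complex_of_real ((1 / b n) *\<^sub>R \<theta> \<bullet> h))))"
        using ii by (intro integrable_norm Bochner_Integration.integrable_diff) auto
      show "integrable \<nu> (\<lambda>h. Z n h / b n)"
        using square_integrable_imp_integrable[OF Zm Zi] by simp
      fix h
      have "cmod (1 - exp (\<i> * complex_of_real z)) \<le> min 2 \<bar>z\<bar>" for z
      proof -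
        have "cmod (1 - exp (\<i> * complex_of_real z)) = cmod (exp (\<i> * complex_of_real z) - 1)" by (rule norm_minus_commute)
        then show ?thesis using iexp_approx1[of z 0] iexp_approx2[of z 0] by simp
      qed
      from this[of "(1 / b n) *\<^sub>R \<theta> \<bullet> h"]
      show "cmod (1 - exp (\<i> * complex_of_real ((1 / b n) *\<^sub>R \<theta> \<bullet> h))) \<le> Z n h / b n"
        using b(1)[of n] by (simp add: Z_def abs_mult)
    qed
    also have "\<dots> = (\<integral>h. Z n h \<partial>\<nu>) / b n" by simp
    finally have "(cmod (1 - char_fun \<nu> ((1 / b n) *\<^sub>R \<theta>)))\<^sup>2 \<le> ((\<integral>h. Z n h \<partial>\<nu>) / b n)\<^sup>2" by (intro power_mono) auto
    then have "(cmod (1 - char_fun \<nu> ((1 / b n) *\<^sub>R \<theta>)))\<^sup>2 / G (b n) \<le> ((\<integral>h. Z n h \<partial>\<nu>) / b n)\<^sup>2 / G (b n)"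
      using tail_pos[of "b n"] by (intro divide_right_mono) auto
    then show ?thesis by (simp add: power_divide)
  qed
  show ?thesis
    by (rule tendsto_sandwich[OF _ _ tendsto_const main])
      (use bound tail_pos in \<open>auto intro!: always_eventually divide_nonneg_nonneg simp: less_imp_le\<close>)
qed

lemma not_point_mass: "\<not> (AE x in \<nu>. x = y)"
proof
  assume "AE x in \<nu>. x = y"
  then have "AE x in \<nu>. x \<notin> {h. norm y < norm h}" by eventually_elim auto
  then have "measure \<nu> {h. norm y < norm h} = 0"
    by (intro measure_eq_0_null_sets AE_iff_null_sets[THEN iffD2]) auto
  then show False using tail_pos[of "norm y"] by (simp add: tail_eq)
qed

text \<open>Symmetrization: \<open>1 - |char_fun|^2\<close> is the mean of \<open>1 - cos\<close> at
  the difference of two independent copies. Its Gaussian average \<open>E c\<close> is positive,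
  because the law is not a point mass, and nonincreasing in \<open>c\<close>; so
  \<open>E (b n)\<close> can tend to \<open>0\<close> only if \<open>b n\<close> tends to
  infinity.\<close>

lemma norming_at_top:
  assumes b: "\<And>n. 0 < b n" and lim: "\<And>\<theta>. (\<lambda>n. 1 - (cmod (char_fun \<nu> ((1 / b n) *\<^sub>R \<theta>)))\<^sup>2) \<longlonglongrightarrow> 0"
  shows "filterlim b at_top sequentially"
proof -
  obtain \<gamma> :: "(real ^ 'd) measure" where \<gamma>: "prob_space \<gamma>" "sets \<gamma> = sets borel"
    and cosint: "\<forall>y. (\<integral>\<theta>. cos (\<theta> \<bullet> y) \<partial>\<gamma>) = exp (- (norm y)\<^sup>2 / 2)"
    using std_gaussian_exists by blast
  interpret g: prob_space \<gamma> by fact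
  note [measurable_cong] = \<gamma>(2)
  interpret N: pair_prob_space \<nu> \<nu> ..
  interpret gN: pair_prob_space \<gamma> "\<nu> \<Otimes>\<^sub>M \<nu>" ..
  note [measurable] = char_fun_measurable[OF prob_space_axioms sets_law]
  define E where "E c = (\<integral>p. 1 - exp (- (norm ((1 / c) *\<^sub>R (fst p - snd p)))\<^sup>2 / 2) \<partial>(\<nu> \<Otimes>\<^sub>M \<nu>))" for c :: real
  have sq: "1 - (cmod (char_fun \<nu> \<theta>))\<^sup>2 = (\<integral>p. 1 - cos (\<theta> \<bullet> (fst p - snd p)) \<partial>(\<nu> \<Otimes>\<^sub>M \<nu>))" for \<theta>
  proof -
    have i: "integrable \<nu> (\<lambda>h. cos (\<theta> \<bullet> h))" "integrable \<nu> (\<lambda>h. sin (\<theta> \<bullet> h))"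
      by (intro integrable_const_bound[of _ 1]; simp)+
    have iN: "integrable (\<nu> \<Otimes>\<^sub>M \<nu>) (\<lambda>p. cos (\<theta> \<bullet> (fst p - snd p)))"
      by (intro N.integrable_const_bound[of _ 1]) auto
    have "(\<integral>p. cos (\<theta> \<bullet> (fst p - snd p)) \<partial>(\<nu> \<Otimes>\<^sub>M \<nu>)) = (\<integral>x. \<integral>y. cos (\<theta> \<bullet> (x - y)) \<partial>\<nu> \<partial>\<nu>)"
      using N.integral_fst'[OF iN] by simp
    also have "\<dots> = (\<integral>x. cos (\<theta> \<bullet> x) * (\<integral>y. cos (\<theta> \<bullet> y) \<partial>\<nu>) + sin (\<theta> \<bullet> x) * (\<integral>y. sin (\<theta> \<bullet> y) \<partial>\<nu>) \<partial>\<nu>)"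
      using i by (simp add: inner_diff_right cos_diff)
    also have "\<dots> = (cmod (char_fun \<nu> \<theta>))\<^sup>2"
      unfolding cmod_power2 char_fun_Re_Im[OF prob_space_axioms sets_law] using i by (simp add: power2_eq_square)
    finally show ?thesis using iN by (simp add: N.prob_space)
  qed
  have avg: "(\<integral>\<theta>. 1 - (cmod (char_fun \<nu> ((1 / c) *\<^sub>R \<theta>)))\<^sup>2 \<partial>\<gamma>) = E c" for c
  proof -
    let ?f = "\<lambda>\<theta> p. 1 - cos (((1 / c) *\<^sub>R \<theta>) \<bullet> (fst p - snd p))"
    have int: "integrable (\<gamma> \<Otimes>\<^sub>M (\<nu> \<Otimes>\<^sub>M \<nu>)) (case_prod ?f)"
      using one_minus_cos_bounds(1,2) by (intro gN.integrable_const_bound[of _ 2]) (auto simp: abs_of_nonneg)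
    have ig: "integrable \<gamma> (\<lambda>\<theta>. cos (\<theta> \<bullet> z))" for z by (intro g.integrable_const_bound[of _ 1]) auto
    have "(\<integral>\<theta>. 1 - (cmod (char_fun \<nu> ((1 / c) *\<^sub>R \<theta>)))\<^sup>2 \<partial>\<gamma>) = (\<integral>p. (\<integral>\<theta>. ?f \<theta> p \<partial>\<gamma>) \<partial>(\<nu> \<Otimes>\<^sub>M \<nu>))"
      unfolding sq using gN.Fubini_integral[OF int] by simp
    also have "\<dots> = E c" unfolding E_def
    proof (rule Bochner_Integration.integral_cong[OF refl])
      fix p :: "(real ^ 'd) \<times> (real ^ 'd)"
      have "(\<integral>\<theta>. ?f \<theta> p \<partial>\<gamma>) = (\<integral>\<theta>. 1 - cos (\<theta> \<bullet> ((1 / c) *\<^sub>R (fst p - snd p))) \<partial>\<gamma>)" by simp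
      also have "\<dots> = 1 - (\<integral>\<theta>. cos (\<theta> \<bullet> ((1 / c) *\<^sub>R (fst p - snd p))) \<partial>\<gamma>)"
        by (subst Bochner_Integration.integral_diff[OF _ ig]) (simp_all add: g.prob_space)
      also have "\<dots> = 1 - exp (- (norm ((1 / c) *\<^sub>R (fst p - snd p)))\<^sup>2 / 2)"
        by (simp only: cosint[rule_format])
      finally show "(\<integral>\<theta>. ?f \<theta> p \<partial>\<gamma>) = 1 - exp (- (norm ((1 / c) *\<^sub>R (fst p - snd p)))\<^sup>2 / 2)" .
    qed
    finally show ?thesis .
  qed
  have "(\<lambda>n. \<integral>\<theta>. 1 - (cmod (char_fun \<nu> ((1 / b n) *\<^sub>R \<theta>)))\<^sup>2 \<partial>\<gamma>) \<longlonglongrightarrow> (\<integral>\<theta>. 0 \<partial>\<gamma>)"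
  proof (rule integral_dominated_convergence[where w = "\<lambda>_. 1"])
    show "AE \<theta> in \<gamma>. norm (1 - (cmod (char_fun \<nu> ((1 / b n) *\<^sub>R \<theta>)))\<^sup>2) \<le> 1" for n
    proof (rule AE_I2)
      fix \<theta>
      have "(cmod (char_fun \<nu> ((1 / b n) *\<^sub>R \<theta>)))\<^sup>2 \<le> 1"
        using cmod_char_fun_le_1[OF prob_space_axioms sets_law] by (intro power_le_one) auto
      then show "norm (1 - (cmod (char_fun \<nu> ((1 / b n) *\<^sub>R \<theta>)))\<^sup>2) \<le> 1" by simp
    qed
  qed (use lim in auto)
  then have E0: "(\<lambda>n. E (b n)) \<longlonglongrightarrow> 0" by (simp add: avg)
  have Ei: "integrable (\<nu> \<Otimes>\<^sub>M \<nu>) (\<lambda>p. 1 - exp (- (norm ((1 / c) *\<^sub>R (fst p - snd p)))\<^sup>2 / 2))" for c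
    by (intro N.integrable_const_bound[of _ 1]) auto
  have E_pos: "0 < E c" if "0 < c" for c
  proof -
    have "E c \<noteq> 0"
    proof
      assume "E c = 0"
      then have "AE p in \<nu> \<Otimes>\<^sub>M \<nu>. 1 - exp (- (norm ((1 / c) *\<^sub>R (fst p - snd p)))\<^sup>2 / 2) = 0"
        unfolding E_def by (subst (asm) integral_nonneg_eq_0_iff_AE[OF Ei]) auto
      then have "AE p in \<nu> \<Otimes>\<^sub>M \<nu>. snd p = fst p"
        by eventually_elim (use that in auto)
      \<comment> \<open>Almost sure equality of two independent copies would make the law a point
        mass, at any \<open>x\<close> with a null section.\<close>
      from N.AE_pair[OF this] have "AE x in \<nu>. AE y in \<nu>. y = x" by simp
      then have "\<exists>x. AE y in \<nu>. y = x" using not_point_mass by (auto dest: AE_False[THEN iffD1])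
      then show False using not_point_mass by blast
    qed
    moreover have "0 \<le> E c" unfolding E_def by (intro Bochner_Integration.integral_nonneg) auto
    ultimately show ?thesis by simp
  qed
  have E_anti: "E y \<le> E x" if "0 < x" "x \<le> y" for x y
    unfolding E_def
  proof (rule integral_mono[OF Ei Ei])
    fix p :: "(real ^ 'd) \<times> (real ^ 'd)"
    have "norm ((1 / y) *\<^sub>R (fst p - snd p)) \<le> norm ((1 / x) *\<^sub>R (fst p - snd p))"
      using that by (simp add: divide_left_mono)
    then have "(norm ((1 / y) *\<^sub>R (fst p - snd p)))\<^sup>2 \<le> (norm ((1 / x) *\<^sub>R (fst p - snd p)))\<^sup>2" by (intro power_mono) auto
    then show "1 - exp (- (norm ((1 / y) *\<^sub>R (fst p - snd p)))\<^sup>2 / 2) \<le> 1 - exp (- (norm ((1 / x) *\<^sub>R (fst p - snd p)))\<^sup>2 / 2)" by simp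
  qed
  show ?thesis
    unfolding filterlim_at_top_gt[where c = 0]
  proof (intro allI impI)
    fix B :: real assume B: "0 < B"
    from order_tendstoD(2)[OF E0 E_pos[OF B]] show "\<forall>\<^sub>F n in sequentially. B \<le> b n"
    proof eventually_elim
      case (elim n)
      show ?case using E_anti[OF b[of n], of B] elim by linarith
    qed
  qed
qed

end

subsection \<open>Identification of the spectral measure\<close>

lemma power2_norm_axis: "(norm x)\<^sup>2 = (\<Sum>i\<in>UNIV. (axis i 1 \<bullet> x)\<^sup>2)" for x :: "real ^ 'd"
proof -
  have "axis i 1 \<bullet> x = x $ i" for i by (simp add: inner_axis')
  moreover have "(norm x)\<^sup>2 = (\<Sum>i\<in>UNIV. (x $ i)\<^sup>2)"
    unfolding power2_norm_eq_inner inner_vec_def by (simp add: power2_eq_square)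
  ultimately show ?thesis by simp
qed

lemma tendsto_zero_bounded_mult:
  fixes p x :: "nat \<Rightarrow> real"
  assumes "\<And>n. \<bar>p n\<bar> \<le> 1" "x \<longlonglongrightarrow> 0"
  shows "(\<lambda>n. p n * x n) \<longlonglongrightarrow> 0"
proof (rule Lim_null_comparison[OF _ tendsto_rabs_zero[OF assms(2)]])
  show "\<forall>\<^sub>F n in sequentially. norm (p n * x n) \<le> \<bar>x n\<bar>"
    using assms(1) by (intro always_eventually allI) (simp add: abs_mult mult_left_le_one_le)
qed

text \<open>The vectors \<open>(p n, 1 - p n)\<close> are asymptotically annihilated by two rows and
  stay away from \<open>0\<close>, since their entries sum to \<open>1\<close>; so the determinant
  of the rows vanishes. The sequence \<open>p\<close> itself may oscillate.\<close>

lemma mixed_limits_proportional: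
  fixes p :: "nat \<Rightarrow> real"
  assumes p: "\<And>n. 0 \<le> p n" "\<And>n. p n \<le> 1"
    and 1: "(\<lambda>n. p n * X - (1 - p n) * X') \<longlonglongrightarrow> 0" and 2: "(\<lambda>n. p n * Y - (1 - p n) * Y') \<longlonglongrightarrow> 0"
  shows "X * Y' = Y * X'"
proof -
  \<comment> \<open>Eliminating each of the two unknowns gives the determinant times
    \<open>p n\<close> and times \<open>1 - p n\<close>; in the sum \<open>p n\<close>
    disappears.\<close>
  have "(\<lambda>n. Y' * (p n * X - (1 - p n) * X') - X' * (p n * Y - (1 - p n) * Y')
      - (X * (p n * Y - (1 - p n) * Y') - Y * (p n * X - (1 - p n) * X'))) \<longlonglongrightarrow> Y' * 0 - X' * 0 - (X * 0 - Y * 0)"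
    by (intro tendsto_intros 1 2)
  moreover have "(\<lambda>n. Y' * (p n * X - (1 - p n) * X') - X' * (p n * Y - (1 - p n) * Y')
      - (X * (p n * Y - (1 - p n) * Y') - Y * (p n * X - (1 - p n) * X'))) = (\<lambda>n. X * Y' - Y * X')"
    by (simp add: algebra_simps)
  ultimately show ?thesis by (simp add: LIMSEQ_const_iff)
qed

text \<open>Minus the real part of the exponent in the spectral representation, where drift and
  compensator are imaginary; \<open>exp (- levy_exponent)\<close> is thus the modulus of the
  characteristic function.\<close>

definition levy_exponent :: "real \<Rightarrow> (real ^ 'd) measure \<Rightarrow> real ^ 'd \<Rightarrow> real" where
  "levy_exponent \<alpha> \<Gamma> \<theta> =
     (\<integral>s. (\<integral>x. (1 - cos (x * (\<theta> \<bullet> s))) * (indicator {0<..} x * x powr (- 1 - \<alpha>)) \<partial>lborel) \<partial>\<Gamma>)"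

lemma levy_truncation_integrable:
  fixes \<alpha> :: real
  assumes "0 < \<alpha>" "\<alpha> < 2"
  shows "integrable lborel (\<lambda>x::real. (min 1 x)\<^sup>2 * (indicator {0<..} x * x powr (- 1 - \<alpha>)))"
proof (rule Bochner_Integration.integrable_bound)
  show "integrable lborel (\<lambda>x. indicator {0<..1} x * x powr (1 - \<alpha>) + indicator {1<..} x * x powr (- 1 - \<alpha>))"
    using assms by (intro Bochner_Integration.integrable_add integrable_powr_0_1 integrable_powr_inf) auto
  have "x\<^sup>2 * x powr (- 1 - \<alpha>) = x powr (1 - \<alpha>)" if "0 < x" for x :: real
  proof -
    have "x powr 2 * x powr (- 1 - \<alpha>) = x powr (2 + (- 1 - \<alpha>))" by (simp only: powr_add)
    then show ?thesis using that by (simp add: powr_numeral)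
  qed
  then show "AE x in lborel. norm ((min 1 x)\<^sup>2 * (indicator {0<..} x * x powr (- 1 - \<alpha>)))
      \<le> norm (indicator {0<..1} x * x powr (1 - \<alpha>) + indicator {1<..} x * x powr (- 1 - \<alpha>))"
    by (intro AE_I2) (auto simp: indicator_def min_def)
qed simp

context tail_law
begin

text \<open>The norming \<open>b\<close> is only known through the limit, so \<open>n G (b n)\<close> is not known to converge, nor
  even to be bounded; normalized to \<open>p n = n G (b n) / (1 + n G (b n))\<close> it is bounded. Averaging
  \<open>1 - |\<phi>|\<^sup>2\<close> against a Gaussian with the two weights \<open>1\<close> and \<open>(\<theta> \<bullet> v)\<^sup>2\<close> gives two asymptotic
  relations involving \<open>p\<close>, and \<open>p\<close> is eliminated between them. The first average is radial and the
  second differs from a radial one by the second moment in direction \<open>v\<close>.\<close>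

theorem spectral_second_moment:
  fixes b :: "nat \<Rightarrow> real" and \<Gamma> :: "(real ^ 'd) measure" and v :: "real ^ 'd"
  assumes b: "\<And>n. 0 < b n"
    and \<Gamma>: "finite_measure \<Gamma>" "sets \<Gamma> = sets borel" "AE s in \<Gamma>. norm s = 1"
    and lim: "\<And>\<theta>. (\<lambda>n. cmod (char_fun \<nu> ((1 / b n) *\<^sub>R \<theta>)) ^ n) \<longlonglongrightarrow> exp (- levy_exponent \<alpha> \<Gamma> \<theta>)"
  shows "(\<integral>s. (s \<bullet> v)\<^sup>2 \<partial>\<Gamma>) = L (\<lambda>s. (s \<bullet> v)\<^sup>2) * measure \<Gamma> (space \<Gamma>)"
proof -
  obtain \<gamma> :: "(real ^ 'd) measure" where \<gamma>: "prob_space \<gamma>" "sets \<gamma> = sets borel"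
    and cosint: "\<forall>y. (\<integral>\<theta>. cos (\<theta> \<bullet> y) \<partial>\<gamma>) = exp (- (norm y)\<^sup>2 / 2)"
    and cosint2: "\<forall>y v. (\<integral>\<theta>. cos (\<theta> \<bullet> y) * (\<theta> \<bullet> v)\<^sup>2 \<partial>\<gamma>) = ((norm v)\<^sup>2 - (y \<bullet> v)\<^sup>2) * exp (- (norm y)\<^sup>2 / 2)"
    and mom: "\<forall>v k. integrable \<gamma> (\<lambda>\<theta>. (\<theta> \<bullet> v) ^ k)"
    using std_gaussian_exists by blast
  interpret g: prob_space \<gamma> by fact
  interpret Gam: finite_measure \<Gamma> by fact
  note [measurable_cong] = \<gamma>(2) \<Gamma>(2)
  note [measurable] = char_fun_measurable[OF prob_space_axioms sets_law]
  interpret GL: pair_sigma_finite \<Gamma> lborel ..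
  interpret gQ: pair_sigma_finite \<gamma> "\<Gamma> \<Otimes>\<^sub>M lborel" ..
  interpret gn: pair_prob_space \<gamma> \<nu> ..
  define \<psi> where "\<psi> = levy_exponent \<alpha> \<Gamma>"
  define m :: "real \<Rightarrow> real" where "m x = indicator {0<..} x * x powr (- 1 - \<alpha>)" for x
  have m_meas[measurable]: "m \<in> borel_measurable borel" unfolding m_def[abs_def] by measurable
  have m0: "0 \<le> m x" for x by (simp add: m_def)
  let ?Q = "\<Gamma> \<Otimes>\<^sub>M lborel"
  let ?\<phi> = "\<lambda>n \<theta>. char_fun \<nu> ((1 / b n) *\<^sub>R \<theta>)"
  define u where "u n \<theta> = 1 - (cmod (?\<phi> n \<theta>))\<^sup>2" for n \<theta>
  have \<phi>1: "cmod (?\<phi> n \<theta>) \<le> 1" for n \<theta> by (rule cmod_char_fun_le_1[OF prob_space_axioms sets_law])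
  have u0: "0 \<le> u n \<theta>" for n \<theta> using power_le_one[OF norm_ge_zero \<phi>1] by (simp add: u_def)
  \<comment> \<open>Squaring the moduli doubles the exponent, and the limit of powers becomes one
    for \<open>n * (1 - |char_fun|^2)\<close>.\<close>
  have nu: "(\<lambda>n. real n * u n \<theta>) \<longlonglongrightarrow> 2 * \<psi> \<theta>" for \<theta>
    unfolding u_def
  proof (rule power_limit_exp)
    have "(\<lambda>n. (cmod (?\<phi> n \<theta>) ^ n)\<^sup>2) \<longlonglongrightarrow> (exp (- \<psi> \<theta>))\<^sup>2" unfolding \<psi>_def by (intro tendsto_power lim)
    then show "(\<lambda>n. (cmod (?\<phi> n \<theta>))\<^sup>2 ^ n) \<longlonglongrightarrow> exp (- (2 * \<psi> \<theta>))"
      by (simp add: power_mult[symmetric] mult.commute exp_double[symmetric] flip: exp_double)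
  qed (use \<phi>1 in \<open>auto intro: power_le_one\<close>)
  have "(\<lambda>n. u n \<theta>) \<longlonglongrightarrow> 0" for \<theta>
  proof -
    have "(\<lambda>n. real n * u n \<theta> * (1 / real n)) \<longlonglongrightarrow> 2 * \<psi> \<theta> * 0" by (intro tendsto_mult nu lim_1_over_n)
    moreover have "\<forall>\<^sub>F n in sequentially. real n * u n \<theta> * (1 / real n) = u n \<theta>"
      using eventually_gt_at_top[of 0] by eventually_elim simp
    ultimately show ?thesis by (auto dest: Lim_transform_eventually)
  qed
  then have b_top: "filterlim b at_top sequentially"
    unfolding u_def by (rule norming_at_top[OF b])
  obtain C where C: "0 < C" "\<forall>\<^sub>F x in at_top. (\<integral>h. (min 1 (norm h / x))\<^sup>2 \<partial>\<nu>) \<le> C * G x"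
    using truncated_moment_bound by blast
  \<comment> \<open>The moment bound holds only from some \<open>N\<close> on, hence the shifted
    sequences in the dominated convergence arguments below.\<close>
  obtain N where N: "\<And>n. N \<le> n \<Longrightarrow> (\<integral>h. (min 1 (norm h / b n))\<^sup>2 \<partial>\<nu>) \<le> C * G (b n)"
    using eventually_compose_filterlim[OF C(2) b_top] unfolding eventually_sequentially by blast
  have ReG: "1 - Re (?\<phi> n \<theta>) \<le> (2 + (norm \<theta>)\<^sup>2) * (C * G (b n))" if "N \<le> n" for n \<theta>
    by (rule order_trans[OF one_minus_Re_bound[OF b] mult_left_mono[OF N[OF that]]]) simp
  \<comment> \<open>Both bounds come from one identity: \<open>2 * (1 - Re)\<close> is the sum of
    the nonnegative terms \<open>u n \<theta>\<close> and \<open>|1 - char_fun|^2\<close>.\<close>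
  have dev: "(cmod (1 - ?\<phi> n \<theta>))\<^sup>2 \<le> 2 * ((2 + (norm \<theta>)\<^sup>2) * (C * G (b n)))"
    and uG: "u n \<theta> \<le> 2 * ((2 + (norm \<theta>)\<^sup>2) * (C * G (b n)))" if "N \<le> n" for n \<theta>
  proof -
    define X where "X = (2 + (norm \<theta>)\<^sup>2) * (C * G (b n))"
    have 1: "1 - Re (?\<phi> n \<theta>) \<le> X" unfolding X_def by (rule ReG[OF that])
    have 2: "0 \<le> 1 - (cmod (?\<phi> n \<theta>))\<^sup>2" using u0[of n \<theta>] by (simp add: u_def)
    have 3: "0 \<le> (cmod (1 - ?\<phi> n \<theta>))\<^sup>2" by simp
    note 4 = one_minus_cmod_square[of "(1 / b n) *\<^sub>R \<theta>"]
    have "(cmod (1 - ?\<phi> n \<theta>))\<^sup>2 \<le> 2 * X" using 1 2 4 by argo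
    then show "(cmod (1 - ?\<phi> n \<theta>))\<^sup>2 \<le> 2 * ((2 + (norm \<theta>)\<^sup>2) * (C * G (b n)))" unfolding X_def .
    have "u n \<theta> \<le> 2 * X" unfolding u_def using 1 3 4 by argo
    then show "u n \<theta> \<le> 2 * ((2 + (norm \<theta>)\<^sup>2) * (C * G (b n)))" unfolding X_def .
  qed
  define t where "t n = real n * G (b n)" for n
  define p where "p n = t n / (1 + t n)" for n
  have t0: "0 \<le> t n" for n using tail_pos[of "b n"] by (simp add: t_def)
  have p: "0 \<le> p n" "p n \<le> 1" and p1: "1 - p n = 1 / (1 + t n)" for n using t0[of n] by (auto simp: p_def field_simps)
  have pabs: "\<bar>p n\<bar> \<le> 1" for n using p[of n] by simp

  \<comment> \<open>The exponent is written as one integral over directions and radii together, so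
    that Fubini can exchange it with the Gaussian average.\<close>
  define f where "f \<theta> q = (1 - cos (snd q * (\<theta> \<bullet> fst q))) * m (snd q)" for \<theta> and q :: "(real ^ 'd) \<times> real"
  have J: "integrable ?Q (\<lambda>q. (min 1 (snd q))\<^sup>2 * m (snd q))"
  proof (rule GL.Fubini_integrable)
    have i: "integrable lborel (\<lambda>x. (min 1 x)\<^sup>2 * m x)"
      using levy_truncation_integrable[OF alpha] by (simp add: m_def)
    then show "AE s in \<Gamma>. integrable lborel (\<lambda>x. (min 1 (snd (s, x)))\<^sup>2 * m (snd (s, x)))" by simp
    show "integrable \<Gamma> (\<lambda>s. \<integral>x. norm ((min 1 (snd (s, x)))\<^sup>2 * m (snd (s, x))) \<partial>lborel)" by simp
  qed measurable
  have AEQ: "AE q in ?Q. norm (fst q) = 1"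
  proof (rule GL.AE_pair_measure)
    show "{q \<in> space ?Q. norm (fst q) = 1} \<in> sets ?Q" by measurable
    show "AE s in \<Gamma>. AE x in lborel. norm (fst (s, x)) = 1" using \<Gamma>(3) by eventually_elim simp
  qed
  have f_bound: "AE q in ?Q. \<bar>f \<theta> q\<bar> \<le> (2 + (norm \<theta>)\<^sup>2) * ((min 1 (snd q))\<^sup>2 * m (snd q))" for \<theta>
    using AEQ
  proof eventually_elim
    case (elim q)
    show ?case
    proof (cases "0 < snd q")
      case True
      have "1 - cos (snd q * (\<theta> \<bullet> fst q)) \<le> (2 + (norm \<theta>)\<^sup>2) * (min 1 (snd q))\<^sup>2"
        using one_minus_cos_inner[of 1 \<theta> "snd q *\<^sub>R fst q"] True elim by simp
      then have "(1 - cos (snd q * (\<theta> \<bullet> fst q))) * m (snd q) \<le> (2 + (norm \<theta>)\<^sup>2) * (min 1 (snd q))\<^sup>2 * m (snd q)"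
        using m0 by (rule mult_right_mono)
      then show ?thesis using m0 by (simp add: f_def abs_mult mult_ac)
    qed (simp add: f_def m_def)
  qed
  have f_int: "integrable ?Q (f \<theta>)" for \<theta>
  proof (rule Bochner_Integration.integrable_bound[OF integrable_mult_right[OF J]])
    show "AE q in ?Q. norm (f \<theta> q) \<le> norm ((2 + (norm \<theta>)\<^sup>2) * ((min 1 (snd q))\<^sup>2 * m (snd q)))"
      using f_bound[of \<theta>] by eventually_elim simp
    show "f \<theta> \<in> borel_measurable ?Q" unfolding f_def by measurable
  qed
  have \<psi>_eq: "\<psi> \<theta> = (\<integral>q. f \<theta> q \<partial>?Q)" for \<theta>
  proof -
    have "\<psi> \<theta> = (\<integral>s. (\<integral>x. f \<theta> (s, x) \<partial>lborel) \<partial>\<Gamma>)" by (simp add: \<psi>_def levy_exponent_def f_def m_def)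
    also have "\<dots> = (\<integral>q. f \<theta> q \<partial>?Q)" by (rule GL.integral_fst'[OF f_int])
    finally show ?thesis .
  qed
  have \<psi>_meas[measurable]: "\<psi> \<in> borel_measurable borel"
    unfolding \<psi>_eq[abs_def] f_def by measurable
  define Jq where "Jq = (\<integral>q. (min 1 (snd q))\<^sup>2 * m (snd q) \<partial>?Q)"
  have f0: "0 \<le> f \<theta> q" for \<theta> q using m0 one_minus_cos_bounds(1) by (simp add: f_def)
  have \<psi>0: "0 \<le> \<psi> \<theta>" for \<theta> unfolding \<psi>_eq by (intro Bochner_Integration.integral_nonneg f0)
  have \<psi>_bound: "\<psi> \<theta> \<le> (2 + (norm \<theta>)\<^sup>2) * Jq" for \<theta>
  proof -
    have "(\<integral>q. f \<theta> q \<partial>?Q) \<le> (\<integral>q. (2 + (norm \<theta>)\<^sup>2) * ((min 1 (snd q))\<^sup>2 * m (snd q)) \<partial>?Q)"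
    proof (intro integral_mono_AE f_int integrable_mult_right J)
      show "AE q in ?Q. f \<theta> q \<le> (2 + (norm \<theta>)\<^sup>2) * ((min 1 (snd q))\<^sup>2 * m (snd q))"
        using f_bound[of \<theta>] by eventually_elim simp
    qed
    then show ?thesis by (simp add: \<psi>_eq Jq_def)
  qed
  have Jq0: "0 \<le> Jq" unfolding Jq_def using m0 by (intro Bochner_Integration.integral_nonneg) simp

  \<comment> \<open>The common form of the two relations. Averaging with weight \<open>W\<close>
    turns \<open>1 - cos\<close> into \<open>F\<close>; on the side of the law \<open>F\<close> has
    the tail limit \<open>V\<close>, on the stable side it is integrated against the Levy measure.
    Dividing both by \<open>1 + t n\<close> produces the factors \<open>p n\<close> and
    \<open>1 - p n\<close>.\<close>
  have weight: "(\<lambda>n. p n * V - (1 - p n) * (\<integral>s. (\<integral>x. F (x *\<^sub>R s) * m x \<partial>lborel) \<partial>\<Gamma>)) \<longlonglongrightarrow> 0"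
    if W[measurable]: "W \<in> borel_measurable borel" and W0: "\<And>\<theta>. 0 \<le> W \<theta>"
      and Wi: "integrable \<gamma> (\<lambda>\<theta>. (2 + (norm \<theta>)\<^sup>2) * W \<theta>)"
      and F: "\<And>y. F y = (\<integral>\<theta>. (1 - cos (\<theta> \<bullet> y)) * W \<theta> \<partial>\<gamma>)"
      and V: "((\<lambda>x. (\<integral>h. F ((1 / x) *\<^sub>R h) \<partial>\<nu>) / G x) \<longlongrightarrow> V) at_top"
    for W F V
  proof -
    define \<Psi> where "\<Psi> = (\<integral>\<theta>. \<psi> \<theta> * W \<theta> \<partial>\<gamma>)"
    have Wle: "W \<theta> \<le> (2 + (norm \<theta>)\<^sup>2) * W \<theta>" for \<theta> using W0[of \<theta>] by (simp add: distrib_right)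
    have W1: "integrable \<gamma> W"
      by (rule Bochner_Integration.integrable_bound[OF Wi]) (use Wle W0 in \<open>auto simp: abs_mult\<close>)
    have \<psi>W: "integrable \<gamma> (\<lambda>\<theta>. \<psi> \<theta> * W \<theta>)"
    proof (rule Bochner_Integration.integrable_bound[OF integrable_mult_right[OF Wi, of Jq]])
      show "AE \<theta> in \<gamma>. norm (\<psi> \<theta> * W \<theta>) \<le> norm (Jq * ((2 + (norm \<theta>)\<^sup>2) * W \<theta>))"
      proof (rule AE_I2)
        fix \<theta>
        have "\<psi> \<theta> * W \<theta> \<le> (2 + (norm \<theta>)\<^sup>2) * Jq * W \<theta>" by (intro mult_right_mono \<psi>_bound W0)
        then show "norm (\<psi> \<theta> * W \<theta>) \<le> norm (Jq * ((2 + (norm \<theta>)\<^sup>2) * W \<theta>))"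
          using \<psi>0[of \<theta>] W0[of \<theta>] Jq0 by (simp add: abs_mult mult_ac)
      qed
    qed measurable
    have \<Psi>_eq: "\<Psi> = (\<integral>s. (\<integral>x. F (x *\<^sub>R s) * m x \<partial>lborel) \<partial>\<Gamma>)"
    proof -
      have int: "integrable (\<gamma> \<Otimes>\<^sub>M ?Q) (case_prod (\<lambda>\<theta> q. f \<theta> q * W \<theta>))"
      proof (rule gQ.Fubini_integrable)
        show "(case_prod (\<lambda>\<theta> q. f \<theta> q * W \<theta>)) \<in> borel_measurable (\<gamma> \<Otimes>\<^sub>M ?Q)" unfolding f_def by measurable
        show "integrable \<gamma> (\<lambda>\<theta>. \<integral>q. norm (case (\<theta>, q) of (\<theta>, q) \<Rightarrow> f \<theta> q * W \<theta>) \<partial>?Q)"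
          using \<psi>W W0 f0 by (simp add: abs_mult \<psi>_eq)
        show "AE \<theta> in \<gamma>. integrable ?Q (\<lambda>q. case (\<theta>, q) of (\<theta>, q) \<Rightarrow> f \<theta> q * W \<theta>)"
          using f_int by simp
      qed
      have inner: "(\<integral>\<theta>. f \<theta> q * W \<theta> \<partial>\<gamma>) = F (snd q *\<^sub>R fst q) * m (snd q)" for q
      proof -
        have "f \<theta> q * W \<theta> = (1 - cos (\<theta> \<bullet> (snd q *\<^sub>R fst q))) * W \<theta> * m (snd q)" for \<theta>
          by (simp add: f_def)
        then show ?thesis unfolding F by (simp only: integral_mult_left_zero)
      qed
      have iq: "integrable ?Q (\<lambda>q. F (snd q *\<^sub>R fst q) * m (snd q))"
        using gQ.integrable_snd[OF int] unfolding inner .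
      have "\<Psi> = (\<integral>\<theta>. (\<integral>q. f \<theta> q * W \<theta> \<partial>?Q) \<partial>\<gamma>)" by (simp add: \<Psi>_def \<psi>_eq)
      also have "\<dots> = (\<integral>q. F (snd q *\<^sub>R fst q) * m (snd q) \<partial>?Q)"
        using gQ.Fubini_integral[OF int] by (simp add: inner)
      also have "\<dots> = (\<integral>s. (\<integral>x. F (x *\<^sub>R s) * m x \<partial>lborel) \<partial>\<Gamma>)"
        using GL.integral_fst'[OF iq] by simp
      finally show ?thesis .
    qed
    have ReW: "(\<integral>\<theta>. (1 - Re (?\<phi> n \<theta>)) * W \<theta> \<partial>\<gamma>) = (\<integral>h. F ((1 / b n) *\<^sub>R h) \<partial>\<nu>)"
      and ReWi: "integrable \<gamma> (\<lambda>\<theta>. (1 - Re (?\<phi> n \<theta>)) * W \<theta>)" for n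
    proof -
      let ?f = "\<lambda>\<theta> h. (1 - cos (((1 / b n) *\<^sub>R \<theta>) \<bullet> h)) * W \<theta>"
      have ci: "integrable \<nu> (\<lambda>h. 1 - cos (z \<bullet> h))" for z
        using one_minus_cos_bounds(1,2) by (intro integrable_const_bound[of _ 2]) auto
      have int: "integrable (\<gamma> \<Otimes>\<^sub>M \<nu>) (case_prod ?f)"
      proof (rule gn.Fubini_integrable)
        show "case_prod ?f \<in> borel_measurable (\<gamma> \<Otimes>\<^sub>M \<nu>)" by measurable
        have "integrable \<gamma> (\<lambda>\<theta>. (1 - Re (?\<phi> n \<theta>)) * W \<theta>)"
        proof (rule Bochner_Integration.integrable_bound[OF integrable_mult_right[OF W1, of 2]])
          show "AE \<theta> in \<gamma>. norm ((1 - Re (?\<phi> n \<theta>)) * W \<theta>) \<le> norm (2 * W \<theta>)"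
          proof (rule AE_I2)
            fix \<theta>
            have "\<bar>Re (?\<phi> n \<theta>)\<bar> \<le> 1" using abs_Re_le_cmod \<phi>1 order_trans by blast
            then have "\<bar>1 - Re (?\<phi> n \<theta>)\<bar> \<le> 2" by linarith
            then show "norm ((1 - Re (?\<phi> n \<theta>)) * W \<theta>) \<le> norm (2 * W \<theta>)"
              using W0[of \<theta>] by (simp add: abs_mult mult_right_mono)
          qed
        qed measurable
        moreover have "(\<integral>h. norm (?f \<theta> h) \<partial>\<nu>) = (1 - Re (?\<phi> n \<theta>)) * W \<theta>" for \<theta>
          unfolding one_minus_Re using W0[of \<theta>] one_minus_cos_bounds(1) by (simp add: abs_mult)
        ultimately show "integrable \<gamma> (\<lambda>\<theta>. \<integral>h. norm (case (\<theta>, h) of (\<theta>, h) \<Rightarrow> ?f \<theta> h) \<partial>\<nu>)"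
          by (simp only: prod.case)
        show "AE \<theta> in \<gamma>. integrable \<nu> (\<lambda>h. case (\<theta>, h) of (\<theta>, h) \<Rightarrow> ?f \<theta> h)"
          unfolding prod.case by (intro AE_I2 integrable_mult_left ci)
      qed
      have 1: "(\<integral>h. ?f \<theta> h \<partial>\<nu>) = (1 - Re (?\<phi> n \<theta>)) * W \<theta>" for \<theta>
        unfolding one_minus_Re by simp
      have 2: "(\<integral>\<theta>. ?f \<theta> h \<partial>\<gamma>) = F ((1 / b n) *\<^sub>R h)" for h unfolding F by simp
      show "(\<integral>\<theta>. (1 - Re (?\<phi> n \<theta>)) * W \<theta> \<partial>\<gamma>) = (\<integral>h. F ((1 / b n) *\<^sub>R h) \<partial>\<nu>)"
        using gn.Fubini_integral[OF int] unfolding 1 2 by simp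
      show "integrable \<gamma> (\<lambda>\<theta>. (1 - Re (?\<phi> n \<theta>)) * W \<theta>)"
        using gn.integrable_fst[OF int] unfolding 1 .
    qed
    have devi: "integrable \<gamma> (\<lambda>\<theta>. (cmod (1 - ?\<phi> n \<theta>))\<^sup>2 * W \<theta>)" for n
    proof (rule Bochner_Integration.integrable_bound[OF integrable_mult_right[OF W1, of 4]])
      show "AE \<theta> in \<gamma>. norm ((cmod (1 - ?\<phi> n \<theta>))\<^sup>2 * W \<theta>) \<le> norm (4 * W \<theta>)"
      proof (rule AE_I2)
        fix \<theta>
        have "cmod (1 - ?\<phi> n \<theta>) \<le> 2" using norm_triangle_ineq4[of 1 "?\<phi> n \<theta>"] \<phi>1[of n \<theta>] by simp
        then have "(cmod (1 - ?\<phi> n \<theta>))\<^sup>2 \<le> 2\<^sup>2" by (intro power_mono) auto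
        then show "norm ((cmod (1 - ?\<phi> n \<theta>))\<^sup>2 * W \<theta>) \<le> norm (4 * W \<theta>)"
          using W0[of \<theta>] by (simp add: abs_mult mult_right_mono)
      qed
    qed measurable
    \<comment> \<open>What the passage to the modulus costs, relative to
      \<open>G (b n)\<close>.\<close>
    define r where "r n = (\<integral>\<theta>. (cmod (1 - ?\<phi> n \<theta>))\<^sup>2 / G (b n) * W \<theta> \<partial>\<gamma>)" for n
    have r: "r \<longlonglongrightarrow> 0"
    proof (rule LIMSEQ_offset[where k = N])
      have "(\<lambda>n. \<integral>\<theta>. (cmod (1 - ?\<phi> (n + N) \<theta>))\<^sup>2 / G (b (n + N)) * W \<theta> \<partial>\<gamma>) \<longlonglongrightarrow> (\<integral>\<theta>. 0 \<partial>\<gamma>)"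
      proof (rule integral_dominated_convergence[where w = "\<lambda>\<theta>. 2 * C * ((2 + (norm \<theta>)\<^sup>2) * W \<theta>)"])
        show "integrable \<gamma> (\<lambda>\<theta>. 2 * C * ((2 + (norm \<theta>)\<^sup>2) * W \<theta>))" by (intro integrable_mult_right Wi)
        show "AE \<theta> in \<gamma>. (\<lambda>n. (cmod (1 - ?\<phi> (n + N) \<theta>))\<^sup>2 / G (b (n + N)) * W \<theta>) \<longlonglongrightarrow> 0"
          by (intro AE_I2 tendsto_mult_left_zero LIMSEQ_ignore_initial_segment[OF char_fun_deviation_small[OF b b_top]])
        show "AE \<theta> in \<gamma>. norm ((cmod (1 - ?\<phi> (n + N) \<theta>))\<^sup>2 / G (b (n + N)) * W \<theta>) \<le> 2 * C * ((2 + (norm \<theta>)\<^sup>2) * W \<theta>)" for n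
        proof (rule AE_I2)
          fix \<theta>
          have "(cmod (1 - ?\<phi> (n + N) \<theta>))\<^sup>2 / G (b (n + N)) \<le> 2 * C * (2 + (norm \<theta>)\<^sup>2)"
          proof -
            have "2 * ((2 + (norm \<theta>)\<^sup>2) * (C * G (b (n + N)))) = 2 * C * (2 + (norm \<theta>)\<^sup>2) * G (b (n + N))"
              by (simp only: mult_ac)
            then show ?thesis using dev[of "n + N" \<theta>] by (simp only: pos_divide_le_eq[OF tail_pos] le_add2)
          qed
          then have "(cmod (1 - ?\<phi> (n + N) \<theta>))\<^sup>2 / G (b (n + N)) * W \<theta> \<le> 2 * C * (2 + (norm \<theta>)\<^sup>2) * W \<theta>"
            by (intro mult_right_mono W0)
          then show "norm ((cmod (1 - ?\<phi> (n + N) \<theta>))\<^sup>2 / G (b (n + N)) * W \<theta>) \<le> 2 * C * ((2 + (norm \<theta>)\<^sup>2) * W \<theta>)"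
            using W0[of \<theta>] tail_pos[of "b (n + N)"] by (simp add: abs_mult mult.assoc)
        qed
      qed measurable
      then show "(\<lambda>n. r (n + N)) \<longlonglongrightarrow> 0" by (simp add: r_def)
    qed
    \<comment> \<open>The difference in the limit \<open>n * u n\<close> to
      \<open>2 * \<psi>\<close>, damped by \<open>1 + t n\<close>: undamped, the bound
      \<open>uG\<close> would contain the possibly unbounded \<open>n * G (b n)\<close>.\<close>
    define D where "D n \<theta> = (real n * u n \<theta> - 2 * \<psi> \<theta>) / (1 + t n) * W \<theta>" for n \<theta>
    have D_int: "(\<integral>\<theta>. D n \<theta> \<partial>\<gamma>) = p n * (2 * ((\<integral>h. F ((1 / b n) *\<^sub>R h) \<partial>\<nu>) / G (b n)) - r n) - 2 * (1 - p n) * \<Psi>" for n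
    proof -
      have "D n \<theta> = real n / (1 + t n) * (2 * ((1 - Re (?\<phi> n \<theta>)) * W \<theta>) - (cmod (1 - ?\<phi> n \<theta>))\<^sup>2 * W \<theta>) - 2 / (1 + t n) * (\<psi> \<theta> * W \<theta>)" for \<theta>
        unfolding D_def u_def one_minus_cmod_square by (simp add: algebra_simps diff_divide_distrib add_divide_distrib)
      then have "(\<integral>\<theta>. D n \<theta> \<partial>\<gamma>) = real n / (1 + t n) * (2 * (\<integral>h. F ((1 / b n) *\<^sub>R h) \<partial>\<nu>) - (\<integral>\<theta>. (cmod (1 - ?\<phi> n \<theta>))\<^sup>2 * W \<theta> \<partial>\<gamma>)) - 2 / (1 + t n) * \<Psi>"
        using ReWi[of n] devi[of n] \<psi>W by (simp add: ReW \<Psi>_def)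
      also have "(\<integral>\<theta>. (cmod (1 - ?\<phi> n \<theta>))\<^sup>2 * W \<theta> \<partial>\<gamma>) = G (b n) * r n"
        using tail_pos[of "b n"] by (simp add: r_def)
      also have "real n / (1 + t n) * (2 * (\<integral>h. F ((1 / b n) *\<^sub>R h) \<partial>\<nu>) - G (b n) * r n) =
        p n * (2 * ((\<integral>h. F ((1 / b n) *\<^sub>R h) \<partial>\<nu>) / G (b n)) - r n)"
      proof -
        have "p n = real n / (1 + t n) * G (b n)" by (simp add: p_def t_def)
        moreover have "G (b n) * (2 * ((\<integral>h. F ((1 / b n) *\<^sub>R h) \<partial>\<nu>) / G (b n)) - r n) = 2 * (\<integral>h. F ((1 / b n) *\<^sub>R h) \<partial>\<nu>) - G (b n) * r n"
          using tail_pos[of "b n"] by (simp add: right_diff_distrib)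
        ultimately show ?thesis by (simp only: mult.assoc)
      qed
      finally show ?thesis by (simp add: p1)
    qed
    have "(\<lambda>n. \<integral>\<theta>. D n \<theta> \<partial>\<gamma>) \<longlonglongrightarrow> 0"
    proof (rule LIMSEQ_offset[where k = N])
      have "(\<lambda>n. \<integral>\<theta>. D (n + N) \<theta> \<partial>\<gamma>) \<longlonglongrightarrow> (\<integral>\<theta>. 0 \<partial>\<gamma>)"
      proof (rule integral_dominated_convergence[where w = "\<lambda>\<theta>. (2 * C + 2 * Jq) * ((2 + (norm \<theta>)\<^sup>2) * W \<theta>)"])
        show "integrable \<gamma> (\<lambda>\<theta>. (2 * C + 2 * Jq) * ((2 + (norm \<theta>)\<^sup>2) * W \<theta>))" by (intro integrable_mult_right Wi)
        show "(\<lambda>\<theta>. D (n + N) \<theta>) \<in> borel_measurable \<gamma>" for n unfolding D_def u_def by measurable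
        show "AE \<theta> in \<gamma>. (\<lambda>n. D (n + N) \<theta>) \<longlonglongrightarrow> 0"
        proof (rule AE_I2)
          fix \<theta>
          have "(\<lambda>n. real n * u n \<theta> - 2 * \<psi> \<theta>) \<longlonglongrightarrow> 2 * \<psi> \<theta> - 2 * \<psi> \<theta>" by (intro tendsto_intros nu)
          then have 0: "(\<lambda>n. real n * u n \<theta> - 2 * \<psi> \<theta>) \<longlonglongrightarrow> 0" by simp
          have "\<bar>1 / (1 + t n)\<bar> \<le> 1" for n using t0[of n] by simp
          then have "(\<lambda>n. 1 / (1 + t n) * (real n * u n \<theta> - 2 * \<psi> \<theta>)) \<longlonglongrightarrow> 0"
            by (rule tendsto_zero_bounded_mult[OF _ 0])
          from tendsto_mult[OF this tendsto_const[of "W \<theta>"]]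
          have "(\<lambda>n. D n \<theta>) \<longlonglongrightarrow> 0" by (simp add: D_def)
          then show "(\<lambda>n. D (n + N) \<theta>) \<longlonglongrightarrow> 0" by (rule LIMSEQ_ignore_initial_segment)
        qed
        show "AE \<theta> in \<gamma>. norm (D (n + N) \<theta>) \<le> (2 * C + 2 * Jq) * ((2 + (norm \<theta>)\<^sup>2) * W \<theta>)" for n
        proof (rule AE_I2)
          fix \<theta> :: "real ^ 'd"
          let ?k = "n + N" and ?c = "2 + (norm \<theta>)\<^sup>2"
          have c0: "0 \<le> ?c" by simp
          \<comment> \<open>Since \<open>n * G (b n) / (1 + t n) = p n \<le> 1\<close>, the unknown
            norming drops out of the bound.\<close>
          have "real ?k * u ?k \<theta> / (1 + t ?k) \<le> real ?k * (2 * (?c * (C * G (b ?k)))) / (1 + t ?k)"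
            using t0[of ?k] by (intro divide_right_mono mult_left_mono uG) auto
          also have "\<dots> = (2 * (?c * C)) * p ?k" by (simp add: p_def t_def mult_ac)
          also have "\<dots> \<le> (2 * (?c * C)) * 1" using C c0 p by (intro mult_left_mono) auto
          finally have 1: "real ?k * u ?k \<theta> / (1 + t ?k) \<le> 2 * (?c * C)" by simp
          have "2 * \<psi> \<theta> / (1 + t ?k) \<le> 2 * \<psi> \<theta> / 1" using \<psi>0[of \<theta>] t0[of ?k] by (intro divide_left_mono) auto
          with \<psi>_bound[of \<theta>] have 2: "2 * \<psi> \<theta> / (1 + t ?k) \<le> 2 * (?c * Jq)" by simp
          have 3: "0 \<le> real ?k * u ?k \<theta> / (1 + t ?k)" "0 \<le> 2 * \<psi> \<theta> / (1 + t ?k)" using u0[of ?k \<theta>] \<psi>0[of \<theta>] t0[of ?k] by auto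
          have "\<bar>x - y\<bar> \<le> a + b" if "0 \<le> x" "x \<le> a" "0 \<le> y" "y \<le> b" for x y a b :: real
            using that by linarith
          from this[OF 3(1) 1 3(2) 2]
          have "\<bar>(real ?k * u ?k \<theta> - 2 * \<psi> \<theta>) / (1 + t ?k)\<bar> \<le> 2 * (?c * C) + 2 * (?c * Jq)"
            unfolding diff_divide_distrib .
          then have "\<bar>(real ?k * u ?k \<theta> - 2 * \<psi> \<theta>) / (1 + t ?k)\<bar> * W \<theta> \<le> (2 * (?c * C) + 2 * (?c * Jq)) * W \<theta>"
            by (intro mult_right_mono W0)
          also have "\<dots> = (2 * C + 2 * Jq) * (?c * W \<theta>)" by (simp add: algebra_simps)
          finally show "norm (D ?k \<theta>) \<le> (2 * C + 2 * Jq) * (?c * W \<theta>)"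
            using W0[of \<theta>] unfolding D_def real_norm_def abs_mult by simp
        qed
      qed measurable
      then show "(\<lambda>n. \<integral>\<theta>. D (n + N) \<theta> \<partial>\<gamma>) \<longlonglongrightarrow> 0" by simp
    qed
    moreover have "(\<lambda>n. p n * r n) \<longlonglongrightarrow> 0" by (rule tendsto_zero_bounded_mult[OF pabs r])
    moreover have "(\<lambda>n. p n * ((\<integral>h. F ((1 / b n) *\<^sub>R h) \<partial>\<nu>) / G (b n) - V)) \<longlonglongrightarrow> 0"
      using filterlim_compose[OF V b_top] by (intro tendsto_zero_bounded_mult[OF pabs]) (simp add: LIM_zero)
    ultimately have "(\<lambda>n. ((\<integral>\<theta>. D n \<theta> \<partial>\<gamma>) + p n * r n) / 2 - p n * ((\<integral>h. F ((1 / b n) *\<^sub>R h) \<partial>\<nu>) / G (b n) - V)) \<longlonglongrightarrow> (0 + 0) / 2 - 0"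
      by (intro tendsto_intros) auto
    moreover have "((\<integral>\<theta>. D n \<theta> \<partial>\<gamma>) + p n * r n) / 2 - p n * ((\<integral>h. F ((1 / b n) *\<^sub>R h) \<partial>\<nu>) / G (b n) - V) = p n * V - (1 - p n) * \<Psi>" for n
    proof -
      have "(x * (2 * y - z) - 2 * (1 - x) * w + x * z) / 2 - x * (y - V) = x * V - (1 - x) * w" for x y z w :: real
        by (simp add: field_simps)
      then show ?thesis unfolding D_int .
    qed
    ultimately show ?thesis by (simp add: \<Psi>_eq)
  qed

  define K1 where "K1 = levy_moment \<alpha> (\<lambda>r. 1 - exp (- r\<^sup>2 / 2))"
  define K2 where "K2 = levy_moment \<alpha> (\<lambda>r. r\<^sup>2 * exp (- r\<^sup>2 / 2))"
  have K: "0 < K1" "0 < K2" using levy_moment_gauss(5,6)[OF alpha] by (auto simp: K1_def K2_def)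
  have K1i: "integrable lborel (\<lambda>x. (1 - exp (- x\<^sup>2 / 2)) * m x)" and K1: "(\<integral>x. (1 - exp (- x\<^sup>2 / 2)) * m x \<partial>lborel) = K1"
    and K2i: "integrable lborel (\<lambda>x. x\<^sup>2 * exp (- x\<^sup>2 / 2) * m x)" and K2: "(\<integral>x. x\<^sup>2 * exp (- x\<^sup>2 / 2) * m x \<partial>lborel) = K2"
    using levy_moment_gauss(1,2)[OF alpha] by (simp_all add: m_def K1_def K2_def levy_moment_def)
  define \<sigma> where "\<sigma> = L (\<lambda>s. (s \<bullet> v)\<^sup>2)"
  define I where "I = (\<integral>s. (s \<bullet> v)\<^sup>2 \<partial>\<Gamma>)"
  define c where "c = measure \<Gamma> (space \<Gamma>)"

  \<comment> \<open>The weights must be integrable together with the growth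
    \<open>2 + |\<theta>|^2\<close> of the bounds; mixed products are split into pure powers by
    \<open>2 * x * y \<le> x^2 + y^2\<close>.\<close>
  have quad: "integrable \<gamma> (\<lambda>\<theta>. (2 + (norm \<theta>)\<^sup>2) * (\<theta> \<bullet> w) ^ (2 * k))" for w k
  proof -
    have "(norm \<theta>)\<^sup>2 = (\<Sum>i\<in>UNIV. (\<theta> \<bullet> axis i 1)\<^sup>2)" for \<theta> :: "real ^ 'd"
      by (simp only: power2_norm_axis inner_commute)
    then have eq: "(2 + (norm \<theta>)\<^sup>2) * (\<theta> \<bullet> w) ^ (2 * k) = 2 * (\<theta> \<bullet> w) ^ (2 * k) + (\<Sum>i\<in>UNIV. (\<theta> \<bullet> axis i 1)\<^sup>2 * (\<theta> \<bullet> w) ^ (2 * k))" for \<theta>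
      by (simp add: distrib_right sum_distrib_right)
    have "integrable \<gamma> (\<lambda>\<theta>. (\<theta> \<bullet> axis i 1)\<^sup>2 * (\<theta> \<bullet> w) ^ (2 * k))" for i
    proof (rule Bochner_Integration.integrable_bound)
      show "integrable \<gamma> (\<lambda>\<theta>. (\<theta> \<bullet> axis i 1) ^ 4 + (\<theta> \<bullet> w) ^ (4 * k))"
        using mom by (intro Bochner_Integration.integrable_add) auto
      have "\<bar>x\<^sup>2 * y ^ (2 * k)\<bar> \<le> \<bar>x ^ 4 + y ^ (4 * k)\<bar>" for x y :: real
      proof -
        have "2 * (x\<^sup>2 * y ^ (2 * k)) \<le> (x\<^sup>2)\<^sup>2 + (y ^ (2 * k))\<^sup>2"
          using sum_squares_bound[of "x\<^sup>2" "y ^ (2 * k)"] by simp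
        moreover have "0 \<le> x\<^sup>2 * y ^ (2 * k)" by (simp add: power_mult)
        moreover have "(x\<^sup>2)\<^sup>2 = x ^ 4" "(y ^ (2 * k))\<^sup>2 = y ^ (4 * k)" by (simp_all flip: power_mult add: mult.commute)
        ultimately show ?thesis by linarith
      qed
      then show "AE \<theta> in \<gamma>. norm ((\<theta> \<bullet> axis i 1)\<^sup>2 * (\<theta> \<bullet> w) ^ (2 * k)) \<le> norm ((\<theta> \<bullet> axis i 1) ^ 4 + (\<theta> \<bullet> w) ^ (4 * k))"
        unfolding real_norm_def by (intro AE_I2)
    qed measurable
    then show ?thesis unfolding eq using mom by (intro Bochner_Integration.integrable_add Bochner_Integration.integrable_sum integrable_mult_right) auto
  qed

  \<comment> \<open>The averaged function is radial, so the directions enter only through the mass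
    \<open>c\<close> of \<open>\<Gamma>\<close> and through
    \<open>L (\<lambda>_. 1) = 1\<close>.\<close>
  have first: "(\<lambda>n. p n * (\<alpha> * K1) - (1 - p n) * (K1 * c)) \<longlonglongrightarrow> 0"
  proof -
    have "(\<lambda>n. p n * (\<alpha> * K1) - (1 - p n) * (\<integral>s. (\<integral>x. (1 - exp (- (norm (x *\<^sub>R s))\<^sup>2 / 2)) * m x \<partial>lborel) \<partial>\<Gamma>)) \<longlonglongrightarrow> 0"
    proof (rule weight[of "\<lambda>_. 1"])
      show "integrable \<gamma> (\<lambda>\<theta>. (2 + (norm \<theta>)\<^sup>2) * 1)" using quad[of 0 0] by simp
      have "integrable \<gamma> (\<lambda>\<theta>. cos (\<theta> \<bullet> y))" for y by (intro g.integrable_const_bound[of _ 1]) auto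
      then show "1 - exp (- (norm y)\<^sup>2 / 2) = (\<integral>\<theta>. (1 - cos (\<theta> \<bullet> y)) * 1 \<partial>\<gamma>)" for y
        using cosint by (simp add: g.prob_space)
      have "((\<lambda>x. (\<integral>h. (1 - exp (- (norm h / x)\<^sup>2 / 2)) \<partial>\<nu>) / G x) \<longlongrightarrow> \<alpha> * K1) at_top"
        unfolding K1_def by (rule gauss_moment_lim(1)[of "\<lambda>_. 1"]) auto
      then show "((\<lambda>x. (\<integral>h. 1 - exp (- (norm ((1 / x) *\<^sub>R h))\<^sup>2 / 2) \<partial>\<nu>) / G x) \<longlongrightarrow> \<alpha> * K1) at_top"
        by (simp add: power_divide)
    qed auto
    moreover have "(\<integral>s. (\<integral>x. (1 - exp (- (norm (x *\<^sub>R s))\<^sup>2 / 2)) * m x \<partial>lborel) \<partial>\<Gamma>) = (\<integral>s. K1 \<partial>\<Gamma>)"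
    proof (rule integral_cong_AE)
      show "AE s in \<Gamma>. (\<integral>x. (1 - exp (- (norm (x *\<^sub>R s))\<^sup>2 / 2)) * m x \<partial>lborel) = K1"
        using \<Gamma>(3) by eventually_elim (simp add: K1[symmetric])
    qed measurable
    ultimately show ?thesis by (simp add: c_def mult.commute)
  qed
  have second: "(\<lambda>n. p n * ((norm v)\<^sup>2 * (\<alpha> * K1) + \<sigma> * (\<alpha> * K2)) - (1 - p n) * ((norm v)\<^sup>2 * K1 * c + K2 * I)) \<longlonglongrightarrow> 0"
  proof -
    \<comment> \<open>The average of
      \<open>(1 - cos (\<theta> \<bullet> y)) * (\<theta> \<bullet> v)^2\<close>, arranged as a
      multiple of the radial function of the first relation plus a term that carries the
      angle.\<close>
    let ?F = "\<lambda>y. (norm v)\<^sup>2 * (1 - exp (- (norm y)\<^sup>2 / 2)) + (y \<bullet> v)\<^sup>2 * exp (- (norm y)\<^sup>2 / 2)"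
    have "(\<lambda>n. p n * ((norm v)\<^sup>2 * (\<alpha> * K1) + \<sigma> * (\<alpha> * K2)) - (1 - p n) * (\<integral>s. (\<integral>x. ?F (x *\<^sub>R s) * m x \<partial>lborel) \<partial>\<Gamma>)) \<longlonglongrightarrow> 0"
    proof (rule weight[of "\<lambda>\<theta>. (\<theta> \<bullet> v)\<^sup>2"])
      show "integrable \<gamma> (\<lambda>\<theta>. (2 + (norm \<theta>)\<^sup>2) * (\<theta> \<bullet> v)\<^sup>2)" using quad[of v 1] by simp
      have i2: "integrable \<gamma> (\<lambda>\<theta>. (\<theta> \<bullet> v)\<^sup>2)" using mom by blast
      have ic: "integrable \<gamma> (\<lambda>\<theta>. cos (\<theta> \<bullet> y) * (\<theta> \<bullet> v)\<^sup>2)" for y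
        by (rule Bochner_Integration.integrable_bound[OF i2]) (auto simp: abs_mult mult_left_le_one_le)
      show "?F y = (\<integral>\<theta>. (1 - cos (\<theta> \<bullet> y)) * (\<theta> \<bullet> v)\<^sup>2 \<partial>\<gamma>)" for y
      proof -
        have "(\<integral>\<theta>. (1 - cos (\<theta> \<bullet> y)) * (\<theta> \<bullet> v)\<^sup>2 \<partial>\<gamma>) = (\<integral>\<theta>. (\<theta> \<bullet> v)\<^sup>2 \<partial>\<gamma>) - (\<integral>\<theta>. cos (\<theta> \<bullet> y) * (\<theta> \<bullet> v)\<^sup>2 \<partial>\<gamma>)"
          using i2 ic[of y] by (simp add: left_diff_distrib)
        also have "(\<integral>\<theta>. (\<theta> \<bullet> v)\<^sup>2 \<partial>\<gamma>) = (norm v)\<^sup>2" using cosint2[rule_format, of 0 v] by simp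
        finally show ?thesis unfolding cosint2[rule_format] by (simp add: algebra_simps)
      qed
      have "((\<lambda>x. (norm v)\<^sup>2 * ((\<integral>h. (1 - exp (- (norm h / x)\<^sup>2 / 2)) \<partial>\<nu>) / G x) +
          (\<integral>h. (norm h / x)\<^sup>2 * exp (- (norm h / x)\<^sup>2 / 2) * (sgn h \<bullet> v)\<^sup>2 \<partial>\<nu>) / G x) \<longlongrightarrow> (norm v)\<^sup>2 * (\<alpha> * K1) + \<sigma> * (\<alpha> * K2)) at_top"
        unfolding K1_def K2_def \<sigma>_def
        by (intro tendsto_add tendsto_mult tendsto_const gauss_moment_lim(1)[of "\<lambda>_. 1"] gauss_moment_lim(2)[of "\<lambda>s. (s \<bullet> v)\<^sup>2"])
           (auto intro!: continuous_intros)
      moreover have "\<forall>\<^sub>F x in at_top. (norm v)\<^sup>2 * ((\<integral>h. (1 - exp (- (norm h / x)\<^sup>2 / 2)) \<partial>\<nu>) / G x) +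
          (\<integral>h. (norm h / x)\<^sup>2 * exp (- (norm h / x)\<^sup>2 / 2) * (sgn h \<bullet> v)\<^sup>2 \<partial>\<nu>) / G x = (\<integral>h. ?F ((1 / x) *\<^sub>R h) \<partial>\<nu>) / G x"
        using eventually_gt_at_top[of 0]
      proof eventually_elim
        case (elim x)
        have 1: "integrable \<nu> (\<lambda>h. 1 - exp (- (norm h / x)\<^sup>2 / 2))"
          by (intro integrable_const_bound[of _ 1]) auto
        have 2: "integrable \<nu> (\<lambda>h. (norm h / x)\<^sup>2 * exp (- (norm h / x)\<^sup>2 / 2) * (sgn h \<bullet> v)\<^sup>2)"
        proof (rule integrable_const_bound[of _ "2 * (norm v)\<^sup>2"])
          show "AE h in \<nu>. norm ((norm h / x)\<^sup>2 * exp (- (norm h / x)\<^sup>2 / 2) * (sgn h \<bullet> v)\<^sup>2) \<le> 2 * (norm v)\<^sup>2"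
          proof (rule AE_I2)
            fix h :: "real ^ 'd"
            have "z\<^sup>2 * exp (- z\<^sup>2 / 2) \<le> 2" for z :: real
            proof -
              have "z\<^sup>2 / 2 \<le> exp (z\<^sup>2 / 2)" using exp_ge_add_one_self[of "z\<^sup>2 / 2"] by linarith
              then have "z\<^sup>2 \<le> 2 * exp (z\<^sup>2 / 2)" by linarith
              then have "z\<^sup>2 * exp (- z\<^sup>2 / 2) \<le> 2 * exp (z\<^sup>2 / 2) * exp (- z\<^sup>2 / 2)" by (intro mult_right_mono) auto
              also have "2 * exp (z\<^sup>2 / 2) * exp (- z\<^sup>2 / 2) = 2" by (simp add: mult.assoc exp_add[symmetric])
              finally show ?thesis .
            qed
            moreover have "(sgn h \<bullet> v)\<^sup>2 \<le> (norm v)\<^sup>2"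
            proof -
              have "\<bar>sgn h \<bullet> v\<bar> \<le> norm (sgn h) * norm v" by (rule Cauchy_Schwarz_ineq2)
              also have "\<dots> \<le> 1 * norm v" by (intro mult_right_mono) (auto simp: norm_sgn)
              finally show ?thesis by (simp add: abs_le_square_iff[symmetric])
            qed
            ultimately have "(norm h / x)\<^sup>2 * exp (- (norm h / x)\<^sup>2 / 2) * (sgn h \<bullet> v)\<^sup>2 \<le> 2 * (norm v)\<^sup>2"
              by (intro mult_mono) auto
            then show "norm ((norm h / x)\<^sup>2 * exp (- (norm h / x)\<^sup>2 / 2) * (sgn h \<bullet> v)\<^sup>2) \<le> 2 * (norm v)\<^sup>2"
              by (simp add: abs_mult)
          qed
        qed measurable
        have "?F ((1 / x) *\<^sub>R h) = (norm v)\<^sup>2 * (1 - exp (- (norm h / x)\<^sup>2 / 2)) + (norm h / x)\<^sup>2 * exp (- (norm h / x)\<^sup>2 / 2) * (sgn h \<bullet> v)\<^sup>2" for h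
        proof -
          have "norm ((1 / x) *\<^sub>R h) = norm h / x" using elim by simp
          moreover have "((1 / x) *\<^sub>R h) \<bullet> v = (norm h / x) * (sgn h \<bullet> v)"
            by (cases "h = 0") (auto simp: sgn_div_norm)
          ultimately show ?thesis by (simp only: power_mult_distrib mult_ac)
        qed
        then have "(\<integral>h. ?F ((1 / x) *\<^sub>R h) \<partial>\<nu>) = (norm v)\<^sup>2 * (\<integral>h. (1 - exp (- (norm h / x)\<^sup>2 / 2)) \<partial>\<nu>) +
            (\<integral>h. (norm h / x)\<^sup>2 * exp (- (norm h / x)\<^sup>2 / 2) * (sgn h \<bullet> v)\<^sup>2 \<partial>\<nu>)"
          using Bochner_Integration.integral_add[OF integrable_mult_right[OF 1] 2] by simp
        then show ?case by (simp add: add_divide_distrib)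
      qed
      ultimately show "((\<lambda>x. (\<integral>h. ?F ((1 / x) *\<^sub>R h) \<partial>\<nu>) / G x) \<longlongrightarrow> (norm v)\<^sup>2 * (\<alpha> * K1) + \<sigma> * (\<alpha> * K2)) at_top"
        by (rule Lim_transform_eventually)
    qed auto
    moreover have "(\<integral>s. (\<integral>x. ?F (x *\<^sub>R s) * m x \<partial>lborel) \<partial>\<Gamma>) = (\<integral>s. (norm v)\<^sup>2 * K1 + (s \<bullet> v)\<^sup>2 * K2 \<partial>\<Gamma>)"
    proof (rule integral_cong_AE)
      show "AE s in \<Gamma>. (\<integral>x. ?F (x *\<^sub>R s) * m x \<partial>lborel) = (norm v)\<^sup>2 * K1 + (s \<bullet> v)\<^sup>2 * K2"
        using \<Gamma>(3)
      proof eventually_elim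
        case (elim s)
        have "?F (x *\<^sub>R s) * m x = (norm v)\<^sup>2 * ((1 - exp (- x\<^sup>2 / 2)) * m x) + (s \<bullet> v)\<^sup>2 * (x\<^sup>2 * exp (- x\<^sup>2 / 2) * m x)" for x
          using elim by (simp add: power_mult_distrib algebra_simps)
        then have "(\<integral>x. ?F (x *\<^sub>R s) * m x \<partial>lborel) =
            (norm v)\<^sup>2 * (\<integral>x. (1 - exp (- x\<^sup>2 / 2)) * m x \<partial>lborel) + (s \<bullet> v)\<^sup>2 * (\<integral>x. x\<^sup>2 * exp (- x\<^sup>2 / 2) * m x \<partial>lborel)"
          using K1i K2i by simp
        then show ?case unfolding K1 K2 .
      qed
    qed measurable
    moreover have "(\<integral>s. (norm v)\<^sup>2 * K1 + (s \<bullet> v)\<^sup>2 * K2 \<partial>\<Gamma>) = (norm v)\<^sup>2 * K1 * c + K2 * I"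
    proof -
      have "integrable \<Gamma> (\<lambda>s. (s \<bullet> v)\<^sup>2)"
      proof (rule Gam.integrable_const_bound[of _ "(norm v)\<^sup>2"])
        show "AE s in \<Gamma>. norm ((s \<bullet> v)\<^sup>2) \<le> (norm v)\<^sup>2"
          using \<Gamma>(3)
        proof eventually_elim
          case (elim s)
          have "\<bar>s \<bullet> v\<bar> \<le> norm s * norm v" by (rule Cauchy_Schwarz_ineq2)
          then show ?case using elim by (simp add: abs_le_square_iff[symmetric])
        qed
      qed measurable
      then show ?thesis by (simp add: c_def I_def mult_ac)
    qed
    ultimately show ?thesis by simp
  qed
  \<comment> \<open>In the cross product the terms with \<open>(norm v)^2\<close> agree and cancel;
    what remains has the common factor \<open>\<alpha> * K1 * K2\<close>.\<close>
  have "(\<alpha> * K1) * ((norm v)\<^sup>2 * K1 * c + K2 * I) = ((norm v)\<^sup>2 * (\<alpha> * K1) + \<sigma> * (\<alpha> * K2)) * (K1 * c)"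
    by (rule mixed_limits_proportional[OF p first second])
  then have "(\<alpha> * K1 * K2) * I = (\<alpha> * K1 * K2) * (\<sigma> * c)" by (simp add: algebra_simps)
  then show ?thesis using K alpha by (simp add: I_def \<sigma>_def c_def)
qed

end

subsection \<open>Independence\<close>

lemma (in prob_space) expectation_square_sum:
  fixes W :: "'i \<Rightarrow> 'a \<Rightarrow> real"
  assumes "finite A" "indep_vars (\<lambda>_. borel) W A" "\<And>i. i \<in> A \<Longrightarrow> integrable M (\<lambda>\<omega>. (W i \<omega>)\<^sup>2)"
    "\<And>i. i \<in> A \<Longrightarrow> expectation (W i) = 0"
  shows "integrable M (\<lambda>\<omega>. (\<Sum>i\<in>A. W i \<omega>)\<^sup>2) \<and> expectation (\<lambda>\<omega>. (\<Sum>i\<in>A. W i \<omega>)\<^sup>2) = (\<Sum>i\<in>A. expectation (\<lambda>\<omega>. (W i \<omega>)\<^sup>2))"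
  using assms
proof (induction A rule: finite_induct)
  case (insert x F)
  have rv: "random_variable borel (W i)" if "i \<in> insert x F" for i
    using insert.prems(1) that by (auto simp: indep_vars_def2)
  have W: "integrable M (W i)" if "i \<in> insert x F" for i
    by (rule square_integrable_imp_integrable[OF rv[OF that] insert.prems(2)[OF that]])
  have IH: "integrable M (\<lambda>\<omega>. (\<Sum>i\<in>F. W i \<omega>)\<^sup>2)" "expectation (\<lambda>\<omega>. (\<Sum>i\<in>F. W i \<omega>)\<^sup>2) = (\<Sum>i\<in>F. expectation (\<lambda>\<omega>. (W i \<omega>)\<^sup>2))"
    using insert.IH insert.prems indep_vars_subset[OF insert.prems(1), of F] by auto
  have ind: "indep_var borel (W x) borel (\<lambda>\<omega>. \<Sum>i\<in>F. W i \<omega>)"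
    by (rule indep_vars_sum[OF insert.hyps(1,2) insert.prems(1)])
  have S: "integrable M (\<lambda>\<omega>. \<Sum>i\<in>F. W i \<omega>)" using W by simp
  have cross: "integrable M (\<lambda>\<omega>. W x \<omega> * (\<Sum>i\<in>F. W i \<omega>))" "expectation (\<lambda>\<omega>. W x \<omega> * (\<Sum>i\<in>F. W i \<omega>)) = 0"
    using indep_var_integrable[OF ind W S] indep_var_lebesgue_integral[OF ind W S] insert.prems(3) by auto
  have eq: "(\<Sum>i\<in>insert x F. W i \<omega>)\<^sup>2 = (W x \<omega>)\<^sup>2 + (\<Sum>i\<in>F. W i \<omega>)\<^sup>2 + 2 * (W x \<omega> * (\<Sum>i\<in>F. W i \<omega>))" for \<omega>
    using insert.hyps by (simp add: power2_sum)
  show ?case unfolding eq using cross IH insert.prems(2) insert.hyps by simp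
qed simp

lemma generated_events_Inter:
  fixes X :: "nat \<Rightarrow> 'w \<Rightarrow> 'a::topological_space"
  assumes "\<And>j. j \<in> J \<Longrightarrow> A j \<in> sets borel" "J \<subseteq> {1..}" "finite J"
  shows "{\<omega> \<in> space P. \<forall>j\<in>J. X j \<omega> \<in> A j} \<in> generated_events P X"
proof -
  let ?S = "{x \<in> space (PiM {1..} (\<lambda>_. borel :: 'a measure)). \<forall>j\<in>J. x j \<in> A j}"
  have "?S \<in> sets (PiM {1..} (\<lambda>_. borel))"
  proof (rule sets.sets_Collect_finite_All[OF _ assms(3)])
    fix j assume j: "j \<in> J"
    have "(\<lambda>x. x j) \<in> measurable (PiM {1..} (\<lambda>_. borel :: 'a measure)) borel"
      using j assms(2) by (intro measurable_component_singleton) auto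
    from measurable_sets[OF this assms(1)[OF j]]
    show "{x \<in> space (PiM {1..} (\<lambda>_. borel)). x j \<in> A j} \<in> sets (PiM {1..} (\<lambda>_. borel))"
      by (simp add: vimage_def Int_def conj_commute)
  qed
  from in_vimage_algebra[OF this, of "\<lambda>\<omega>. \<lambda>j\<in>{1..}. X j \<omega>" "space P"]
  have "(\<lambda>\<omega>. \<lambda>j\<in>{1..}. X j \<omega>) -` ?S \<inter> space P \<in> generated_events P X"
    unfolding generated_events_def .
  moreover have "(\<lambda>\<omega>. \<lambda>j\<in>{1..}. X j \<omega>) -` ?S \<inter> space P = {\<omega> \<in> space P. \<forall>j\<in>J. X j \<omega> \<in> A j}"
    using assms(2) by (auto simp: space_PiM)
  ultimately show ?thesis by simp
qed

text \<open>Independence between the two sequences separates the \<open>H\<close> part of an event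
  from its \<open>R\<close> part, and independence within each sequence then splits both into
  products. Rectangles suffice because they generate the product sigma-algebra and are stable under
  intersection.\<close>

lemma (in prob_space) indep_pairs:
  fixes H :: "nat \<Rightarrow> 'a \<Rightarrow> 'b::second_countable_topology" and R :: "nat \<Rightarrow> 'a \<Rightarrow> 'c::second_countable_topology"
  assumes H: "iid_seq M H" and R: "iid_seq M R" and HR: "indep_seqs M H R"
  shows "1 \<le> n \<Longrightarrow> indep_vars (\<lambda>_. borel \<Otimes>\<^sub>M borel) (\<lambda>j \<omega>. (H j \<omega>, R j \<omega>)) {1..n}"
    and "1 \<le> j \<Longrightarrow> distr M (borel \<Otimes>\<^sub>M borel) (\<lambda>\<omega>. (H j \<omega>, R j \<omega>)) = distr M borel (H 1) \<Otimes>\<^sub>M distr M borel (R 1)"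
proof -
  have Hi: "indep_vars (\<lambda>_. borel) H {1..}" and Ri: "indep_vars (\<lambda>_. borel) R {1..}"
    using H R by (auto simp: iid_seq_def)
  have Hm: "random_variable borel (H j)" and Rm: "random_variable borel (R j)" if "1 \<le> j" for j
    using Hi Ri that by (auto simp: indep_vars_def2)
  have main: "prob (\<Inter>j\<in>J. (\<lambda>\<omega>. (H j \<omega>, R j \<omega>)) -` (A j \<times> B j) \<inter> space M) =
      (\<Prod>j\<in>J. prob (H j -` A j \<inter> space M)) * (\<Prod>j\<in>J. prob (R j -` B j \<inter> space M))"
    if J: "J \<noteq> {}" "finite J" "J \<subseteq> {1..}" and A: "\<And>j. j \<in> J \<Longrightarrow> A j \<in> sets borel" and B: "\<And>j. j \<in> J \<Longrightarrow> B j \<in> sets borel" for J A B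
  proof -
    let ?a = "{\<omega> \<in> space M. \<forall>j\<in>J. H j \<omega> \<in> A j}" and ?b = "{\<omega> \<in> space M. \<forall>j\<in>J. R j \<omega> \<in> B j}"
    have "(\<Inter>j\<in>J. (\<lambda>\<omega>. (H j \<omega>, R j \<omega>)) -` (A j \<times> B j) \<inter> space M) = ?a \<inter> ?b" using J(1) by auto
    also have "prob \<dots> = prob ?a * prob ?b"
      using HR unfolding indep_seqs_def
      by (rule indep_setD) (intro generated_events_Inter A B J; assumption)+
    also have "?a = (\<Inter>j\<in>J. H j -` A j \<inter> space M)" using J(1) by auto
    also have "?b = (\<Inter>j\<in>J. R j -` B j \<inter> space M)" using J(1) by auto
    also have "prob (\<Inter>j\<in>J. H j -` A j \<inter> space M) = (\<Prod>j\<in>J. prob (H j -` A j \<inter> space M))"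
      by (rule indep_varsD[OF Hi J A])
    also have "prob (\<Inter>j\<in>J. R j -` B j \<inter> space M) = (\<Prod>j\<in>J. prob (R j -` B j \<inter> space M))"
      by (rule indep_varsD[OF Ri J B])
    finally show ?thesis .
  qed
  have pair: "prob ((\<lambda>\<omega>. (H j \<omega>, R j \<omega>)) -` (A \<times> B) \<inter> space M) = prob (H j -` A \<inter> space M) * prob (R j -` B \<inter> space M)"
    if "1 \<le> j" "A \<in> sets borel" "B \<in> sets borel" for j A B
    using main[of "{j}" "\<lambda>_. A" "\<lambda>_. B"] that by simp
  let ?E = "{a \<times> b | a b. a \<in> sets (borel :: 'b measure) \<and> b \<in> sets (borel :: 'c measure)}"
  show "indep_vars (\<lambda>_. borel \<Otimes>\<^sub>M borel) (\<lambda>j \<omega>. (H j \<omega>, R j \<omega>)) {1..n}" if n: "1 \<le> n"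
  proof (subst indep_vars_finite[where E = "\<lambda>_. ?E"])
    show "sets (borel \<Otimes>\<^sub>M borel) = sigma_sets (space (borel \<Otimes>\<^sub>M borel)) ?E"
      by (simp add: sets_pair_measure space_pair_measure)
    show "random_variable (borel \<Otimes>\<^sub>M borel) (\<lambda>\<omega>. (H i \<omega>, R i \<omega>))" if "i \<in> {1..n}" for i
      using Hm[of i] Rm[of i] that by (intro measurable_Pair) auto
    show "Int_stable ?E" by (rule Int_stable_pair_measure_generator)
    show "space (borel \<Otimes>\<^sub>M borel) \<in> ?E" by (rule CollectI, intro exI[of _ UNIV]) (simp add: space_pair_measure)
    show "?E \<subseteq> Pow (space (borel \<Otimes>\<^sub>M borel))" by (auto simp: space_pair_measure)
    show "\<forall>C\<in>{1..n} \<rightarrow> ?E. prob (\<Inter>j\<in>{1..n}. (\<lambda>\<omega>. (H j \<omega>, R j \<omega>)) -` C j \<inter> space M) =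
      (\<Prod>j\<in>{1..n}. prob ((\<lambda>\<omega>. (H j \<omega>, R j \<omega>)) -` C j \<inter> space M))"
    proof
      fix C assume C: "C \<in> {1..n} \<rightarrow> ?E"
      then have "\<forall>j\<in>{1..n}. \<exists>a b. C j = a \<times> b \<and> a \<in> sets borel \<and> b \<in> sets borel" by (auto simp: Pi_iff)
      then obtain A where "\<forall>j\<in>{1..n}. \<exists>b. C j = A j \<times> b \<and> A j \<in> sets borel \<and> b \<in> sets borel"
        unfolding bchoice_iff by blast
      then obtain B where AB: "\<And>j. j \<in> {1..n} \<Longrightarrow> C j = A j \<times> B j \<and> A j \<in> sets borel \<and> B j \<in> sets borel"
        unfolding bchoice_iff by blast
      have "(\<Inter>j\<in>{1..n}. (\<lambda>\<omega>. (H j \<omega>, R j \<omega>)) -` C j \<inter> space M) = (\<Inter>j\<in>{1..n}. (\<lambda>\<omega>. (H j \<omega>, R j \<omega>)) -` (A j \<times> B j) \<inter> space M)"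
        by (rule INF_cong[OF refl]) (simp only: AB)
      moreover have "prob (\<Inter>j\<in>{1..n}. (\<lambda>\<omega>. (H j \<omega>, R j \<omega>)) -` (A j \<times> B j) \<inter> space M) =
          (\<Prod>j\<in>{1..n}. prob (H j -` A j \<inter> space M)) * (\<Prod>j\<in>{1..n}. prob (R j -` B j \<inter> space M))"
        by (rule main) (use AB n in auto)
      ultimately have "prob (\<Inter>j\<in>{1..n}. (\<lambda>\<omega>. (H j \<omega>, R j \<omega>)) -` C j \<inter> space M) =
          (\<Prod>j\<in>{1..n}. prob (H j -` A j \<inter> space M)) * (\<Prod>j\<in>{1..n}. prob (R j -` B j \<inter> space M))"
        by (simp only:)
      also have "\<dots> = (\<Prod>j\<in>{1..n}. prob (H j -` A j \<inter> space M) * prob (R j -` B j \<inter> space M))"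
        by (rule prod.distrib[symmetric])
      also have "\<dots> = (\<Prod>j\<in>{1..n}. prob ((\<lambda>\<omega>. (H j \<omega>, R j \<omega>)) -` C j \<inter> space M))"
      proof (rule prod.cong[OF refl])
        fix j assume j: "j \<in> {1..n}"
        then have "prob ((\<lambda>\<omega>. (H j \<omega>, R j \<omega>)) -` (A j \<times> B j) \<inter> space M) = prob (H j -` A j \<inter> space M) * prob (R j -` B j \<inter> space M)"
          using AB[OF j] by (intro pair) auto
        then show "prob (H j -` A j \<inter> space M) * prob (R j -` B j \<inter> space M) = prob ((\<lambda>\<omega>. (H j \<omega>, R j \<omega>)) -` C j \<inter> space M)"
          using AB[OF j] by simp
      qed
      finally show "prob (\<Inter>j\<in>{1..n}. (\<lambda>\<omega>. (H j \<omega>, R j \<omega>)) -` C j \<inter> space M) =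
        (\<Prod>j\<in>{1..n}. prob ((\<lambda>\<omega>. (H j \<omega>, R j \<omega>)) -` C j \<inter> space M))" .
    qed
  qed (use n in auto)
  show "distr M (borel \<Otimes>\<^sub>M borel) (\<lambda>\<omega>. (H j \<omega>, R j \<omega>)) = distr M borel (H 1) \<Otimes>\<^sub>M distr M borel (R 1)" if j: "1 \<le> j"
  proof -
    have d: "distr M borel (H 1) = distr M borel (H j)" "distr M borel (R 1) = distr M borel (R j)"
      by (rule sym; use H R j in \<open>unfold iid_seq_def, blast\<close>)+
    note [measurable] = Hm[OF j] Rm[OF j]
    interpret h: prob_space "distr M borel (H j)" by (rule prob_space_distr) simp
    interpret r: prob_space "distr M borel (R j)" by (rule prob_space_distr) simp
    have "distr M borel (H j) \<Otimes>\<^sub>M distr M borel (R j) = distr M (borel \<Otimes>\<^sub>M borel) (\<lambda>\<omega>. (H j \<omega>, R j \<omega>))"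
    proof (rule pair_measure_eqI)
      show "sigma_finite_measure (distr M borel (H j))" "sigma_finite_measure (distr M borel (R j))" by unfold_locales
      show "sets (distr M borel (H j) \<Otimes>\<^sub>M distr M borel (R j)) = sets (distr M (borel \<Otimes>\<^sub>M borel) (\<lambda>\<omega>. (H j \<omega>, R j \<omega>)))"
        by (simp cong: sets_pair_measure_cong)
      fix A B assume "A \<in> sets (distr M borel (H j))" "B \<in> sets (distr M borel (R j))"
      then have A[measurable]: "A \<in> sets borel" and B[measurable]: "B \<in> sets borel" by auto
      have "emeasure (distr M (borel \<Otimes>\<^sub>M borel) (\<lambda>\<omega>. (H j \<omega>, R j \<omega>))) (A \<times> B) = ennreal (prob ((\<lambda>\<omega>. (H j \<omega>, R j \<omega>)) -` (A \<times> B) \<inter> space M))"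
        by (subst emeasure_distr) (auto simp: emeasure_eq_measure)
      also have "\<dots> = emeasure (distr M borel (H j)) A * emeasure (distr M borel (R j)) B"
        unfolding pair[OF j A B] by (simp add: emeasure_distr emeasure_eq_measure ennreal_mult)
      finally show "emeasure (distr M borel (H j)) A * emeasure (distr M borel (R j)) B =
        emeasure (distr M (borel \<Otimes>\<^sub>M borel) (\<lambda>\<omega>. (H j \<omega>, R j \<omega>))) (A \<times> B)" by simp
    qed
    then show ?thesis unfolding d ..
  qed
qed

lemma (in prob_space) expectation_product_pair:
  fixes H :: "'a \<Rightarrow> 'b::second_countable_topology" and R :: "'a \<Rightarrow> 'c::second_countable_topology"
  assumes [measurable]: "H \<in> borel_measurable M" "R \<in> borel_measurable M"
    and joint: "distr M (borel \<Otimes>\<^sub>M borel) (\<lambda>\<omega>. (H \<omega>, R \<omega>)) = distr M borel H \<Otimes>\<^sub>M distr M borel R"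
    and [measurable]: "f \<in> borel_measurable borel" "g \<in> borel_measurable borel"
    and f: "integrable M (\<lambda>\<omega>. f (H \<omega>))" and g: "integrable M (\<lambda>\<omega>. g (R \<omega>))"
  shows "integrable M (\<lambda>\<omega>. f (H \<omega>) * g (R \<omega>) :: real)"
    and "expectation (\<lambda>\<omega>. f (H \<omega>) * g (R \<omega>)) = expectation (\<lambda>\<omega>. f (H \<omega>)) * expectation (\<lambda>\<omega>. g (R \<omega>))"
proof -
  let ?h = "distr M borel H" and ?r = "distr M borel R"
  interpret h: prob_space ?h by (rule prob_space_distr) simp
  interpret r: prob_space ?r by (rule prob_space_distr) simp
  interpret hr: pair_prob_space ?h ?r ..
  have f': "integrable ?h f" and g': "integrable ?r g" using f g by (simp_all add: integrable_distr_eq)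
  have int: "integrable (?h \<Otimes>\<^sub>M ?r) (\<lambda>q. f (fst q) * g (snd q))"
    by (rule hr.Fubini_integrable) (use f' g' in \<open>auto simp: abs_mult\<close>)
  then have "integrable (distr M (borel \<Otimes>\<^sub>M borel) (\<lambda>\<omega>. (H \<omega>, R \<omega>))) (\<lambda>q. f (fst q) * g (snd q))"
    by (simp add: joint)
  then show "integrable M (\<lambda>\<omega>. f (H \<omega>) * g (R \<omega>))" by (subst (asm) integrable_distr_eq) auto
  have "expectation (\<lambda>\<omega>. f (H \<omega>) * g (R \<omega>)) = (\<integral>q. f (fst q) * g (snd q) \<partial>distr M (borel \<Otimes>\<^sub>M borel) (\<lambda>\<omega>. (H \<omega>, R \<omega>)))"
    by (subst integral_distr) auto
  also have "\<dots> = (\<integral>x. \<integral>y. f x * g y \<partial>?r \<partial>?h)"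
    unfolding joint using hr.integral_fst'[OF int] by simp
  also have "\<dots> = expectation (\<lambda>\<omega>. f (H \<omega>)) * expectation (\<lambda>\<omega>. g (R \<omega>))"
    by (simp add: integral_distr)
  finally show "expectation (\<lambda>\<omega>. f (H \<omega>) * g (R \<omega>)) = expectation (\<lambda>\<omega>. f (H \<omega>)) * expectation (\<lambda>\<omega>. g (R \<omega>))" .
qed

subsection \<open>The truncated model\<close>

lemma truncated_norm_le: "0 \<le> r \<Longrightarrow> norm (truncated m h r) \<le> \<bar>m\<bar> + r"
  by (auto simp: truncated_def)

lemma truncated_norm_le_base: "norm h \<le> m \<Longrightarrow> norm (truncated m h r) = norm h"
  by (simp add: truncated_def)

text \<open>The squared projection splits into a term without \<open>r\<close> and an overshoot term
  that is a function of \<open>h\<close> times a function of \<open>r\<close>, so that independence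
  factors the mean of the latter.\<close>

lemma truncated_inner_square:
  assumes "0 < m"
  shows "(\<theta> \<bullet> truncated m h r)\<^sup>2 =
    m\<^sup>2 * ((min 1 (norm h / m))\<^sup>2 * (sgn h \<bullet> \<theta>)\<^sup>2) + ((sgn h \<bullet> \<theta>)\<^sup>2 * indicator {m<..} (norm h)) * (2 * m * r + r\<^sup>2)"
proof (cases "norm h \<le> m")
  case True
  have "m * (norm h / m * (sgn h \<bullet> \<theta>)) = \<theta> \<bullet> h"
    using assms by (cases "h = 0") (auto simp: sgn_div_norm inner_commute)
  moreover have "min 1 (norm h / m) = norm h / m" using True assms by simp
  ultimately have "m\<^sup>2 * ((min 1 (norm h / m))\<^sup>2 * (sgn h \<bullet> \<theta>)\<^sup>2) = (\<theta> \<bullet> h)\<^sup>2"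
    by (metis power_mult_distrib)
  then show ?thesis using True by (simp add: truncated_def)
next
  case False
  then have "min 1 (norm h / m) = 1" using assms by simp
  moreover have "\<theta> \<bullet> truncated m h r = (m + r) * (sgn h \<bullet> \<theta>)"
    using False by (simp add: truncated_def sgn_div_norm inner_commute divide_inverse)
  ultimately show ?thesis using False by (simp add: power_mult_distrib power2_eq_square algebra_simps)
qed

lemma truncated_norm_square:
  assumes "0 < m"
  shows "(norm (truncated m h r))\<^sup>2 = m\<^sup>2 * (min 1 (norm h / m))\<^sup>2 + indicator {m<..} (norm h) * (2 * m * r + r\<^sup>2)"
proof (cases "norm h \<le> m")
  case True
  then show ?thesis using assms by (simp add: truncated_def power_divide)
next
  case False
  then have "0 < norm h" using assms by linarith
  with False show ?thesis using assms by (simp add: truncated_def power2_eq_square algebra_simps)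
qed

lemma truncated_measurable[measurable]:
  assumes [measurable]: "h \<in> borel_measurable M" "r \<in> borel_measurable M"
  shows "(\<lambda>x. truncated m (h x) (r x) :: real ^ 'd) \<in> borel_measurable M"
  unfolding truncated_def by measurable

text \<open>One generic summand: \<open>h\<close> and \<open>\<rho>\<close> stand for
  \<open>H 1\<close> and \<open>R 1\<close>, and \<open>joint\<close> expresses their independence.
  Rows are identically distributed, so all moment estimates concern this summand alone. In this
  locale \<open>\<rho>\<close> is the overshoot, not the stable law.\<close>

locale truncated_model = tail_law \<nu> \<alpha> L + P: prob_space P
  for \<nu> :: "(real ^ 'd) measure" and \<alpha> L and P :: "'w measure" +
  fixes h :: "'w \<Rightarrow> real ^ 'd" and \<rho> :: "'w \<Rightarrow> real" and M :: "nat \<Rightarrow> real"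
  assumes h_meas[measurable]: "h \<in> borel_measurable P" and rho_meas[measurable]: "\<rho> \<in> borel_measurable P"
    and h_law: "distr P borel h = \<nu>"
    and joint: "distr P (borel \<Otimes>\<^sub>M borel) (\<lambda>\<omega>. (h \<omega>, \<rho> \<omega>)) = distr P borel h \<Otimes>\<^sub>M distr P borel \<rho>"
    and rho_nonneg: "\<And>\<omega>. \<omega> \<in> space P \<Longrightarrow> 0 \<le> \<rho> \<omega>"
    and rho_square: "integrable P (\<lambda>\<omega>. (\<rho> \<omega>)\<^sup>2)"
    and M_pos: "\<And>n. 1 \<le> n \<Longrightarrow> 0 < M n"
    and M_top: "filterlim M at_top sequentially"
    and hard: "filterlim (\<lambda>n. real n * G (M n)) at_top sequentially"
begin

definition X where "X n \<omega> = truncated (M n) (h \<omega>) (\<rho> \<omega>)"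
definition B where "B n = sqrt (real n * (M n)\<^sup>2 * G (M n))"

lemma X_meas[measurable]: "X n \<in> borel_measurable P"
  unfolding X_def[abs_def] by measurable

lemma rho_int: "integrable P \<rho>"
  by (rule P.square_integrable_imp_integrable[OF rho_meas rho_square])

lemma X_square_int: "integrable P (\<lambda>\<omega>. (norm (X n \<omega>))\<^sup>2)"
proof (rule Bochner_Integration.integrable_bound)
  show "integrable P (\<lambda>\<omega>. 2 * (M n)\<^sup>2 + 2 * (\<rho> \<omega>)\<^sup>2)" using rho_square by simp
  show "AE \<omega> in P. norm ((norm (X n \<omega>))\<^sup>2) \<le> norm (2 * (M n)\<^sup>2 + 2 * (\<rho> \<omega>)\<^sup>2)"
  proof (rule AE_I2)
    fix \<omega> assume "\<omega> \<in> space P"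
    then have "norm (X n \<omega>) \<le> \<bar>M n\<bar> + \<rho> \<omega>" unfolding X_def by (intro truncated_norm_le rho_nonneg)
    then have "(norm (X n \<omega>))\<^sup>2 \<le> (\<bar>M n\<bar> + \<rho> \<omega>)\<^sup>2" by (intro power_mono) auto
    also have "\<dots> \<le> 2 * (M n)\<^sup>2 + 2 * (\<rho> \<omega>)\<^sup>2"
      using sum_squares_bound[of "\<bar>M n\<bar>" "\<rho> \<omega>"] unfolding power2_sum by simp
    finally show "norm ((norm (X n \<omega>))\<^sup>2) \<le> norm (2 * (M n)\<^sup>2 + 2 * (\<rho> \<omega>)\<^sup>2)" by simp
  qed
qed measurable

lemma inner_X_square_int: "integrable P (\<lambda>\<omega>. (\<theta> \<bullet> X n \<omega>)\<^sup>2)"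
proof (rule Bochner_Integration.integrable_bound[OF integrable_mult_right[OF X_square_int, of "(norm \<theta>)\<^sup>2" n]])
  have "(\<theta> \<bullet> x)\<^sup>2 \<le> (norm \<theta>)\<^sup>2 * (norm x)\<^sup>2" for x
  proof -
    have "\<bar>\<theta> \<bullet> x\<bar> \<le> \<bar>norm \<theta> * norm x\<bar>" using Cauchy_Schwarz_ineq2[of \<theta> x] by simp
    then show ?thesis by (simp only: abs_le_square_iff power_mult_distrib)
  qed
  then show "AE \<omega> in P. norm ((\<theta> \<bullet> X n \<omega>)\<^sup>2) \<le> norm ((norm \<theta>)\<^sup>2 * (norm (X n \<omega>))\<^sup>2)" by simp
qed measurable

lemma X_int: "integrable P (X n)"
proof -
  have "integrable P (\<lambda>\<omega>. norm (X n \<omega>))"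
    by (rule P.square_integrable_imp_integrable[OF _ X_square_int]) measurable
  then show ?thesis by (rule integrable_norm_cancel) measurable
qed

lemma inner_X_int: "integrable P (\<lambda>\<omega>. \<theta> \<bullet> X n \<omega>)"
  using X_int by simp

lemma law_integral: "f \<in> borel_measurable borel \<Longrightarrow> (\<integral>\<omega>. f (h \<omega>) \<partial>P) = (\<integral>x. f x \<partial>\<nu> :: real)"
  unfolding h_law[symmetric] by (simp add: integral_distr)

lemma B_top: "filterlim (\<lambda>n. B n / M n) at_top sequentially"
proof -
  have "filterlim (\<lambda>n. sqrt (real n * G (M n))) at_top sequentially"
    by (rule filterlim_compose[OF sqrt_at_top hard])
  moreover have "\<forall>\<^sub>F n in sequentially. sqrt (real n * G (M n)) = B n / M n"
    using eventually_ge_at_top[of 1]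
  proof eventually_elim
    case (elim n)
    then show ?case using M_pos[OF elim] by (simp add: B_def real_sqrt_mult)
  qed
  ultimately show ?thesis by (rule filterlim_cong[THEN iffD1, OF refl refl, rotated])
qed

lemma B_pos: "1 \<le> n \<Longrightarrow> 0 < B n"
  using M_pos[of n] tail_pos[of "M n"] by (simp add: B_def)

lemma B_square: "(B n)\<^sup>2 = real n * ((M n)\<^sup>2 * G (M n))"
  using tail_pos[of "M n"] by (simp add: B_def less_imp_le)

lemma overshoot_integral:
  assumes [measurable]: "f \<in> borel_measurable borel" "g \<in> borel_measurable borel" and "\<And>x. \<bar>f x\<bar> \<le> C" and "integrable P (\<lambda>\<omega>. g (\<rho> \<omega>))"
  shows "integrable P (\<lambda>\<omega>. f (h \<omega>) * g (\<rho> \<omega>) :: real)"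
    "(\<integral>\<omega>. f (h \<omega>) * g (\<rho> \<omega>) \<partial>P) = (\<integral>x. f x \<partial>\<nu>) * (\<integral>\<omega>. g (\<rho> \<omega>) \<partial>P)"
proof -
  have f: "integrable P (\<lambda>\<omega>. f (h \<omega>))" using assms(3) by (intro P.integrable_const_bound[of _ C]) auto
  show "integrable P (\<lambda>\<omega>. f (h \<omega>) * g (\<rho> \<omega>))"
    "(\<integral>\<omega>. f (h \<omega>) * g (\<rho> \<omega>) \<partial>P) = (\<integral>x. f x \<partial>\<nu>) * (\<integral>\<omega>. g (\<rho> \<omega>) \<partial>P)"
    using P.expectation_product_pair[OF h_meas rho_meas joint assms(1,2) f assms(4)] by (simp_all add: law_integral)
qed

text \<open>The truncated term is governed by Karamata's theorem. The overshoot adds a tail integral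
  times \<open>2 * M n * E \<rho> + E \<rho>^2\<close>, which is of smaller order than
  \<open>(M n)^2 * G (M n)\<close>.\<close>

lemma second_moment_lim:
  "(\<lambda>n. (\<integral>\<omega>. (\<theta> \<bullet> X n \<omega>)\<^sup>2 \<partial>P) / ((M n)\<^sup>2 * G (M n))) \<longlonglongrightarrow> 2 / (2 - \<alpha>) * L (\<lambda>s. (s \<bullet> \<theta>)\<^sup>2)"
proof -
  let ?g = "\<lambda>s. (s \<bullet> \<theta>)\<^sup>2"
  have gc: "continuous_on UNIV ?g" by (intro continuous_intros)
  have sgn_le: "(sgn x \<bullet> \<theta>)\<^sup>2 \<le> (norm \<theta>)\<^sup>2" for x :: "real ^ 'd"
  proof -
    have "\<bar>sgn x \<bullet> \<theta>\<bar> \<le> norm (sgn x) * norm \<theta>" by (rule Cauchy_Schwarz_ineq2)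
    also have "\<dots> \<le> 1 * norm \<theta>" by (intro mult_right_mono) (auto simp: norm_sgn)
    finally show ?thesis by (simp add: abs_le_square_iff[symmetric])
  qed
  define a where "a n = (\<integral>x. (min 1 (norm x / M n))\<^sup>2 * (sgn x \<bullet> \<theta>)\<^sup>2 \<partial>\<nu>)" for n
  define r where "r n = tail_integral \<nu> ?g (M n) * (2 * M n * P.expectation \<rho> + P.expectation (\<lambda>\<omega>. (\<rho> \<omega>)\<^sup>2))" for n
  have eq: "(\<integral>\<omega>. (\<theta> \<bullet> X n \<omega>)\<^sup>2 \<partial>P) = (M n)\<^sup>2 * a n + r n" if n: "1 \<le> n" for n
  proof -
    have m: "0 < M n" by (rule M_pos[OF n])
    have 1: "integrable P (\<lambda>\<omega>. (min 1 (norm (h \<omega>) / M n))\<^sup>2 * (sgn (h \<omega>) \<bullet> \<theta>)\<^sup>2)"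
    proof (rule P.integrable_const_bound[of _ "(norm \<theta>)\<^sup>2"])
      have "(min 1 (norm x / M n))\<^sup>2 * (sgn x \<bullet> \<theta>)\<^sup>2 \<le> 1 * (norm \<theta>)\<^sup>2" for x :: "real ^ 'd"
        using m by (intro mult_mono sgn_le power_le_one) auto
      then show "AE \<omega> in P. norm ((min 1 (norm (h \<omega>) / M n))\<^sup>2 * (sgn (h \<omega>) \<bullet> \<theta>)\<^sup>2) \<le> (norm \<theta>)\<^sup>2" by simp
    qed measurable
    have g: "integrable P (\<lambda>\<omega>. 2 * M n * \<rho> \<omega> + (\<rho> \<omega>)\<^sup>2)" using rho_int rho_square by simp
    have bd: "\<bar>(sgn x \<bullet> \<theta>)\<^sup>2 * indicator {M n<..} (norm x)\<bar> \<le> (norm \<theta>)\<^sup>2" for x :: "real ^ 'd"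
      using sgn_le[of x] by (simp add: indicator_def)
    have 2: "integrable P (\<lambda>\<omega>. ((sgn (h \<omega>) \<bullet> \<theta>)\<^sup>2 * indicator {M n<..} (norm (h \<omega>))) * (2 * M n * \<rho> \<omega> + (\<rho> \<omega>)\<^sup>2))"
      "(\<integral>\<omega>. ((sgn (h \<omega>) \<bullet> \<theta>)\<^sup>2 * indicator {M n<..} (norm (h \<omega>))) * (2 * M n * \<rho> \<omega> + (\<rho> \<omega>)\<^sup>2) \<partial>P) = r n"
      using overshoot_integral[of "\<lambda>x. (sgn x \<bullet> \<theta>)\<^sup>2 * indicator {M n<..} (norm x)" "\<lambda>y. 2 * M n * y + y\<^sup>2", OF _ _ bd g] rho_int rho_square
      by (simp_all add: r_def tail_integral_def)
    have "(\<integral>\<omega>. (min 1 (norm (h \<omega>) / M n))\<^sup>2 * (sgn (h \<omega>) \<bullet> \<theta>)\<^sup>2 \<partial>P) = a n"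
      unfolding a_def by (rule law_integral) measurable
    then show ?thesis
      unfolding X_def truncated_inner_square[OF m]
      using 1 2 by (subst Bochner_Integration.integral_add) simp_all
  qed
  have a_lim: "(\<lambda>n. a n / G (M n)) \<longlonglongrightarrow> L ?g * (2 / (2 - \<alpha>))"
    unfolding a_def by (rule filterlim_compose[OF truncated_moment_lim[OF gc] M_top]) simp
  have t_lim: "(\<lambda>n. tail_integral \<nu> ?g (M n) / G (M n)) \<longlonglongrightarrow> L ?g"
    using filterlim_compose[OF tail_lim[OF gc, of 1] M_top] by simp
  have Minv: "(\<lambda>n. 1 / M n) \<longlonglongrightarrow> 0"
    by (intro tendsto_divide_0[OF tendsto_const] filterlim_at_top_imp_at_infinity M_top)
  have "(\<lambda>n. a n / G (M n) + tail_integral \<nu> ?g (M n) / G (M n) * (2 * P.expectation \<rho> * (1 / M n) + P.expectation (\<lambda>\<omega>. (\<rho> \<omega>)\<^sup>2) * (1 / M n)\<^sup>2))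
      \<longlonglongrightarrow> L ?g * (2 / (2 - \<alpha>)) + L ?g * (2 * P.expectation \<rho> * 0 + P.expectation (\<lambda>\<omega>. (\<rho> \<omega>)\<^sup>2) * 0\<^sup>2)"
    by (intro tendsto_add tendsto_mult tendsto_power tendsto_const a_lim t_lim Minv)
  then have "(\<lambda>n. a n / G (M n) + tail_integral \<nu> ?g (M n) / G (M n) * (2 * P.expectation \<rho> * (1 / M n) + P.expectation (\<lambda>\<omega>. (\<rho> \<omega>)\<^sup>2) * (1 / M n)\<^sup>2))
      \<longlonglongrightarrow> 2 / (2 - \<alpha>) * L ?g" by (simp add: mult.commute)
  then show ?thesis
  proof (rule Lim_transform_eventually)
    show "\<forall>\<^sub>F n in sequentially. a n / G (M n) + tail_integral \<nu> ?g (M n) / G (M n) * (2 * P.expectation \<rho> * (1 / M n) + P.expectation (\<lambda>\<omega>. (\<rho> \<omega>)\<^sup>2) * (1 / M n)\<^sup>2)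
      = (\<integral>\<omega>. (\<theta> \<bullet> X n \<omega>)\<^sup>2 \<partial>P) / ((M n)\<^sup>2 * G (M n))"
      using eventually_ge_at_top[of 1]
    proof eventually_elim
      case (elim n)
      have m: "M n \<noteq> 0" "G (M n) \<noteq> 0" using M_pos[OF elim] tail_pos[of "M n"] by auto
      show ?case unfolding eq[OF elim] r_def using m
        by (simp add: add_divide_distrib) (simp add: field_simps power2_eq_square)
    qed
  qed
qed

text \<open>This is \<open>small_mean\<close> at \<open>x = M\<close>: within radius
  \<open>M n\<close> truncation changes nothing, and \<open>E |X n|^2\<close> is at most of order
  \<open>(M n)^2 * G (M n)\<close>.\<close>

lemma mean_small:
  "(\<lambda>n. (\<integral>\<omega>. norm (X n \<omega>) \<partial>P)\<^sup>2 / ((M n)\<^sup>2 * G (M n))) \<longlonglongrightarrow> 0"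
proof -
  obtain C where C: "0 < C" "\<forall>\<^sub>F x in at_top. (\<integral>x'. (min 1 (norm x' / x))\<^sup>2 \<partial>\<nu>) \<le> C * G x"
    using truncated_moment_bound by blast
  \<comment> \<open>For \<open>M n \<ge> 1\<close> the overshoot factor
    \<open>2 * M n * E \<rho> + E \<rho>^2\<close> is at most \<open>(M n)^2 * K\<close>.\<close>
  define K where "K = 2 * P.expectation \<rho> + P.expectation (\<lambda>\<omega>. (\<rho> \<omega>)\<^sup>2)"
  have e0: "0 \<le> P.expectation \<rho>" using rho_nonneg by (intro Bochner_Integration.integral_nonneg) auto
  have e0': "0 \<le> P.expectation (\<lambda>\<omega>. (\<rho> \<omega>)\<^sup>2)" by simp
  have K0: "0 \<le> K" using e0 e0' by (simp add: K_def)
  show ?thesis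
  proof (rule small_mean[where h = h and c = 1 and C = "C + K"])
    show "\<forall>\<^sub>F n in sequentially. (\<integral>\<omega>. (norm (X n \<omega>))\<^sup>2 \<partial>P) \<le> (C + K) * ((M n)\<^sup>2 * G (M n))"
      using eventually_compose_filterlim[OF C(2) M_top] M_top[unfolded filterlim_at_top, rule_format, of 1]
    proof eventually_elim
      case (elim n)
      then have m: "0 < M n" "1 \<le> M n" by auto
      have 1: "integrable P (\<lambda>\<omega>. (min 1 (norm (h \<omega>) / M n))\<^sup>2)"
        using m by (intro P.integrable_const_bound[of _ 1]) (auto simp: power_le_one)
      have g: "integrable P (\<lambda>\<omega>. 2 * M n * \<rho> \<omega> + (\<rho> \<omega>)\<^sup>2)" using rho_int rho_square by simp
      have bd: "\<bar>indicator {M n<..} (norm x)\<bar> \<le> (1::real)" for x :: "real ^ 'd" by (simp add: indicator_def)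
      have 2: "integrable P (\<lambda>\<omega>. indicator {M n<..} (norm (h \<omega>)) * (2 * M n * \<rho> \<omega> + (\<rho> \<omega>)\<^sup>2))"
        "(\<integral>\<omega>. indicator {M n<..} (norm (h \<omega>)) * (2 * M n * \<rho> \<omega> + (\<rho> \<omega>)\<^sup>2) \<partial>P)
          = G (M n) * (2 * M n * P.expectation \<rho> + P.expectation (\<lambda>\<omega>. (\<rho> \<omega>)\<^sup>2))"
        using overshoot_integral[of "\<lambda>x. indicator {M n<..} (norm x)" "\<lambda>y. 2 * M n * y + y\<^sup>2", OF _ _ bd g] rho_int rho_square
        by (simp_all add: tail_integral_def)
      have "(\<integral>\<omega>. (norm (X n \<omega>))\<^sup>2 \<partial>P) = (M n)\<^sup>2 * (\<integral>\<omega>. (min 1 (norm (h \<omega>) / M n))\<^sup>2 \<partial>P)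
          + G (M n) * (2 * M n * P.expectation \<rho> + P.expectation (\<lambda>\<omega>. (\<rho> \<omega>)\<^sup>2))"
        unfolding X_def truncated_norm_square[OF m(1)]
        using 1 2 by (subst Bochner_Integration.integral_add) simp_all
      also have "(\<integral>\<omega>. (min 1 (norm (h \<omega>) / M n))\<^sup>2 \<partial>P) = (\<integral>x. (min 1 (norm x / M n))\<^sup>2 \<partial>\<nu>)"
        by (rule law_integral) measurable
      also have "(M n)\<^sup>2 * \<dots> \<le> (M n)\<^sup>2 * (C * G (M n))" using elim by (intro mult_left_mono) auto
      also have "G (M n) * (2 * M n * P.expectation \<rho> + P.expectation (\<lambda>\<omega>. (\<rho> \<omega>)\<^sup>2)) \<le> G (M n) * ((M n)\<^sup>2 * K)"
      proof (intro mult_left_mono)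
        have "M n \<le> (M n)\<^sup>2" "1 \<le> (M n)\<^sup>2" using m by (simp add: power2_eq_square, simp add: one_le_power)
        then have "M n * (2 * P.expectation \<rho>) + 1 * P.expectation (\<lambda>\<omega>. (\<rho> \<omega>)\<^sup>2)
          \<le> (M n)\<^sup>2 * (2 * P.expectation \<rho>) + (M n)\<^sup>2 * P.expectation (\<lambda>\<omega>. (\<rho> \<omega>)\<^sup>2)"
          using e0 e0' by (intro add_mono mult_right_mono) auto
        then show "2 * M n * P.expectation \<rho> + P.expectation (\<lambda>\<omega>. (\<rho> \<omega>)\<^sup>2) \<le> (M n)\<^sup>2 * K"
          by (simp add: K_def algebra_simps)
      qed (use tail_pos[of "M n"] in simp)
      finally show ?case by (simp add: algebra_simps)
    qed
    show "norm (X n \<omega>) \<le> 1 * norm (h \<omega>)" if "norm (h \<omega>) \<le> M n" for n \<omega>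
      using truncated_norm_le_base[OF that] by (simp add: X_def)
  qed (use h_law M_top C K0 X_square_int P.prob_space_axioms in auto)
qed

text \<open>Without overshoot the projection is at most \<open>|\<theta>| * M n\<close>, which is
  eventually no more than \<open>e * B n\<close>. An exceedance thus requires
  \<open>|h| > M n\<close> and a large \<open>\<rho>\<close>. The first condition contributes the
  factor \<open>G (M n)\<close>, which the norming cancels; what is left is a tail of the second
  moment of \<open>M n + \<rho>\<close> relative to \<open>(M n)^2\<close>.\<close>

lemma lindeberg:
  assumes e: "0 < e"
  shows "(\<lambda>n. real n * (\<integral>\<omega>. (\<theta> \<bullet> X n \<omega> / B n)\<^sup>2 * indicator {e<..} \<bar>\<theta> \<bullet> X n \<omega> / B n\<bar> \<partial>P)) \<longlonglongrightarrow> 0"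
proof -
  define c where "c = norm \<theta>"
  have c0: "0 \<le> c" by (simp add: c_def)
  \<comment> \<open>Up to the factor \<open>c^2\<close>, this bounds the squared projection on an
    exceedance by a function of the overshoot alone.\<close>
  define q where "q n y = (if e * B n < c * (M n + y) then (M n + y)\<^sup>2 else 0)" for n and y :: real
  have q_meas[measurable]: "q n \<in> borel_measurable borel" for n unfolding q_def by measurable
  have q0: "0 \<le> q n y" for n y by (simp add: q_def)
  have sq_le: "(M n + \<rho> \<omega>)\<^sup>2 \<le> 2 * (M n)\<^sup>2 + 2 * (\<rho> \<omega>)\<^sup>2" for n \<omega>
    using sum_squares_bound[of "M n" "\<rho> \<omega>"] unfolding power2_sum by simp
  have q_int: "integrable P (\<lambda>\<omega>. q n (\<rho> \<omega>))" for n
  proof (rule Bochner_Integration.integrable_bound[of _ "\<lambda>\<omega>. 2 * (M n)\<^sup>2 + 2 * (\<rho> \<omega>)\<^sup>2"])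
    show "AE \<omega> in P. norm (q n (\<rho> \<omega>)) \<le> norm (2 * (M n)\<^sup>2 + 2 * (\<rho> \<omega>)\<^sup>2)" using sq_le by (simp add: q_def)
  qed (use rho_square in simp_all)
  have large: "\<forall>\<^sub>F n in sequentially. c * M n \<le> e * B n"
    using B_top[unfolded filterlim_at_top, rule_format, of "c / e"] eventually_ge_at_top[of 1]
  proof eventually_elim
    case (elim n)
    then show ?case using e M_pos[of n] by (simp add: field_simps)
  qed
  have bound: "\<forall>\<^sub>F n in sequentially. real n * (\<integral>\<omega>. (\<theta> \<bullet> X n \<omega> / B n)\<^sup>2 * indicator {e<..} \<bar>\<theta> \<bullet> X n \<omega> / B n\<bar> \<partial>P)
      \<le> c\<^sup>2 * (\<integral>\<omega>. q n (\<rho> \<omega>) / (M n)\<^sup>2 \<partial>P)"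
    using large eventually_ge_at_top[of 1]
  proof eventually_elim
    case (elim n)
    have m: "0 < M n" and Bn: "0 < B n" using M_pos B_pos elim by auto
    have bd: "\<bar>indicator {M n<..} (norm x)\<bar> \<le> (1::real)" for x :: "real ^ 'd" by (simp add: indicator_def)
    note o = overshoot_integral[of "\<lambda>x. indicator {M n<..} (norm x)" "q n", OF _ _ bd q_int]
    have "(\<integral>\<omega>. (\<theta> \<bullet> X n \<omega> / B n)\<^sup>2 * indicator {e<..} \<bar>\<theta> \<bullet> X n \<omega> / B n\<bar> \<partial>P)
      \<le> (\<integral>\<omega>. c\<^sup>2 / (B n)\<^sup>2 * (indicator {M n<..} (norm (h \<omega>)) * q n (\<rho> \<omega>)) \<partial>P)"
    proof (rule integral_mono)
      have i: "integrable P (\<lambda>\<omega>. (\<theta> \<bullet> X n \<omega> / B n)\<^sup>2)" using inner_X_square_int by (simp add: power_divide)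
      show "integrable P (\<lambda>\<omega>. (\<theta> \<bullet> X n \<omega> / B n)\<^sup>2 * indicator {e<..} \<bar>\<theta> \<bullet> X n \<omega> / B n\<bar>)"
        by (rule Bochner_Integration.integrable_bound[OF i]) (auto simp: indicator_def)
      show "integrable P (\<lambda>\<omega>. c\<^sup>2 / (B n)\<^sup>2 * (indicator {M n<..} (norm (h \<omega>)) * q n (\<rho> \<omega>)))"
        by (intro integrable_mult_right o(1)) measurable
      fix \<omega> assume \<omega>: "\<omega> \<in> space P"
      have CS: "\<bar>\<theta> \<bullet> X n \<omega>\<bar> \<le> c * norm (X n \<omega>)" unfolding c_def by (rule Cauchy_Schwarz_ineq2)
      show "(\<theta> \<bullet> X n \<omega> / B n)\<^sup>2 * indicator {e<..} \<bar>\<theta> \<bullet> X n \<omega> / B n\<bar> \<le> c\<^sup>2 / (B n)\<^sup>2 * (indicator {M n<..} (norm (h \<omega>)) * q n (\<rho> \<omega>))"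
      proof (cases "e < \<bar>\<theta> \<bullet> X n \<omega> / B n\<bar>")
        case True
        then have big: "e * B n < \<bar>\<theta> \<bullet> X n \<omega>\<bar>" using Bn by (simp add: pos_less_divide_eq)
        have "\<not> norm (h \<omega>) \<le> M n"
        proof
          assume "norm (h \<omega>) \<le> M n"
          then have "c * norm (X n \<omega>) \<le> c * M n"
            using c0 by (intro mult_left_mono) (simp_all add: X_def truncated_norm_le_base)
          with big CS elim(1) show False by linarith
        qed
        moreover have "norm (X n \<omega>) \<le> M n + \<rho> \<omega>"
          using truncated_norm_le[OF rho_nonneg[OF \<omega>], of "M n" "h \<omega>"] m by (simp add: X_def)
        then have le: "\<bar>\<theta> \<bullet> X n \<omega>\<bar> \<le> c * (M n + \<rho> \<omega>)" using CS mult_left_mono[OF _ c0] order_trans by blast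
        then have "(\<theta> \<bullet> X n \<omega>)\<^sup>2 \<le> (c * (M n + \<rho> \<omega>))\<^sup>2" by (metis abs_ge_zero power2_abs power_mono)
        moreover have "e * B n < c * (M n + \<rho> \<omega>)" using big le by linarith
        ultimately show ?thesis using True Bn
          by (simp add: q_def power_divide power_mult_distrib divide_right_mono)
      qed (use q0 in simp)
    qed
    also have "\<dots> = c\<^sup>2 / (B n)\<^sup>2 * (G (M n) * (\<integral>\<omega>. q n (\<rho> \<omega>) \<partial>P))"
      using o(2) by (simp add: tail_integral_def)
    finally have "real n * (\<integral>\<omega>. (\<theta> \<bullet> X n \<omega> / B n)\<^sup>2 * indicator {e<..} \<bar>\<theta> \<bullet> X n \<omega> / B n\<bar> \<partial>P)
      \<le> real n * (c\<^sup>2 / (B n)\<^sup>2 * (G (M n) * (\<integral>\<omega>. q n (\<rho> \<omega>) \<partial>P)))" by (rule mult_left_mono) simp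
    also have "\<dots> = c\<^sup>2 * (\<integral>\<omega>. q n (\<rho> \<omega>) / (M n)\<^sup>2 \<partial>P)"
      using elim(2) m tail_pos[of "M n"] by (simp add: B_square)
    finally show ?case .
  qed
  obtain N where N: "\<And>n. N \<le> n \<Longrightarrow> 1 \<le> M n"
    using M_top[unfolded filterlim_at_top, rule_format, of 1] unfolding eventually_sequentially by blast
  have "(\<lambda>n. \<integral>\<omega>. q n (\<rho> \<omega>) / (M n)\<^sup>2 \<partial>P) \<longlonglongrightarrow> 0"
  proof (rule LIMSEQ_offset[where k = N])
    have "(\<lambda>n. \<integral>\<omega>. q (n + N) (\<rho> \<omega>) / (M (n + N))\<^sup>2 \<partial>P) \<longlonglongrightarrow> (\<integral>\<omega>. 0 \<partial>P)"
    proof (rule integral_dominated_convergence[where w = "\<lambda>\<omega>. 2 + 2 * (\<rho> \<omega>)\<^sup>2"])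
      show "integrable P (\<lambda>\<omega>. 2 + 2 * (\<rho> \<omega>)\<^sup>2)" using rho_square by simp
      show "AE \<omega> in P. (\<lambda>n. q (n + N) (\<rho> \<omega>) / (M (n + N))\<^sup>2) \<longlonglongrightarrow> 0"
      proof (rule AE_I2)
        fix \<omega> assume \<omega>: "\<omega> \<in> space P"
        \<comment> \<open>For fixed \<open>\<omega>\<close> the threshold \<open>e * B n\<close>
          eventually passes \<open>c * (M n + \<rho> \<omega>)\<close>, because
          \<open>B n / M n\<close> tends to infinity; from then on \<open>q\<close> is exactly
          \<open>0\<close>.\<close>
        have "\<forall>\<^sub>F n in sequentially. q n (\<rho> \<omega>) / (M n)\<^sup>2 = 0"
          using B_top[unfolded filterlim_at_top, rule_format, of "c * (1 + \<rho> \<omega>) / e"] eventually_ge_at_top[of N]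
        proof eventually_elim
          case (elim n)
          have m: "1 \<le> M n" by (rule N[OF elim(2)])
          then have "c * (1 + \<rho> \<omega>) * M n \<le> e * B n" using elim(1) e by (simp add: field_simps)
          moreover have "c * (M n + \<rho> \<omega>) \<le> c * ((1 + \<rho> \<omega>) * M n)"
          proof (rule mult_left_mono[OF _ c0])
            have "\<rho> \<omega> * 1 \<le> \<rho> \<omega> * M n" using m rho_nonneg[OF \<omega>] by (intro mult_left_mono) auto
            then show "M n + \<rho> \<omega> \<le> (1 + \<rho> \<omega>) * M n" by (simp add: distrib_right)
          qed
          ultimately show ?case by (simp add: q_def mult.assoc)
        qed
        then have "(\<lambda>n. q n (\<rho> \<omega>) / (M n)\<^sup>2) \<longlonglongrightarrow> 0" by (rule tendsto_eventually)
        then show "(\<lambda>n. q (n + N) (\<rho> \<omega>) / (M (n + N))\<^sup>2) \<longlonglongrightarrow> 0" by (rule LIMSEQ_ignore_initial_segment)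
      qed
      show "AE \<omega> in P. norm (q (n + N) (\<rho> \<omega>) / (M (n + N))\<^sup>2) \<le> 2 + 2 * (\<rho> \<omega>)\<^sup>2" for n
      proof (rule AE_I2)
        fix \<omega>
        have m: "1 \<le> M (n + N)" by (rule N) simp
        then have m2: "1 \<le> (M (n + N))\<^sup>2" by (simp add: one_le_power)
        have "q (n + N) (\<rho> \<omega>) \<le> 2 * (M (n + N))\<^sup>2 + 2 * (\<rho> \<omega>)\<^sup>2" using sq_le[of "n + N" \<omega>] by (simp add: q_def)
        also have "2 * (\<rho> \<omega>)\<^sup>2 * 1 \<le> 2 * (\<rho> \<omega>)\<^sup>2 * (M (n + N))\<^sup>2" using m2 by (intro mult_left_mono) auto
        then have "2 * (M (n + N))\<^sup>2 + 2 * (\<rho> \<omega>)\<^sup>2 \<le> (2 + 2 * (\<rho> \<omega>)\<^sup>2) * (M (n + N))\<^sup>2" by (simp add: distrib_right)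
        finally have "q (n + N) (\<rho> \<omega>) / (M (n + N))\<^sup>2 \<le> 2 + 2 * (\<rho> \<omega>)\<^sup>2" using m2 by (subst pos_divide_le_eq) auto
        then show "norm (q (n + N) (\<rho> \<omega>) / (M (n + N))\<^sup>2) \<le> 2 + 2 * (\<rho> \<omega>)\<^sup>2" using q0 by simp
      qed
    qed measurable
    then show "(\<lambda>n. \<integral>\<omega>. q (n + N) (\<rho> \<omega>) / (M (n + N))\<^sup>2 \<partial>P) \<longlonglongrightarrow> 0" by simp
  qed
  then have "(\<lambda>n. c\<^sup>2 * (\<integral>\<omega>. q n (\<rho> \<omega>) / (M n)\<^sup>2 \<partial>P)) \<longlonglongrightarrow> c\<^sup>2 * 0" by (intro tendsto_intros)
  then show ?thesis
    by (intro tendsto_sandwich[OF _ bound tendsto_const]) (auto intro!: always_eventually mult_nonneg_nonneg)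
qed

end

section \<open>The centered and normed summand\<close>

context truncated_model
begin

definition W where "W \<theta> n \<omega> = (\<theta> \<bullet> X n \<omega> - \<theta> \<bullet> (\<integral>\<omega>. X n \<omega> \<partial>P)) / B n"

lemma W_meas[measurable]: "W \<theta> n \<in> borel_measurable P"
  unfolding W_def[abs_def] by measurable

lemma inner_mean: "\<theta> \<bullet> (\<integral>\<omega>. X n \<omega> \<partial>P) = (\<integral>\<omega>. \<theta> \<bullet> X n \<omega> \<partial>P)"
  using X_int by simp

lemma W_mean: "(\<integral>\<omega>. W \<theta> n \<omega> \<partial>P) = 0"
  unfolding W_def inner_mean using inner_X_int by (simp add: P.prob_space)

lemma W_square_int: "integrable P (\<lambda>\<omega>. (W \<theta> n \<omega>)\<^sup>2)"
proof -
  have "(W \<theta> n \<omega>)\<^sup>2 = ((\<theta> \<bullet> X n \<omega>)\<^sup>2 - 2 * (\<theta> \<bullet> (\<integral>\<omega>. X n \<omega> \<partial>P)) * (\<theta> \<bullet> X n \<omega>) + (\<theta> \<bullet> (\<integral>\<omega>. X n \<omega> \<partial>P))\<^sup>2) / (B n)\<^sup>2" for \<omega>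
    by (simp add: W_def power_divide power2_diff mult_ac)
  then show ?thesis using inner_X_square_int inner_X_int by simp
qed

lemma W_square: "(\<integral>\<omega>. (W \<theta> n \<omega>)\<^sup>2 \<partial>P) = ((\<integral>\<omega>. (\<theta> \<bullet> X n \<omega>)\<^sup>2 \<partial>P) - (\<integral>\<omega>. \<theta> \<bullet> X n \<omega> \<partial>P)\<^sup>2) / (B n)\<^sup>2"
proof -
  define m where "m = (\<integral>\<omega>. \<theta> \<bullet> X n \<omega> \<partial>P)"
  have "(W \<theta> n \<omega>)\<^sup>2 = ((\<theta> \<bullet> X n \<omega>)\<^sup>2 - 2 * m * (\<theta> \<bullet> X n \<omega>) + m\<^sup>2) / (B n)\<^sup>2" for \<omega>
    unfolding W_def inner_mean m_def[symmetric] by (simp add: power_divide power2_diff mult_ac)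
  then have "(\<integral>\<omega>. (W \<theta> n \<omega>)\<^sup>2 \<partial>P) = ((\<integral>\<omega>. (\<theta> \<bullet> X n \<omega>)\<^sup>2 \<partial>P) - 2 * m * (\<integral>\<omega>. \<theta> \<bullet> X n \<omega> \<partial>P) + m\<^sup>2) / (B n)\<^sup>2"
    using inner_X_square_int inner_X_int by (simp add: P.prob_space)
  then show ?thesis by (simp add: m_def[symmetric] power2_eq_square)
qed

text \<open>Since \<open>(B n)^2 = n * (M n)^2 * G (M n)\<close>, the factor \<open>n\<close>
  cancels and \<open>mean_small\<close> applies after Cauchy-Schwarz.\<close>

lemma mean_contribution: "(\<lambda>n. real n * ((\<integral>\<omega>. \<theta> \<bullet> X n \<omega> \<partial>P) / B n)\<^sup>2) \<longlonglongrightarrow> 0"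
proof -
  have lim: "(\<lambda>n. (norm \<theta>)\<^sup>2 * ((\<integral>\<omega>. norm (X n \<omega>) \<partial>P)\<^sup>2 / ((M n)\<^sup>2 * G (M n)))) \<longlonglongrightarrow> 0"
    using tendsto_mult[OF tendsto_const mean_small] by simp
  have "\<forall>\<^sub>F n in sequentially. norm (real n * ((\<integral>\<omega>. \<theta> \<bullet> X n \<omega> \<partial>P) / B n)\<^sup>2)
    \<le> (norm \<theta>)\<^sup>2 * ((\<integral>\<omega>. norm (X n \<omega>) \<partial>P)\<^sup>2 / ((M n)\<^sup>2 * G (M n)))"
    using eventually_ge_at_top[of 1]
  proof eventually_elim
    case (elim n)
    have "\<bar>\<integral>\<omega>. \<theta> \<bullet> X n \<omega> \<partial>P\<bar> \<le> (\<integral>\<omega>. norm \<theta> * norm (X n \<omega>) \<partial>P)"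
    proof (rule order_trans[OF integral_abs_bound])
      show "(\<integral>\<omega>. \<bar>\<theta> \<bullet> X n \<omega>\<bar> \<partial>P) \<le> (\<integral>\<omega>. norm \<theta> * norm (X n \<omega>) \<partial>P)"
        using inner_X_int X_int by (intro integral_mono integrable_abs integrable_mult_right integrable_norm Cauchy_Schwarz_ineq2) auto
    qed
    then have "(\<integral>\<omega>. \<theta> \<bullet> X n \<omega> \<partial>P)\<^sup>2 \<le> (norm \<theta> * (\<integral>\<omega>. norm (X n \<omega>) \<partial>P))\<^sup>2"
      by (metis abs_ge_zero power2_abs power_mono integral_mult_right_zero)
    then have "(\<integral>\<omega>. \<theta> \<bullet> X n \<omega> \<partial>P)\<^sup>2 / ((M n)\<^sup>2 * G (M n)) \<le> (norm \<theta> * (\<integral>\<omega>. norm (X n \<omega>) \<partial>P))\<^sup>2 / ((M n)\<^sup>2 * G (M n))"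
      using tail_pos[of "M n"] by (intro divide_right_mono) auto
    moreover have "real n * ((\<integral>\<omega>. \<theta> \<bullet> X n \<omega> \<partial>P) / B n)\<^sup>2 = (\<integral>\<omega>. \<theta> \<bullet> X n \<omega> \<partial>P)\<^sup>2 / ((M n)\<^sup>2 * G (M n))"
      using elim by (simp add: power_divide B_square)
    moreover have "0 \<le> (\<integral>\<omega>. \<theta> \<bullet> X n \<omega> \<partial>P)\<^sup>2 / ((M n)\<^sup>2 * G (M n))" using tail_pos[of "M n"] by simp
    ultimately show ?case by (simp add: power_mult_distrib)
  qed
  from Lim_null_comparison[OF this lim] show ?thesis .
qed

lemma W_variance_lim:
  "(\<lambda>n. real n * (\<integral>\<omega>. (W \<theta> n \<omega>)\<^sup>2 \<partial>P)) \<longlonglongrightarrow> 2 / (2 - \<alpha>) * L (\<lambda>s. (s \<bullet> \<theta>)\<^sup>2)"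
proof -
  have "(\<lambda>n. (\<integral>\<omega>. (\<theta> \<bullet> X n \<omega>)\<^sup>2 \<partial>P) / ((M n)\<^sup>2 * G (M n)) - real n * ((\<integral>\<omega>. \<theta> \<bullet> X n \<omega> \<partial>P) / B n)\<^sup>2)
    \<longlonglongrightarrow> 2 / (2 - \<alpha>) * L (\<lambda>s. (s \<bullet> \<theta>)\<^sup>2) - 0"
    by (intro tendsto_diff second_moment_lim mean_contribution)
  then have "(\<lambda>n. (\<integral>\<omega>. (\<theta> \<bullet> X n \<omega>)\<^sup>2 \<partial>P) / ((M n)\<^sup>2 * G (M n)) - real n * ((\<integral>\<omega>. \<theta> \<bullet> X n \<omega> \<partial>P) / B n)\<^sup>2)
    \<longlonglongrightarrow> 2 / (2 - \<alpha>) * L (\<lambda>s. (s \<bullet> \<theta>)\<^sup>2)" by simp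
  then show ?thesis
  proof (rule Lim_transform_eventually)
    show "\<forall>\<^sub>F n in sequentially. (\<integral>\<omega>. (\<theta> \<bullet> X n \<omega>)\<^sup>2 \<partial>P) / ((M n)\<^sup>2 * G (M n)) - real n * ((\<integral>\<omega>. \<theta> \<bullet> X n \<omega> \<partial>P) / B n)\<^sup>2
      = real n * (\<integral>\<omega>. (W \<theta> n \<omega>)\<^sup>2 \<partial>P)"
      using eventually_ge_at_top[of 1]
    proof eventually_elim
      case (elim n)
      then have "real n * (a / (real n * z)) = a / z" for a z :: real by simp
      then show ?case by (simp only: W_square power_divide B_square diff_divide_distrib right_diff_distrib)
    qed
  qed
qed

text \<open>The centering \<open>m\<close> is eventually at most \<open>e / 2\<close> in modulus, so
  \<open>|a - m| > e\<close> implies \<open>|a| > e / 2\<close> and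
  \<open>|a - m| \<le> 2 * |a|\<close>. The uncentered condition at level \<open>e / 2\<close>
  therefore dominates, with the factor \<open>4\<close>.\<close>

lemma W_lindeberg:
  assumes e: "0 < e"
  shows "(\<lambda>n. real n * (\<integral>\<omega>. (W \<theta> n \<omega>)\<^sup>2 * indicator {e<..} \<bar>W \<theta> n \<omega>\<bar> \<partial>P)) \<longlonglongrightarrow> 0"
proof -
  let ?A = "\<lambda>n \<omega>. \<theta> \<bullet> X n \<omega> / B n"
  have "0 < e / 2" using e by simp
  from tendsto_mult[OF tendsto_const lindeberg[OF this, of \<theta>], of 4]
  have lim: "(\<lambda>n. 4 * (real n * (\<integral>\<omega>. (?A n \<omega>)\<^sup>2 * indicator {e / 2<..} \<bar>?A n \<omega>\<bar> \<partial>P))) \<longlonglongrightarrow> 0" by simp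
  have "0 < (e / 2)\<^sup>2" using e by simp
  from order_tendstoD(2)[OF mean_contribution this, of \<theta>] eventually_ge_at_top[of 1]
  have bound: "\<forall>\<^sub>F n in sequentially. real n * (\<integral>\<omega>. (W \<theta> n \<omega>)\<^sup>2 * indicator {e<..} \<bar>W \<theta> n \<omega>\<bar> \<partial>P)
      \<le> 4 * (real n * (\<integral>\<omega>. (?A n \<omega>)\<^sup>2 * indicator {e / 2<..} \<bar>?A n \<omega>\<bar> \<partial>P))"
  proof eventually_elim
    case (elim n)
    define m where "m = (\<integral>\<omega>. \<theta> \<bullet> X n \<omega> \<partial>P) / B n"
    have "m\<^sup>2 \<le> real n * m\<^sup>2" using elim(2) by (intro mult_le_cancel_right1[THEN iffD2]) auto
    then have "m\<^sup>2 \<le> (e / 2)\<^sup>2" using elim(1) by (simp add: m_def)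
    then have m: "\<bar>m\<bar> \<le> e / 2" using e by (simp add: abs_le_square_iff[symmetric])
    have W: "W \<theta> n \<omega> = ?A n \<omega> - m" for \<omega> by (simp add: W_def inner_mean m_def diff_divide_distrib)
    have "(\<integral>\<omega>. (W \<theta> n \<omega>)\<^sup>2 * indicator {e<..} \<bar>W \<theta> n \<omega>\<bar> \<partial>P)
      \<le> (\<integral>\<omega>. 4 * ((?A n \<omega>)\<^sup>2 * indicator {e / 2<..} \<bar>?A n \<omega>\<bar>) \<partial>P)"
    proof (rule integral_mono)
      show "integrable P (\<lambda>\<omega>. (W \<theta> n \<omega>)\<^sup>2 * indicator {e<..} \<bar>W \<theta> n \<omega>\<bar>)"
        by (rule Bochner_Integration.integrable_bound[OF W_square_int[of \<theta> n]]) (auto simp: indicator_def)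
      have i: "integrable P (\<lambda>\<omega>. (?A n \<omega>)\<^sup>2)" using inner_X_square_int by (simp add: power_divide)
      have "integrable P (\<lambda>\<omega>. (?A n \<omega>)\<^sup>2 * indicator {e / 2<..} \<bar>?A n \<omega>\<bar>)"
        by (rule Bochner_Integration.integrable_bound[OF i]) (auto simp: indicator_def)
      then show "integrable P (\<lambda>\<omega>. 4 * ((?A n \<omega>)\<^sup>2 * indicator {e / 2<..} \<bar>?A n \<omega>\<bar>))" by (rule integrable_mult_right)
      show "(W \<theta> n \<omega>)\<^sup>2 * indicator {e<..} \<bar>W \<theta> n \<omega>\<bar> \<le> 4 * ((?A n \<omega>)\<^sup>2 * indicator {e / 2<..} \<bar>?A n \<omega>\<bar>)" for \<omega>
      proof (cases "e < \<bar>W \<theta> n \<omega>\<bar>")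
        case True
        define a where "a = ?A n \<omega>"
        have "e < \<bar>a - m\<bar>" using True by (simp add: W a_def)
        then have a: "e / 2 < \<bar>a\<bar>" using m by linarith
        then have "\<bar>a - m\<bar> \<le> 2 * \<bar>a\<bar>" using m by linarith
        then have "\<bar>a - m\<bar> \<le> \<bar>2 * a\<bar>" by simp
        then have "(a - m)\<^sup>2 \<le> (2 * a)\<^sup>2" by (simp only: abs_le_square_iff)
        then have "(a - m)\<^sup>2 \<le> 4 * a\<^sup>2" by (simp add: power_mult_distrib)
        then have "(W \<theta> n \<omega>)\<^sup>2 \<le> 4 * (?A n \<omega>)\<^sup>2" by (simp only: W a_def)
        then show ?thesis using True a by (simp add: a_def)
      qed simp
    qed
    then have "(\<integral>\<omega>. (W \<theta> n \<omega>)\<^sup>2 * indicator {e<..} \<bar>W \<theta> n \<omega>\<bar> \<partial>P)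
      \<le> 4 * (\<integral>\<omega>. (?A n \<omega>)\<^sup>2 * indicator {e / 2<..} \<bar>?A n \<omega>\<bar> \<partial>P)" by simp
    from mult_left_mono[OF this, of "real n"] show ?case by simp
  qed
  show ?thesis
    by (rule tendsto_sandwich[OF _ bound tendsto_const lim]) (auto intro!: always_eventually)
qed

end

text \<open>The centering \<open>c n\<close> multiplies the characteristic function by a number of
  modulus one. Taking moduli therefore turns attraction to \<open>\<rho>\<close> into a limit of
  powers of a single modulus, with only \<open>b\<close> left unknown.\<close>

lemma (in prob_space) normed_sum_char_limit:
  fixes H :: "nat \<Rightarrow> 'a \<Rightarrow> real ^ 'd"
  assumes H: "iid_seq M H" and rho: "prob_space \<rho>" "sets \<rho> = sets borel"
    and conv: "weakly_converges (\<lambda>n. distr M borel (\<lambda>\<omega>. (1 / b n) *\<^sub>R (\<Sum>j=1..n. H j \<omega>) - c n)) \<rho>"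
  shows "(\<lambda>n. cmod (char_fun (distr M borel (H 1)) ((1 / b n) *\<^sub>R \<theta>)) ^ n) \<longlonglongrightarrow> cmod (char_fun \<rho> \<theta>)"
proof -
  have Hi: "indep_vars (\<lambda>_. borel) H {1..}" and law: "\<forall>j\<ge>1. distr M borel (H j) = distr M borel (H 1)"
    using H unfolding iid_seq_def by blast+
  have Hm: "random_variable borel (H j)" if "1 \<le> j" for j
    using Hi that by (auto simp: indep_vars_def2)
  define Y where "Y n \<omega> = (1 / b n) *\<^sub>R (\<Sum>j=1..n. H j \<omega>) - c n" for n \<omega>
  have Ym[measurable]: "random_variable borel (Y n)" for n
    unfolding Y_def using Hm by (intro borel_measurable_diff borel_measurable_scaleR borel_measurable_sum) auto
  have pr: "prob_space (distr M borel (Y n))" "sets (distr M borel (Y n)) = sets borel" for n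
    by (auto intro: prob_space_distr)
  have conv': "(\<lambda>n. \<integral>x. f x \<partial>distr M borel (Y n)) \<longlonglongrightarrow> (\<integral>x. f x \<partial>\<rho>)"
    if "continuous_on UNIV f" "\<And>x. \<bar>f x\<bar> \<le> 1" for f :: "real ^ 'd \<Rightarrow> real"
  proof -
    have "bounded (range f)" using that(2) by (auto simp: bounded_iff)
    with that(1) conv[unfolded weakly_converges_def Y_def[symmetric]] show ?thesis by blast
  qed
  have "(\<lambda>n. Re (char_fun (distr M borel (Y n)) \<theta>)) \<longlonglongrightarrow> Re (char_fun \<rho> \<theta>)"
    unfolding char_fun_Re_Im[OF pr] char_fun_Re_Im[OF rho] by (rule conv') (auto intro!: continuous_intros)
  moreover have "(\<lambda>n. Im (char_fun (distr M borel (Y n)) \<theta>)) \<longlonglongrightarrow> Im (char_fun \<rho> \<theta>)"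
    unfolding char_fun_Re_Im[OF pr] char_fun_Re_Im[OF rho] by (rule conv') (auto intro!: continuous_intros)
  ultimately have "(\<lambda>n. char_fun (distr M borel (Y n)) \<theta>) \<longlonglongrightarrow> char_fun \<rho> \<theta>"
    by (simp add: tendsto_complex_iff)
  then have lim: "(\<lambda>n. cmod (char_fun (distr M borel (Y n)) \<theta>)) \<longlonglongrightarrow> cmod (char_fun \<rho> \<theta>)"
    by (intro tendsto_norm)
  have eq: "cmod (char_fun (distr M borel (Y n)) \<theta>) = cmod (char_fun (distr M borel (H 1)) ((1 / b n) *\<^sub>R \<theta>)) ^ n" for n
  proof -
    define Z where "Z j \<omega> = ((1 / b n) *\<^sub>R \<theta>) \<bullet> H j \<omega>" for j \<omega>
    have Zi: "indep_vars (\<lambda>_. borel) Z {1..n}"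
      unfolding Z_def by (rule indep_vars_compose2[OF indep_vars_subset[OF Hi]]) auto
    have "char (distr M borel (\<lambda>\<omega>. \<Sum>j=1..n. Z j \<omega>)) 1 = (\<Prod>j=1..n. char (distr M borel (Z j)) 1)"
      by (rule char_distr_sum[OF Zi])
    also have "\<dots> = (\<Prod>j=1..n. char_fun (distr M borel (H 1)) ((1 / b n) *\<^sub>R \<theta>))"
    proof (rule prod.cong[OF refl])
      fix j assume j: "j \<in> {1..n}"
      then have j1: "1 \<le> j" by simp
      have d: "distr M borel (H j) = distr M borel (H 1)" by (rule law[rule_format, OF j1])
      have "(\<lambda>\<omega>. ((1 / b n) *\<^sub>R \<theta>) \<bullet> H j \<omega>) \<in> borel_measurable M"
        using Hm[OF j1] by measurable
      then have "char (distr M borel (Z j)) 1 = (CLINT \<omega>|M. exp (\<i> * complex_of_real (((1 / b n) *\<^sub>R \<theta>) \<bullet> H j \<omega>)))"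
        unfolding char_def Z_def[abs_def] by (subst integral_distr) simp_all
      also have "\<dots> = char_fun (distr M borel (H j)) ((1 / b n) *\<^sub>R \<theta>)"
        unfolding char_fun_def by (rule integral_distr[OF Hm[OF j1], symmetric]) measurable
      finally have "char (distr M borel (Z j)) 1 = char_fun (distr M borel (H j)) ((1 / b n) *\<^sub>R \<theta>)" .
      then show "char (distr M borel (Z j)) 1 = char_fun (distr M borel (H 1)) ((1 / b n) *\<^sub>R \<theta>)" unfolding d .
    qed
    finally have 1: "char (distr M borel (\<lambda>\<omega>. \<Sum>j=1..n. Z j \<omega>)) 1 = char_fun (distr M borel (H 1)) ((1 / b n) *\<^sub>R \<theta>) ^ n" by simp
    have "char_fun (distr M borel (Y n)) \<theta> = (CLINT \<omega>|M. exp (\<i> * complex_of_real (- (\<theta> \<bullet> c n))) * exp (\<i> * complex_of_real (\<Sum>j=1..n. Z j \<omega>)))"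
    proof -
      have e: "\<theta> \<bullet> Y n \<omega> = - (\<theta> \<bullet> c n) + (\<Sum>j=1..n. Z j \<omega>)" for \<omega>
        by (simp add: Y_def Z_def inner_diff_right inner_sum_right sum_divide_distrib)
      have "char_fun (distr M borel (Y n)) \<theta> = (CLINT \<omega>|M. exp (\<i> * complex_of_real (\<theta> \<bullet> Y n \<omega>)))"
        unfolding char_fun_def by (rule integral_distr[OF Ym]) measurable
      then show ?thesis by (simp only: e of_real_add distrib_left exp_add)
    qed
    also have "\<dots> = exp (\<i> * complex_of_real (- (\<theta> \<bullet> c n))) * char (distr M borel (\<lambda>\<omega>. \<Sum>j=1..n. Z j \<omega>)) 1"
    proof -
      have "(\<lambda>\<omega>. \<Sum>j=1..n. Z j \<omega>) \<in> borel_measurable M"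
        using Zi by (intro borel_measurable_sum) (auto simp: indep_vars_def2)
      then show ?thesis unfolding char_def by (simp add: integral_distr)
    qed
    finally have 2: "char_fun (distr M borel (Y n)) \<theta> = exp (\<i> * complex_of_real (- (\<theta> \<bullet> c n))) * char_fun (distr M borel (H 1)) ((1 / b n) *\<^sub>R \<theta>) ^ n"
      unfolding 1 .
    show ?thesis unfolding 2 norm_mult norm_exp_i_times norm_power by simp
  qed
  show ?thesis using lim unfolding eq .
qed

subsection \<open>The limit law\<close>

lemma integral_scale_measure:
  fixes f :: "'a \<Rightarrow> real"
  assumes "0 \<le> r" "f \<in> borel_measurable M"
  shows "(\<integral>x. f x \<partial>scale_measure (ennreal r) M) = r * (\<integral>x. f x \<partial>M)"
proof -
  have "scale_measure (ennreal r) M = density M (\<lambda>_. ennreal r)"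
    by (rule measure_eqI) (simp_all add: emeasure_density nn_integral_cmult_indicator)
  then show ?thesis using assms by (simp add: integral_density)
qed

text \<open>Second-order Taylor expansion for \<open>x \<le> 1\<close>, where the compensator is
  present, and the trivial bound \<open>2\<close> beyond. The factor \<open>(min 1 x)^2\<close> is
  integrable against the Levy density.\<close>

lemma spectral_kernel_bound:
  fixes x a :: real
  assumes "0 < x"
  shows "cmod (exp (\<i> * complex_of_real (x * a)) - 1 - \<i> * complex_of_real (x * a * indicator {..1} x)) \<le> (2 + a\<^sup>2) * (min 1 x)\<^sup>2"
proof (cases "x \<le> 1")
  case True
  have "cmod (exp (\<i> * complex_of_real (x * a)) - 1 - \<i> * complex_of_real (x * a)) \<le> (x * a)\<^sup>2 / 2"
    using iexp_approx1[of "x * a" 1] by (simp add: diff_diff_eq power2_eq_square)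
  also have "\<dots> \<le> (2 + a\<^sup>2) * x\<^sup>2" by (simp add: power_mult_distrib algebra_simps)
  finally show ?thesis using True assms by simp
next
  case False
  have "cmod (exp (\<i> * complex_of_real (x * a)) - 1) \<le> 2"
    using iexp_approx2[of "x * a" 0] by simp
  then show ?thesis using False by (simp add: add_increasing2)
qed

text \<open>By \<open>|exp z| = exp (Re z)\<close>, drift and compensator disappear. Moving the real
  part inside the double integral relies on integrability of the complex kernel at both levels. The
  identity map transports \<open>\<Gamma>\<close> from the sphere to the whole space.\<close>

lemma cmod_spectral_char_fun:
  fixes \<rho> \<Gamma> :: "(real ^ 'd) measure"
  assumes \<alpha>: "0 < \<alpha>" "\<alpha> < 2" and spec: "spectral_measure \<alpha> \<rho> \<Gamma>"
  shows "cmod (char_fun \<rho> \<theta>) = exp (- levy_exponent \<alpha> (distr \<Gamma> borel (\<lambda>s. s)) \<theta>)"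
proof -
  have fin: "finite_measure \<Gamma>" and sets: "sets \<Gamma> = sets (restrict_space borel (sphere 0 1))"
    using spec by (auto simp: spectral_measure_def)
  interpret finite_measure \<Gamma> by fact
  have sp: "space \<Gamma> = sphere 0 1" using sets_eq_imp_space_eq[OF sets] by (simp add: space_restrict_space)
  have meas: "f \<in> measurable \<Gamma> N" if "f \<in> measurable borel N" for f :: "real ^ 'd \<Rightarrow> 'b" and N
    using measurable_restrict_space1[OF that] by (simp add: measurable_cong_sets[OF sets refl])
  define m :: "real \<Rightarrow> real" where "m x = indicator {0<..} x * x powr (- 1 - \<alpha>)" for x
  have m_meas[measurable]: "m \<in> borel_measurable borel" unfolding m_def[abs_def] by measurable
  have m0: "0 \<le> m x" for x by (simp add: m_def)
  define J where "J = (\<integral>x. (min 1 x)\<^sup>2 * m x \<partial>lborel)"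
  have Ji: "integrable lborel (\<lambda>x. (min 1 x)\<^sup>2 * m x)"
    using levy_truncation_integrable[OF \<alpha>] by (simp add: m_def)
  have J0: "0 \<le> J" unfolding J_def using m0 by (intro Bochner_Integration.integral_nonneg) simp
  define k where "k s x = (exp (\<i> * complex_of_real (x * (\<theta> \<bullet> s))) - 1 - \<i> * complex_of_real (x * (\<theta> \<bullet> s) * indicator {..1} x)) * complex_of_real (m x)"
    for s :: "real ^ 'd" and x
  have k_meas[measurable]: "(\<lambda>(s, x). k s x) \<in> borel_measurable (borel \<Otimes>\<^sub>M borel)"
    unfolding k_def by measurable
  have k_eq: "(\<integral>x\<in>{0<..}. (exp (\<i> * complex_of_real (x * (\<theta> \<bullet> s))) - 1 - \<i> * complex_of_real (x * (\<theta> \<bullet> s) * indicator {..1} x))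
      * complex_of_real (x powr (- (1 + \<alpha>))) \<partial>lborel) = (\<integral>x. k s x \<partial>lborel)" for s
    unfolding set_lebesgue_integral_def
    by (intro Bochner_Integration.integral_cong) (auto simp: k_def m_def indicator_def)
  have k_bound: "cmod (k s x) \<le> (2 + (\<theta> \<bullet> s)\<^sup>2) * ((min 1 x)\<^sup>2 * m x)" for s x
  proof (cases "0 < x")
    case True
    show ?thesis
      unfolding k_def norm_mult mult.assoc[symmetric] norm_of_real abs_of_nonneg[OF m0]
      by (rule mult_right_mono[OF spectral_kernel_bound[OF True] m0])
  qed (simp add: k_def m_def)
  have k_int: "integrable lborel (k s)" for s
  proof (rule Bochner_Integration.integrable_bound[OF integrable_mult_right[OF Ji, of "2 + (\<theta> \<bullet> s)\<^sup>2"]])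
    show "AE x in lborel. cmod (k s x) \<le> norm ((2 + (\<theta> \<bullet> s)\<^sup>2) * ((min 1 x)\<^sup>2 * m x))"
      using order_trans[OF k_bound abs_ge_self] by (intro AE_I2) simp
  qed (simp add: k_def)
  have Re_k: "Re (k s x) = - ((1 - cos (x * (\<theta> \<bullet> s))) * m x)" for s x
    by (simp add: k_def Re_exp algebra_simps)
  have Re_inner: "Re (\<integral>x. k s x \<partial>lborel) = - (\<integral>x. (1 - cos (x * (\<theta> \<bullet> s))) * m x \<partial>lborel)" for s
    by (simp only: integral_Re[OF k_int, symmetric] Re_k integral_minus)
  have outer: "integrable \<Gamma> (\<lambda>s. \<integral>x. k s x \<partial>lborel)"
  proof (rule integrable_const_bound[of _ "(2 + (norm \<theta>)\<^sup>2) * J"])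
    show "(\<lambda>s. \<integral>x. k s x \<partial>lborel) \<in> borel_measurable \<Gamma>" by (rule meas) measurable
    show "AE s in \<Gamma>. norm (\<integral>x. k s x \<partial>lborel) \<le> (2 + (norm \<theta>)\<^sup>2) * J"
    proof (rule AE_I2)
      fix s assume "s \<in> space \<Gamma>"
      then have "norm s = 1" by (simp add: sp)
      then have "\<bar>\<theta> \<bullet> s\<bar> \<le> \<bar>norm \<theta>\<bar>" using Cauchy_Schwarz_ineq2[of \<theta> s] by simp
      then have a: "(\<theta> \<bullet> s)\<^sup>2 \<le> (norm \<theta>)\<^sup>2" by (simp only: abs_le_square_iff)
      have "norm (\<integral>x. k s x \<partial>lborel) \<le> (\<integral>x. norm (k s x) \<partial>lborel)" by (rule integral_norm_bound)
      also have "\<dots> \<le> (\<integral>x. (2 + (\<theta> \<bullet> s)\<^sup>2) * ((min 1 x)\<^sup>2 * m x) \<partial>lborel)"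
        by (intro integral_mono integrable_norm k_int integrable_mult_right Ji k_bound)
      also have "\<dots> = (2 + (\<theta> \<bullet> s)\<^sup>2) * J" by (simp add: J_def)
      also have "\<dots> \<le> (2 + (norm \<theta>)\<^sup>2) * J" using a J0 by (intro mult_right_mono) auto
      finally show "norm (\<integral>x. k s x \<partial>lborel) \<le> (2 + (norm \<theta>)\<^sup>2) * J" .
    qed
  qed
  from spec obtain \<gamma> where \<gamma>: "\<forall>\<theta>. char_fun \<rho> \<theta> = exp (\<i> * complex_of_real (\<theta> \<bullet> \<gamma>) +
      (\<integral>s. (\<integral>x\<in>{0<..}. (exp (\<i> * complex_of_real (x * (\<theta> \<bullet> s))) - 1
         - \<i> * complex_of_real (x * (\<theta> \<bullet> s) * indicator {..1} x))
      * complex_of_real (x powr (- (1 + \<alpha>))) \<partial>lborel) \<partial>\<Gamma>))"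
    unfolding spectral_measure_def by blast
  have "char_fun \<rho> \<theta> = exp (\<i> * complex_of_real (\<theta> \<bullet> \<gamma>) + (\<integral>s. (\<integral>x. k s x \<partial>lborel) \<partial>\<Gamma>))"
    using \<gamma>[rule_format, of \<theta>] unfolding k_eq .
  then have "cmod (char_fun \<rho> \<theta>) = exp (Re (\<integral>s. (\<integral>x. k s x \<partial>lborel) \<partial>\<Gamma>))" by simp
  also have "Re (\<integral>s. (\<integral>x. k s x \<partial>lborel) \<partial>\<Gamma>) = - (\<integral>s. (\<integral>x. (1 - cos (x * (\<theta> \<bullet> s))) * m x \<partial>lborel) \<partial>\<Gamma>)"
    by (simp only: integral_Re[OF outer, symmetric] Re_inner integral_minus)
  also have "(\<integral>s. (\<integral>x. (1 - cos (x * (\<theta> \<bullet> s))) * m x \<partial>lborel) \<partial>\<Gamma>) = levy_exponent \<alpha> (distr \<Gamma> borel (\<lambda>s. s)) \<theta>"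
    unfolding levy_exponent_def m_def by (rule integral_distr[symmetric]) (rule meas, simp, measurable)
  finally show ?thesis .
qed

text \<open>All moments are read off one-dimensional projections, the mixed ones by
  polarization.\<close>

lemma gaussian_mean_covariance:
  fixes \<eta> :: "(real ^ 'd) measure" and Q :: "real ^ 'd \<Rightarrow> real ^ 'd \<Rightarrow> real"
  assumes \<eta>: "prob_space \<eta>" "sets \<eta> = sets borel" "\<And>\<theta>. char_fun \<eta> \<theta> = exp (- complex_of_real (Q \<theta> \<theta>) / 2)"
    and sym: "\<And>x y. Q x y = Q y x" and lin: "\<And>y. linear (\<lambda>x. Q x y)" and pos: "\<And>x. 0 \<le> Q x x"
  shows "gaussian_law \<eta>" "mean_vector \<eta> = 0" "covariance_matrix \<eta> $ i $ j = Q (axis i 1) (axis j 1)"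
    "integrable \<eta> (\<lambda>x. (norm x)\<^sup>2)" "(\<integral>x. (norm x)\<^sup>2 \<partial>\<eta>) = (\<Sum>i\<in>UNIV. Q (axis i 1) (axis i 1))"
proof -
  interpret prob_space \<eta> by fact
  note [measurable_cong] = \<eta>(2)
  have lin2: "linear (Q x)" for x using lin[of x] unfolding sym[of _ x] .
  have marg: "distr \<eta> borel (\<lambda>x. \<theta> \<bullet> x) = normal_law 0 (sqrt (Q \<theta> \<theta>))" for \<theta>
    using \<eta>(3) pos by (intro gaussian_marginal[OF \<eta>(1,2)])
      (simp_all add: linear_cmul[OF lin] linear_cmul[OF lin2] power2_eq_square exp_of_real[symmetric])
  have s0: "0 \<le> sqrt (Q \<theta> \<theta>)" for \<theta> using pos by simp
  note mom = gaussian_moments[OF \<eta>(1,2) s0 marg]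
  have comp: "axis k 1 \<bullet> x = x $ k" for k and x :: "real ^ 'd" by (simp add: inner_axis')
  show "gaussian_law \<eta>" unfolding gaussian_law_def using \<eta> marg s0 by blast
  have int1: "integrable \<eta> (\<lambda>x. x $ k)" for k using mom(1)[of "axis k 1" 1] by (simp add: comp)
  have sq: "(\<integral>x. (\<theta> \<bullet> x)\<^sup>2 \<partial>\<eta>) = Q \<theta> \<theta>" for \<theta> using mom(3)[of \<theta>] pos by simp
  have "mean_vector \<eta> $ k = 0" for k
  proof -
    have "integrable \<eta> (\<lambda>x. \<Sum>k\<in>UNIV. x $ k *\<^sub>R axis k 1)" using int1 by simp
    moreover have "(\<lambda>x :: real ^ 'd. \<Sum>k\<in>UNIV. x $ k *\<^sub>R axis k 1) = (\<lambda>x. x)"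
    proof
      show "(\<Sum>k\<in>UNIV. x $ k *\<^sub>R axis k 1) = x" for x :: "real ^ 'd"
        using basis_expansion[of x] by (simp add: scalar_mult_eq_scaleR)
    qed
    ultimately have "integrable \<eta> (\<lambda>x. x)" by (rule back_subst[where P = "integrable \<eta>"])
    then have "axis k 1 \<bullet> (\<integral>x. x \<partial>\<eta>) = (\<integral>x. axis k 1 \<bullet> x \<partial>\<eta>)" by simp
    then show ?thesis using mom(2)[of "axis k 1"] by (simp add: mean_vector_def comp)
  qed
  then show mean: "mean_vector \<eta> = 0" by (simp add: vec_eq_iff)
  have polar: "x $ i * x $ j = (((axis i 1 + axis j 1) \<bullet> x)\<^sup>2 - (axis i 1 \<bullet> x)\<^sup>2 - (axis j 1 \<bullet> x)\<^sup>2) / 2" for x :: "real ^ 'd"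
    by (simp add: inner_add_left comp power2_eq_square algebra_simps)
  have "(\<integral>x. x $ i * x $ j \<partial>\<eta>) =
      ((\<integral>x. ((axis i 1 + axis j 1) \<bullet> x)\<^sup>2 \<partial>\<eta>) - (\<integral>x. (axis i 1 \<bullet> x)\<^sup>2 \<partial>\<eta>) - (\<integral>x. (axis j 1 \<bullet> x)\<^sup>2 \<partial>\<eta>)) / 2"
    unfolding polar using mom(1)[of _ 2] by simp
  also have "\<dots> = (Q (axis i 1 + axis j 1) (axis i 1 + axis j 1) - Q (axis i 1) (axis i 1) - Q (axis j 1) (axis j 1)) / 2"
    unfolding sq ..
  also have "\<dots> = Q (axis i 1) (axis j 1)"
    using sym[of "axis j 1" "axis i 1"] by (simp add: linear_add[OF lin] linear_add[OF lin2])
  finally show "covariance_matrix \<eta> $ i $ j = Q (axis i 1) (axis j 1)" by (simp add: covariance_matrix_def mean)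
  show "integrable \<eta> (\<lambda>x. (norm x)\<^sup>2)" unfolding power2_norm_axis using mom(1)[of _ 2] by simp
  show "(\<integral>x. (norm x)\<^sup>2 \<partial>\<eta>) = (\<Sum>i\<in>UNIV. Q (axis i 1) (axis i 1))"
    unfolding power2_norm_axis using mom(1)[of _ 2] by (simp add: sq)
qed

theorem theorem2p2:
  fixes P :: "'w measure"
    and H :: "nat \<Rightarrow> 'w \<Rightarrow> real ^ 'd"
    and R :: "nat \<Rightarrow> 'w \<Rightarrow> real"
    and M :: "nat \<Rightarrow> real"
    and \<rho> \<Gamma> :: "(real ^ 'd) measure"
    and \<alpha> :: real
  assumes "prob_space P"
    and "0 < \<alpha>" and "\<alpha> < 2"
    and "iid_seq P H"
    and "regularly_varying_tails \<alpha> (distr P borel (H 1))"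
    and "stable_law \<alpha> \<rho>"
    and "in_domain_of_attraction P H \<rho>"
    and "spectral_measure \<alpha> \<rho> \<Gamma>"
    and "iid_seq P R"
    and "\<And>j \<omega>. 1 \<le> j \<Longrightarrow> \<omega> \<in> space P \<Longrightarrow> 0 \<le> R j \<omega>"
    and "indep_seqs P H R"
    and "\<And>n. 1 \<le> n \<Longrightarrow> 0 < M n"
    and "filterlim M at_top sequentially"
    and "integrable P (\<lambda>\<omega>. (R 1 \<omega>)\<^sup>2)"
    and "filterlim (\<lambda>n. real n * tail_prob P (H 1) (M n)) at_top sequentially"
  shows "\<exists>\<eta> :: (real ^ 'd) measure.
      gaussian_law \<eta> \<and> mean_vector \<eta> = 0 \<and>
      (\<forall>i j. covariance_matrix \<eta> $ i $ j =
         2 / (2 - \<alpha>) * (\<integral>s. s $ i * s $ j \<partial>normalized_measure \<Gamma>)) \<and>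
      weakly_converges
        (\<lambda>n. distr P borel (\<lambda>\<omega>. (1 / norming P M H n) *\<^sub>R
           (truncated_sum M H R n \<omega> - (\<integral>\<omega>'. truncated_sum M H R n \<omega>' \<partial>P)))) \<eta>"
proof -
  interpret P: prob_space P by fact
  define \<nu> where "\<nu> = distr P borel (H 1)"
  have Hm[measurable]: "H j \<in> borel_measurable P" and Rm[measurable]: "R j \<in> borel_measurable P" if "1 \<le> j" for j
    using assms(4,9) that by (auto simp: iid_seq_def P.indep_vars_def2)
  have \<nu>: "prob_space \<nu>" "sets \<nu> = sets borel"
    unfolding \<nu>_def using Hm[of 1] by (auto intro!: P.prob_space_distr)
  obtain L :: "(real ^ 'd \<Rightarrow> real) \<Rightarrow> real" where L1: "L (\<lambda>_. 1) = 1"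
    and L: "\<forall>g l. continuous_on UNIV g \<and> (\<forall>s. 0 \<le> g s) \<and> 0 < l \<longrightarrow>
        ((\<lambda>x. tail_integral \<nu> g (l * x) / tail_integral \<nu> (\<lambda>_. 1) x) \<longlongrightarrow> l powr - \<alpha> * L g) at_top"
    and tpos: "\<forall>x. 0 < tail_integral \<nu> (\<lambda>_. 1) x"
    using rv_tail[OF \<nu>, of \<alpha>] assms(5) unfolding \<nu>_def by blast
  have TL: "tail_law \<nu> \<alpha> L"
    unfolding tail_law_def tail_law_axioms_def using \<nu> assms(2,3) L1 L tpos by blast
  then interpret T: tail_law \<nu> \<alpha> L .
  have G: "T.G x = tail_prob P (H 1) x" for x
  proof -
    have "T.G x = measure P (H 1 -` {h. x < norm h} \<inter> space P)"
      unfolding T.tail_eq using Hm[of 1] by (simp add: \<nu>_def measure_distr)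
    also have "H 1 -` {h. x < norm h} \<inter> space P = {\<omega> \<in> space P. x < norm (H 1 \<omega>)}" by auto
    finally show ?thesis by (simp add: tail_prob_def)
  qed
  have joint: "distr P (borel \<Otimes>\<^sub>M borel) (\<lambda>\<omega>. (H j \<omega>, R j \<omega>)) = distr P borel (H 1) \<Otimes>\<^sub>M distr P borel (R 1)" if "1 \<le> j" for j
    by (rule P.indep_pairs(2)[OF assms(4,9,11) that])
  have hard: "filterlim (\<lambda>n. real n * T.G (M n)) at_top sequentially" using assms(15) unfolding G .
  have TM: "truncated_model \<nu> \<alpha> L P (H 1) (R 1) M"
    unfolding truncated_model_def truncated_model_axioms_def
    using TL assms(1,10,12,13,14) hard Hm[OF order_refl] Rm[OF order_refl] joint[OF order_refl] by (simp add: \<nu>_def)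
  then interpret X: truncated_model \<nu> \<alpha> L P "H 1" "R 1" M .

  \<comment> \<open>The measure \<open>\<Gamma>\<close> lives on the sphere as a subspace; its image
    \<open>\<Gamma>'\<close> in the whole space is concentrated on unit vectors and has the Borel
    sets of the whole space.\<close>
  define \<Gamma>' where "\<Gamma>' = distr \<Gamma> borel (\<lambda>s. s)"
  have fin: "finite_measure \<Gamma>" and sets\<Gamma>: "sets \<Gamma> = sets (restrict_space borel (sphere 0 1))"
    and nonnull: "emeasure \<Gamma> (sphere 0 1) \<noteq> 0"
    using assms(8) by (auto simp: spectral_measure_def)
  interpret Gam: finite_measure \<Gamma> by fact
  have sp: "space \<Gamma> = sphere 0 1" using sets_eq_imp_space_eq[OF sets\<Gamma>] by (simp add: space_restrict_space)
  have meas: "f \<in> measurable \<Gamma> N" if "f \<in> measurable borel N" for f :: "real ^ 'd \<Rightarrow> 'b" and N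
    using measurable_restrict_space1[OF that] by (simp add: measurable_cong_sets[OF sets\<Gamma> refl])
  have id_meas: "(\<lambda>s. s) \<in> measurable \<Gamma> (borel :: (real ^ 'd) measure)" by (rule meas) simp
  define c where "c = measure \<Gamma> (space \<Gamma>)"
  have c: "0 < c"
    using nonnull Gam.emeasure_eq_measure[of "sphere 0 1"] measure_nonneg[of \<Gamma> "sphere 0 1"] by (simp add: c_def sp less_le)
  have \<Gamma>': "finite_measure \<Gamma>'" "sets \<Gamma>' = sets borel" "AE s in \<Gamma>'. norm s = 1"
  proof -
    show "finite_measure \<Gamma>'" unfolding \<Gamma>'_def by (rule Gam.finite_measure_distr[OF id_meas])
    show "sets \<Gamma>' = sets borel" by (simp add: \<Gamma>'_def)
    show "AE s in \<Gamma>'. norm s = 1" unfolding \<Gamma>'_def by (subst AE_distr_iff[OF id_meas]) (auto simp: sp)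
  qed
  interpret Gam': finite_measure \<Gamma>' by fact
  have c': "measure \<Gamma>' (space \<Gamma>') = c"
    using id_meas by (simp add: \<Gamma>'_def c_def measure_distr)
  note [measurable_cong] = \<Gamma>'(2)
  have norm_int: "(\<integral>s. f s \<partial>normalized_measure \<Gamma>) = (\<integral>s. f s \<partial>\<Gamma>') / c" if "f \<in> borel_measurable borel" for f :: "real ^ 'd \<Rightarrow> real"
  proof -
    have "1 / emeasure \<Gamma> (space \<Gamma>) = ennreal (1 / c)"
      using c by (simp add: c_def Gam.emeasure_eq_measure divide_ennreal[of 1, simplified])
    then have "(\<integral>s. f s \<partial>normalized_measure \<Gamma>) = 1 / c * (\<integral>s. f s \<partial>\<Gamma>)"
      unfolding normalized_measure_def using c meas[OF that] by (simp only: integral_scale_measure) (simp add: integral_scale_measure)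
    also have "(\<integral>s. f s \<partial>\<Gamma>) = (\<integral>s. f s \<partial>\<Gamma>')" unfolding \<Gamma>'_def using id_meas that by (simp add: integral_distr)
    finally show ?thesis by simp
  qed

  obtain b cc where b: "\<And>n. 0 < b n"
    and conv: "weakly_converges (\<lambda>n. distr P borel (\<lambda>\<omega>. (1 / b n) *\<^sub>R (\<Sum>j=1..n. H j \<omega>) - cc n)) \<rho>"
    using assms(7) unfolding in_domain_of_attraction_def by blast
  have \<rho>: "prob_space \<rho>" "sets \<rho> = sets borel" using assms(6) by (auto simp: stable_law_def)
  have "(\<lambda>n. cmod (char_fun \<nu> ((1 / b n) *\<^sub>R \<theta>)) ^ n) \<longlonglongrightarrow> exp (- levy_exponent \<alpha> \<Gamma>' \<theta>)" for \<theta>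
    using P.normed_sum_char_limit[OF assms(4) \<rho> conv, of \<theta>]
    unfolding cmod_spectral_char_fun[OF assms(2,3,8)] \<nu>_def \<Gamma>'_def .
  \<comment> \<open>The identification in normalized form; it replaces every value of
    \<open>L\<close> in the variances by an integral over directions.\<close>
  from T.spectral_second_moment[OF b \<Gamma>' this]
  have spectral: "L (\<lambda>s. (s \<bullet> v)\<^sup>2) = (\<integral>s. (s \<bullet> v)\<^sup>2 \<partial>\<Gamma>') / c" for v
    using c by (simp add: c')

  \<comment> \<open>Written as an integral over \<open>\<Gamma>'\<close>, the covariance is visibly
    symmetric, bilinear and nonnegative, as the construction of the Gaussian law requires.\<close>
  define Q where "Q x y = 2 / (2 - \<alpha>) * ((\<integral>s. (s \<bullet> x) * (s \<bullet> y) \<partial>\<Gamma>') / c)" for x y :: "real ^ 'd"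
  have Q_int: "integrable \<Gamma>' (\<lambda>s. (s \<bullet> x) * (s \<bullet> y))" for x y :: "real ^ 'd"
  proof (rule Gam'.integrable_const_bound[of _ "norm x * norm y"])
    show "AE s in \<Gamma>'. norm ((s \<bullet> x) * (s \<bullet> y)) \<le> norm x * norm y"
      using \<Gamma>'(3)
    proof eventually_elim
      case (elim s)
      have "\<bar>s \<bullet> x\<bar> \<le> norm x" "\<bar>s \<bullet> y\<bar> \<le> norm y"
        using Cauchy_Schwarz_ineq2[of s x] Cauchy_Schwarz_ineq2[of s y] elim by auto
      then show ?case by (simp add: abs_mult mult_mono)
    qed
  qed measurable
  have Q_sym: "Q x y = Q y x" for x y by (simp add: Q_def mult.commute)
  have Q_lin: "linear (\<lambda>x. Q x y)" for y
  proof (rule linearI)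
    fix x x' :: "real ^ 'd" and r :: real
    show "Q (x + x') y = Q x y + Q x' y"
      using Q_int by (simp add: Q_def inner_add_right distrib_right add_divide_distrib distrib_left)
    show "Q (r *\<^sub>R x) y = r *\<^sub>R Q x y" by (simp add: Q_def mult.assoc)
  qed
  have Q_pos: "0 \<le> Q x x" for x
  proof -
    have "0 \<le> (\<integral>s. (s \<bullet> x) * (s \<bullet> x) \<partial>\<Gamma>')" by (rule Bochner_Integration.integral_nonneg) simp
    then show ?thesis using c assms(3) by (simp add: Q_def)
  qed
  have Q_L: "2 / (2 - \<alpha>) * L (\<lambda>s. (s \<bullet> \<theta>)\<^sup>2) = Q \<theta> \<theta>" for \<theta>
    unfolding spectral Q_def by (simp add: power2_eq_square)
  obtain \<eta> :: "(real ^ 'd) measure" where \<eta>: "prob_space \<eta>" "sets \<eta> = sets borel"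
    and \<eta>_char: "\<And>\<theta>. char_fun \<eta> \<theta> = exp (- complex_of_real (Q \<theta> \<theta>) / 2)"
    using gaussian_exists[OF Q_sym Q_lin Q_pos] by (auto simp: exp_of_real[symmetric])
  note gauss = gaussian_mean_covariance[OF \<eta> \<eta>_char Q_sym Q_lin Q_pos]
  have cov: "covariance_matrix \<eta> $ i $ j = 2 / (2 - \<alpha>) * (\<integral>s. s $ i * s $ j \<partial>normalized_measure \<Gamma>)" for i j
    unfolding gauss(3) by (subst norm_int) (simp_all add: Q_def inner_axis)

  \<comment> \<open>The summands for all \<open>j\<close>, each centered by the mean of the generic
    one; \<open>j = 1\<close> is the generic summand itself.\<close>
  define W where "W \<theta> n j \<omega> = (\<theta> \<bullet> truncated (M n) (H j \<omega>) (R j \<omega>) - \<theta> \<bullet> (\<integral>\<omega>. X.X n \<omega> \<partial>P)) / X.B n" for \<theta> n j \<omega>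
  have W1: "W \<theta> n 1 = X.W \<theta> n" for \<theta> n by (rule ext) (simp only: W_def X.W_def X.X_def)
  have T_meas: "(\<lambda>z. truncated (M n) (fst z) (snd z)) \<in> borel_measurable (borel \<Otimes>\<^sub>M borel)" for n
    by measurable
  have W_fun: "(\<lambda>z. (\<theta> \<bullet> truncated (M n) (fst z) (snd z) - \<theta> \<bullet> (\<integral>\<omega>. X.X n \<omega> \<partial>P)) / X.B n) \<in> borel_measurable (borel \<Otimes>\<^sub>M borel)" for \<theta> n
    using T_meas[of n] by measurable
  have pair_meas: "(\<lambda>\<omega>. (H j \<omega>, R j \<omega>)) \<in> measurable P (borel \<Otimes>\<^sub>M borel)" if "1 \<le> j" for j
    using Hm[OF that] Rm[OF that] by (rule measurable_Pair)
  have W_indep: "P.indep_vars (\<lambda>_. borel) (W \<theta> n) {1..n}" if "1 \<le> n" for \<theta> n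
    using P.indep_vars_compose2[OF P.indep_pairs(1)[OF assms(4,9,11) that] W_fun[of \<theta> n]] by (simp add: W_def[abs_def])
  have W_law: "distr P borel (W \<theta> n j) = distr P borel (X.W \<theta> n)" if "1 \<le> j" for \<theta> n j
  proof -
    have "distr P borel (W \<theta> n j) = distr (distr P (borel \<Otimes>\<^sub>M borel) (\<lambda>\<omega>. (H j \<omega>, R j \<omega>))) borel
      (\<lambda>z. (\<theta> \<bullet> truncated (M n) (fst z) (snd z) - \<theta> \<bullet> (\<integral>\<omega>. X.X n \<omega> \<partial>P)) / X.B n)" if "1 \<le> j" for j
      by (subst distr_distr[OF W_fun pair_meas[OF that]]) (simp add: W_def[abs_def] o_def)
    from this[OF that] this[of 1] show ?thesis unfolding joint[OF that] joint[OF order_refl] W1 by simp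
  qed
  \<comment> \<open>The joint law of \<open>(H j, R j)\<close> is the same for all
    \<open>j \<ge> 1\<close>, so integrability and mean carry over from the generic summand and give
    the expectation of the sum.\<close>
  have X_law: "integrable P (\<lambda>\<omega>. truncated (M n) (H j \<omega>) (R j \<omega>)) \<and>
    (\<integral>\<omega>. truncated (M n) (H j \<omega>) (R j \<omega>) \<partial>P) = (\<integral>\<omega>. X.X n \<omega> \<partial>P)" if j: "1 \<le> j" for n j
  proof -
    have d: "distr P (borel \<Otimes>\<^sub>M borel) (\<lambda>\<omega>. (H j \<omega>, R j \<omega>)) = distr P (borel \<Otimes>\<^sub>M borel) (\<lambda>\<omega>. (H 1 \<omega>, R 1 \<omega>))"
      using joint[OF j] joint[OF order_refl] by simp
    have "integrable (distr P (borel \<Otimes>\<^sub>M borel) (\<lambda>\<omega>. (H 1 \<omega>, R 1 \<omega>))) (\<lambda>z. truncated (M n) (fst z) (snd z))"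
      using X.X_int[of n] unfolding X.X_def[abs_def]
      by (subst integrable_distr_eq[OF pair_meas[OF order_refl] T_meas]) (simp only: fst_conv snd_conv)
    moreover have "(\<integral>\<omega>. truncated (M n) (H i \<omega>) (R i \<omega>) \<partial>P) =
        (\<integral>z. truncated (M n) (fst z) (snd z) \<partial>distr P (borel \<Otimes>\<^sub>M borel) (\<lambda>\<omega>. (H i \<omega>, R i \<omega>)))" if "1 \<le> i" for i
      by (subst integral_distr[OF pair_meas[OF that] T_meas]) simp
    ultimately show ?thesis
      using integrable_distr_eq[OF pair_meas[OF j] T_meas, of n] unfolding X.X_def d[symmetric] using j d by simp
  qed
  define Y where "Y n \<omega> = (1 / norming P M H n) *\<^sub>R
           (truncated_sum M H R n \<omega> - (\<integral>\<omega>'. truncated_sum M H R n \<omega>' \<partial>P))" for n \<omega>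
  have norming: "norming P M H n = X.B n" for n by (simp add: norming_def X.B_def G)
  have Y_inner: "\<theta> \<bullet> Y n \<omega> = (\<Sum>j=1..n. W \<theta> n j \<omega>)" for \<theta> n \<omega>
  proof -
    have "(\<integral>\<omega>'. truncated_sum M H R n \<omega>' \<partial>P) = (\<Sum>j=1..n. (\<integral>\<omega>. X.X n \<omega> \<partial>P))"
      unfolding truncated_sum_def using X_law by (subst Bochner_Integration.integral_sum) auto
    then have "truncated_sum M H R n \<omega> - (\<integral>\<omega>'. truncated_sum M H R n \<omega>' \<partial>P)
        = (\<Sum>j=1..n. truncated (M n) (H j \<omega>) (R j \<omega>) - (\<integral>\<omega>. X.X n \<omega> \<partial>P))"
      unfolding truncated_sum_def by (simp only: sum_subtractf)
    then show ?thesis unfolding Y_def norming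
      by (simp only: inner_scaleR_right inner_sum_right inner_diff_right W_def sum_distrib_left) simp
  qed
  have Y_meas[measurable]: "Y n \<in> borel_measurable P" for n
    unfolding Y_def truncated_sum_def using Hm Rm
    by (intro borel_measurable_scaleR borel_measurable_diff borel_measurable_const borel_measurable_sum truncated_measurable) auto
  have Y_law: "prob_space (distr P borel (Y n))" "sets (distr P borel (Y n)) = sets borel" for n
    by (auto intro: P.prob_space_distr)
  have Y_char: "(\<lambda>n. char_fun (distr P borel (Y n)) \<theta>) \<longlonglongrightarrow> char_fun \<eta> \<theta>" for \<theta>
  proof -
    have "(\<lambda>n. char (distr P borel (\<lambda>\<omega>. \<Sum>j=1..n. W \<theta> n j \<omega>)) 1) \<longlonglongrightarrow> exp (- complex_of_real (Q \<theta> \<theta>) / 2)"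
    proof (rule P.triangular_char_limit[OF W_indep, where \<mu> = "\<lambda>n. distr P borel (X.W \<theta> n)"])
      show "(\<integral>x. x \<partial>distr P borel (X.W \<theta> n)) = 0" for n
        by (subst integral_distr[OF X.W_meas]) (simp, rule X.W_mean)
      show "integrable (distr P borel (X.W \<theta> n)) (\<lambda>x. x\<^sup>2)" for n
        by (subst integrable_distr_eq[OF X.W_meas]) (simp, rule X.W_square_int)
      show "(\<lambda>n. real n * (\<integral>x. x\<^sup>2 \<partial>distr P borel (X.W \<theta> n))) \<longlonglongrightarrow> Q \<theta> \<theta>"
        using X.W_variance_lim[of \<theta>] unfolding Q_L integral_distr[OF X.W_meas borel_measurable_power[OF measurable_ident_sets[OF refl]]] .
      show "(\<lambda>n. real n * (\<integral>x. x\<^sup>2 * indicator {e<..} \<bar>x\<bar> \<partial>distr P borel (X.W \<theta> n))) \<longlonglongrightarrow> 0" if "0 < e" for e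
      proof -
        have "(\<integral>x. x\<^sup>2 * indicator {e<..} \<bar>x\<bar> \<partial>distr P borel (X.W \<theta> n))
          = (\<integral>\<omega>. (X.W \<theta> n \<omega>)\<^sup>2 * indicator {e<..} \<bar>X.W \<theta> n \<omega>\<bar> \<partial>P)" for n
          by (rule integral_distr[OF X.W_meas]) measurable
        then show ?thesis using X.W_lindeberg[OF that, of \<theta>] by (simp only:)
      qed
      show "distr P borel (W \<theta> n j) = distr P borel (X.W \<theta> n)" if "1 \<le> j" "j \<le> n" for n j
        by (rule W_law[OF that(1)])
    qed
    moreover have "char_fun (distr P borel (Y n)) \<theta> = char (distr P borel (\<lambda>\<omega>. \<Sum>j=1..n. W \<theta> n j \<omega>)) 1" for n
    proof -
      have "(\<lambda>\<omega>. \<Sum>j=1..n. W \<theta> n j \<omega>) = (\<lambda>\<omega>. \<theta> \<bullet> Y n \<omega>)" by (simp add: Y_inner)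
      then show ?thesis by (simp add: char_fun_def char_def integral_distr)
    qed
    ultimately show ?thesis by (simp add: \<eta>_char)
  qed
  \<comment> \<open>Variances of independent centered summands add up, so each projection of
    \<open>Y n\<close> has \<open>n\<close> times the second moment of one summand; this is the
    input for tightness.\<close>
  have Y_square: "integrable P (\<lambda>\<omega>. (\<theta> \<bullet> Y n \<omega>)\<^sup>2)" "(\<integral>\<omega>. (\<theta> \<bullet> Y n \<omega>)\<^sup>2 \<partial>P) = real n * (\<integral>\<omega>. (X.W \<theta> n \<omega>)\<^sup>2 \<partial>P)"
    if n: "1 \<le> n" for \<theta> n
  proof -
    have Wm: "W \<theta> n j \<in> borel_measurable P" if "1 \<le> j" for j
      using measurable_compose[OF pair_meas[OF that] W_fun[of \<theta> n]] by (simp add: W_def[abs_def])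
    have Wl: "integrable P (\<lambda>\<omega>. f (W \<theta> n j \<omega>)) = integrable P (\<lambda>\<omega>. f (X.W \<theta> n \<omega>)) \<and>
        (\<integral>\<omega>. f (W \<theta> n j \<omega>) \<partial>P) = (\<integral>\<omega>. f (X.W \<theta> n \<omega>) \<partial>P)" if "1 \<le> j" "f \<in> borel_measurable borel" for j and f :: "real \<Rightarrow> real"
      using W_law[OF that(1), of \<theta> n] integral_distr[OF Wm[OF that(1)] that(2)] integral_distr[OF X.W_meas that(2)]
        integrable_distr_eq[OF Wm[OF that(1)] that(2)] integrable_distr_eq[OF X.W_meas that(2)] by simp
    have sq: "integrable P (\<lambda>\<omega>. (W \<theta> n j \<omega>)\<^sup>2)" "(\<integral>\<omega>. (W \<theta> n j \<omega>)\<^sup>2 \<partial>P) = (\<integral>\<omega>. (X.W \<theta> n \<omega>)\<^sup>2 \<partial>P)" "(\<integral>\<omega>. W \<theta> n j \<omega> \<partial>P) = 0"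
      if "j \<in> {1..n}" for j
      using Wl[of j "\<lambda>x. x\<^sup>2"] Wl[of j "\<lambda>x. x"] X.W_square_int[of \<theta> n] X.W_mean[of \<theta> n] that by auto
    note P.expectation_square_sum[OF _ W_indep[OF n] sq(1,3)]
    then show "integrable P (\<lambda>\<omega>. (\<theta> \<bullet> Y n \<omega>)\<^sup>2)" "(\<integral>\<omega>. (\<theta> \<bullet> Y n \<omega>)\<^sup>2 \<partial>P) = real n * (\<integral>\<omega>. (X.W \<theta> n \<omega>)\<^sup>2 \<partial>P)"
      using sq(2) by (simp_all add: Y_inner)
  qed
  \<comment> \<open>This is \<open>E |Y n|^2\<close>, summed over the axes; it converges and is
    therefore eventually bounded.\<close>
  define S where "S n = (\<Sum>i\<in>UNIV. real n * (\<integral>\<omega>. (X.W (axis i 1) n \<omega>)\<^sup>2 \<partial>P))" for n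
  have "S \<longlonglongrightarrow> (\<Sum>i\<in>UNIV. Q (axis i 1) (axis i 1))"
    unfolding S_def Q_L[symmetric] by (intro tendsto_sum X.W_variance_lim)
  then have S_bound: "\<forall>\<^sub>F n in sequentially. S n < (\<Sum>i\<in>UNIV. Q (axis i 1) (axis i 1)) + 1"
    by (rule order_tendstoD) simp
  have "weakly_converges (\<lambda>n. distr P borel (Y n)) \<eta>"
  proof (rule weakly_converges_of_char_fun[OF Y_law \<eta> Y_char])
    show "\<forall>\<^sub>F n in sequentially. integrable (distr P borel (Y n)) (\<lambda>x. (norm x)\<^sup>2) \<and>
        (\<integral>x. (norm x)\<^sup>2 \<partial>distr P borel (Y n)) \<le> (\<Sum>i\<in>UNIV. Q (axis i 1) (axis i 1)) + 1"
      using S_bound eventually_ge_at_top[of 1]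
    proof eventually_elim
      case (elim n)
      have "integrable P (\<lambda>\<omega>. (norm (Y n \<omega>))\<^sup>2)" unfolding power2_norm_axis using Y_square(1)[OF elim(2)] by simp
      moreover have "(\<integral>\<omega>. (norm (Y n \<omega>))\<^sup>2 \<partial>P) = S n"
        unfolding power2_norm_axis S_def using Y_square[OF elim(2)] by simp
      ultimately show ?case using elim by (simp add: integrable_distr_eq integral_distr)
    qed
    show "integrable \<eta> (\<lambda>x. (norm x)\<^sup>2)" by (rule gauss(4))
    show "(\<integral>x. (norm x)\<^sup>2 \<partial>\<eta>) \<le> (\<Sum>i\<in>UNIV. Q (axis i 1) (axis i 1)) + 1" unfolding gauss(5) by simp
  qed
  then show ?thesis using gauss(1,2) cov unfolding Y_def by blast
qed

end
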